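(* Let $\mathcal{M}$ be a $\sigma$-finite, semifinite infinite factor, let $A,B\in\mathcal{M}^+$ with $B\ne0$, $0\in\sigma_e(B)$, and $N_A\prec N_B$. Then any of the following mutually exclusive conditions implies that $A=\sum_{j=1}^\infty C_j$ for some $C_j\cong B$: (i) $\|A\|_e>\|B\|$; (ii) $\|A\|_e=\|B\|$ and $\chi_{\{\|B\|\}}(B)=0$; (iii) $\|A\|_e=\|B\|$, $\chi_{\{\|B\|\}}(B)\ne0$, $B\ne\|B\|\chi_{\{\|B\|\}}(B)$, $\chi_{\{\|A\|_e\}}(A)$ is infinite, and $N_B$ is infinite; (iv) $\|A\|_e=\|B\|$, $B=\|B\|\chi_{\{\|B\|\}}(B)$, $A=\|A\|\chi_{\{\|A\|\}}(A)$, $\chi_{\{\|A\|\}}(A)$ is infinite, and $N_B$ is infinite.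
   Context: $\mathcal{M}$ acts on a Hilbert space; $\mathcal{M}^+$ is its set of positive elements. A semifinite infinite factor is of type I$_\infty$ or II$_\infty$. $\mathcal{J}$ is the norm-closed two-sided ideal generated by the finite projections of $\mathcal{M}$, $\pi:\mathcal{M}\to\mathcal{M}/\mathcal{J}$ is the quotient map, $\|A\|_e=\|\pi(A)\|$ and $\sigma_e(A)=\sigma(\pi(A))$. $C\cong B$ means $C=UBU^*$ for some unitary $U\in\mathcal{M}$. For projections, $P\prec Q$ means $P$ is Murray-von Neumann equivalent in $\mathcal{M}$ to a subprojection of $Q$; "infinite" for a projection is meant relative to $\mathcal{M}$. $N_A$ is the projection on the null space of $A$. $\chi_S(B)$ is the spectral projection of $B$ for the Borel set $S$. Infinite sums of operators converge in the strong operator topology. *)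

theory Defs
  imports "HOL-Analysis.Analysis" "HOL-Algebra.QuotRing"
begin

section \<open>Complex Hilbert spaces\<close>

text \<open>
  The real inner product of the underlying class is the real part of the complex one, so the
  norm, metric and topology are those of the complex inner product (which is linear in its first
  argument), and positive definiteness is inherited.
\<close>

class complex_inner = real_inner +
  fixes scaleC :: "complex \<Rightarrow> 'a \<Rightarrow> 'a" (infixr "*\<^sub>C" 75)
    and cinner :: "'a \<Rightarrow> 'a \<Rightarrow> complex"
  assumes scaleC_add_right: "c *\<^sub>C (x + y) = c *\<^sub>C x + c *\<^sub>C y"
    and scaleC_add_left: "(c + d) *\<^sub>C x = c *\<^sub>C x + d *\<^sub>C x"
    and scaleC_scaleC: "c *\<^sub>C (d *\<^sub>C x) = (c * d) *\<^sub>C x"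
    and scaleC_of_real: "complex_of_real r *\<^sub>C x = r *\<^sub>R x"
    and cinner_commute: "cinner x y = cnj (cinner y x)"
    and cinner_add_left: "cinner (x + y) z = cinner x z + cinner y z"
    and cinner_scaleC_left: "cinner (c *\<^sub>C x) y = c * cinner x y"
    and inner_eq_Re_cinner: "inner x y = Re (cinner x y)"

class complex_hilbert = complex_inner + complete_space

lemma norm_scaleC: "norm (c *\<^sub>C x) = cmod c * norm (x :: 'a::complex_inner)"
proof -
  have "cinner (c *\<^sub>C x) (c *\<^sub>C x) = c * cnj (cinner (c *\<^sub>C x) x)"
    using cinner_scaleC_left cinner_commute by metis
  also have "\<dots> = (c * cnj c) * cnj (cinner x x)"
    by (simp add: cinner_scaleC_left)
  finally have "cinner (c *\<^sub>C x) (c *\<^sub>C x) = of_real ((cmod c)\<^sup>2) * cinner x x"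
    using cinner_commute[of x x] by (metis complex_norm_square of_real_power)
  then have "inner (c *\<^sub>C x) (c *\<^sub>C x) = (cmod c)\<^sup>2 * inner x x"
    by (simp add: inner_eq_Re_cinner)
  then show ?thesis
    by (simp add: norm_eq_sqrt_inner real_sqrt_mult)
qed

section \<open>Bounded operators\<close>

text \<open>
  An operator is a bounded real-linear map in \<open>'a \<Rightarrow>\<^sub>L 'a\<close> that is complex-linear; its norm is the
  operator norm of that type.
\<close>

definition bounded_ops :: "('a::complex_hilbert \<Rightarrow>\<^sub>L 'a) set" where
  "bounded_ops = {T :: 'a \<Rightarrow>\<^sub>L 'a. \<forall>c x. T (c *\<^sub>C x) = c *\<^sub>C T x}"

lift_definition scalar_op :: "complex \<Rightarrow> 'a::complex_hilbert \<Rightarrow>\<^sub>L 'a" is "\<lambda>c x. c *\<^sub>C x"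
proof (rule bounded_linear_intro)
  fix c r and x y :: 'a
  show "c *\<^sub>C (x + y) = c *\<^sub>C x + c *\<^sub>C y"
    by (rule scaleC_add_right)
  show "c *\<^sub>C (r *\<^sub>R x) = r *\<^sub>R (c *\<^sub>C x)"
    by (simp flip: scaleC_of_real add: scaleC_scaleC mult.commute)
  show "norm (c *\<^sub>C x) \<le> norm x * cmod c"
    by (simp add: norm_scaleC)
qed

definition adj :: "('a::complex_hilbert \<Rightarrow>\<^sub>L 'a) \<Rightarrow> 'a \<Rightarrow>\<^sub>L 'a" where
  "adj T = (THE S :: 'a \<Rightarrow>\<^sub>L 'a. \<forall>x y. cinner (T x) y = cinner x (S y))"

definition commutant :: "('a::complex_hilbert \<Rightarrow>\<^sub>L 'a) set \<Rightarrow> ('a \<Rightarrow>\<^sub>L 'a) set" where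
  "commutant S = {T \<in> bounded_ops. \<forall>X\<in>S. T o\<^sub>L X = X o\<^sub>L T}"

definition is_projection :: "('a::complex_hilbert \<Rightarrow>\<^sub>L 'a) \<Rightarrow> bool" where
  "is_projection P \<longleftrightarrow> P \<in> bounded_ops \<and> P o\<^sub>L P = P \<and> adj P = P"

definition proj_le :: "('a::complex_hilbert \<Rightarrow>\<^sub>L 'a) \<Rightarrow> ('a \<Rightarrow>\<^sub>L 'a) \<Rightarrow> bool" where
  "proj_le P Q \<longleftrightarrow> Q o\<^sub>L P = P"

definition null_proj :: "('a::complex_hilbert \<Rightarrow>\<^sub>L 'a) \<Rightarrow> 'a \<Rightarrow>\<^sub>L 'a" where
  "null_proj A = (THE P. is_projection P \<and> range (blinfun_apply P) = {x. A x = 0})"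

section \<open>Spectral projections\<close>

text \<open>
  \<open>E\<close> is a projection-valued Borel measure on the line with \<open>B = \<integral> t dE(t)\<close>, the integral being
  taken in the weak sense. Integrability of \<open>t\<close> is part of \<open>has_bochner_integral\<close>. For
  self-adjoint \<open>B\<close> there is exactly one such \<open>E\<close>, up to its values off the Borel sets.
\<close>

definition spectral_measure ::
    "('a::complex_hilbert \<Rightarrow>\<^sub>L 'a) \<Rightarrow> (real set \<Rightarrow> 'a \<Rightarrow>\<^sub>L 'a) \<Rightarrow> bool" where
  "spectral_measure B E \<longleftrightarrow>
     (\<forall>S\<in>sets borel. is_projection (E S)) \<and>
     E UNIV = id_blinfun \<and>
     (\<forall>S\<in>sets borel. \<forall>T\<in>sets borel. E (S \<inter> T) = E S o\<^sub>L E T) \<and>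
     (\<forall>F :: nat \<Rightarrow> real set. range F \<subseteq> sets borel \<and> disjoint_family F \<longrightarrow>
        (\<forall>x. (\<lambda>n. E (F n) x) sums E (\<Union>n. F n) x)) \<and>
     (\<forall>x. has_bochner_integral
            (measure_of UNIV (sets borel) (\<lambda>S. ennreal (Re (cinner (E S x) x))))
            complex_of_real (cinner (B x) x))"

definition spectral_proj :: "real set \<Rightarrow> ('a::complex_hilbert \<Rightarrow>\<^sub>L 'a) \<Rightarrow> 'a \<Rightarrow>\<^sub>L 'a" where
  "spectral_proj S B = (THE P. \<exists>E. spectral_measure B E \<and> P = E S)"

section \<open>Von Neumann algebras\<close>

definition von_neumann_algebra :: "('a::complex_hilbert \<Rightarrow>\<^sub>L 'a) set \<Rightarrow> bool" where
  "von_neumann_algebra M \<longleftrightarrow>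
     M \<subseteq> bounded_ops \<and> (\<forall>T\<in>M. adj T \<in> M) \<and> commutant (commutant M) = M"

definition center :: "('a::complex_hilbert \<Rightarrow>\<^sub>L 'a) set \<Rightarrow> ('a \<Rightarrow>\<^sub>L 'a) set" where
  "center M = M \<inter> commutant M"

definition factor :: "('a::complex_hilbert \<Rightarrow>\<^sub>L 'a) set \<Rightarrow> bool" where
  "factor M \<longleftrightarrow> von_neumann_algebra M \<and> center M = range scalar_op"

definition positives :: "('a::complex_hilbert \<Rightarrow>\<^sub>L 'a) set \<Rightarrow> ('a \<Rightarrow>\<^sub>L 'a) set" where
  "positives M = {A \<in> M. \<forall>x. cinner (A x) x \<in> \<real>\<^sub>\<ge>\<^sub>0}"

definition projections :: "('a::complex_hilbert \<Rightarrow>\<^sub>L 'a) set \<Rightarrow> ('a \<Rightarrow>\<^sub>L 'a) set" where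
  "projections M = {P \<in> M. is_projection P}"

definition mvn_equiv ::
    "('a::complex_hilbert \<Rightarrow>\<^sub>L 'a) set \<Rightarrow> ('a \<Rightarrow>\<^sub>L 'a) \<Rightarrow> ('a \<Rightarrow>\<^sub>L 'a) \<Rightarrow> bool" where
  "mvn_equiv M P Q \<longleftrightarrow> (\<exists>V\<in>M. adj V o\<^sub>L V = P \<and> V o\<^sub>L adj V = Q)"

definition mvn_le ::
    "('a::complex_hilbert \<Rightarrow>\<^sub>L 'a) set \<Rightarrow> ('a \<Rightarrow>\<^sub>L 'a) \<Rightarrow> ('a \<Rightarrow>\<^sub>L 'a) \<Rightarrow> bool" where
  "mvn_le M P Q \<longleftrightarrow> (\<exists>Q'\<in>projections M. proj_le Q' Q \<and> mvn_equiv M P Q')"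

definition finite_proj :: "('a::complex_hilbert \<Rightarrow>\<^sub>L 'a) set \<Rightarrow> ('a \<Rightarrow>\<^sub>L 'a) \<Rightarrow> bool" where
  "finite_proj M P \<longleftrightarrow> P \<in> projections M \<and>
     (\<forall>Q\<in>projections M. proj_le Q P \<and> mvn_equiv M P Q \<longrightarrow> Q = P)"

definition infinite_proj :: "('a::complex_hilbert \<Rightarrow>\<^sub>L 'a) set \<Rightarrow> ('a \<Rightarrow>\<^sub>L 'a) \<Rightarrow> bool" where
  "infinite_proj M P \<longleftrightarrow> P \<in> projections M \<and> \<not> finite_proj M P"

definition infinite_algebra :: "('a::complex_hilbert \<Rightarrow>\<^sub>L 'a) set \<Rightarrow> bool" where
  "infinite_algebra M \<longleftrightarrow> infinite_proj M id_blinfun"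

definition semifinite :: "('a::complex_hilbert \<Rightarrow>\<^sub>L 'a) set \<Rightarrow> bool" where
  "semifinite M \<longleftrightarrow> (\<forall>Z\<in>projections (center M). Z \<noteq> 0 \<longrightarrow>
     (\<exists>P. finite_proj M P \<and> P \<noteq> 0 \<and> proj_le P Z))"

definition sigma_finite :: "('a::complex_hilbert \<Rightarrow>\<^sub>L 'a) set \<Rightarrow> bool" where
  "sigma_finite M \<longleftrightarrow> (\<forall>\<P> \<subseteq> projections M - {0}.
     pairwise (\<lambda>P Q. P o\<^sub>L Q = 0) \<P> \<longrightarrow> countable \<P>)"

definition unitarily_equiv ::
    "('a::complex_hilbert \<Rightarrow>\<^sub>L 'a) set \<Rightarrow> ('a \<Rightarrow>\<^sub>L 'a) \<Rightarrow> ('a \<Rightarrow>\<^sub>L 'a) \<Rightarrow> bool" where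
  "unitarily_equiv M C B \<longleftrightarrow> (\<exists>U\<in>M. adj U o\<^sub>L U = id_blinfun \<and> U o\<^sub>L adj U = id_blinfun \<and>
     C = U o\<^sub>L B o\<^sub>L adj U)"

section \<open>The quotient by the ideal of the finite projections\<close>

definition op_ring :: "('a::complex_hilbert \<Rightarrow>\<^sub>L 'a) set \<Rightarrow> ('a \<Rightarrow>\<^sub>L 'a) ring" where
  "op_ring M = \<lparr>carrier = M, monoid.mult = (o\<^sub>L), one = id_blinfun,
     ring.zero = 0, ring.add = (+)\<rparr>"

text \<open>Ring ideals of \<open>M\<close> are complex subspaces, because \<open>M\<close> contains the scalar operators.\<close>

definition finite_ideal :: "('a::complex_hilbert \<Rightarrow>\<^sub>L 'a) set \<Rightarrow> ('a \<Rightarrow>\<^sub>L 'a) set" where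
  "finite_ideal M = \<Inter>{I. ideal I (op_ring M) \<and> closed I \<and> Collect (finite_proj M) \<subseteq> I}"

definition quot_alg :: "('a::complex_hilbert \<Rightarrow>\<^sub>L 'a) set \<Rightarrow> ('a \<Rightarrow>\<^sub>L 'a) set ring" where
  "quot_alg M = op_ring M Quot finite_ideal M"

definition quot_map ::
    "('a::complex_hilbert \<Rightarrow>\<^sub>L 'a) set \<Rightarrow> ('a \<Rightarrow>\<^sub>L 'a) \<Rightarrow> ('a \<Rightarrow>\<^sub>L 'a) set" where
  "quot_map M A = finite_ideal M +>\<^bsub>op_ring M\<^esub> A"

definition quot_norm :: "('a::complex_hilbert \<Rightarrow>\<^sub>L 'a) set \<Rightarrow> real" where
  "quot_norm X = (INF T\<in>X. norm T)"

definition ess_norm :: "('a::complex_hilbert \<Rightarrow>\<^sub>L 'a) set \<Rightarrow> ('a \<Rightarrow>\<^sub>L 'a) \<Rightarrow> real" where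
  "ess_norm M A = quot_norm (quot_map M A)"

definition ess_spectrum :: "('a::complex_hilbert \<Rightarrow>\<^sub>L 'a) set \<Rightarrow> ('a \<Rightarrow>\<^sub>L 'a) \<Rightarrow> complex set" where
  "ess_spectrum M A =
     {c. quot_map M A \<ominus>\<^bsub>quot_alg M\<^esub> quot_map M (scalar_op c) \<notin> Units (quot_alg M)}"

end

theory Submission
  imports Defs
begin

text \<open>
  The copies of \<open>B\<close> are removed from \<open>A\<close> one at a time. Let \<open>\<lambda>\<close> be the essential norm of \<open>A\<close>.
  Every \<open>A'\<close> that occurs stays above each level \<open>\<beta> n\<close> on some infinite projection, where
  \<open>\<beta> n\<close> increases to \<open>\<lambda>\<close> in cases (i) and (ii) and is constantly \<open>\<lambda>\<close> in case (iii).
  Suppose \<open>A' \<ge> s P\<close> with \<open>P\<close> subequivalent to a fixed finite projection below a spectral band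
  \<open>[\<delta>, f)\<close> of \<open>B\<close>, where \<open>f < \<beta> 0\<close>. A Schur complement gives \<open>A' \<ge> (s/2) P + X\<close> with \<open>X\<close> supported
  off \<open>P\<close> and again above every \<open>\<beta> n\<close> on infinite projections. Tilting \<open>P\<close> slightly towards a
  part of \<open>X\<close> of height \<open>\<beta> 0\<close> makes room for a copy of that band which still sees a fixed
  proportion \<open>\<theta> s \<parallel>P x\<parallel>\<^sup>2\<close> of a given vector \<open>x\<close>; the higher bands of \<open>B\<close> are put below the parts of
  \<open>X\<close> of height \<open>\<beta> n\<close>. What is left of the space takes the null space of \<open>B\<close> if that is infinite;
  otherwise \<open>0 \<in> \<sigma>\<^sub>e(B)\<close> supplies arbitrarily small infinite pieces of \<open>B\<close>, and
  \<open>N\<^sub>A \<prec> N\<^sub>B\<close> makes the null spaces fit exactly. Choosing \<open>x\<close> from a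
  separating sequence, each term infinitely often, forces the remainders to decrease to \<open>0\<close>
  strongly. Case (iv) only needs an infinite projection to be cut into copies of \<open>P\<close>.
\<close>

text \<open>Two obstacles shape the construction. The level \<open>s\<close> at which A' dominates P
  may lie far below \<delta>, so a copy of the band need not fit under s P. Tilting borrows height
  from a level above f, at the price of a factor \<theta> depending only on \<delta>, f and \<beta>
  0; since \<theta> is the same at every step, a nonzero limit would lose a fixed amount at each
  return of the same vector. Moreover, removal must be repeatable with the same \<beta>. The room
  for level n is therefore taken at height \<beta> (n+2): one part carries a band of B bounded by
  \<beta> n, another infinite part spends only \<beta> (n+2) - \<beta> n and so keeps \<beta> n.
  With \<beta> strictly increasing, every piece off the null space keeps a positive remainder, so
  the null space never grows, as a finite N_B requires; with \<beta> constant it may grow, and an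
  infinite N_B absorbs it. P is finite so that a Schur complement costs only finite projections,
  which leave infinite levels infinite. The removal works with spectral projections of half-lines;
  the full spectral measure serves to identify the spectral projections of single points in the
  hypotheses.\<close>

unbundle inner_syntax

section \<open>Real Hilbert space preliminaries\<close>

lemma parallelogram:
  fixes x y :: "'a::real_inner"
  shows "(norm (x - y))\<^sup>2 = 2 * (norm x)\<^sup>2 + 2 * (norm y)\<^sup>2 - (norm (x + y))\<^sup>2"
  by (simp add: power2_norm_eq_inner inner_commute algebra_simps)

text \<open>A minimizing sequence for the distance to \<open>x\<close> is Cauchy: midpoints stay in
  \<open>S\<close>, so the parallelogram law bounds the distance between two near-minimizers. The
  limit is the foot of the perpendicular.\<close>

lemma orthogonal_projection_exists:
  fixes S :: "'a::{real_inner,complete_space} set"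
  assumes S: "subspace S" "closed S"
  shows "\<exists>p\<in>S. \<forall>y\<in>S. (x - p) \<bullet> y = 0"
proof -
  define D where "D = (\<lambda>y. (norm (x - y))\<^sup>2) ` S"
  define d where "d = Inf D"
  have ne: "D \<noteq> {}" using S(1) subspace_0 by (auto simp: D_def)
  have bdd: "bdd_below D" by (rule bdd_belowI[of _ 0]) (auto simp: D_def)
  have lower: "d \<le> (norm (x - y))\<^sup>2" if "y \<in> S" for y
    unfolding d_def by (rule cInf_lower[OF _ bdd]) (use that in \<open>auto simp: D_def\<close>)
  have "\<exists>y\<in>S. (norm (x - y))\<^sup>2 < d + 1 / real (Suc n)" for n
  proof -
    have "Inf D < d + 1 / real (Suc n)" by (simp add: d_def)
    then show ?thesis using cInf_lessD[OF ne] by (auto simp: D_def)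
  qed
  then obtain p where pS: "\<And>n. p n \<in> S" and p: "\<And>n. (norm (x - p n))\<^sup>2 < d + 1 / real (Suc n)"
    by metis
  have bound: "(norm (p m - p n))\<^sup>2 \<le> 2 / real (Suc m) + 2 / real (Suc n)" for m n
  proof -
    have mid: "(1/2) *\<^sub>R (p m + p n) \<in> S"
      using S(1) pS by (simp add: subspace_add subspace_scale)
    have "(x - p m) + (x - p n) = 2 *\<^sub>R (x - (1/2) *\<^sub>R (p m + p n))"
      by (simp add: algebra_simps scaleR_2)
    then have "(norm ((x - p m) + (x - p n)))\<^sup>2 = 4 * (norm (x - (1/2) *\<^sub>R (p m + p n)))\<^sup>2"
      by (simp only: norm_scaleR power_mult_distrib) simp
    then have "(norm ((x - p m) + (x - p n)))\<^sup>2 \<ge> 4 * d"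
      using lower[OF mid] by simp
    moreover have "(norm (p m - p n))\<^sup>2 = 2 * (norm (x - p m))\<^sup>2 + 2 * (norm (x - p n))\<^sup>2
        - (norm ((x - p m) + (x - p n)))\<^sup>2"
      using parallelogram[of "x - p m" "x - p n"] by (simp add: norm_minus_commute)
    ultimately show ?thesis using p[of m] p[of n] by argo
  qed
  have "Cauchy p"
  proof (rule metric_CauchyI)
    fix e :: real assume e: "e > 0"
    obtain N where N: "4 / real (Suc N) < e\<^sup>2"
    proof -
      obtain N where "4 / e\<^sup>2 < real N" using reals_Archimedean2 by blast
      then have "4 < e\<^sup>2 * real N" using e by (simp add: field_simps)
      then have "4 < e\<^sup>2 * real (Suc N)" using e by (smt (verit) of_nat_Suc mult_left_mono zero_le_power2)
      then have "4 / real (Suc N) < e\<^sup>2" by (simp add: field_simps)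
      then show ?thesis using that by blast
    qed
    show "\<exists>M. \<forall>m\<ge>M. \<forall>n\<ge>M. dist (p m) (p n) < e"
    proof (intro exI allI impI)
      fix m n assume mn: "m \<ge> N" "n \<ge> N"
      have "2 / real (Suc m) \<le> 2 / real (Suc N)" "2 / real (Suc n) \<le> 2 / real (Suc N)"
        using mn by (auto intro!: divide_left_mono)
      then have "(norm (p m - p n))\<^sup>2 < e\<^sup>2" using bound[of m n] N by simp
      then show "dist (p m) (p n) < e" using e by (simp add: dist_norm power2_less_imp_less)
    qed
  qed
  then obtain q where q: "p \<longlonglongrightarrow> q" using convergent_eq_Cauchy by blast
  have qS: "q \<in> S" using closed_sequentially[OF S(2)] pS q by blast
  have "(\<lambda>n. (norm (x - p n))\<^sup>2) \<longlonglongrightarrow> (norm (x - q))\<^sup>2"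
    by (intro tendsto_intros q)
  moreover have "(\<lambda>n. d + 1 / real (Suc n)) \<longlonglongrightarrow> d + 0"
    using LIMSEQ_inverse_real_of_nat by (intro tendsto_intros) (simp add: inverse_eq_divide)
  ultimately have "(norm (x - q))\<^sup>2 \<le> d + 0"
    by (rule LIMSEQ_le) (use p less_imp_le in blast)
  then have qd: "(norm (x - q))\<^sup>2 \<le> d" by simp
  have "(x - q) \<bullet> y = 0" if y: "y \<in> S" for y
  proof (rule ccontr)
    assume ne0: "(x - q) \<bullet> y \<noteq> 0"
    \<comment> \<open>The minimizer of the squared distance along the line q + t y; a nonzero inner
      product would make the distance strictly smaller there.\<close>
    define t where "t = ((x - q) \<bullet> y) / (y \<bullet> y)"
    have yy: "y \<bullet> y > 0" using ne0 by auto
    have "q + t *\<^sub>R y \<in> S" using qS y S(1) by (simp add: subspace_add subspace_scale)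
    then have "(norm (x - q))\<^sup>2 \<le> (norm (x - (q + t *\<^sub>R y)))\<^sup>2" using lower[of "q + t *\<^sub>R y"] qd by linarith
    also have "\<dots> = (norm (x - q))\<^sup>2 - 2 * t * ((x - q) \<bullet> y) + t\<^sup>2 * (y \<bullet> y)"
      unfolding power2_norm_eq_inner by (simp add: inner_commute algebra_simps power2_eq_square)
    also have "\<dots> = (norm (x - q))\<^sup>2 - ((x - q) \<bullet> y)\<^sup>2 / (y \<bullet> y)"
      using yy by (simp add: t_def power2_eq_square field_simps)
    finally show False using yy ne0 by (simp add: field_simps divide_le_0_iff)
  qed
  then show ?thesis using qS by blast
qed

text \<open>Orthogonality refers to the real inner product; on a complex subspace this is the same
  projection as for the complex one.\<close>

definition proj_on :: "'a::complex_hilbert set \<Rightarrow> 'a \<Rightarrow>\<^sub>L 'a" where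
  "proj_on S = (SOME P :: 'a \<Rightarrow>\<^sub>L 'a. \<forall>x. P x \<in> S \<and> (\<forall>y\<in>S. (x - P x) \<bullet> y = 0))"

lemma orthogonal_projection_unique:
  assumes "subspace S" "p \<in> S" "\<forall>y\<in>S. (x - p) \<bullet> y = 0" "q \<in> S" "\<forall>y\<in>S. (x - q) \<bullet> y = 0"
  shows "p = q"
proof -
  have pq: "p - q \<in> S" using assms by (simp add: subspace_diff)
  have "(p - q) \<bullet> (p - q) = (x - q) \<bullet> (p - q) - (x - p) \<bullet> (p - q)" by (simp add: algebra_simps)
  then have "(p - q) \<bullet> (p - q) = 0" using assms(3,5) pq by simp
  then show ?thesis by simp
qed

lemma proj_on_works:
  fixes S :: "'a::complex_hilbert set"
  assumes S: "subspace S" "closed S"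
  shows "proj_on S x \<in> S" "y \<in> S \<Longrightarrow> (x - proj_on S x) \<bullet> y = 0"
proof -
  obtain f where f: "\<And>x. f x \<in> S" "\<And>x y. y \<in> S \<Longrightarrow> (x - f x) \<bullet> y = 0"
    using orthogonal_projection_exists[OF S] by metis
  have uniq: "f x = p" if "p \<in> S" "\<forall>y\<in>S. (x - p) \<bullet> y = 0" for x p
    using orthogonal_projection_unique[OF S(1)] f that by blast
  have "bounded_linear f"
  proof (rule bounded_linear_intro)
    fix x y :: 'a and r :: real
    show "f (x + y) = f x + f y"
    proof (rule uniq)
      show "f x + f y \<in> S" using f(1) S(1) by (simp add: subspace_add)
      have "(x + y - (f x + f y)) \<bullet> z = (x - f x) \<bullet> z + (y - f y) \<bullet> z" for z
        by (simp add: algebra_simps)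
      then show "\<forall>z\<in>S. (x + y - (f x + f y)) \<bullet> z = 0" using f(2) by simp
    qed
    show "f (r *\<^sub>R x) = r *\<^sub>R f x"
    proof (rule uniq)
      show "r *\<^sub>R f x \<in> S" using f(1) S(1) by (simp add: subspace_scale)
      have "(r *\<^sub>R x - r *\<^sub>R f x) \<bullet> z = r * ((x - f x) \<bullet> z)" for z
        by (simp add: algebra_simps)
      then show "\<forall>z\<in>S. (r *\<^sub>R x - r *\<^sub>R f x) \<bullet> z = 0" using f(2) by simp
    qed
    have "f x \<bullet> f x = x \<bullet> f x" using f(2)[OF f(1), of x x] by (simp add: inner_diff_left)
    then have "(norm (f x))\<^sup>2 \<le> norm x * norm (f x)"
      using norm_cauchy_schwarz[of x "f x"] by (simp add: power2_norm_eq_inner)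
    then show "norm (f x) \<le> norm x * 1"
      by (cases "f x = 0") (auto simp: power2_eq_square)
  qed
  then have bl: "blinfun_apply (Blinfun f) = f" by (rule bounded_linear_Blinfun_apply)
  have "\<forall>x. proj_on S x \<in> S \<and> (\<forall>y\<in>S. (x - proj_on S x) \<bullet> y = 0)"
    unfolding proj_on_def by (rule someI[of _ "Blinfun f"]) (use f bl in auto)
  then show "proj_on S x \<in> S" "y \<in> S \<Longrightarrow> (x - proj_on S x) \<bullet> y = 0" by auto
qed

lemma proj_on_eqI:
  assumes "subspace S" "closed S" "p \<in> S" "\<And>y. y \<in> S \<Longrightarrow> (x - p) \<bullet> y = 0"
  shows "proj_on S x = p"
  using orthogonal_projection_unique[OF assms(1)] proj_on_works[OF assms(1,2)] assms(3,4) by blast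

lemma proj_on_id: "subspace S \<Longrightarrow> closed S \<Longrightarrow> x \<in> S \<Longrightarrow> proj_on S x = x"
  by (rule proj_on_eqI) auto

lemma range_proj_on: "subspace S \<Longrightarrow> closed S \<Longrightarrow> range (proj_on S) = S"
  using proj_on_works(1)[of S] proj_on_id[of S] by (auto simp: image_iff) metis

lemma proj_on_selfadj:
  assumes S: "subspace S" "closed S"
  shows "proj_on S x \<bullet> y = x \<bullet> proj_on S y"
proof -
  have "(x - proj_on S x) \<bullet> proj_on S y = 0" "(y - proj_on S y) \<bullet> proj_on S x = 0"
    using proj_on_works[OF S] by auto
  then show ?thesis by (simp add: inner_diff_left inner_diff_right inner_commute)
qed

text \<open>\<open>f\<close> preserves \<open>S\<close>, and its adjoint \<open>g\<close> does too,
  so \<open>f\<close> also preserves the orthogonal complement and splits along the two.\<close>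

lemma proj_on_commute:
  assumes S: "subspace S" "closed S" and "\<And>x. x \<in> S \<Longrightarrow> f x \<in> S" "\<And>x. x \<in> S \<Longrightarrow> g x \<in> S"
    and lin: "linear f" and adj: "\<And>x y. f x \<bullet> y = x \<bullet> g y"
  shows "proj_on S (f x) = f (proj_on S x)"
proof (rule proj_on_eqI[OF S])
  show "f (proj_on S x) \<in> S" using proj_on_works[OF S] assms(3) by blast
  fix y assume "y \<in> S"
  have "(f x - f (proj_on S x)) \<bullet> y = (x - proj_on S x) \<bullet> g y"
    using adj lin by (metis linear_diff)
  then show "(f x - f (proj_on S x)) \<bullet> y = 0" using proj_on_works[OF S] assms(4) \<open>y \<in> S\<close> by simp
qed

section \<open>Riesz representation and adjoints\<close>

lemma riesz_representation:
  fixes f :: "'a::{real_inner,complete_space} \<Rightarrow> real"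
  assumes f: "bounded_linear f"
  shows "\<exists>y. \<forall>x. f x = x \<bullet> y"
proof (cases "\<forall>x. f x = 0")
  case True then show ?thesis by (intro exI[of _ 0]) auto
next
  case False
  then obtain x0 where x0: "f x0 \<noteq> 0" by blast
  interpret f: bounded_linear f by (rule f)
  let ?S = "{x. f x = 0}"
  have S: "subspace ?S" by (simp add: subspace_def f.add f.scaleR)
  have cl: "closed ?S" by (intro closed_Collect_eq continuous_on_const f.continuous_on continuous_on_id)
  obtain p where p: "f p = 0" "\<forall>y\<in>?S. (x0 - p) \<bullet> y = 0"
    using orthogonal_projection_exists[OF S cl, of x0] by auto
  \<comment> \<open>Orthogonal to the kernel of \<open>f\<close>. Since
    \<open>f z *\<^sub>R x - f x *\<^sub>R z\<close> lies in the kernel, pairing it with z computes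
    f x.\<close>
  define z where "z = x0 - p"
  have fz: "f z = f x0" by (simp add: z_def f.diff p(1))
  have zz: "z \<bullet> z > 0" using fz x0 by (auto simp: f.zero)
  have "f x = x \<bullet> ((f z / (z \<bullet> z)) *\<^sub>R z)" for x
  proof -
    have "f (f z *\<^sub>R x - f x *\<^sub>R z) = 0" by (simp add: f.diff f.scaleR mult.commute)
    then have "z \<bullet> (f z *\<^sub>R x - f x *\<^sub>R z) = 0" using p(2) by (simp add: z_def)
    then have "f z * (z \<bullet> x) = f x * (z \<bullet> z)" by (simp add: inner_diff_right)
    then show ?thesis using zz by (simp add: field_simps inner_commute)
  qed
  then show ?thesis by blast
qed

text \<open>Riesz representation of x \<mapsto> T x \<bullet> y for each y. The resulting map is
  bounded because the squared norm of s x equals T (s x) \<bullet> x.\<close>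

lemma real_adjoint_exists:
  fixes T :: "'a::{real_inner,complete_space} \<Rightarrow>\<^sub>L 'a"
  shows "\<exists>S :: 'a \<Rightarrow>\<^sub>L 'a. \<forall>x y. T x \<bullet> y = x \<bullet> S y"
proof -
  have "\<exists>z. \<forall>x. T x \<bullet> y = x \<bullet> z" for y
    by (rule riesz_representation) (intro bounded_linear_intros)
  then obtain s where s: "\<And>x y. T x \<bullet> y = x \<bullet> s y" by metis
  have eq: "u = v" if "\<And>x :: 'a. x \<bullet> u = x \<bullet> v" for u v
    by (metis that vector_eq_ldot)
  have "bounded_linear s"
  proof (rule bounded_linear_intro)
    fix x y :: 'a and r :: real
    show "s (x + y) = s x + s y" by (rule eq) (simp add: s[symmetric] inner_add_right)
    show "s (r *\<^sub>R x) = r *\<^sub>R s x" by (rule eq) (simp add: s[symmetric])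
    have "(norm (s x))\<^sup>2 = T (s x) \<bullet> x" by (simp add: s power2_norm_eq_inner)
    also have "\<dots> \<le> norm (T (s x)) * norm x" by (rule norm_cauchy_schwarz)
    also have "\<dots> \<le> norm T * norm (s x) * norm x" by (intro mult_right_mono norm_blinfun) auto
    finally have "norm (s x) * norm (s x) \<le> (norm x * norm T) * norm (s x)"
      by (simp add: power2_eq_square algebra_simps)
    then show "norm (s x) \<le> norm x * norm T"
      by (cases "s x = 0") auto
  qed
  then have "blinfun_apply (Blinfun s) = s" by (rule bounded_linear_Blinfun_apply)
  then show ?thesis using s by (intro exI[of _ "Blinfun s"]) simp
qed

section \<open>Complex structure and adjoints\<close>

lemma inner_scaleC_left: "(c *\<^sub>C x) \<bullet> y = x \<bullet> (cnj c *\<^sub>C (y :: 'a::complex_inner))"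
proof -
  have "cinner x (cnj c *\<^sub>C y) = c * cinner x y"
    by (metis cinner_commute cinner_scaleC_left complex_cnj_cnj complex_cnj_mult)
  then show ?thesis by (simp add: inner_eq_Re_cinner cinner_scaleC_left)
qed

lemma Im_cinner: "Im (cinner x y) = - ((\<i> *\<^sub>C x) \<bullet> (y :: 'a::complex_inner))"
  by (simp add: inner_eq_Re_cinner cinner_scaleC_left)

lemma bounded_opsD: "T \<in> bounded_ops \<Longrightarrow> T (c *\<^sub>C x) = c *\<^sub>C T x"
  by (simp add: bounded_ops_def)

text \<open>Up to sign, the imaginary part of \<open>cinner\<close> is the real inner product with
  the first argument multiplied by i, so complex-linearity of \<open>T\<close> lifts the real
  adjoint identity to the complex one.\<close>

lemma cinner_adjointI:
  fixes T S :: "'a::complex_hilbert \<Rightarrow>\<^sub>L 'a"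
  assumes "T \<in> bounded_ops" "\<And>x y. T x \<bullet> y = x \<bullet> S y"
  shows "cinner (T x) y = cinner x (S y)"
  by (rule complex_eqI) (use assms in \<open>simp_all add: Im_cinner bounded_opsD[symmetric] flip: inner_eq_Re_cinner\<close>)

lemma adj_eqI:
  fixes T S :: "'a::complex_hilbert \<Rightarrow>\<^sub>L 'a"
  assumes "T \<in> bounded_ops" "\<And>x y. T x \<bullet> y = x \<bullet> S y"
  shows "adj T = S"
  unfolding adj_def
proof (rule the_equality)
  show "\<forall>x y. cinner (T x) y = cinner x (S y)" using cinner_adjointI assms by blast
  fix S' assume "\<forall>x y. cinner (T x) y = cinner x (blinfun_apply S' y)"
  then have "x \<bullet> S' y = x \<bullet> S y" for x y
    by (metis assms(2) inner_eq_Re_cinner)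
  then show "S' = S" by (metis blinfun_eqI vector_eq_ldot)
qed

lemma adj_inner: "T \<in> bounded_ops \<Longrightarrow> T x \<bullet> y = x \<bullet> adj T y"
  using real_adjoint_exists[of T] adj_eqI by metis

lemma adj_inner': "T \<in> bounded_ops \<Longrightarrow> adj T x \<bullet> y = x \<bullet> T y"
  by (metis adj_inner inner_commute)

lemma adj_bounded_ops: "T \<in> bounded_ops \<Longrightarrow> adj T \<in> bounded_ops"
  unfolding bounded_ops_def mem_Collect_eq
proof (intro allI)
  fix c x assume T: "\<forall>c x. T (c *\<^sub>C x) = c *\<^sub>C T x"
  then have bo: "T \<in> bounded_ops" by (simp add: bounded_ops_def)
  have "z \<bullet> adj T (c *\<^sub>C x) = z \<bullet> (c *\<^sub>C adj T x)" for z
    using T by (metis adj_inner[OF bo] complex_cnj_cnj inner_scaleC_left)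
  then show "adj T (c *\<^sub>C x) = c *\<^sub>C adj T x" by (metis vector_eq_ldot)
qed

lemma bounded_ops_comp: "S \<in> bounded_ops \<Longrightarrow> T \<in> bounded_ops \<Longrightarrow> S o\<^sub>L T \<in> bounded_ops"
  and bounded_ops_add: "S \<in> bounded_ops \<Longrightarrow> T \<in> bounded_ops \<Longrightarrow> S + T \<in> bounded_ops"
  and bounded_ops_id: "id_blinfun \<in> bounded_ops"
  by (simp_all add: bounded_ops_def blinfun.add_left scaleC_add_right)

lemma scalar_op_bounded_ops: "scalar_op c \<in> bounded_ops"
  by (simp add: bounded_ops_def scalar_op.rep_eq scaleC_scaleC mult.commute)

lemma adj_comp: "S \<in> bounded_ops \<Longrightarrow> T \<in> bounded_ops \<Longrightarrow> adj (S o\<^sub>L T) = adj T o\<^sub>L adj S"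
  by (rule adj_eqI) (auto simp: bounded_ops_comp adj_inner)

lemma adj_adj: "T \<in> bounded_ops \<Longrightarrow> adj (adj T) = T"
  by (rule adj_eqI) (auto simp: adj_bounded_ops adj_inner')

text \<open>Reality of the form says A (i x) \<bullet> x = 0 for every x. Polarization makes (x, y)
  \<mapsto> A (i x) \<bullet> y skew, and substituting -i x turns skewness into symmetry.\<close>

lemma positive_imp_selfadjoint:
  fixes A :: "'a::complex_hilbert \<Rightarrow>\<^sub>L 'a"
  assumes A: "A \<in> bounded_ops" and "\<And>x. cinner (A x) x \<in> \<real>\<^sub>\<ge>\<^sub>0"
  shows "A x \<bullet> y = x \<bullet> A y" "A x \<bullet> x \<ge> 0"
proof -
  have z: "A (\<i> *\<^sub>C x) \<bullet> x = 0" for x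
    using assms(2)[of x] Im_cinner[of "A x" x] by (simp add: bounded_opsD[OF A] complex_nonneg_Reals_iff)
  have skew: "A (\<i> *\<^sub>C x) \<bullet> y = - (A (\<i> *\<^sub>C y) \<bullet> x)" for x y
    using z[of "x + y"] z[of x] z[of y]
    by (simp add: scaleC_add_right blinfun.add_right inner_add_left inner_add_right)
  have i: "\<i> *\<^sub>C (- \<i>) *\<^sub>C x = x" for x :: 'a
    by (metis scaleC_scaleC scaleC_of_real scaleR_one of_real_1 complex_i_mult_minus mult_minus_right i_squared minus_minus)
  have "A x \<bullet> y = - (A (\<i> *\<^sub>C y) \<bullet> ((- \<i>) *\<^sub>C x))"
    using skew[of "(- \<i>) *\<^sub>C x" y] i by simp
  also have "\<dots> = - (A (\<i> *\<^sub>C y) \<bullet> (cnj \<i> *\<^sub>C x))" by simp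
  also have "\<dots> = - ((\<i> *\<^sub>C A (\<i> *\<^sub>C y)) \<bullet> x)" by (simp only: inner_scaleC_left)
  also have "\<i> *\<^sub>C A (\<i> *\<^sub>C y) = A (- y)"
  proof -
    have "\<i> *\<^sub>C A (\<i> *\<^sub>C y) = A (\<i> *\<^sub>C \<i> *\<^sub>C y)" by (simp add: bounded_opsD[OF A])
    also have "\<i> *\<^sub>C \<i> *\<^sub>C y = - y"
      by (metis scaleC_scaleC i_squared scaleC_of_real scaleR_minus1_left of_real_1 of_real_minus)
    finally show ?thesis .
  qed
  finally show "A x \<bullet> y = x \<bullet> A y" by (simp add: blinfun.minus_right inner_commute)
  show "A x \<bullet> x \<ge> 0" using assms(2)[of x] by (simp add: inner_eq_Re_cinner complex_nonneg_Reals_iff)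
qed

subclass (in complex_hilbert) banach ..

section \<open>Orthogonal series and monotone limits of operators\<close>

lemma orthogonal_summable:
  fixes a :: "nat \<Rightarrow> 'a::{real_inner,banach}"
  assumes orth: "\<And>m n. m \<noteq> n \<Longrightarrow> a m \<bullet> a n = 0"
    and bound: "\<And>n. (\<Sum>k<n. (norm (a k))\<^sup>2) \<le> C"
  shows "summable a" "(norm (suminf a))\<^sup>2 \<le> C" "(\<lambda>k. (norm (a k))\<^sup>2) sums (norm (suminf a))\<^sup>2"
proof -
  have pyth: "(norm (sum a I))\<^sup>2 = (\<Sum>k\<in>I. (norm (a k))\<^sup>2)" if "finite I" for I
    using that orth by (intro norm_sum_Pythagorean) (auto simp: pairwise_def orthogonal_def)
  have summ: "summable (\<lambda>k. (norm (a k))\<^sup>2)"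
    by (rule summableI_nonneg_bounded[of _ C]) (use bound in auto)
  show sa: "summable a"
    unfolding summable_Cauchy
  proof (intro allI impI)
    fix e :: real assume e: "e > 0"
    then obtain N where N: "\<And>m n. m \<ge> N \<Longrightarrow> norm (\<Sum>k = m..<n. (norm (a k))\<^sup>2) < e\<^sup>2"
      using summ unfolding summable_Cauchy by (metis zero_less_power)
    have "norm (sum a {m..<n}) < e" if "m \<ge> N" for m n
    proof -
      have "(norm (sum a {m..<n}))\<^sup>2 < e\<^sup>2" using N[OF that, of n] pyth[of "{m..<n}"] by auto
      then show ?thesis using e by (simp add: power2_less_imp_less)
    qed
    then show "\<exists>N. \<forall>m\<ge>N. \<forall>n. norm (sum a {m..<n}) < e" by blast
  qed
  have "(\<lambda>n. (norm (\<Sum>k<n. a k))\<^sup>2) \<longlonglongrightarrow> (norm (suminf a))\<^sup>2"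
    using summable_LIMSEQ[OF sa] by (intro tendsto_intros)
  then have lim: "(\<lambda>n. \<Sum>k<n. (norm (a k))\<^sup>2) \<longlonglongrightarrow> (norm (suminf a))\<^sup>2"
    by (simp add: pyth)
  then show "(\<lambda>k. (norm (a k))\<^sup>2) sums (norm (suminf a))\<^sup>2" by (simp add: sums_def)
  show "(norm (suminf a))\<^sup>2 \<le> C" by (rule LIMSEQ_le_const2[OF lim]) (use bound in blast)
qed

text \<open>The form at x + t y is a nonnegative polynomial in t; its minimum gives the inequality.
  If the quadratic coefficient vanishes, the linear one must vanish too.\<close>

lemma psd_Cauchy_Schwarz:
  fixes D :: "'a::real_inner \<Rightarrow>\<^sub>L 'a"
  assumes sa: "\<And>x y. D x \<bullet> y = x \<bullet> D y" and pos: "\<And>x. 0 \<le> D x \<bullet> x"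
  shows "(D x \<bullet> y)\<^sup>2 \<le> (D x \<bullet> x) * (D y \<bullet> y)"
proof -
  define a b c where "a = D x \<bullet> x" and "b = D x \<bullet> y" and "c = D y \<bullet> y"
  have b': "D y \<bullet> x = b" using sa[of y x] by (simp add: b_def inner_commute)
  have q: "0 \<le> a + 2 * t * b + t\<^sup>2 * c" for t
  proof -
    have "0 \<le> D (x + t *\<^sub>R y) \<bullet> (x + t *\<^sub>R y)" by (rule pos)
    also have "\<dots> = a + 2 * t * b + t\<^sup>2 * c"
      using b' by (simp add: blinfun.add_right blinfun.scaleR_right inner_add_left inner_add_right
          a_def b_def c_def power2_eq_square algebra_simps)
    finally show ?thesis .
  qed
  have a: "0 \<le> a" and c: "0 \<le> c" using pos by (auto simp: a_def c_def)
  show ?thesis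
  proof (cases "c = 0")
    case True
    have "b = 0"
    proof (rule ccontr)
      assume "b \<noteq> 0"
      \<comment> \<open>At this t the linear polynomial a + 2 t b takes the value -1.\<close>
      then show False using q[of "- (a + 1) / (2 * b)"] True by (simp add: field_simps)
    qed
    then show ?thesis using True by (simp add: b_def[symmetric] c_def[symmetric])
  next
    case False
    then have c0: "c > 0" using c by simp
    have "0 \<le> a - b\<^sup>2 / c" using q[of "- b / c"] c0 by (simp add: field_simps power2_eq_square)
    then have "b\<^sup>2 \<le> a * c" using c0 by (simp add: field_simps)
    then show ?thesis by (simp add: a_def b_def c_def)
  qed
qed

text \<open>Cauchy-Schwarz with y = D x, followed by the upper bound at the vector D x. In operator
  terms, D^2 \<le> K D.\<close>

lemma psd_norm_bound:
  fixes D :: "'a::real_inner \<Rightarrow>\<^sub>L 'a"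
  assumes sa: "\<And>x y. D x \<bullet> y = x \<bullet> D y" and pos: "\<And>x. 0 \<le> D x \<bullet> x"
    and le: "\<And>x. D x \<bullet> x \<le> K * (x \<bullet> x)"
  shows "(norm (D x))\<^sup>2 \<le> K * (D x \<bullet> x)"
proof (cases "D x = 0")
  case False
  have "((norm (D x))\<^sup>2)\<^sup>2 \<le> (D x \<bullet> x) * (D (D x) \<bullet> D x)"
    using psd_Cauchy_Schwarz[OF sa pos, of x "D x"] by (simp add: power2_norm_eq_inner)
  also have "\<dots> \<le> (D x \<bullet> x) * (K * (norm (D x))\<^sup>2)"
    by (rule mult_left_mono) (use le[of "D x"] pos in \<open>auto simp: power2_norm_eq_inner\<close>)
  finally have "(norm (D x))\<^sup>2 * (norm (D x))\<^sup>2 \<le> (K * (D x \<bullet> x)) * (norm (D x))\<^sup>2"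
    by (simp add: power2_eq_square[of "(norm (D x))\<^sup>2"] mult_ac)
  then show ?thesis by (rule mult_right_le_imp_le) (use False in simp)
qed simp

lemma psd_zero:
  fixes D :: "'a::real_inner \<Rightarrow>\<^sub>L 'a"
  assumes "\<And>x y. D x \<bullet> y = x \<bullet> D y" "\<And>x. 0 \<le> D x \<bullet> x" "D x \<bullet> x = 0"
  shows "D x = 0"
  using psd_Cauchy_Schwarz[OF assms(1,2), of x "D x"] assms(3) by simp

lemma blinfun_le_norm: "(D x \<bullet> x) \<le> norm D * (x \<bullet> x)" for D :: "'a::real_inner \<Rightarrow>\<^sub>L 'a"
proof -
  have "D x \<bullet> x \<le> norm (D x) * norm x" by (rule norm_cauchy_schwarz)
  also have "\<dots> \<le> (norm D * norm x) * norm x" by (intro mult_right_mono norm_blinfun) simp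
  finally show ?thesis by (simp add: power2_norm_eq_inner[symmetric] power2_eq_square mult.assoc)
qed

lemma blinfun_ge_norm: "- (norm D * (x \<bullet> x)) \<le> (D x \<bullet> x)" for D :: "'a::real_inner \<Rightarrow>\<^sub>L 'a"
  using blinfun_le_norm[of "- D" x] by (simp add: blinfun.minus_left)

lemma strong_limit_exists:
  fixes T :: "nat \<Rightarrow> 'a::real_normed_vector \<Rightarrow>\<^sub>L 'b::real_normed_vector"
  assumes conv: "\<And>x. convergent (\<lambda>n. T n x)" and bound: "\<And>n x. norm (T n x) \<le> c * norm x"
  shows "\<exists>L. \<forall>x. (\<lambda>n. T n x) \<longlonglongrightarrow> blinfun_apply L x"
proof -
  define f where "f = (\<lambda>x. lim (\<lambda>n. T n x))"
  have f: "(\<lambda>n. T n x) \<longlonglongrightarrow> f x" for x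
    using conv[of x] by (simp add: f_def convergent_LIMSEQ_iff)
  have "bounded_linear f"
  proof (rule bounded_linear_intro)
    fix x y and r :: real
    have "(\<lambda>n. T n (x + y)) \<longlonglongrightarrow> f x + f y"
      unfolding blinfun.add_right by (intro tendsto_intros f)
    then show "f (x + y) = f x + f y" using f LIMSEQ_unique by blast
    have "(\<lambda>n. T n (r *\<^sub>R x)) \<longlonglongrightarrow> r *\<^sub>R f x"
      unfolding blinfun.scaleR_right by (intro tendsto_intros f)
    then show "f (r *\<^sub>R x) = r *\<^sub>R f x" using f LIMSEQ_unique by blast
    have "norm (f x) \<le> c * norm x"
      by (rule LIMSEQ_le_const2[OF tendsto_norm[OF f]]) (use bound in blast)
    then show "norm (f x) \<le> norm x * c" by (simp add: mult.commute)
  qed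
  then have "blinfun_apply (Blinfun f) = f" by (rule bounded_linear_Blinfun_apply)
  then show ?thesis using f by (intro exI[of _ "Blinfun f"]) simp
qed

text \<open>Scalar monotone convergence of the forms controls the vectors: the differences are
  positive with a common upper bound, so the squared norm of a difference is at most K times the
  difference of the forms.\<close>

lemma monotone_strong_limit:
  fixes T :: "nat \<Rightarrow> 'a::{real_inner,banach} \<Rightarrow>\<^sub>L 'a"
  assumes sa: "\<And>n x y. T n x \<bullet> y = x \<bullet> T n y"
    and mono: "\<And>n x. T n x \<bullet> x \<le> T (Suc n) x \<bullet> x"
    and bound: "\<And>n x. T n x \<bullet> x \<le> C * (x \<bullet> x)"
  shows "\<exists>L. \<forall>x. (\<lambda>n. T n x) \<longlonglongrightarrow> blinfun_apply L x"
proof -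
  \<comment> \<open>Bounds every T n - T m with m \<le> n: C bounds T n from above, and T m lies
    above T 0, hence above - norm (T 0).\<close>
  define K where "K = \<bar>C\<bar> + norm (T 0)"
  have le: "T m x \<bullet> x \<le> T n x \<bullet> x" if "m \<le> n" for m n x
    using lift_Suc_mono_le[of "\<lambda>n. T n x \<bullet> x"] mono that by blast
  have lower: "- (norm (T 0) * (x \<bullet> x)) \<le> T n x \<bullet> x" for n x
    using blinfun_ge_norm[of "T 0" x] le[of 0 n x] by simp
  have diff: "(norm (T n x - T m x))\<^sup>2 \<le> K * (T n x \<bullet> x - T m x \<bullet> x)" if "m \<le> n" for m n x
  proof -
    have "(norm ((T n - T m) x))\<^sup>2 \<le> K * ((T n - T m) x \<bullet> x)"
    proof (rule psd_norm_bound)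
      fix x
      show "0 \<le> (T n - T m) x \<bullet> x" using le[OF that] by (simp add: blinfun.diff_left inner_diff_left)
      have "C * (x \<bullet> x) \<le> \<bar>C\<bar> * (x \<bullet> x)" by (intro mult_right_mono) auto
      then show "(T n - T m) x \<bullet> x \<le> K * (x \<bullet> x)"
        using bound[of n x] lower[of x m]
        by (simp add: blinfun.diff_left inner_diff_left K_def algebra_simps)
    qed (simp add: blinfun.diff_left inner_diff_left inner_diff_right sa)
    then show ?thesis by (simp add: blinfun.diff_left inner_diff_left)
  qed
  have conv: "convergent (\<lambda>n. T n x)" for x
  proof -
    obtain L where L: "(\<lambda>n. T n x \<bullet> x) \<longlonglongrightarrow> L" "\<forall>n. T n x \<bullet> x \<le> L"
      using incseq_convergent[of "\<lambda>n. T n x \<bullet> x" "C * (x \<bullet> x)"] le bound by (auto simp: incseq_def)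
    have K0: "K \<ge> 0" by (simp add: K_def)
    have "Cauchy (\<lambda>n. T n x)"
    proof (rule metric_CauchyI)
      fix e :: real assume e: "e > 0"
      have "(e / 2)\<^sup>2 / (K + 1) > 0" using e K0 by simp
      then have "\<forall>\<^sub>F n in sequentially. L - (e / 2)\<^sup>2 / (K + 1) < T n x \<bullet> x"
        by (intro order_tendstoD(1)[OF L(1)]) simp
      then obtain N where N: "L - (e / 2)\<^sup>2 / (K + 1) < T N x \<bullet> x"
        using eventually_happens trivial_limit_sequentially by blast
      have near: "norm (T n x - T N x) < e / 2" if "n \<ge> N" for n
      proof -
        have "(norm (T n x - T N x))\<^sup>2 \<le> K * (T n x \<bullet> x - T N x \<bullet> x)" by (rule diff[OF that])
        also have "\<dots> \<le> K * ((e / 2)\<^sup>2 / (K + 1))"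
        proof (rule mult_left_mono[OF _ K0])
          show "T n x \<bullet> x - T N x \<bullet> x \<le> (e / 2)\<^sup>2 / (K + 1)" using N spec[OF L(2), of n] by linarith
        qed
        also have "\<dots> = (e / 2)\<^sup>2 * (K / (K + 1))" by simp
        also have "\<dots> < (e / 2)\<^sup>2 * 1"
          using K0 e by (intro mult_strict_left_mono) auto
        finally have "(norm (T n x - T N x))\<^sup>2 < (e / 2)\<^sup>2" by simp
        then show ?thesis by (rule power2_less_imp_less) (use e in simp)
      qed
      show "\<exists>M. \<forall>m\<ge>M. \<forall>n\<ge>M. dist (T m x) (T n x) < e"
      proof (intro exI allI impI)
        fix m n assume "m \<ge> N" "n \<ge> N"
        then show "dist (T m x) (T n x) < e"
          using dist_triangle_half_l[of "T m x" "T N x" e "T n x"] near by (simp add: dist_norm)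
      qed
    qed
    then show ?thesis by (rule Cauchy_convergent)
  qed
  have "norm (T n x) \<le> (K + norm (T 0)) * norm x" for n x
  proof -
    have "(norm (T n x - T 0 x))\<^sup>2 \<le> K * (T n x \<bullet> x - T 0 x \<bullet> x)" by (rule diff) simp
    also have "\<dots> \<le> K * (K * (x \<bullet> x))"
    proof (rule mult_left_mono)
      have "C * (x \<bullet> x) \<le> \<bar>C\<bar> * (x \<bullet> x)" by (intro mult_right_mono) auto
      then show "T n x \<bullet> x - T 0 x \<bullet> x \<le> K * (x \<bullet> x)"
        using bound[of n x] lower[of x 0] by (simp add: K_def algebra_simps)
    qed (simp add: K_def)
    also have "\<dots> = (K * norm x)\<^sup>2" by (simp add: power2_norm_eq_inner[symmetric] power_mult_distrib power2_eq_square)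
    finally have "norm (T n x - T 0 x) \<le> K * norm x"
      by (rule power2_le_imp_le) (simp add: K_def)
    moreover have "norm (T 0 x) \<le> norm (T 0) * norm x" by (rule norm_blinfun)
    ultimately show ?thesis using norm_triangle_ineq[of "T n x - T 0 x" "T 0 x"] by (simp add: algebra_simps)
  qed
  with conv show ?thesis by (rule strong_limit_exists)
qed

section \<open>Von Neumann algebras: membership, projections, ranges\<close>

locale vn_algebra =
  fixes M :: "('a::complex_hilbert \<Rightarrow>\<^sub>L 'a) set"
  assumes vn: "von_neumann_algebra M"
begin

lemma M_bounded_ops: "T \<in> M \<Longrightarrow> T \<in> bounded_ops"
  and M_adj: "T \<in> M \<Longrightarrow> adj T \<in> M"
  and bicommutant: "commutant (commutant M) = M"
  using vn by (auto simp: von_neumann_algebra_def)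

lemma commutantD: "X \<in> commutant M \<Longrightarrow> T \<in> M \<Longrightarrow> T (X x) = X (T x)"
  by (auto simp: commutant_def) (metis blinfun_apply_blinfun_compose)

lemma scalar_op_commutant: "scalar_op c \<in> commutant M"
  unfolding commutant_def mem_Collect_eq
proof (intro conjI ballI scalar_op_bounded_ops)
  fix X assume "X \<in> M"
  then show "scalar_op c o\<^sub>L X = X o\<^sub>L scalar_op c"
    by (intro blinfun_eqI) (simp add: scalar_op.rep_eq bounded_opsD M_bounded_ops)
qed

lemma commutant_adj:
  assumes X: "X \<in> commutant M" shows "adj X \<in> commutant M"
  unfolding commutant_def mem_Collect_eq
proof (intro conjI ballI)
  have bo: "X \<in> bounded_ops" using X by (simp add: commutant_def)
  show "adj X \<in> bounded_ops" using bo by (rule adj_bounded_ops)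
  fix T assume T: "T \<in> M"
  show "adj X o\<^sub>L T = T o\<^sub>L adj X"
  proof (rule blinfun_eqI)
    fix x
    have "y \<bullet> (adj X o\<^sub>L T) x = y \<bullet> (T o\<^sub>L adj X) x" for y
    proof -
      have "y \<bullet> adj X (T x) = adj T (X y) \<bullet> x"
        by (metis adj_inner adj_inner' bo M_bounded_ops T)
      also have "\<dots> = X (adj T y) \<bullet> x" using commutantD[OF X M_adj[OF T]] by simp
      also have "\<dots> = y \<bullet> T (adj X x)" by (metis adj_inner adj_inner' bo M_bounded_ops T)
      finally show ?thesis by simp
    qed
    then show "(adj X o\<^sub>L T) x = (T o\<^sub>L adj X) x" by (metis vector_eq_ldot)
  qed
qed

text \<open>This is the double commutant equation. Multiplication by a scalar lies in the commutant,
  so the premise already contains the complex-linearity of \<open>T\<close>.\<close>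

lemma in_M:
  fixes T :: "'a \<Rightarrow>\<^sub>L 'a"
  assumes "\<And>X x. X \<in> commutant M \<Longrightarrow> T (X x) = X (T x)"
  shows "T \<in> M"
proof -
  have "T \<in> bounded_ops"
    using assms[OF scalar_op_commutant] by (simp add: bounded_ops_def scalar_op.rep_eq)
  then have "T \<in> commutant (commutant M)"
    unfolding commutant_def[of "commutant M"] using assms by (auto intro!: blinfun_eqI)
  then show ?thesis by (simp add: bicommutant)
qed

lemma M_comp: "S \<in> M \<Longrightarrow> T \<in> M \<Longrightarrow> S o\<^sub>L T \<in> M"
  by (rule in_M) (simp add: commutantD)
lemma M_add: "S \<in> M \<Longrightarrow> T \<in> M \<Longrightarrow> S + T \<in> M"
  by (rule in_M) (simp add: commutantD blinfun.add_left blinfun.add_right)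
lemma M_diff: "S \<in> M \<Longrightarrow> T \<in> M \<Longrightarrow> S - T \<in> M"
  by (rule in_M) (simp add: commutantD blinfun.diff_left blinfun.diff_right)
lemma M_scaleR: "T \<in> M \<Longrightarrow> r *\<^sub>R T \<in> M"
  by (rule in_M) (simp add: commutantD blinfun.scaleR_left blinfun.scaleR_right)
lemma M_id: "id_blinfun \<in> M" by (rule in_M) simp
lemma M_0: "0 \<in> M" by (rule in_M) simp
lemma M_sum: "(\<And>i. i \<in> I \<Longrightarrow> T i \<in> M) \<Longrightarrow> sum T I \<in> M"
  by (induction I rule: infinite_finite_induct) (auto simp: M_0 M_add)

lemma M_strong_limit:
  fixes T :: "nat \<Rightarrow> 'a \<Rightarrow>\<^sub>L 'a"
  assumes "\<And>n. T n \<in> M" "\<And>x. (\<lambda>n. T n x) \<longlonglongrightarrow> blinfun_apply L x"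
  shows "L \<in> M"
proof (rule in_M)
  fix X x assume X: "X \<in> commutant M"
  have "(\<lambda>n. X (T n x)) \<longlonglongrightarrow> X (L x)" by (intro tendsto_intros assms)
  moreover have "(\<lambda>n. X (T n x)) = (\<lambda>n. T n (X x))" using commutantD[OF X assms(1)] by simp
  ultimately show "L (X x) = X (L x)" using assms(2) LIMSEQ_unique by metis
qed

lemma projectionsI:
  assumes "P \<in> M" "\<And>x. P (P x) = P x" "\<And>x y. P x \<bullet> y = x \<bullet> P y"
  shows "P \<in> projections M"
  using assms adj_eqI[of P P] M_bounded_ops
  by (auto simp: projections_def is_projection_def intro!: blinfun_eqI)

lemma projectionsD:
  assumes "P \<in> projections M"
  shows "P \<in> M" "P (P x) = P x" "P x \<bullet> y = x \<bullet> P y" "P x \<bullet> x = (norm (P x))\<^sup>2" "norm (P x) \<le> norm x"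
    "adj P = P" "P o\<^sub>L P = P"
proof -
  show M: "P \<in> M" and adj: "adj P = P" and PP: "P o\<^sub>L P = P"
    using assms by (auto simp: projections_def is_projection_def)
  show i: "P (P x) = P x" for x by (metis PP blinfun_apply_blinfun_compose)
  show sa: "P x \<bullet> y = x \<bullet> P y" for x y using adj_inner[OF M_bounded_ops[OF M]] by (simp add: adj)
  show n: "P x \<bullet> x = (norm (P x))\<^sup>2" for x using sa[of x "P x"] i by (simp add: power2_norm_eq_inner inner_commute)
  show "norm (P x) \<le> norm x"
    using norm_cauchy_schwarz[of "P x" x] unfolding n by (cases "P x = 0") (auto simp: power2_eq_square)
qed

text \<open>The commutant is closed under adjoints, so a subspace invariant under it reduces it, and
  the orthogonal projection commutes with the commutant.\<close>

lemma proj_on_projection: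
  assumes S: "subspace S" "closed S" and inv: "\<And>X x. X \<in> commutant M \<Longrightarrow> x \<in> S \<Longrightarrow> X x \<in> S"
  shows "proj_on S \<in> projections M" "proj_on S x = x \<longleftrightarrow> x \<in> S"
proof -
  have "proj_on S \<in> M"
  proof (rule in_M)
    fix X x assume X: "X \<in> commutant M"
    then have "X \<in> bounded_ops" by (simp add: commutant_def)
    then show "proj_on S (X x) = X (proj_on S x)"
      using inv X commutant_adj[OF X]
      by (intro proj_on_commute[OF S, of _ "adj X"]) (auto simp: adj_inner bounded_linear.linear[OF blinfun.bounded_linear_right])
  qed
  then show "proj_on S \<in> projections M"
    using proj_on_id[OF S] proj_on_works[OF S] proj_on_selfadj[OF S] by (intro projectionsI) auto
  show "proj_on S x = x \<longleftrightarrow> x \<in> S" using proj_on_id[OF S] proj_on_works(1)[OF S, of x] by metis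
qed

lemma subspace_ker: "subspace {x. (T :: 'a \<Rightarrow>\<^sub>L 'a) x = 0}"
  by (auto simp: subspace_def blinfun.add_right blinfun.scaleR_right)

lemma closed_ker: "closed {x. (T :: 'a \<Rightarrow>\<^sub>L 'a) x = 0}"
  by (intro closed_Collect_eq continuous_intros)

lemma projection_eqI:
  assumes P: "P \<in> projections M" and Q: "Q \<in> projections M" and "\<And>x. P x = x \<longleftrightarrow> Q x = x"
  shows "P = Q"
proof (rule blinfun_eqI)
  fix x
  have QP: "Q (P y) = P y" and PQ: "P (Q y) = Q y" for y using assms(3) projectionsD(2)[OF P] projectionsD(2)[OF Q] by auto
  have "z \<bullet> P x = z \<bullet> Q x" for z
  proof -
    have "z \<bullet> P x = P z \<bullet> x" using projectionsD(3)[OF P] by simp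
    also have "\<dots> = Q (P z) \<bullet> x" using QP by simp
    also have "\<dots> = P z \<bullet> Q x" using projectionsD(3)[OF Q] by simp
    also have "\<dots> = z \<bullet> Q x" using projectionsD(3)[OF P] PQ by simp
    finally show ?thesis .
  qed
  then show "P x = Q x" by (metis vector_eq_ldot)
qed

lemma is_projection_M_eqI:
  assumes P: "is_projection P" and S: "subspace S" "closed S" "range P = S"
  shows "P = proj_on S"
proof (rule blinfun_eqI)
  fix x
  have bo: "P \<in> bounded_ops" and PP: "\<And>x. P (P x) = P x" and adj: "adj P = P"
    using P by (auto simp: is_projection_def) (metis blinfun_apply_blinfun_compose)
  have "proj_on S x = P x"
  proof (rule proj_on_eqI[OF S(1,2)])
    show "P x \<in> S" using S(3) by auto
    fix y assume "y \<in> S"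
    then have "P y = y" using S(3) PP by force
    then show "(x - P x) \<bullet> y = 0"
      using adj_inner[OF bo, of "x" y] by (simp add: adj inner_diff_left)
  qed
  then show "P x = proj_on S x" by simp
qed

lemma null_proj_M:
  assumes T: "T \<in> M"
  shows "null_proj T \<in> projections M" "null_proj T x = x \<longleftrightarrow> T x = 0"
proof -
  let ?S = "{x. T x = 0}"
  have inv: "X x \<in> ?S" if "X \<in> commutant M" "x \<in> ?S" for X x
    using commutantD[OF that(1) T, of x] that(2) by simp
  note p = proj_on_projection[OF subspace_ker closed_ker inv]
  have "null_proj T = proj_on ?S"
    unfolding null_proj_def
  proof (rule the_equality)
    show "is_projection (proj_on ?S) \<and> range (proj_on ?S) = ?S"
      using p(1) range_proj_on[OF subspace_ker closed_ker] by (auto simp: projections_def)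
    show "P = proj_on ?S" if "is_projection P \<and> range P = ?S" for P
      using is_projection_M_eqI[OF _ subspace_ker closed_ker] that by blast
  qed
  then show "null_proj T \<in> projections M" "null_proj T x = x \<longleftrightarrow> T x = 0" using p by auto
qed

end

section \<open>Strong sums, order and orthogonality of projections\<close>

definition osum :: "(nat \<Rightarrow> 'a::complex_hilbert \<Rightarrow>\<^sub>L 'a) \<Rightarrow> 'a \<Rightarrow>\<^sub>L 'a" where
  "osum T = Blinfun (\<lambda>x. \<Sum>n. T n x)"

text \<open>\<open>osum\<close> is total because \<open>Blinfun\<close> is. It denotes the strong
  sum once a bounded operator with these pointwise sums has been exhibited.\<close>

lemma osum_eqI:
  fixes L :: "'a::complex_hilbert \<Rightarrow>\<^sub>L 'a" and T :: "nat \<Rightarrow> 'a \<Rightarrow>\<^sub>L 'a"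
  assumes "\<And>x. (\<lambda>n. T n x) sums L x" shows "osum T = L"
proof -
  have "(\<lambda>x. \<Sum>n. T n x) = blinfun_apply L" using sums_unique[OF assms, symmetric] by (rule ext)
  then show ?thesis by (simp add: osum_def blinfun_apply_inverse)
qed

definition pleq :: "('a::complex_hilbert \<Rightarrow>\<^sub>L 'a) \<Rightarrow> ('a \<Rightarrow>\<^sub>L 'a) \<Rightarrow> bool" where
  "pleq P Q \<longleftrightarrow> (\<forall>x. Q (P x) = P x)"

definition porth :: "('a::complex_hilbert \<Rightarrow>\<^sub>L 'a) \<Rightarrow> ('a \<Rightarrow>\<^sub>L 'a) \<Rightarrow> bool" where
  "porth P Q \<longleftrightarrow> (\<forall>x. P (Q x) = 0)"

lemma proj_le_pleq: "proj_le P Q \<longleftrightarrow> pleq P Q"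
  by (auto simp: proj_le_def pleq_def intro!: blinfun_eqI) (metis blinfun_apply_blinfun_compose)

lemma pleqD: "pleq P Q \<Longrightarrow> Q (P x) = P x" by (simp add: pleq_def)
lemma porthD: "porth P Q \<Longrightarrow> P (Q x) = 0" by (simp add: porth_def)

context vn_algebra
begin

lemma pleqD': "pleq P Q \<Longrightarrow> P \<in> projections M \<Longrightarrow> Q \<in> projections M \<Longrightarrow> P (Q x) = P x"
proof -
  assume h: "pleq P Q" "P \<in> projections M" "Q \<in> projections M"
  have "z \<bullet> P (Q x) = z \<bullet> P x" for z
    using pleqD[OF h(1), of z] by (metis projectionsD(3)[OF h(2)] projectionsD(3)[OF h(3)])
  then show ?thesis by (metis vector_eq_ldot)
qed

lemma porth_sym: "porth P Q \<Longrightarrow> P \<in> projections M \<Longrightarrow> Q \<in> projections M \<Longrightarrow> porth Q P"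
proof -
  assume h: "porth P Q" "P \<in> projections M" "Q \<in> projections M"
  have "z \<bullet> Q (P x) = z \<bullet> 0" for z x
    using porthD[OF h(1), of z] by (metis inner_zero_left inner_zero_right projectionsD(3)[OF h(2)] projectionsD(3)[OF h(3)])
  then show ?thesis unfolding porth_def by (metis vector_eq_ldot)
qed

lemma pleq_refl: "P \<in> projections M \<Longrightarrow> pleq P P" by (simp add: pleq_def projectionsD)
lemma pleq_trans: "pleq P Q \<Longrightarrow> pleq Q R \<Longrightarrow> pleq P R" by (simp add: pleq_def) metis
lemma pleq_antisym: "pleq P Q \<Longrightarrow> pleq Q P \<Longrightarrow> P \<in> projections M \<Longrightarrow> Q \<in> projections M \<Longrightarrow> P = Q"
  by (rule projection_eqI) (auto simp: pleq_def, metis+)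

lemma pleqI: "P \<in> projections M \<Longrightarrow> (\<And>x. P x = x \<Longrightarrow> blinfun_apply Q x = x) \<Longrightarrow> pleq P Q"
  by (simp add: pleq_def projectionsD)

lemma porth_pleq: "porth P Q \<Longrightarrow> pleq P' P \<Longrightarrow> P' \<in> projections M \<Longrightarrow> P \<in> projections M \<Longrightarrow> porth P' Q"
  unfolding porth_def by (metis blinfun.zero_right pleqD')

lemma porth_pleq2: "porth P Q \<Longrightarrow> pleq Q' Q \<Longrightarrow> porth P Q'"
  unfolding porth_def pleq_def by metis

lemma projection_id: "id_blinfun \<in> projections M"
  by (rule projectionsI) (auto simp: M_id)

lemma projection_0: "0 \<in> projections M"
  by (rule projectionsI) (auto simp: M_0)

lemma projection_compl: "P \<in> projections M \<Longrightarrow> id_blinfun - P \<in> projections M"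
  by (rule projectionsI)
    (auto simp: M_diff M_id projectionsD blinfun.diff_left blinfun.diff_right inner_diff_left inner_diff_right)

lemma projection_add: "P \<in> projections M \<Longrightarrow> Q \<in> projections M \<Longrightarrow> porth P Q \<Longrightarrow> P + Q \<in> projections M"
  by (rule projectionsI)
    (use porth_sym[of P Q] in \<open>auto simp: M_add projectionsD blinfun.add_left blinfun.add_right inner_add_left inner_add_right porthD\<close>)

lemma projection_diff: "P \<in> projections M \<Longrightarrow> Q \<in> projections M \<Longrightarrow> pleq P Q \<Longrightarrow> Q - P \<in> projections M"
  by (rule projectionsI)
    (auto simp: M_diff projectionsD blinfun.diff_left blinfun.diff_right inner_diff_left inner_diff_right pleqD pleqD')

lemma porth_diff: "P \<in> projections M \<Longrightarrow> Q \<in> projections M \<Longrightarrow> pleq P Q \<Longrightarrow> porth P (Q - P)"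
  by (auto simp: porth_def blinfun.diff_left blinfun.diff_right pleqD' projectionsD)

lemma pleq_diff: "P \<in> projections M \<Longrightarrow> Q \<in> projections M \<Longrightarrow> pleq P Q \<Longrightarrow> pleq (Q - P) Q"
  by (auto simp: pleq_def blinfun.diff_left blinfun.diff_right projectionsD)

lemma pleq_add1: "P \<in> projections M \<Longrightarrow> Q \<in> projections M \<Longrightarrow> porth P Q \<Longrightarrow> pleq P (P + Q)"
  using porth_sym[of P Q] by (auto simp: pleq_def blinfun.add_left porthD projectionsD)

lemma pleq_add2: "P \<in> projections M \<Longrightarrow> Q \<in> projections M \<Longrightarrow> porth P Q \<Longrightarrow> pleq Q (P + Q)"
  by (auto simp: pleq_def blinfun.add_left porthD projectionsD)

lemma pleq_add_least: "pleq P R \<Longrightarrow> pleq Q R \<Longrightarrow> pleq (P + Q) R"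
  by (auto simp: pleq_def blinfun.add_left blinfun.add_right)

lemma pleq_norm: "pleq P Q \<Longrightarrow> P \<in> projections M \<Longrightarrow> Q \<in> projections M \<Longrightarrow> norm (P x) \<le> norm (Q x)"
  using pleqD'[of P Q x] projectionsD(5)[of P "Q x"] by simp

lemma norm_compl:
  assumes "P \<in> projections M" "Q \<in> projections M" "pleq P Q"
  shows "(norm ((Q - P) x))\<^sup>2 = (norm (Q x))\<^sup>2 - (norm (P x))\<^sup>2"
  using projectionsD(4)[OF projection_diff[OF assms], of x] projectionsD(4)[OF assms(1), of x] projectionsD(4)[OF assms(2), of x]
  by (simp add: blinfun.diff_left inner_diff_left)

lemma porth_add_norm:
  assumes "P \<in> projections M" "Q \<in> projections M" "porth P Q"
  shows "(norm ((P + Q) x))\<^sup>2 = (norm (P x))\<^sup>2 + (norm (Q x))\<^sup>2"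
  using projectionsD(4)[OF projection_add[OF assms], of x] projectionsD(4)[OF assms(1), of x] projectionsD(4)[OF assms(2), of x]
  by (simp add: blinfun.add_left inner_add_left)

lemma porth_compl: "P \<in> projections M \<Longrightarrow> porth P Q \<longleftrightarrow> pleq Q (id_blinfun - P)"
  by (auto simp: porth_def pleq_def blinfun.diff_left)

lemma porth_add: "porth P R \<Longrightarrow> porth Q R \<Longrightarrow> porth (P + Q) R"
  by (simp add: porth_def blinfun.add_left)

lemma porth_add2: "porth R P \<Longrightarrow> porth R Q \<Longrightarrow> porth R (P + Q)"
  by (simp add: porth_def blinfun.add_left blinfun.add_right)

section \<open>Meets, supports and range projections\<close>

definition pinf :: "('a \<Rightarrow>\<^sub>L 'a) \<Rightarrow> ('a \<Rightarrow>\<^sub>L 'a) \<Rightarrow> 'a \<Rightarrow>\<^sub>L 'a" where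
  "pinf P Q = null_proj ((id_blinfun - P) + (id_blinfun - Q))"

text \<open>Both complements are positive, so their sum kills a vector only if each of them does.
  The null projection of the sum is therefore the lattice meet.\<close>

lemma pinf:
  assumes P: "P \<in> projections M" and Q: "Q \<in> projections M"
  shows "pinf P Q \<in> projections M" "pinf P Q x = x \<longleftrightarrow> P x = x \<and> Q x = x"
proof -
  let ?T = "(id_blinfun - P) + (id_blinfun - Q)"
  have T: "?T \<in> M" using P Q by (simp add: M_add M_diff M_id projectionsD)
  show "pinf P Q \<in> projections M" unfolding pinf_def by (rule null_proj_M(1)[OF T])
  have "P x = x \<and> Q x = x" if "?T x = 0"
  proof -
    have "0 = (id_blinfun - P) x \<bullet> x + (id_blinfun - Q) x \<bullet> x" 
      using arg_cong[OF that, of "\<lambda>y. y \<bullet> x"] by (simp only: blinfun.add_left inner_add_left inner_zero_left)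
    then have "(norm ((id_blinfun - P) x))\<^sup>2 + (norm ((id_blinfun - Q) x))\<^sup>2 = 0"
      by (simp only: projectionsD(4)[OF projection_compl[OF P]] projectionsD(4)[OF projection_compl[OF Q]])
    then show ?thesis by (simp add: sum_power2_eq_zero_iff blinfun.diff_left)
  qed
  then show "pinf P Q x = x \<longleftrightarrow> P x = x \<and> Q x = x"
    unfolding pinf_def null_proj_M(2)[OF T] by (auto simp: blinfun.diff_left blinfun.add_left)
qed

definition supp :: "('a \<Rightarrow>\<^sub>L 'a) \<Rightarrow> 'a \<Rightarrow>\<^sub>L 'a" where "supp T = id_blinfun - null_proj T"

text \<open>The projection onto the closure of the range, obtained as the orthogonal complement of
  the kernel of the adjoint.\<close>

definition rproj :: "('a \<Rightarrow>\<^sub>L 'a) \<Rightarrow> 'a \<Rightarrow>\<^sub>L 'a" where "rproj T = supp (adj T)"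

lemma supp:
  assumes T: "T \<in> M"
  shows "supp T \<in> projections M" "T (supp T x) = T x"
    "\<And>P. P \<in> projections M \<Longrightarrow> (\<And>x. T (P x) = T x) \<Longrightarrow> pleq (supp T) P"
    "supp T x = 0 \<longleftrightarrow> T x = 0"
proof -
  note N = null_proj_M[OF T]
  show S: "supp T \<in> projections M" unfolding supp_def by (rule projection_compl[OF N(1)])
  have "T (null_proj T x) = 0" for x using N projectionsD(2)[OF N(1)] by blast
  then show "T (supp T x) = T x" by (simp add: supp_def blinfun.diff_left blinfun.diff_right)
  show "supp T x = 0 \<longleftrightarrow> T x = 0" using N(2)[of x]
    by (simp add: supp_def blinfun.diff_left) metis
  show "pleq (supp T) P" if P: "P \<in> projections M" "\<And>x. T (P x) = T x" for P
  proof -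
    have "pleq (id_blinfun - P) (null_proj T)"
      unfolding pleq_def
    proof
      fix x
      have "T (x - P x) = 0" using P(2)[of x] by (simp add: blinfun.diff_right)
      then have "null_proj T (x - P x) = x - P x" using N(2) by blast
      then show "null_proj T ((id_blinfun - P) x) = (id_blinfun - P) x" by (simp add: blinfun.diff_left)
    qed
    then have a: "(id_blinfun - P) (null_proj T x) = (id_blinfun - P) x" for x
      using pleqD' N(1) projection_compl[OF P(1)] by blast
    have "P (supp T x) = supp T x" for x
    proof -
      have "null_proj T x - P (null_proj T x) = x - P x" using a[of x] by (simp add: blinfun.diff_left)
      then show ?thesis by (simp add: supp_def blinfun.diff_left blinfun.diff_right algebra_simps)
    qed
    then show ?thesis by (simp add: pleq_def)
  qed
qed

lemma rproj:
  assumes T: "T \<in> M"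
  shows "rproj T \<in> projections M" "rproj T (T x) = T x"
    "\<And>P. P \<in> projections M \<Longrightarrow> (\<And>x. P (T x) = T x) \<Longrightarrow> pleq (rproj T) P"
proof -
  note S = supp[OF M_adj[OF T]]
  have bo: "T \<in> bounded_ops" using T by (rule M_bounded_ops)
  show R: "rproj T \<in> projections M" unfolding rproj_def by (rule S(1))
  have "z \<bullet> rproj T (T x) = z \<bullet> T x" for z
    unfolding rproj_def using S(2)[of z] by (metis S(1) adj_inner' bo projectionsD(3))
  then show "rproj T (T x) = T x" by (metis vector_eq_ldot)
  show "pleq (rproj T) P" if P: "P \<in> projections M" "\<And>x. P (T x) = T x" for P
    unfolding rproj_def
  proof (rule S(3)[OF P(1)])
    fix x
    have "z \<bullet> adj T (P x) = z \<bullet> adj T x" for z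
      using P(2)[of z] by (metis P(1) adj_inner bo projectionsD(3))
    then show "adj T (P x) = adj T x" by (metis vector_eq_ldot)
  qed
qed

section \<open>Partial isometries and Murray-von Neumann equivalence\<close>

definition partiso :: "('a \<Rightarrow>\<^sub>L 'a) \<Rightarrow> ('a \<Rightarrow>\<^sub>L 'a) \<Rightarrow> ('a \<Rightarrow>\<^sub>L 'a) \<Rightarrow> bool" where
  "partiso V P Q \<longleftrightarrow> V \<in> M \<and> P \<in> projections M \<and> Q \<in> projections M \<and>
     (\<forall>x. adj V (V x) = P x) \<and> (\<forall>x. V (adj V x) = Q x)"

definition eqv :: "('a \<Rightarrow>\<^sub>L 'a) \<Rightarrow> ('a \<Rightarrow>\<^sub>L 'a) \<Rightarrow> bool" where
  "eqv P Q \<longleftrightarrow> (\<exists>V. partiso V P Q)"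

lemma partisoD:
  assumes "partiso V P Q"
  shows "V \<in> M" "P \<in> projections M" "Q \<in> projections M" "adj V (V x) = P x" "V (adj V x) = Q x"
    "V (P x) = V x" "Q (V x) = V x" "P (adj V x) = adj V x" "adj V (Q x) = adj V x"
    "V x \<bullet> y = x \<bullet> adj V y" "adj V x \<bullet> y = x \<bullet> V y"
    "norm (V x) = norm (P x)" "norm (adj V x) = norm (Q x)"
proof -
  show V: "V \<in> M" and P: "P \<in> projections M" and Q: "Q \<in> projections M"
    and a: "adj V (V x) = P x" and b: "V (adj V x) = Q x" for x
    using assms by (auto simp: partiso_def)
  show i: "V x \<bullet> y = x \<bullet> adj V y" "adj V x \<bullet> y = x \<bullet> V y" for x y
    using adj_inner adj_inner' M_bounded_ops[OF V] by auto
  have "(norm (V x))\<^sup>2 = (norm (P x))\<^sup>2" for x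
    using projectionsD(4)[OF P, of x] a[of x] i(2)[of "V x" x] by (simp add: power2_norm_eq_inner)
  then show n: "norm (V x) = norm (P x)" for x by simp
  have "(norm (adj V x))\<^sup>2 = (norm (Q x))\<^sup>2" for x
    using projectionsD(4)[OF Q, of x] b[of x] i(1)[of "adj V x" x] by (simp add: power2_norm_eq_inner)
  then show n': "norm (adj V x) = norm (Q x)" for x by simp
  have "norm (V (P x - x)) = 0" for x unfolding n by (simp add: blinfun.diff_right projectionsD(2)[OF P])
  then show "V (P x) = V x" for x by (simp add: blinfun.diff_right)
  have "norm (adj V (Q x - x)) = 0" for x unfolding n' by (simp add: blinfun.diff_right projectionsD(2)[OF Q])
  then show "adj V (Q x) = adj V x" for x by (simp add: blinfun.diff_right)
  show "Q (V x) = V x" for x by (metis a b \<open>\<And>x. V (P x) = V x\<close>)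
  show "P (adj V x) = adj V x" for x by (metis a b \<open>\<And>x. adj V (Q x) = adj V x\<close>)
qed

lemma eqv_mvn_equiv: "P \<in> projections M \<Longrightarrow> Q \<in> projections M \<Longrightarrow> mvn_equiv M P Q \<longleftrightarrow> eqv P Q"
  unfolding mvn_equiv_def eqv_def partiso_def
  by (intro iffI; elim bexE exE conjE; intro exI bexI conjI) (auto intro!: blinfun_eqI)

lemma partiso_adj: "partiso V P Q \<Longrightarrow> partiso (adj V) Q P"
  by (simp add: partiso_def M_adj adj_adj M_bounded_ops)

lemma eqv_sym: "eqv P Q \<Longrightarrow> eqv Q P" unfolding eqv_def using partiso_adj by blast

lemma partiso_refl: "P \<in> projections M \<Longrightarrow> partiso P P P" by (simp add: partiso_def projectionsD)

lemma eqv_refl: "P \<in> projections M \<Longrightarrow> eqv P P" unfolding eqv_def using partiso_refl by blast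

lemma partiso_comp:
  assumes "partiso V P Q" "partiso W Q R" shows "partiso (W o\<^sub>L V) P R"
  unfolding partiso_def
  by (simp add: adj_comp M_bounded_ops partisoD[OF assms(1)] partisoD[OF assms(2)] M_comp)

lemma eqv_trans: "eqv P Q \<Longrightarrow> eqv Q R \<Longrightarrow> eqv P R" unfolding eqv_def using partiso_comp by blast

lemma eqv_projections: "eqv P Q \<Longrightarrow> P \<in> projections M \<and> Q \<in> projections M"
  unfolding eqv_def using partisoD by blast

lemma partiso_restrict:
  assumes V: "partiso V P Q" and P': "P' \<in> projections M" "pleq P' P"
  shows "partiso (V o\<^sub>L P') P' (V o\<^sub>L P' o\<^sub>L adj V)" "pleq (V o\<^sub>L P' o\<^sub>L adj V) Q"
    "(V o\<^sub>L P' o\<^sub>L adj V) (V x) = V (P' x)"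
proof -
  note v = partisoD[OF V] and p = projectionsD[OF P'(1)]
  have PP': "P (P' x) = P' x" "P' (P x) = P' x" for x using pleqD[OF P'(2)] pleqD'[OF P'(2) P'(1) v(2)] by auto
  have "V o\<^sub>L P' o\<^sub>L adj V \<in> projections M"
    by (rule projectionsI) (simp_all add: M_comp M_adj v(1,4,10,11) p PP')
  moreover have "adj (V o\<^sub>L P') = P' o\<^sub>L adj V" by (simp add: adj_comp M_bounded_ops v(1) p)
  ultimately show "partiso (V o\<^sub>L P') P' (V o\<^sub>L P' o\<^sub>L adj V)"
    unfolding partiso_def using P'(1) by (simp add: M_comp v p PP')
  show "pleq (V o\<^sub>L P' o\<^sub>L adj V) Q" by (simp add: pleq_def v)
  show "(V o\<^sub>L P' o\<^sub>L adj V) (V x) = V (P' x)" by (simp add: v PP')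
qed

text \<open>Each of the four cross terms factors through a product of two orthogonal
  projections.\<close>

lemma partiso_add:
  assumes V: "partiso V P Q" and W: "partiso W P' Q'" and o: "porth P P'" "porth Q Q'"
  shows "partiso (V + W) (P + P') (Q + Q')"
proof -
  note v = partisoD[OF V] and w = partisoD[OF W]
  have o': "porth P' P" "porth Q' Q" using porth_sym o v w by auto
  have adj: "adj (V + W) = adj V + adj W"
    by (rule adj_eqI) (auto simp: bounded_ops_add M_bounded_ops v w blinfun.add_left inner_add_left inner_add_right)
  have z1: "adj V (W x) = 0" for x
  proof -
    have "adj V (W x) = adj V (Q (Q' (W x)))" using v(9) w(7) by simp
    then show ?thesis using porthD[OF o(2)] by simp
  qed
  have z2: "adj W (V x) = 0" for x
  proof -
    have "adj W (V x) = adj W (Q' (Q (V x)))" using w(9) v(7) by simp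
    then show ?thesis using porthD[OF o'(2)] by simp
  qed
  have z3: "V (adj W x) = 0" for x
  proof -
    have "V (adj W x) = V (P (P' (adj W x)))" using v(6) w(8) by simp
    then show ?thesis using porthD[OF o(1)] by simp
  qed
  have z4: "W (adj V x) = 0" for x
  proof -
    have "W (adj V x) = W (P' (P (adj V x)))" using w(6) v(8) by simp
    then show ?thesis using porthD[OF o'(1)] by simp
  qed
  show ?thesis unfolding partiso_def adj
    by (simp add: M_add v(1,2,3,4,5) w(1,2,3,4,5) projection_add o blinfun.add_left blinfun.add_right z1 z2 z3 z4)
qed

section \<open>Orthogonal sequences of projections and sums of partial isometries\<close>

definition oseq :: "(nat \<Rightarrow> 'a \<Rightarrow>\<^sub>L 'a) \<Rightarrow> bool" where
  "oseq P \<longleftrightarrow> (\<forall>n. P n \<in> projections M) \<and> (\<forall>m n. m \<noteq> n \<longrightarrow> porth (P m) (P n))"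

lemma oseqD: "oseq P \<Longrightarrow> P n \<in> projections M" "oseq P \<Longrightarrow> m \<noteq> n \<Longrightarrow> porth (P m) (P n)"
  by (auto simp: oseq_def)

lemma oseq_inner: "oseq P \<Longrightarrow> m \<noteq> n \<Longrightarrow> P m x \<bullet> P n y = 0"
  by (metis inner_zero_right oseqD porthD projectionsD(3))

lemma oseq_bessel: "oseq P \<Longrightarrow> (\<Sum>k<n. (norm (P k x))\<^sup>2) \<le> (norm x)\<^sup>2"
proof -
  assume P: "oseq P"
  let ?S = "\<Sum>k<n. P k x"
  have a: "(norm ?S)\<^sup>2 = (\<Sum>k<n. (norm (P k x))\<^sup>2)"
    by (rule norm_sum_Pythagorean) (auto simp: pairwise_def orthogonal_def oseq_inner[OF P])
  also have "\<dots> = ?S \<bullet> x" by (simp add: inner_sum_left projectionsD(4)[OF oseqD(1)[OF P]])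
  also have "\<dots> \<le> norm ?S * norm x" by (rule norm_cauchy_schwarz)
  finally have "norm ?S \<le> norm x" by (cases "?S = 0") (auto simp: power2_eq_square)
  then show ?thesis unfolding a[symmetric] by simp
qed

text \<open>Orthogonal final projections make the partial sums Pythagorean, orthogonal initial
  projections bound them by Bessel's inequality, and so V, its adjoints and both families of
  projections sum strongly.\<close>

lemma partiso_osum:
  assumes V: "\<And>n. partiso (V n) (P n) (Q n)" and P: "oseq P" and Q: "oseq Q"
  shows "(\<lambda>n. V n x) sums osum V x" "(\<lambda>n. P n x) sums osum P x" "(\<lambda>n. Q n x) sums osum Q x"
    "partiso (osum V) (osum P) (osum Q)" "(\<lambda>n. adj (V n) x) sums adj (osum V) x"
proof -
  \<comment> \<open>Stated for arbitrary sequences, because it is applied to V, to the adjoints, and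
    to P and Q, each P n or Q n being a partial isometry from itself to itself.\<close>
  have key: "(\<lambda>n. V n x) sums osum V x \<and> osum V \<in> M"
    if V: "\<And>n. partiso (V n) (P n) (Q n)" and P: "oseq P" and Q: "oseq Q" for V P Q x
  proof -
    have orth: "V m x \<bullet> V n x = 0" if "m \<noteq> n" for m n x
      using oseq_inner[OF Q that, of "V m x" "V n x"] by (simp add: partisoD(7)[OF V])
    have bd: "(\<Sum>k<n. (norm (V k x))\<^sup>2) \<le> (norm x)\<^sup>2" for n x
      using oseq_bessel[OF P] by (simp add: partisoD(12)[OF V])
    note s = orthogonal_summable[OF orth bd]
    let ?T = "\<lambda>n. \<Sum>k<n. V k"
    have Tapp: "?T n x = (\<Sum>k<n. V k x)" for n x by (rule blinfun.sum_left)
    have nb: "norm (?T n x) \<le> 1 * norm x" for n x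
    proof -
      have "(norm (?T n x))\<^sup>2 = (\<Sum>k<n. (norm (V k x))\<^sup>2)"
        unfolding Tapp by (rule norm_sum_Pythagorean) (auto simp: pairwise_def orthogonal_def orth)
      then have "(norm (?T n x))\<^sup>2 \<le> (norm x)\<^sup>2" using bd by simp
      then show ?thesis unfolding mult_1 by (rule power2_le_imp_le) simp
    qed
    have conv: "convergent (\<lambda>n. ?T n x)" for x
      unfolding Tapp using s(1)[of x] by (simp add: summable_iff_convergent)
    obtain L where L: "\<And>x. (\<lambda>n. ?T n x) \<longlonglongrightarrow> blinfun_apply L x"
      using strong_limit_exists[OF conv nb] by blast
    then have sums: "(\<lambda>n. V n x) sums L x" for x by (simp add: sums_def Tapp)
    have "L \<in> M" by (rule M_strong_limit[OF _ L]) (simp add: M_sum partisoD(1)[OF V])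
    then show ?thesis using sums osum_eqI[of V L] by simp
  qed
  have v: "(\<lambda>n. V n x) sums osum V x" "osum V \<in> M" for x using key[OF V P Q] by auto
  have p: "(\<lambda>n. P n x) sums osum P x" "osum P \<in> M" for x
    using key[OF partiso_refl P P] oseqD(1)[OF P] by auto
  have q: "(\<lambda>n. Q n x) sums osum Q x" "osum Q \<in> M" for x
    using key[OF partiso_refl Q Q] oseqD(1)[OF Q] by auto
  have w: "(\<lambda>n. adj (V n) x) sums osum (\<lambda>n. adj (V n)) x" for x
    using key[OF partiso_adj[OF V] Q P] by auto
  have adj: "adj (osum V) = osum (\<lambda>n. adj (V n))"
  proof (rule adj_eqI)
    show "osum V \<in> bounded_ops" using v(2) by (rule M_bounded_ops)
    fix x y
    have "(\<lambda>n. V n x \<bullet> y) sums (osum V x \<bullet> y)" using v(1) by (rule bounded_linear.sums[OF bounded_linear_inner_left])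
    moreover have "(\<lambda>n. x \<bullet> adj (V n) y) sums (x \<bullet> osum (\<lambda>n. adj (V n)) y)" using w by (rule bounded_linear.sums[OF bounded_linear_inner_right])
    ultimately show "osum V x \<bullet> y = x \<bullet> osum (\<lambda>n. adj (V n)) y"
      by (simp add: partisoD(10)[OF V] sums_unique2)
  qed
  \<comment> \<open>Of the whole series only the n-th term survives; the others have orthogonal
    final projections.\<close>
  have comp: "adj (V n) (osum V x) = P n x" if V: "\<And>n. partiso (V n) (P n) (Q n)" and Q: "oseq Q"
    and v: "\<And>x. (\<lambda>n. V n x) sums osum V x" for V P Q n x
  proof -
    have "(\<lambda>m. adj (V n) (V m x)) sums adj (V n) (osum V x)"
      by (rule bounded_linear.sums[OF blinfun.bounded_linear_right v])
    moreover have "(\<lambda>m. adj (V n) (V m x)) = (\<lambda>m. if m = n then P n x else 0)"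
    proof
      fix m
      show "adj (V n) (V m x) = (if m = n then P n x else 0)"
      proof (cases "m = n")
        case False
        have "adj (V n) (V m x) = adj (V n) (Q n (Q m (V m x)))" by (simp add: partisoD(9,7)[OF V])
        then show ?thesis using porthD[OF oseqD(2)[OF Q, of n m]] False by simp
      qed (simp add: partisoD(4)[OF V])
    qed
    ultimately have "(\<lambda>m. if m = n then P n x else 0) sums adj (V n) (osum V x)" by simp
    from sums_unique2[OF this sums_single] show ?thesis .
  qed
  have c1: "adj (osum V) (osum V x) = osum P x" for x
  proof -
    have "(\<lambda>n. adj (V n) (osum V x)) sums adj (osum V) (osum V x)" using w unfolding adj .
    then show ?thesis unfolding comp[OF V Q v(1)] using p(1) by (rule sums_unique2)
  qed
  have c2: "osum V (adj (osum V) x) = osum Q x" for x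
  proof -
    have "(\<lambda>n. V n (osum (\<lambda>n. adj (V n)) x)) sums osum V (osum (\<lambda>n. adj (V n)) x)" by (rule v)
    moreover have "V n (osum (\<lambda>n. adj (V n)) x) = Q n x" for n
      using comp[OF partiso_adj[OF V] P w] by (simp add: adj_adj M_bounded_ops partisoD(1)[OF V])
    ultimately have "(\<lambda>n. Q n x) sums osum V (osum (\<lambda>n. adj (V n)) x)" by simp
    from sums_unique2[OF this q(1)] show ?thesis unfolding adj .
  qed
  have proj: "osum P \<in> projections M" if P: "oseq P" and p: "\<And>x. (\<lambda>n. P n x) sums osum P x" "osum P \<in> M" for P
  proof (rule projectionsI[OF p(2)])
    note P1 = oseqD(1)[OF P]
    fix x y
    have "(\<lambda>n. P n (osum P x)) sums osum P (osum P x)" by (rule p)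
    moreover have "P n (osum P x) = P n x" for n
      using comp[OF partiso_refl[OF P1] P p(1)] by (simp add: projectionsD(6)[OF P1])
    ultimately have "(\<lambda>n. P n x) sums osum P (osum P x)" by simp
    from sums_unique2[OF this p(1)] show "osum P (osum P x) = osum P x" .
    have "(\<lambda>n. P n x \<bullet> y) sums (osum P x \<bullet> y)" using p(1) by (rule bounded_linear.sums[OF bounded_linear_inner_left])
    moreover have "(\<lambda>n. x \<bullet> P n y) sums (x \<bullet> osum P y)" using p(1) by (rule bounded_linear.sums[OF bounded_linear_inner_right])
    ultimately show "osum P x \<bullet> y = x \<bullet> osum P y" by (simp add: projectionsD(3)[OF P1] sums_unique2)
  qed
  show "(\<lambda>n. V n x) sums osum V x" "(\<lambda>n. P n x) sums osum P x" "(\<lambda>n. Q n x) sums osum Q x" using v p q by auto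
  show "partiso (osum V) (osum P) (osum Q)"
    unfolding partiso_def using v(2) c1 c2 proj[OF P p] proj[OF Q q] by simp
  show "(\<lambda>n. adj (V n) x) sums adj (osum V) x" using w unfolding adj .
qed

lemma osum_projection:
  assumes P: "oseq P"
  shows "(\<lambda>n. P n x) sums osum P x" "osum P \<in> projections M" "pleq (P n) (osum P)"
    "\<And>Q. (\<And>n. pleq (P n) Q) \<Longrightarrow> pleq (osum P) Q"
    "\<And>Q. (\<And>n. porth Q (P n)) \<Longrightarrow> porth Q (osum P)"
    "(\<lambda>n. (norm (P n x))\<^sup>2) sums (norm (osum P x))\<^sup>2"
proof -
  note s = partiso_osum[OF partiso_refl[OF oseqD(1)[OF P]] P P]
  show a: "(\<lambda>n. P n x) sums osum P x" for x by (rule s)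
  show pr: "osum P \<in> projections M" using s(4) by (rule partisoD)
  show "pleq (P n) (osum P)"
    unfolding pleq_def
  proof
    fix x
    have "(\<lambda>m. P m (P n x)) sums osum P (P n x)" by (rule a)
    moreover have "(\<lambda>m. P m (P n x)) = (\<lambda>m. if m = n then P n x else 0)"
      using porthD[OF oseqD(2)[OF P]] projectionsD(2)[OF oseqD(1)[OF P]] by auto
    ultimately have "(\<lambda>m. if m = n then P n x else 0) sums osum P (P n x)" by simp
    from sums_unique2[OF this sums_single] show "osum P (P n x) = P n x" .
  qed
  show "pleq (osum P) Q" if "\<And>n. pleq (P n) Q" for Q
    unfolding pleq_def
  proof
    fix x
    have "(\<lambda>n. Q (P n x)) sums Q (osum P x)" by (rule bounded_linear.sums[OF blinfun.bounded_linear_right a])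
    then show "Q (osum P x) = osum P x" using a[of x] that by (simp add: pleq_def sums_unique2)
  qed
  show "porth Q (osum P)" if "\<And>n. porth Q (P n)" for Q
    unfolding porth_def
  proof
    fix x
    have "(\<lambda>n. Q (P n x)) sums Q (osum P x)" by (rule bounded_linear.sums[OF blinfun.bounded_linear_right a])
    then show "Q (osum P x) = 0" using that sums_unique2[OF _ sums_zero] by (simp add: porth_def)
  qed
  have "(\<lambda>n. P n x \<bullet> x) sums (osum P x \<bullet> x)" using a by (rule bounded_linear.sums[OF bounded_linear_inner_left])
  then show "(\<lambda>n. (norm (P n x))\<^sup>2) sums (norm (osum P x))\<^sup>2"
    by (simp add: projectionsD(4)[OF pr] projectionsD(4)[OF oseqD(1)[OF P]])
qed

end

section \<open>Square roots, polar decomposition and spectral projections\<close>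

text \<open>Nonnegative polynomials in \<open>X\<close>; unlike general products of commuting positive operators,
  these are positive for elementary reasons.\<close>

inductive pospoly :: "('a::real_normed_vector \<Rightarrow>\<^sub>L 'a) \<Rightarrow> ('a \<Rightarrow>\<^sub>L 'a) \<Rightarrow> bool" for X where
  pospoly_id: "pospoly X id_blinfun"
| pospoly_add: "pospoly X S \<Longrightarrow> pospoly X T \<Longrightarrow> pospoly X (S + T)"
| pospoly_scale: "r \<ge> 0 \<Longrightarrow> pospoly X S \<Longrightarrow> pospoly X (r *\<^sub>R S)"
| pospoly_mult: "pospoly X S \<Longrightarrow> pospoly X (X o\<^sub>L S)"

lemma pospoly_commute:
  assumes "pospoly X S" "\<And>x. blinfun_apply Z (X x) = X (Z x)" shows "Z (S x) = S (Z x)"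
  using assms(1) by (induction arbitrary: x)
    (simp_all add: assms(2) blinfun.add_left blinfun.add_right blinfun.scaleR_left blinfun.scaleR_right)

lemma pospoly_comp: "pospoly X S \<Longrightarrow> pospoly X T \<Longrightarrow> pospoly X (S o\<^sub>L T)"
proof (induction rule: pospoly.induct)
  case pospoly_id
  have "id_blinfun o\<^sub>L T = T" by (intro blinfun_eqI) simp
  then show ?case using pospoly_id by simp
next
  case (pospoly_add S S')
  have "(S + S') o\<^sub>L T = (S o\<^sub>L T) + (S' o\<^sub>L T)" by (intro blinfun_eqI) (simp add: blinfun.add_left)
  then show ?case using pospoly_add by (simp add: pospoly.pospoly_add)
next
  case (pospoly_scale r S)
  have "(r *\<^sub>R S) o\<^sub>L T = r *\<^sub>R (S o\<^sub>L T)" by (intro blinfun_eqI) (simp add: blinfun.scaleR_left)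
  then show ?case using pospoly_scale by (simp add: pospoly.pospoly_scale)
next
  case (pospoly_mult S)
  have "(X o\<^sub>L S) o\<^sub>L T = X o\<^sub>L (S o\<^sub>L T)" by (intro blinfun_eqI) simp
  then show ?case using pospoly_mult by (simp add: pospoly.pospoly_mult)
qed

lemma pospoly_selfadj:
  fixes X :: "'a::real_inner \<Rightarrow>\<^sub>L 'a"
  assumes "pospoly X S" and sa: "\<And>x y. X x \<bullet> y = x \<bullet> X y"
  shows "S x \<bullet> y = x \<bullet> S y"
  using assms(1)
proof (induction arbitrary: x y)
  case (pospoly_mult S)
  have "X (S x) \<bullet> y = S x \<bullet> X y" by (rule sa)
  also have "\<dots> = x \<bullet> S (X y)" by (rule pospoly_mult)
  also have "S (X y) = X (S y)" using pospoly_commute[OF pospoly_mult(1)] by metis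
  finally show ?case by simp
qed (simp_all add: blinfun.add_left blinfun.scaleR_left inner_add_left inner_add_right)

text \<open>The induction carries X S along with S. One more factor gives X X S, whose form at x is
  the form of S at X x.\<close>

lemma pospoly_nonneg:
  fixes X :: "'a::real_inner \<Rightarrow>\<^sub>L 'a"
  assumes "pospoly X S" and sa: "\<And>x y. X x \<bullet> y = x \<bullet> X y" and pos: "\<And>x. 0 \<le> X x \<bullet> x"
  shows "0 \<le> S x \<bullet> x" "0 \<le> X (S x) \<bullet> x"
proof -
  have "(\<forall>x. 0 \<le> S x \<bullet> x) \<and> (\<forall>x. 0 \<le> X (S x) \<bullet> x)"
    using assms(1)
  proof induction
    case (pospoly_mult S)
    have "X (X (S x)) \<bullet> x = S (X x) \<bullet> X x" for x
      using pospoly_commute[OF pospoly_mult(1), of X x] sa by simp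
    then show ?case using pospoly_mult by simp
  qed (auto simp: pos blinfun.add_left blinfun.add_right blinfun.scaleR_left blinfun.scaleR_right inner_add_left)
  then show "0 \<le> S x \<bullet> x" "0 \<le> X (S x) \<bullet> x" by auto
qed

context vn_algebra
begin

section \<open>Positive square roots\<close>

definition pos :: "('a \<Rightarrow>\<^sub>L 'a) \<Rightarrow> bool" where
  "pos T \<longleftrightarrow> T \<in> M \<and> (\<forall>x y. T x \<bullet> y = x \<bullet> T y) \<and> (\<forall>x. 0 \<le> T x \<bullet> x)"

lemma posD: "pos T \<Longrightarrow> T \<in> M" "pos T \<Longrightarrow> T x \<bullet> y = x \<bullet> T y" "pos T \<Longrightarrow> 0 \<le> T x \<bullet> x"
  by (auto simp: pos_def)

lemma posI: "T \<in> M \<Longrightarrow> (\<And>x y. T x \<bullet> y = x \<bullet> T y) \<Longrightarrow> (\<And>x. 0 \<le> T x \<bullet> x) \<Longrightarrow> pos T"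
  by (auto simp: pos_def)

lemma pos_zero: "pos T \<Longrightarrow> T x \<bullet> x = 0 \<Longrightarrow> T x = 0"
  by (rule psd_zero[OF posD(2) posD(3)])

lemma pos_scaleR: "pos T \<Longrightarrow> r \<ge> 0 \<Longrightarrow> pos (r *\<^sub>R T)"
  by (rule posI) (auto simp: M_scaleR posD(1,3) blinfun.scaleR_left, simp add: posD(2))

text \<open>With X = 1 - T, the iterates Y n are nonnegative polynomials in X that increase and stay
  below 1. Their strong limit L satisfies 2 L = X + L^2, so 1 - L is the root. Whatever commutes
  with T commutes with X, with every Y n and with L.\<close>

lemma sqrt_exists_contraction:
  assumes T: "pos T" and le1: "\<And>x. T x \<bullet> x \<le> x \<bullet> x"
  shows "\<exists>S. pos S \<and> (\<forall>x. S (S x) = T x) \<and>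
    (\<forall>Z. (\<forall>x. blinfun_apply Z (T x) = T (Z x)) \<longrightarrow> (\<forall>x. Z (S x) = S (Z x)))"
proof -
  define X where "X = id_blinfun - T"
  have Xap: "X x = x - T x" for x by (simp add: X_def blinfun.diff_left)
  have XM: "X \<in> M" by (simp add: X_def M_diff M_id posD(1)[OF T])
  have Xsa: "X x \<bullet> y = x \<bullet> X y" for x y by (simp add: Xap inner_diff_left inner_diff_right posD(2)[OF T])
  have Xpos: "0 \<le> X x \<bullet> x" for x using le1 by (simp add: Xap inner_diff_left)
  have Xle: "X x \<bullet> x \<le> x \<bullet> x" for x using posD(3)[OF T] by (simp add: Xap inner_diff_left)
  \<comment> \<open>Fixed-point iteration for Y = (X + Y^2) / 2, which is equivalent to (1 - Y)^2 =
    1 - X = T.\<close>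
  define Y where "Y = rec_nat 0 (\<lambda>_ Y. (1/2) *\<^sub>R (X + (Y o\<^sub>L Y)))"
  have Y0: "Y 0 = 0" and YS: "Y (Suc n) = (1/2) *\<^sub>R (X + (Y n o\<^sub>L Y n))" for n
    by (simp_all add: Y_def)
  have ppX: "pospoly X X"
  proof -
    have "X o\<^sub>L id_blinfun = X" by (intro blinfun_eqI) simp
    then show ?thesis using pospoly_mult[OF pospoly_id, of X] by simp
  qed
  have pp0: "pospoly X 0" using pospoly_scale[OF order_refl pospoly_id, of X] by simp
  have ppY: "pospoly X (Y n)" for n
    by (induction n) (auto simp: Y0 YS pp0 intro!: pospoly_scale pospoly_add ppX pospoly_comp)
  have Ycomm: "Z (Y n x) = Y n (Z x)" if "\<And>x. blinfun_apply Z (X x) = X (Z x)" for Z n x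
    by (rule pospoly_commute[OF ppY that])
  have YY: "Y m (Y n x) = Y n (Y m x)" for m n x
    using Ycomm[of "Y m"] Ycomm[of X, OF refl] by metis
  \<comment> \<open>Increments keep nonnegative coefficients because Y (n+2) - Y (n+1) = (Y (n+1) -
    Y n) (Y (n+1) + Y n) / 2. This yields monotonicity.\<close>
  have ppD: "pospoly X (Y (Suc n) - Y n)" for n
  proof (induction n)
    case 0
    have "Y (Suc 0) - Y 0 = (1/2) *\<^sub>R X" by (intro blinfun_eqI) (simp add: Y0 YS blinfun.scaleR_left blinfun.add_left)
    then show ?case by (simp add: pospoly_scale ppX)
  next
    case (Suc n)
    have "Y (Suc (Suc n)) - Y (Suc n) = (1/2) *\<^sub>R ((Y (Suc n) - Y n) o\<^sub>L (Y (Suc n) + Y n))"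
    proof (rule blinfun_eqI)
      fix x
      have "Y (Suc (Suc n)) x - Y (Suc n) x = (1/2) *\<^sub>R (Y (Suc n) (Y (Suc n) x) - Y n (Y n x))"
      proof -
        have "Y (Suc (Suc n)) x = (1/2) *\<^sub>R (X x + Y (Suc n) (Y (Suc n) x))"
          "Y (Suc n) x = (1/2) *\<^sub>R (X x + Y n (Y n x))"
          by (simp_all only: YS[of "Suc n"] YS[of n] blinfun.scaleR_left blinfun.add_left blinfun_apply_blinfun_compose)
        from arg_cong2[where f = "(-)", OF this] show ?thesis by (simp add: algebra_simps)
      qed
      also have "\<dots> = (1/2) *\<^sub>R ((Y (Suc n) - Y n) ((Y (Suc n) + Y n) x))"
        using YY[of "Suc n" n x] by (simp add: blinfun.diff_left blinfun.add_left blinfun.add_right algebra_simps)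
      finally show "(Y (Suc (Suc n)) - Y (Suc n)) x = ((1/2) *\<^sub>R ((Y (Suc n) - Y n) o\<^sub>L (Y (Suc n) + Y n))) x"
        by (simp add: blinfun.diff_left blinfun.scaleR_left)
    qed
    then show ?case using Suc by (auto intro!: pospoly_scale pospoly_comp pospoly_add ppY)
  qed
  have Ysa: "Y n x \<bullet> y = x \<bullet> Y n y" for n x y by (rule pospoly_selfadj[OF ppY Xsa])
  have Ypos: "0 \<le> Y n x \<bullet> x" for n x by (rule pospoly_nonneg(1)[OF ppY Xsa Xpos])
  have Yle: "Y n x \<bullet> x \<le> x \<bullet> x" for n x
  proof (induction n arbitrary: x)
    case (Suc n)
    have "(norm (Y n x))\<^sup>2 \<le> 1 * (Y n x \<bullet> x)" by (rule psd_norm_bound) (use Ysa Ypos Suc in auto)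
    then have "Y n (Y n x) \<bullet> x \<le> x \<bullet> x" using Suc[of x] Ysa by (simp add: power2_norm_eq_inner)
    then show ?case using Xle[of x] by (simp add: YS blinfun.scaleR_left blinfun.add_left inner_add_left)
  qed (simp add: Y0)
  have Ynorm: "norm (Y n x) \<le> norm x" for n x
  proof -
    have "(norm (Y n x))\<^sup>2 \<le> 1 * (Y n x \<bullet> x)" by (rule psd_norm_bound) (use Ysa Ypos Yle in auto)
    also have "\<dots> \<le> (norm x)\<^sup>2" using Yle[of n x] by (simp add: power2_norm_eq_inner)
    finally show ?thesis by (rule power2_le_imp_le) simp
  qed
  have Ymono: "Y n x \<bullet> x \<le> Y (Suc n) x \<bullet> x" for n x
    using pospoly_nonneg(1)[OF ppD Xsa Xpos, of n x] by (simp add: blinfun.diff_left inner_diff_left)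
  obtain L where L: "\<And>x. (\<lambda>n. Y n x) \<longlonglongrightarrow> blinfun_apply L x"
    using monotone_strong_limit[of Y 1] Ysa Ymono Yle by auto
  have YM: "Y n \<in> M" for n by (induction n) (auto simp: Y0 YS M_0 XM M_add M_scaleR M_comp)
  have LM: "L \<in> M" by (rule M_strong_limit[OF YM L])
  have Linner: "(\<lambda>n. Y n x \<bullet> y) \<longlonglongrightarrow> L x \<bullet> y" "(\<lambda>n. x \<bullet> Y n y) \<longlonglongrightarrow> x \<bullet> L y" for x y
    by (intro tendsto_intros L)+
  have Lsa: "L x \<bullet> y = x \<bullet> L y" for x y
    using LIMSEQ_unique[OF Linner(1)[of x y]] Linner(2)[of x y] by (simp add: Ysa)
  have Lle: "L x \<bullet> x \<le> x \<bullet> x" for x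
    by (rule LIMSEQ_le_const2[OF Linner(1)]) (use Yle in blast)
  have YYL: "(\<lambda>n. Y n (Y n x)) \<longlonglongrightarrow> L (L x)" for x
  proof -
    have "(\<lambda>n. Y n (Y n x - L x)) \<longlonglongrightarrow> 0"
    proof (rule Lim_null_comparison)
      show "\<forall>\<^sub>F n in sequentially. norm (Y n (Y n x - L x)) \<le> norm (Y n x - L x)"
        using Ynorm by simp
      show "(\<lambda>n. norm (Y n x - L x)) \<longlonglongrightarrow> 0"
        using L[of x] by (simp add: LIM_zero tendsto_norm_zero)
    qed
    then have "(\<lambda>n. Y n (Y n x - L x) + Y n (L x)) \<longlonglongrightarrow> 0 + L (L x)" by (intro tendsto_intros L)
    then show ?thesis by (simp add: blinfun.diff_right)
  qed
  have Leq: "L x = (1/2) *\<^sub>R (X x + L (L x))" for x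
  proof -
    have "(\<lambda>n. Y (Suc n) x) \<longlonglongrightarrow> L x" using L[of x] by (rule LIMSEQ_Suc)
    moreover have "(\<lambda>n. Y (Suc n) x) \<longlonglongrightarrow> (1/2) *\<^sub>R (X x + L (L x))"
      unfolding YS by (simp add: blinfun.scaleR_left blinfun.add_left) (intro tendsto_intros YYL)
    ultimately show ?thesis by (rule LIMSEQ_unique)
  qed
  define S where "S = id_blinfun - L"
  have Sap: "S x = x - L x" for x by (simp add: S_def blinfun.diff_left)
  have "pos S"
    by (rule posI) (use Lle Lsa in \<open>auto simp: S_def M_diff M_id LM blinfun.diff_left inner_diff_left inner_diff_right\<close>)
  moreover have "S (S x) = T x" for x
  proof -
    have "2 *\<^sub>R L x = X x + L (L x)" by (subst Leq) simp
    then have "T x = x - 2 *\<^sub>R L x + L (L x)" by (simp add: Xap)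
    then show ?thesis by (simp add: Sap blinfun.diff_right scaleR_2)
  qed
  moreover have "Z (S x) = S (Z x)" if Z: "\<forall>x. blinfun_apply Z (T x) = T (Z x)" for Z x
  proof -
    have "Z (X x) = X (Z x)" for x using Z by (simp add: Xap blinfun.diff_right)
    then have "(\<lambda>n. Z (Y n x)) = (\<lambda>n. Y n (Z x))" using Ycomm by blast
    moreover have "(\<lambda>n. Z (Y n x)) \<longlonglongrightarrow> Z (L x)" by (intro tendsto_intros L)
    ultimately have "Z (L x) = L (Z x)" using L[of "Z x"] LIMSEQ_unique by fastforce
    then show ?thesis by (simp add: Sap blinfun.diff_right)
  qed
  ultimately show ?thesis by blast
qed

lemma sqrt_exists:
  assumes T: "pos T"
  shows "\<exists>S. pos S \<and> (\<forall>x. S (S x) = T x) \<and>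
    (\<forall>Z. (\<forall>x. blinfun_apply Z (T x) = T (Z x)) \<longrightarrow> (\<forall>x. Z (S x) = S (Z x)))"
proof -
  define c where "c = norm T + 1"
  have c: "c > 0" by (simp add: c_def add_nonneg_pos)
  define T' where "T' = (1 / c) *\<^sub>R T"
  have T': "pos T'" using T c by (simp add: T'_def pos_scaleR)
  have "T' x \<bullet> x \<le> x \<bullet> x" for x
  proof -
    have "T x \<bullet> x \<le> norm T * (x \<bullet> x)" by (rule blinfun_le_norm)
    also have "\<dots> \<le> c * (x \<bullet> x)" by (intro mult_right_mono) (auto simp: c_def)
    finally show ?thesis using c by (simp add: T'_def blinfun.scaleR_left field_simps)
  qed
  then obtain S where S: "pos S" "\<And>x. S (S x) = T' x"
    "\<And>Z x. (\<forall>x. blinfun_apply Z (T' x) = T' (Z x)) \<Longrightarrow> Z (S x) = S (Z x)"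
    using sqrt_exists_contraction[OF T'] by blast
  define S' where "S' = sqrt c *\<^sub>R S"
  have "pos S'" using S(1) c by (simp add: S'_def pos_scaleR)
  moreover have "S' (S' x) = T x" for x
    using c S(2) by (simp add: S'_def blinfun.scaleR_left blinfun.scaleR_right T'_def)
  moreover have "Z (S' x) = S' (Z x)" if "\<forall>x. blinfun_apply Z (T x) = T (Z x)" for Z x
    using S(3)[of Z x] that by (simp add: S'_def T'_def blinfun.scaleR_left blinfun.scaleR_right)
  ultimately show ?thesis by blast
qed

text \<open>The choice includes the clause on commuting operators, so that the chosen root inherits
  every commutation relation of \<open>T\<close>.\<close>

definition sqrtop :: "('a \<Rightarrow>\<^sub>L 'a) \<Rightarrow> 'a \<Rightarrow>\<^sub>L 'a" where
  "sqrtop T = (SOME S. pos S \<and> (\<forall>x. S (S x) = T x) \<and>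
    (\<forall>Z. (\<forall>x. blinfun_apply Z (T x) = T (Z x)) \<longrightarrow> (\<forall>x. Z (S x) = S (Z x))))"

lemma sqrtop:
  assumes "pos T"
  shows "pos (sqrtop T)" "sqrtop T (sqrtop T x) = T x"
    "\<And>Z. (\<And>x. blinfun_apply Z (T x) = T (Z x)) \<Longrightarrow> Z (sqrtop T x) = sqrtop T (Z x)"
    "(norm (sqrtop T x))\<^sup>2 = T x \<bullet> x"
proof -
  note s = someI_ex[OF sqrt_exists[OF assms], folded sqrtop_def]
  show p: "pos (sqrtop T)" and q: "sqrtop T (sqrtop T x) = T x"
    and "\<And>Z. (\<And>x. blinfun_apply Z (T x) = T (Z x)) \<Longrightarrow> Z (sqrtop T x) = sqrtop T (Z x)" for x
    using s by blast+
  show "(norm (sqrtop T x))\<^sup>2 = T x \<bullet> x" using posD(2)[OF p, of "sqrtop T x" x] q by (simp add: power2_norm_eq_inner)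
qed

section \<open>Polar decomposition\<close>

lemma pos_adj_comp: "T \<in> M \<Longrightarrow> pos (adj T o\<^sub>L T)"
  by (rule posI) (auto simp: M_comp M_adj adj_inner' M_bounded_ops adj_inner[symmetric])

text \<open>With H = |T| and K n = (1 - H)^n, the partial isometry is the strong limit of T (K 0 +
  ... + K (n-1)). The sum approximates an inverse of H: multiplied by H it telescopes to 1 - K n,
  and K n decreases strongly to the projection onto the kernel of T.\<close>

lemma polar_contraction:
  assumes T: "T \<in> M" and le: "\<And>x. norm (T x) \<le> norm x"
  shows "eqv (supp T) (rproj T)"
proof -
  have bo: "T \<in> bounded_ops" using T by (rule M_bounded_ops)
  define H where "H = sqrtop (adj T o\<^sub>L T)"
  note h = sqrtop[OF pos_adj_comp[OF T], folded H_def]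
  have Hn: "norm (H x) = norm (T x)" for x
  proof -
    have "(norm (H x))\<^sup>2 = (norm (T x))\<^sup>2" using h(4)[of x] by (simp add: adj_inner' bo power2_norm_eq_inner)
    then show ?thesis by simp
  qed
  have Hle: "H x \<bullet> x \<le> x \<bullet> x" for x
  proof -
    have "H x \<bullet> x \<le> norm (H x) * norm x" by (rule norm_cauchy_schwarz)
    also have "\<dots> \<le> norm x * norm x" by (intro mult_right_mono) (auto simp: Hn le)
    finally show ?thesis by (simp add: power2_norm_eq_inner[symmetric] power2_eq_square)
  qed
  define K where "K n = ((\<lambda>S. (id_blinfun - H) o\<^sub>L S) ^^ n) id_blinfun" for n
  have K0: "K 0 x = x" and KS: "K (Suc n) x = K n x - H (K n x)" for n x
    by (simp_all add: K_def blinfun.diff_left)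
  have KH: "K n (H x) = H (K n x)" for n x
    by (induction n) (simp_all add: K0 KS blinfun.diff_right)
  have KM: "K n \<in> M" for n
  proof (induction n)
    case (Suc n)
    have "K (Suc n) = (id_blinfun - H) o\<^sub>L K n" by (simp add: K_def)
    then show ?case using Suc by (simp add: M_comp M_diff M_id posD(1)[OF h(1)])
  qed (simp add: K_def M_id)
  have Ksa: "K n x \<bullet> y = x \<bullet> K n y" for n x y
    by (induction n arbitrary: x y) (simp_all add: K0 KS inner_diff_left inner_diff_right posD(2)[OF h(1)] KH)
  \<comment> \<open>Induction by two: H K (n+2) = (1 - H) H K n (1 - H), so positivity passes from n
    to n + 2. The case n = 1 is H^2 \<le> H.\<close>
  have HK: "0 \<le> H (K n x) \<bullet> x" for n x
  proof (induction n arbitrary: x rule: induct_nat_012)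
    case 0 then show ?case using posD(3)[OF h(1)] by (simp add: K0)
  next
    case 1
    have "(norm (H x))\<^sup>2 \<le> 1 * (H x \<bullet> x)" by (rule psd_norm_bound) (use posD[OF h(1)] Hle in auto)
    then show ?case using posD(2)[OF h(1), of "H x" x]
      by (simp add: K0 KS blinfun.diff_right inner_diff_left power2_norm_eq_inner)
  next
    case (ge2 n)
    have "H (K (Suc (Suc n)) x) \<bullet> x = H (K n (x - H x)) \<bullet> (x - H x)"
      by (simp add: KS blinfun.diff_right inner_diff_left inner_diff_right KH posD(2)[OF h(1)])
    then show ?case using ge2(1) by simp
  qed
  have Kn: "norm (K n x) \<le> norm x" for n x
  proof (induction n)
    case (Suc n)
    have "norm (y - H y) \<le> norm y" for y
    proof -
      have "(norm (H y))\<^sup>2 \<le> 1 * (H y \<bullet> y)" by (rule psd_norm_bound) (use posD[OF h(1)] Hle in auto)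
      moreover have "(norm (y - H y))\<^sup>2 = (norm y)\<^sup>2 - 2 * (H y \<bullet> y) + (norm (H y))\<^sup>2"
        by (simp add: power2_norm_eq_inner inner_diff_left inner_diff_right inner_commute)
      ultimately have "(norm (y - H y))\<^sup>2 \<le> (norm y)\<^sup>2" using posD(3)[OF h(1), of y] by simp
      then show ?thesis by (rule power2_le_imp_le) simp
    qed
    then show ?case unfolding KS using Suc by (rule order_trans)
  qed (simp add: K0)
  \<comment> \<open>The convergence lemma is about increasing sequences, hence the sign.\<close>
  obtain N' where N': "\<And>x. (\<lambda>n. (- K n) x) \<longlonglongrightarrow> blinfun_apply N' x"
  proof -
    have "\<exists>L. \<forall>x. (\<lambda>n. (- K n) x) \<longlonglongrightarrow> blinfun_apply L x"
    proof (rule monotone_strong_limit)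
      fix n x
      show "(- K n) x \<bullet> x \<le> (- K (Suc n)) x \<bullet> x"
        using HK[of n x] by (simp add: blinfun.minus_left KS inner_diff_left)
      have "- (K n x \<bullet> x) \<le> norm (K n x) * norm x" using norm_cauchy_schwarz[of "- K n x" x] by simp
      also have "\<dots> \<le> norm x * norm x" by (intro mult_right_mono Kn) simp
      finally show "(- K n) x \<bullet> x \<le> 1 * (x \<bullet> x)"
        by (simp add: blinfun.minus_left power2_norm_eq_inner[symmetric] power2_eq_square)
    qed (simp add: blinfun.minus_left Ksa)
    then show ?thesis using that by blast
  qed
  define N where "N = - N'"
  have N: "(\<lambda>n. K n x) \<longlonglongrightarrow> N x" for x
    using tendsto_minus[OF N'[of x]] by (simp add: N_def blinfun.minus_left)
  have HN: "H (N x) = 0" for x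
  proof -
    have "(\<lambda>n. H (K n x)) \<longlonglongrightarrow> H (N x)" by (intro tendsto_intros N)
    moreover have "(\<lambda>n. K n x - K (Suc n) x) \<longlonglongrightarrow> N x - N x" by (rule tendsto_diff[OF N LIMSEQ_Suc[OF N]])
    then have "(\<lambda>n. H (K n x)) \<longlonglongrightarrow> 0" by (simp add: KS)
    ultimately show ?thesis by (rule LIMSEQ_unique)
  qed
  have Nsa: "N x \<bullet> y = x \<bullet> N y" for x y
  proof -
    have "(\<lambda>n. K n x \<bullet> y) \<longlonglongrightarrow> N x \<bullet> y" "(\<lambda>n. x \<bullet> K n y) \<longlonglongrightarrow> x \<bullet> N y" by (intro tendsto_intros N)+
    then show ?thesis using LIMSEQ_unique by (simp add: Ksa)
  qed
  have Nid: "N x = x" if "T x = 0" for x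
  proof -
    have "H x = 0" using that Hn[of x] by simp
    then have "K n x = x" for n by (induction n) (simp_all add: K0 KS)
    then show ?thesis using N[of x] LIMSEQ_unique[of "\<lambda>n. x"] by simp
  qed
  have TN: "T (N x) = 0" for x using Hn[of "N x"] HN by simp
  have NN: "N x = null_proj T x" for x
  proof -
    have "N (supp T x) \<bullet> N (supp T x) = supp T x \<bullet> N (supp T x)" using Nid[OF TN] Nsa by simp
    also have "\<dots> = x \<bullet> supp T (N (supp T x))" by (rule projectionsD(3)[OF supp(1)[OF T]])
    also have "\<dots> = 0" using supp(4)[OF T, of "N (supp T x)"] TN[of "supp T x"] by simp
    finally have "N (supp T x) = 0" by simp
    then have "N x = N (null_proj T x)" by (simp add: supp_def blinfun.diff_left blinfun.diff_right)
    also have "\<dots> = null_proj T x"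
      using null_proj_M(2)[OF T] projectionsD(2)[OF null_proj_M(1)[OF T]] by (intro Nid) blast
    finally show ?thesis .
  qed
  define W where "W n = T o\<^sub>L (\<Sum>k<n. K k)" for n
  have Wap: "W n x = T (\<Sum>k<n. K k x)" for n x by (simp add: W_def blinfun.sum_left)
  have Hsum: "H (\<Sum>k<n. K k x) = x - K n x" for n x
    by (induction n) (simp_all add: K0 KS blinfun.add_right)
  have Wn: "norm (W n x) = norm (x - K n x)" for n x by (simp add: Wap Hn[symmetric] Hsum)
  \<comment> \<open>H and T have the same norm on every vector, so differences of the W n are
    measured by differences of the convergent K n.\<close>
  have Wdiff: "norm (W m x - W n x) = norm (K n x - K m x)" for m n x
  proof -
    have "norm (W m x - W n x) = norm (H ((\<Sum>k<m. K k x) - (\<Sum>k<n. K k x)))"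
      by (simp only: Wap Hn blinfun.diff_right[symmetric])
    then show ?thesis by (simp add: blinfun.diff_right Hsum)
  qed
  have Wb: "norm (W n x) \<le> 2 * norm x" for n x
    unfolding Wn using norm_triangle_ineq4[of x "K n x"] Kn[of n x] by linarith
  have "Cauchy (\<lambda>n. W n x)" for x
  proof -
    have "Cauchy (\<lambda>n. K n x)" using N LIMSEQ_imp_Cauchy by blast
    then show ?thesis unfolding Cauchy_def dist_norm Wdiff by (metis norm_minus_commute)
  qed
  then have "convergent (\<lambda>n. W n x)" for x by (rule Cauchy_convergent)
  then obtain V where V: "\<And>x. (\<lambda>n. W n x) \<longlonglongrightarrow> blinfun_apply V x"
    using strong_limit_exists[of W, OF _ Wb] by metis
  have VM: "V \<in> M" by (rule M_strong_limit[OF _ V]) (simp add: W_def M_comp M_sum T KM)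
  have Vbo: "V \<in> bounded_ops" using VM by (rule M_bounded_ops)
  have Vn: "norm (V x) = norm (supp T x)" for x
  proof -
    have "(\<lambda>n. norm (W n x)) \<longlonglongrightarrow> norm (V x)" by (intro tendsto_intros V)
    moreover have "(\<lambda>n. norm (W n x)) \<longlonglongrightarrow> norm (x - N x)" unfolding Wn by (intro tendsto_intros N)
    ultimately have "norm (V x) = norm (x - N x)" by (rule LIMSEQ_unique)
    then show ?thesis by (simp add: NN supp_def blinfun.diff_left)
  qed
  have VH: "V (H x) = T x" for x
  proof -
    have W: "W n (H x) = T (x - K n x)" for n
    proof -
      have "(\<Sum>k<n. K k (H x)) = H (\<Sum>k<n. K k x)" by (simp add: KH blinfun.sum_right)
      then show ?thesis by (simp add: Wap Hsum)
    qed
    have "(\<lambda>n. T (x - K n x)) \<longlonglongrightarrow> T (x - N x)" by (intro tendsto_intros N)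
    then have "V (H x) = T (x - N x)" using LIMSEQ_unique[OF V[of "H x"]] by (simp add: W)
    then show ?thesis by (simp add: blinfun.diff_right TN)
  qed
  note sp = projectionsD[OF supp(1)[OF T]]
  have VV: "adj V (V x) = supp T x" for x
  proof -
    let ?D = "(adj V o\<^sub>L V) - supp T"
    have "?D x = 0"
    proof (rule psd_zero)
      show "?D x \<bullet> y = x \<bullet> ?D y" for x y
        by (simp add: blinfun.diff_left inner_diff_left inner_diff_right sp(3) adj_inner' Vbo)
          (simp add: adj_inner Vbo)
      have z: "?D x \<bullet> x = 0" for x
        by (simp add: blinfun.diff_left inner_diff_left sp(4) adj_inner' Vbo Vn[symmetric])
          (simp add: power2_norm_eq_inner)
      then show "0 \<le> ?D x \<bullet> x" "?D x \<bullet> x = 0" for x by auto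
    qed
    then show ?thesis by (simp add: blinfun.diff_left)
  qed
  have Vs: "V (supp T x) = V x" for x
  proof -
    have "norm (V (supp T x - x)) = 0" unfolding Vn by (simp add: blinfun.diff_right sp(2))
    then show ?thesis by (simp add: blinfun.diff_right)
  qed
  define F where "F = V o\<^sub>L adj V"
  have F: "F \<in> projections M"
    by (rule projectionsI) (simp_all add: F_def M_comp VM M_adj VV Vs adj_inner Vbo adj_inner'[symmetric])
  have rV: "rproj T (V x) = V x" for x
  proof -
    have "(\<lambda>n. rproj T (W n x)) \<longlonglongrightarrow> rproj T (V x)" by (intro tendsto_intros V)
    then have "(\<lambda>n. W n x) \<longlonglongrightarrow> rproj T (V x)" by (simp add: Wap rproj(2)[OF T])
    from LIMSEQ_unique[OF this V] show ?thesis .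
  qed
  have "F = rproj T"
  proof (rule pleq_antisym[OF _ _ F rproj(1)[OF T]])
    show "pleq F (rproj T)" by (simp add: pleq_def F_def rV)
    show "pleq (rproj T) F"
    proof (rule rproj(3)[OF T F])
      fix x
      have "F (T x) = V (adj V (V (H x)))" by (simp add: F_def VH)
      also have "\<dots> = V (H x)" by (simp only: VV Vs)
      finally show "F (T x) = T x" by (simp only: VH)
    qed
  qed
  then have "V (adj V x) = rproj T x" for x by (simp only: F_def[symmetric] blinfun_apply_blinfun_compose[symmetric])
  then have "partiso V (supp T) (rproj T)"
    unfolding partiso_def using VM supp(1)[OF T] rproj(1)[OF T] VV by blast
  then show ?thesis unfolding eqv_def by blast
qed

text \<open>Rescaling to a contraction changes neither the kernel of T nor that of its
  adjoint.\<close>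

theorem polar:
  assumes T: "T \<in> M"
  shows "eqv (supp T) (rproj T)"
proof -
  define c where "c = 1 / (norm T + 1)"
  have c: "c > 0" by (simp add: c_def add_nonneg_pos)
  define T' where "T' = c *\<^sub>R T"
  have T': "T' \<in> M" by (simp add: T'_def M_scaleR T)
  have z: "T' x = 0 \<longleftrightarrow> T x = 0" for x using c by (simp add: T'_def blinfun.scaleR_left)
  have adj: "adj T' = c *\<^sub>R adj T"
    by (rule adj_eqI) (rule M_bounded_ops[OF T'], simp add: T'_def blinfun.scaleR_left adj_inner M_bounded_ops T)
  have "norm (T' x) \<le> norm x" for x
  proof -
    have "norm (T x) \<le> norm T * norm x" by (rule norm_blinfun)
    also have "\<dots> \<le> (norm T + 1) * norm x" by (intro mult_right_mono) auto
    finally have "c * norm (T x) \<le> c * ((norm T + 1) * norm x)" using c by (intro mult_left_mono) auto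
    also have "\<dots> = norm x" by (simp add: c_def) (metis add_nonneg_pos norm_ge_zero zero_less_one less_irrefl nonzero_eq_divide_eq times_divide_eq_left mult.commute)
    finally show ?thesis using c by (simp add: T'_def blinfun.scaleR_left)
  qed
  then have "eqv (supp T') (rproj T')" by (rule polar_contraction[OF T'])
  moreover have "supp T' = supp T"
  proof -
    have "null_proj T' = null_proj T"
      by (rule projection_eqI) (auto simp: null_proj_M T' T z)
    then show ?thesis by (simp add: supp_def)
  qed
  moreover have "rproj T' = rproj T"
  proof -
    have "null_proj (adj T') = null_proj (adj T)"
      using c by (intro projection_eqI) (auto simp: null_proj_M M_adj T' T, simp_all add: adj blinfun.scaleR_left)
    then show ?thesis by (simp add: rproj_def supp_def)
  qed
  ultimately show ?thesis by simp
qed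

text \<open>The spectral projection of \<open>A\<close> for \<open>[t, \<infinity>)\<close>: the null space of the negative part of \<open>A - t\<close>.\<close>

definition spg :: "('a \<Rightarrow>\<^sub>L 'a) \<Rightarrow> real \<Rightarrow> 'a \<Rightarrow>\<^sub>L 'a" where
  "spg A t = (let D = A - t *\<^sub>R id_blinfun in null_proj (sqrtop (D o\<^sub>L D) - D))"

text \<open>With D = A - t and R = |D|, the range of \<open>spg A t\<close> is where R and D agree.
  Since (R - D)(R + D) = 0, R + D maps into it, so a vector orthogonal to it satisfies D x = - R x.
  The form of R cannot vanish at such an x unless x = 0, for R x = 0 would put x back into the
  range; this makes the last inequality strict.\<close>

lemma spg:
  assumes A: "pos A"
  shows "spg A t \<in> projections M"
    "\<And>Z. (\<And>x. blinfun_apply Z (A x) = A (Z x)) \<Longrightarrow> (\<And>x y. Z x \<bullet> y = x \<bullet> Z y) \<Longrightarrow> spg A t (Z x) = Z (spg A t x)"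
    "spg A t x = x \<Longrightarrow> t * (norm x)\<^sup>2 \<le> A x \<bullet> x"
    "spg A t x = 0 \<Longrightarrow> x \<noteq> 0 \<Longrightarrow> A x \<bullet> x < t * (norm x)\<^sup>2"
proof -
  define D where "D = A - t *\<^sub>R id_blinfun"
  have Dap: "D x = A x - t *\<^sub>R x" for x by (simp add: D_def blinfun.diff_left blinfun.scaleR_left)
  have DM: "D \<in> M" by (simp add: D_def M_diff M_scaleR M_id posD(1)[OF A])
  have Dsa: "D x \<bullet> y = x \<bullet> D y" for x y by (simp add: Dap inner_diff_left inner_diff_right posD(2)[OF A])
  have DD: "pos (D o\<^sub>L D)"
  proof (rule posI)
    show "0 \<le> (D o\<^sub>L D) x \<bullet> x" for x using Dsa[of "D x" x] by simp
  qed (simp_all add: M_comp DM Dsa)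
  define R where "R = sqrtop (D o\<^sub>L D)"
  note r = sqrtop[OF DD, folded R_def]
  have RM: "R - D \<in> M" by (simp add: M_diff DM posD(1)[OF r(1)])
  define G where "G = null_proj (R - D)"
  have spG: "spg A t = G" by (simp add: spg_def G_def R_def D_def Let_def)
  note g = null_proj_M[OF RM, folded G_def]
  have gx: "G x = x \<longleftrightarrow> R x = D x" for x using g(2) by (simp add: blinfun.diff_left)
  show "spg A t \<in> projections M" unfolding spG by (rule g(1))
  have RD: "R (D x) = D (R x)" for x using r(3)[of D x] by simp
  show "spg A t (Z x) = Z (spg A t x)"
    if Z: "\<And>x. blinfun_apply Z (A x) = A (Z x)" "\<And>x y. Z x \<bullet> y = x \<bullet> Z y" for Z x
  proof -
    have ZD: "Z (D x) = D (Z x)" for x by (simp add: Dap Z blinfun.diff_right blinfun.scaleR_right)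
    then have ZR: "Z (R x) = R (Z x)" for x using r(3)[of Z x] by simp
    have GZG: "G (Z (G y)) = Z (G y)" for y
      using gx[of "G y"] gx[of "Z (G y)"] projectionsD(2)[OF g(1)] ZD ZR by metis
    have "w \<bullet> G (Z x) = w \<bullet> Z (G x)" for w
    proof -
      have "w \<bullet> G (Z x) = Z (G w) \<bullet> x" by (simp add: Z(2) projectionsD(3)[OF g(1), symmetric])
      also have "\<dots> = G (Z (G w)) \<bullet> x" by (simp add: GZG)
      also have "\<dots> = w \<bullet> G (Z (G x))" by (simp add: Z(2) projectionsD(3)[OF g(1)])
      finally show ?thesis by (simp add: GZG)
    qed
    then show ?thesis unfolding spG by (metis vector_eq_ldot)
  qed
  show "t * (norm x)\<^sup>2 \<le> A x \<bullet> x" if "spg A t x = x"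
  proof -
    have "R x = D x" using that gx by (simp add: spG)
    then have "0 \<le> D x \<bullet> x" using posD(3)[OF r(1), of x] by simp
    then show ?thesis by (simp add: Dap inner_diff_left power2_norm_eq_inner)
  qed
  show "A x \<bullet> x < t * (norm x)\<^sup>2" if x: "spg A t x = 0" "x \<noteq> 0"
  proof -
    have "R x + D x = 0"
    proof -
      have "G (R y + D y) = R y + D y" for y
        unfolding gx by (simp add: blinfun.add_right r(2) RD)
      then have "(R y + D y) \<bullet> x = 0" for y
        using projectionsD(3)[OF g(1), of "R y + D y" x] x(1) by (simp add: spG)
      then have "y \<bullet> (R x + D x) = 0" for y
        using posD(2)[OF r(1)] Dsa by (simp add: inner_add_left inner_add_right)
      then show ?thesis by (metis inner_eq_zero_iff)
    qed
    then have Dx: "D x = - R x" by (simp add: eq_neg_iff_add_eq_0 add.commute)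
    have "R x \<bullet> x \<noteq> 0"
    proof
      assume "R x \<bullet> x = 0"
      then have "R x = 0" by (rule pos_zero[OF r(1)])
      then have "G x = x" unfolding gx using Dx by simp
      then show False using x by (simp add: spG)
    qed
    then have "D x \<bullet> x < 0" using posD(3)[OF r(1), of x] Dx by simp
    then show ?thesis by (simp add: Dap inner_diff_left power2_norm_eq_inner)
  qed
qed

lemma spg_comm:
  assumes A: "pos A" shows "spg A t (A x) = A (spg A t x)" 
  by (rule spg(2)[OF A]) (auto simp: posD(2)[OF A])

lemma spg_ge: "pos A \<Longrightarrow> t * (norm (spg A t x))\<^sup>2 \<le> A (spg A t x) \<bullet> spg A t x"
  by (rule spg(3)) (auto simp: projectionsD(2)[OF spg(1)])

lemma spg_le:
  assumes A: "pos A" and "spg A t x = 0" shows "A x \<bullet> x \<le> t * (norm x)\<^sup>2"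
  using spg(4)[OF A assms(2)] by (cases "x = 0") auto

text \<open>For x in Q the component outside \<open>spg A t\<close> stays in Q by commutation, so
  its form is at least t times the squared norm; outside the spectral projection it is strictly less
  unless the component is 0.\<close>

lemma spg_greatest:
  assumes A: "pos A" and Q: "Q \<in> projections M" "\<And>x. Q (A x) = A (Q x)"
    and ge: "\<And>x. Q x = x \<Longrightarrow> t * (norm x)\<^sup>2 \<le> A x \<bullet> x"
  shows "pleq Q (spg A t)"
proof (rule pleqI[OF Q(1)])
  fix x assume x: "Q x = x"
  let ?y = "x - spg A t x"
  have "Q ?y = ?y" using spg(2)[OF A Q(2) projectionsD(3)[OF Q(1)], of t x] x by (simp add: blinfun.diff_right)
  then have "t * (norm ?y)\<^sup>2 \<le> A ?y \<bullet> ?y" by (rule ge)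
  moreover have "spg A t ?y = 0" by (simp add: blinfun.diff_right projectionsD(2)[OF spg(1)[OF A]])
  ultimately have "?y = 0" using spg(4)[OF A, of t ?y] by force
  then show "spg A t x = x" by simp
qed

lemma spg_antimono:
  assumes A: "pos A" and st: "s \<le> t" shows "pleq (spg A t) (spg A s)"
proof (rule spg_greatest[OF A spg(1)[OF A] spg_comm[OF A]])
  fix x assume "spg A t x = x"
  then have "t * (norm x)\<^sup>2 \<le> A x \<bullet> x" by (rule spg(3)[OF A])
  moreover have "s * (norm x)\<^sup>2 \<le> t * (norm x)\<^sup>2" using st by (intro mult_right_mono) auto
  ultimately show "s * (norm x)\<^sup>2 \<le> A x \<bullet> x" by simp
qed

end

section \<open>Comparison of projections\<close>

context vn_algebra
begin

definition sle :: "('a \<Rightarrow>\<^sub>L 'a) \<Rightarrow> ('a \<Rightarrow>\<^sub>L 'a) \<Rightarrow> bool" where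
  "sle P Q \<longleftrightarrow> Q \<in> projections M \<and> (\<exists>Q'. eqv P Q' \<and> pleq Q' Q)"

lemma sle_projections: "sle P Q \<Longrightarrow> P \<in> projections M \<and> Q \<in> projections M"
  unfolding sle_def using eqv_projections by blast

lemma sle_pleq: "P \<in> projections M \<Longrightarrow> Q \<in> projections M \<Longrightarrow> pleq P Q \<Longrightarrow> sle P Q"
  unfolding sle_def using eqv_refl by blast

lemma sle_eqv: "eqv P Q \<Longrightarrow> sle P Q"
  unfolding sle_def using eqv_projections pleq_refl by blast

lemma eqv_restrict:
  assumes "eqv P Q" "P' \<in> projections M" "pleq P' P"
  shows "\<exists>Q'. eqv P' Q' \<and> pleq Q' Q"
  using assms partiso_restrict(1,2) unfolding eqv_def by meson

lemma sle_trans: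
  assumes PQ: "sle P Q" and QR: "sle Q R" shows "sle P R"
proof -
  obtain Q' where Q': "eqv P Q'" "pleq Q' Q" using PQ by (auto simp: sle_def)
  obtain R' where R': "eqv Q R'" "pleq R' R" "R \<in> projections M" using QR by (auto simp: sle_def)
  obtain R'' where "eqv Q' R''" "pleq R'' R'" using eqv_restrict[OF R'(1)] Q' eqv_projections by blast
  then show ?thesis unfolding sle_def using Q' R' eqv_trans pleq_trans by blast
qed

lemma eqv_add:
  assumes "eqv P P'" "eqv Q Q'" "porth P Q" "porth P' Q'" shows "eqv (P + Q) (P' + Q')"
  using assms partiso_add unfolding eqv_def by blast

lemma sle_add:
  assumes "sle P P'" "sle Q Q'" "porth P Q" "porth P' Q'" shows "sle (P + Q) (P' + Q')"
proof -
  obtain P1 where P1: "eqv P P1" "pleq P1 P'" "P' \<in> projections M" using assms(1) by (auto simp: sle_def)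
  obtain Q1 where Q1: "eqv Q Q1" "pleq Q1 Q'" "Q' \<in> projections M" using assms(2) by (auto simp: sle_def)
  have pr: "P1 \<in> projections M" "Q1 \<in> projections M" using P1 Q1 eqv_projections by auto
  have o: "porth P1 Q1" using porth_pleq porth_pleq2 assms(4) P1 Q1 pr by blast
  have "pleq P1 (P' + Q')" "pleq Q1 (P' + Q')"
    using P1 Q1 assms(4) pleq_trans pleq_add1 pleq_add2 by blast+
  then have "pleq (P1 + Q1) (P' + Q')" by (rule pleq_add_least)
  then show ?thesis unfolding sle_def using eqv_add[OF P1(1) Q1(1) assms(3) o] projection_add P1 Q1 assms(4) by blast
qed

lemma eqv_osum:
  assumes "\<And>n. eqv (P n) (Q n)" "oseq P" "oseq Q" shows "eqv (osum P) (osum Q)"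
proof -
  obtain V where "\<And>n. partiso (V n) (P n) (Q n)" using assms(1) unfolding eqv_def by metis
  then show ?thesis unfolding eqv_def using partiso_osum(4) assms by blast
qed

lemma oseq_pleq:
  assumes "oseq Q" "\<And>n. P n \<in> projections M" "\<And>n. pleq (P n) (Q n)" shows "oseq P"
  unfolding oseq_def using assms porth_pleq porth_pleq2 oseqD by meson

lemma sle_osum:
  assumes "\<And>n. sle (P n) (Q n)" "oseq P" "oseq Q" shows "sle (osum P) (osum Q)"
proof -
  obtain Q' where Q': "\<And>n. eqv (P n) (Q' n)" "\<And>n. pleq (Q' n) (Q n)"
    using assms(1) unfolding sle_def by metis
  have o: "oseq Q'" using oseq_pleq[OF assms(3)] Q' eqv_projections by blast
  have "pleq (osum Q') (osum Q)"
    using osum_projection(4)[OF o] osum_projection(3)[OF assms(3)] Q'(2) pleq_trans by blast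
  then show ?thesis
    unfolding sle_def using eqv_osum[OF Q'(1) assms(2) o] osum_projection(2)[OF assms(3)] by blast
qed

lemma eqv_0: "eqv P Q \<Longrightarrow> P = 0 \<longleftrightarrow> Q = 0"
proof -
  have "Q = 0" if e: "eqv P Q" and 0: "P = 0" for P Q
  proof -
    obtain V where V: "partiso V P Q" using e unfolding eqv_def by blast
    have "norm (V x) = 0" for x using partisoD(12)[OF V] 0 by simp
    then have "Q x = 0" for x using partisoD(5)[OF V, of x] by simp
    then show ?thesis by (intro blinfun_eqI) simp
  qed
  then show "eqv P Q \<Longrightarrow> P = 0 \<longleftrightarrow> Q = 0" using eqv_sym by blast
qed

lemma eqv_00: "eqv 0 0" by (rule eqv_refl[OF projection_0])

lemma pleq_0: "pleq P 0 \<Longrightarrow> P = 0"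
  by (intro blinfun_eqI) (simp add: pleq_def)

lemma porth_self: "P \<in> projections M \<Longrightarrow> porth P P \<Longrightarrow> P = 0"
  by (intro blinfun_eqI) (simp add: porth_def projectionsD)

lemma porth_0: "porth P 0" "porth 0 P" by (auto simp: porth_def)
lemma zero_pleq: "pleq 0 P" by (simp add: pleq_def)

lemma oseq_subseq: "oseq P \<Longrightarrow> inj f \<Longrightarrow> oseq (\<lambda>n. P (f n))"
  unfolding oseq_def by (metis injD)

lemma osum_split_first:
  assumes P: "oseq P"
  shows "osum P = P 0 + osum (\<lambda>n. P (Suc n))" "porth (P 0) (osum (\<lambda>n. P (Suc n)))"
proof -
  have o: "oseq (\<lambda>n. P (Suc n))" by (rule oseq_subseq[OF P]) simp
  show "porth (P 0) (osum (\<lambda>n. P (Suc n)))"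
    by (rule osum_projection(5)[OF o]) (rule oseqD(2)[OF P], simp)
  show "osum P = P 0 + osum (\<lambda>n. P (Suc n))"
  proof (rule osum_eqI)
    fix x
    show "(\<lambda>n. P n x) sums (P 0 + osum (\<lambda>n. P (Suc n))) x"
      using sums_Suc[OF osum_projection(1)[OF o, of x]] by (simp add: blinfun.add_left add.commute)
  qed
qed

text \<open>The wandering projections of a partial isometry that maps \<open>P\<close> into itself.\<close>

lemma shift_sequence:
  assumes V: "partiso V P P''" and le: "pleq P'' P'" "pleq P' P" "P' \<in> projections M"
  obtains R where "oseq R" "R 0 = P - P'" "\<And>n. pleq (R n) P" "\<And>n. eqv (R n) (R (Suc n))"
proof -
  define R where "R = rec_nat (P - P') (\<lambda>_ R. V o\<^sub>L R o\<^sub>L adj V)"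
  have R0: "R 0 = P - P'" and RS: "R (Suc n) = V o\<^sub>L R n o\<^sub>L adj V" for n by (simp_all add: R_def)
  note v = partisoD[OF V]
  have Rn: "R n \<in> projections M \<and> pleq (R n) P" for n
  proof (induction n)
    case 0 then show ?case using projection_diff[OF le(3) v(2) le(2)] pleq_diff[OF le(3) v(2) le(2)] by (simp add: R0)
  next
    case (Suc n)
    note r = partiso_restrict[OF V, of "R n"]
    show ?case using r(1,2) Suc partisoD(3) le pleq_trans unfolding RS by blast
  qed
  have RS': "pleq (R (Suc n)) P''" for n
    using partiso_restrict(2)[OF V, of "R n"] Rn unfolding RS by blast
  have eq: "eqv (R n) (R (Suc n))" for n
    using partiso_restrict(1)[OF V, of "R n"] Rn unfolding RS eqv_def by blast
  \<comment> \<open>P - P' is orthogonal to P', which contains all later terms; conjugation by V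
    carries this to every index.\<close>
  have o: "porth (R m) (R (m + Suc k))" for m k
  proof (induction m)
    case 0
    have "porth P' (R 0)" unfolding R0 by (rule porth_diff[OF le(3) v(2) le(2)])
    then have "porth (R 0) P'" using porth_sym le(3) Rn by blast
    moreover have "pleq (R (Suc k)) P'" using RS' le(1) pleq_trans by blast
    ultimately show ?case using porth_pleq2 by simp
  next
    case (Suc m)
    have "R (Suc m) (R (Suc m + Suc k) x) = V (R m (R (m + Suc k) (adj V x)))" for x
      by (simp only: add_Suc RS v(4) blinfun_apply_blinfun_compose pleqD[OF conjunct2[OF Rn]])
    then show ?case using porthD[OF Suc] by (simp add: porth_def)
  qed
  have "oseq R"
    unfolding oseq_def
  proof (intro conjI allI impI)
    show "R n \<in> projections M" for n using Rn by blast
    fix m n :: nat assume "m \<noteq> n"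
    then consider k where "n = m + Suc k" | k where "m = n + Suc k"
      by (metis less_imp_Suc_add nat_neq_iff add_Suc_right)
    then show "porth (R m) (R n)" by cases (use o porth_sym Rn in blast)+
  qed
  then show ?thesis using that R0 Rn eq by blast
qed

lemma eqv_all: "(\<And>n. eqv (R n) (R (Suc n))) \<Longrightarrow> R 0 \<in> projections M \<Longrightarrow> eqv (R 0) (R n)"
  by (induction n) (auto intro: eqv_refl eqv_trans)

text \<open>Composing the embeddings gives P'' \<le> P' \<le> P with P equivalent to P'' and Q to
  P'. Let S be the sum of the wandering projections that start from P - P'. Shifting S by one place
  and fixing P - S carries P onto P'.\<close>

lemma cantor_schroeder_bernstein:
  assumes PQ: "sle P Q" and QP: "sle Q P" shows "eqv P Q"
proof -
  obtain P' where P': "eqv Q P'" "pleq P' P" using QP by (auto simp: sle_def)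
  have pr: "P \<in> projections M" "Q \<in> projections M" "P' \<in> projections M"
    using PQ sle_projections P' eqv_projections by auto
  have "sle P P'" using PQ P'(1) sle_eqv sle_trans by blast
  then obtain P'' where P'': "eqv P P''" "pleq P'' P'" by (auto simp: sle_def)
  obtain V where V: "partiso V P P''" using P'' by (auto simp: eqv_def)
  obtain R where R: "oseq R" "R 0 = P - P'" "\<And>n. pleq (R n) P" "\<And>n. eqv (R n) (R (Suc n))"
    using shift_sequence[OF V P''(2) P'(2) pr(3)] by blast
  have o: "oseq (\<lambda>n. R (Suc n))" by (rule oseq_subseq[OF R(1)]) simp
  let ?S = "osum R" and ?S1 = "osum (\<lambda>n. R (Suc n))"
  note S = osum_projection[OF R(1)] and S1 = osum_projection[OF o]
  have SP: "pleq ?S P" by (rule S(4)[OF R(3)])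
  have e: "eqv ?S ?S1" by (rule eqv_osum[OF R(4) R(1) o])
  have d: "P - ?S \<in> projections M" "porth ?S (P - ?S)"
    using projection_diff[OF S(2) pr(1) SP] porth_diff[OF S(2) pr(1) SP] by auto
  have "pleq ?S1 ?S" by (rule S1(4)) (rule S(3))
  then have "porth ?S1 (P - ?S)" using porth_pleq[OF d(2)] S1(2) S(2) by blast
  then have "eqv (?S + (P - ?S)) (?S1 + (P - ?S))" using eqv_add[OF e eqv_refl[OF d(1)] d(2)] by blast
  moreover have "?S1 + (P - ?S) = P'" using osum_split_first(1)[OF R(1)] R(2) by simp
  ultimately have "eqv P P'" by simp
  then show ?thesis using P'(1) eqv_sym eqv_trans by blast
qed

text \<open>Injectivity on the range of Q makes Q the support of T Q, and the polar decomposition of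
  T Q gives the equivalence.\<close>

lemma injective_eqv:
  assumes Q: "Q \<in> projections M" and T: "T \<in> M"
    and inj: "\<And>x. Q x = x \<Longrightarrow> T x = 0 \<Longrightarrow> x = 0"
  shows "eqv Q (rproj (T o\<^sub>L Q))"
proof -
  let ?T = "T o\<^sub>L Q"
  have TM: "?T \<in> M" by (simp add: M_comp T projectionsD[OF Q])
  have le: "pleq (supp ?T) Q" by (rule supp(3)[OF TM Q]) (simp add: projectionsD(2)[OF Q])
  have "Q x = supp ?T x" for x
  proof -
    let ?y = "Q x - supp ?T x"
    have "Q ?y = ?y" using pleqD[OF le] by (simp add: blinfun.diff_right projectionsD(2)[OF Q])
    moreover have "T ?y = 0"
    proof -
      have "T (supp ?T x) = ?T (supp ?T x)" using pleqD[OF le] by simp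
      also have "\<dots> = ?T x" by (rule supp(2)[OF TM])
      finally show ?thesis by (simp add: blinfun.diff_right)
    qed
    ultimately have "?y = 0" using inj by blast
    then show ?thesis by simp
  qed
  then have "supp ?T = Q" by (intro blinfun_eqI) simp
  then show ?thesis using polar[OF TM] by simp
qed

subsection \<open>Finite and infinite projections\<close>

abbreviation inft :: "('a \<Rightarrow>\<^sub>L 'a) \<Rightarrow> bool" where "inft \<equiv> infinite_proj M"

lemma inft_iff: "inft P \<longleftrightarrow> (\<exists>Q. eqv P Q \<and> pleq Q P \<and> Q \<noteq> P)"
  unfolding infinite_proj_def finite_proj_def proj_le_pleq
  using eqv_mvn_equiv eqv_projections by blast

lemma inft_projection: "inft P \<Longrightarrow> P \<in> projections M" by (simp add: infinite_proj_def)

text \<open>A proper self-embedding of P extends by the identity on Q - P.\<close>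

lemma inft_pleq:
  assumes P: "inft P" and Q: "Q \<in> projections M" and le: "pleq P Q" shows "inft Q"
proof -
  obtain P' where P': "eqv P P'" "pleq P' P" "P' \<noteq> P" using P inft_iff by blast
  have pr: "P \<in> projections M" "P' \<in> projections M" using P'(1) eqv_projections by auto
  have d: "Q - P \<in> projections M" "porth P (Q - P)"
    using projection_diff[OF pr(1) Q le] porth_diff[OF pr(1) Q le] by auto
  have o: "porth P' (Q - P)" using porth_pleq[OF d(2) P'(2)] pr by blast
  have "eqv (P + (Q - P)) (P' + (Q - P))" by (rule eqv_add[OF P'(1) eqv_refl[OF d(1)] d(2) o])
  moreover have "pleq (P' + (Q - P)) Q"
    using P'(2) le pleq_trans pleq_diff[OF pr(1) Q le] by (intro pleq_add_least) blast+
  moreover have "P' + (Q - P) \<noteq> Q" using P'(3) by (simp add: algebra_simps)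
  ultimately show ?thesis using inft_iff by auto
qed

lemma inft_eqv:
  assumes P: "inft P" and e: "eqv P Q" shows "inft Q"
proof -
  obtain P' where P': "eqv P P'" "pleq P' P" "P' \<noteq> P" using P inft_iff by blast
  obtain V where V: "partiso V P Q" using e by (auto simp: eqv_def)
  have pr: "P' \<in> projections M" using P'(1) eqv_projections by auto
  let ?Q' = "V o\<^sub>L P' o\<^sub>L adj V"
  note r = partiso_restrict[OF V pr P'(2)]
  have "eqv P' ?Q'" using r(1) eqv_def by blast
  then have "eqv Q ?Q'" using e P'(1) eqv_trans eqv_sym by blast
  moreover have "?Q' \<noteq> Q"
  proof
    assume eq: "?Q' = Q"
    have "P' x = P x" for x
    proof -
      have "V (P' x) = V x" using r(3)[of x] partisoD(7)[OF V] eq by simp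
      then have "adj V (V (P' x)) = adj V (V x)" by simp
      then show ?thesis using pleqD[OF P'(2)] by (simp add: partisoD(4)[OF V])
    qed
    then have "P' = P" by (intro blinfun_eqI)
    then show False using P'(3) by simp
  qed
  ultimately show ?thesis using inft_iff r(2) by blast
qed

lemma inft_sle: "inft P \<Longrightarrow> sle P Q \<Longrightarrow> inft Q"
  unfolding sle_def using inft_eqv inft_pleq by blast

text \<open>The wandering projections of a proper self-embedding; the initial one is the nonzero
  defect.\<close>

lemma inft_sequence:
  assumes "inft P"
  obtains R where "oseq R" "\<And>n. pleq (R n) P" "\<And>n. eqv (R 0) (R n)" "R 0 \<noteq> 0"
proof -
  obtain P' where P': "eqv P P'" "pleq P' P" "P' \<noteq> P" using assms inft_iff by blast
  obtain V where V: "partiso V P P'" using P' by (auto simp: eqv_def)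
  have pr: "P' \<in> projections M" by (rule partisoD[OF V])
  obtain R where R: "oseq R" "R 0 = P - P'" "\<And>n. pleq (R n) P" "\<And>n. eqv (R n) (R (Suc n))"
    using shift_sequence[OF V pleq_refl[OF pr] P'(2) pr] by blast
  have "eqv (R 0) (R n)" for n by (rule eqv_all[where R = R]) (rule R(4), rule oseqD(1)[OF R(1)])
  then show ?thesis using that R P'(3) by auto
qed

text \<open>Shifting the sequence by one place embeds its sum properly into itself.\<close>

lemma sequence_inft:
  assumes R: "oseq R" "\<And>n. pleq (R n) P" "\<And>n. eqv (R 0) (R n)" "R 0 \<noteq> 0" and P: "P \<in> projections M"
  shows "inft P"
proof -
  have o: "oseq (\<lambda>n. R (Suc n))" by (rule oseq_subseq[OF R(1)]) simp
  note S = osum_projection[OF R(1)]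
  have "eqv (R n) (R (Suc n))" for n using R(3) eqv_sym eqv_trans by blast
  then have e: "eqv (osum R) (osum (\<lambda>n. R (Suc n)))" by (rule eqv_osum[OF _ R(1) o])
  have "pleq (osum (\<lambda>n. R (Suc n))) (osum R)" by (rule osum_projection(4)[OF o]) (rule S(3))
  moreover have "osum (\<lambda>n. R (Suc n)) \<noteq> osum R" using osum_split_first(1)[OF R(1)] R(4) by simp
  ultimately have "inft (osum R)" using inft_iff e by blast
  then show ?thesis using inft_pleq[OF _ P] S(4)[OF R(2)] by blast
qed

lemma inft_0: "\<not> inft 0"
proof
  assume "inft 0"
  then obtain R :: "nat \<Rightarrow> 'a \<Rightarrow>\<^sub>L 'a" where "oseq R" "\<And>n. pleq (R n) 0" "\<And>n. eqv (R 0) (R n)" "R 0 \<noteq> 0"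
    using inft_sequence[of 0 thesis] by blast
  then show False using pleq_0 by blast
qed

end

subsection \<open>Comparability in sigma-finite semifinite factors\<close>

lemma inner_all_zero: "(\<And>w. w \<bullet> v = 0) \<Longrightarrow> v = (0 :: 'a::real_inner)"
  using inner_eq_zero_iff by blast

locale sf_factor = vn_algebra +
  assumes trivial_center: "center M = range scalar_op"
    and sf: "sigma_finite M" and semi: "semifinite M" and inf_alg: "infinite_algebra M"
begin

text \<open>The center consists of scalars, and an idempotent scalar is 0 or 1.\<close>

lemma central_projection:
  assumes C: "C \<in> projections M" and comm: "\<And>T x. T \<in> M \<Longrightarrow> C (T x) = T (C x)"
  shows "C = 0 \<or> C = id_blinfun"
proof -
  have CM: "C \<in> M" using C by (rule projectionsD)
  have "C \<in> commutant M"
    unfolding commutant_def using comm M_bounded_ops[OF CM] by (auto intro!: blinfun_eqI)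
  then have "C \<in> center M" using CM by (simp add: center_def)
  then obtain c where c: "C = scalar_op c" using trivial_center by auto
  show ?thesis
  proof (cases "C = 0")
    case False
    then obtain x where x: "C x \<noteq> 0" by (metis blinfun_eqI zero_blinfun.rep_eq)
    have "c *\<^sub>C C x = C x" using projectionsD(2)[OF C, of x] c by (simp add: scalar_op.rep_eq)
    moreover have "(c - 1) *\<^sub>C y + y = c *\<^sub>C y" for y :: 'a
      by (metis diff_add_cancel scaleC_add_left scaleC_of_real scaleR_one of_real_1)
    ultimately have "(c - 1) *\<^sub>C C x = 0" by (metis add_cancel_left_left)
    then have "cmod (c - 1) * norm (C x) = 0" by (metis norm_scaleC norm_zero)
    then have "c = 1" using x by simp
    then have "C = id_blinfun"
      using c by (intro blinfun_eqI) (simp add: scalar_op.rep_eq, metis of_real_1 scaleC_of_real scaleR_one)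
    then show ?thesis by simp
  qed simp
qed

text \<open>If Q T P = 0 for all T in M, consider the orthogonal complement of the vectors T (P x).
  It is invariant under M and under the commutant, so its projection is central, hence 0 or 1. It
  contains the range of Q, and if it were everything, P would be orthogonal to itself.\<close>

lemma nonzero_connection:
  assumes P: "P \<in> projections M" "P \<noteq> 0" and Q: "Q \<in> projections M" "Q \<noteq> 0"
  shows "\<exists>T\<in>M. \<exists>x. Q (T (P x)) \<noteq> 0"
proof (rule ccontr)
  assume "\<not> (\<exists>T\<in>M. \<exists>x. Q (T (P x)) \<noteq> 0)"
  then have z: "Q (T (P x)) = 0" if "T \<in> M" for T x using that by blast
  let ?S = "{z. \<forall>T\<in>M. \<forall>x. T (P x) \<bullet> z = 0}"
  have S: "subspace ?S" by (auto simp: subspace_def inner_add_right)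
  have "?S = (\<Inter>T\<in>M. \<Inter>x. {z. blinfun_apply T (P x) \<bullet> z = 0})" by auto
  then have cl: "closed ?S" by (auto intro!: closed_INT closed_Collect_eq continuous_intros)
  have inv: "X z \<in> ?S" if X: "X \<in> commutant M" and z: "z \<in> ?S" for X z
  proof -
    have bo: "X \<in> bounded_ops" using X by (simp add: commutant_def)
    have "T (P x) \<bullet> X z = T (P (adj X x)) \<bullet> z" if "T \<in> M" for T x
      using commutantD[OF commutant_adj[OF X]] that P(1) by (simp add: adj_inner'[OF bo, symmetric] projectionsD(1))
    then show ?thesis using z by simp
  qed
  note C = proj_on_projection[OF S cl inv]
  let ?C = "proj_on ?S"
  have "?C (T x) = T (?C x)" if T: "T \<in> M" for T x
  proof (rule proj_on_commute[OF S cl, of _ "adj T"])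
    have bo: "T \<in> bounded_ops" using T by (rule M_bounded_ops)
    show "linear T" by (rule bounded_linear.linear[OF blinfun.bounded_linear_right])
    show "T x \<bullet> y = x \<bullet> adj T y" for x y by (rule adj_inner[OF bo])
    show "T z \<in> ?S" if "z \<in> ?S" for z
    proof -
      have "blinfun_apply R (P x) \<bullet> T z = 0" if "R \<in> M" for R x
      proof -
        have "adj T o\<^sub>L R \<in> M" using that T by (simp add: M_comp M_adj)
        then have "(adj T o\<^sub>L R) (P x) \<bullet> z = 0" using \<open>z \<in> ?S\<close> by blast
        then show ?thesis by (simp add: adj_inner'[OF bo])
      qed
      then show ?thesis by blast
    qed
    show "adj T z \<in> ?S" if "z \<in> ?S" for z
    proof -
      have "blinfun_apply R (P x) \<bullet> adj T z = 0" if "R \<in> M" for R x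
      proof -
        have "T o\<^sub>L R \<in> M" using that T by (simp add: M_comp)
        then have "(T o\<^sub>L R) (P x) \<bullet> z = 0" using \<open>z \<in> ?S\<close> by blast
        then show ?thesis by (simp add: adj_inner[OF bo])
      qed
      then show ?thesis by blast
    qed
  qed
  then consider "?C = 0" | "?C = id_blinfun" using central_projection[OF C(1)] by blast
  then show False
  proof cases
    case 1
    have "T (P x) \<bullet> Q z = 0" if "T \<in> M" for T x z
      using z[OF that] projectionsD(3)[OF Q(1)] by (metis inner_zero_left)
    then have "Q z \<in> ?S" for z by simp
    then have "Q z = 0" for z using C(2)[of "Q z"] 1 by simp
    then show False using Q(2) by (metis blinfun_eqI zero_blinfun.rep_eq)
  next
    case 2
    then have "P x \<in> ?S" for x using C(2)[of "P x"] by simp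
    then have "id_blinfun (P x) \<bullet> P x = 0" for x using M_id by blast
    then have "P x = 0" for x by simp
    then show False using P(2) by (metis blinfun_eqI zero_blinfun.rep_eq)
  qed
qed

text \<open>Polar decomposition of a nonzero Q T P: its support lies under P and its range
  projection under Q.\<close>

lemma nonzero_equivalent:
  assumes P: "P \<in> projections M" "P \<noteq> 0" and Q: "Q \<in> projections M" "Q \<noteq> 0"
  obtains P' Q' where "eqv P' Q'" "P' \<noteq> 0" "pleq P' P" "pleq Q' Q"
proof -
  obtain T x where T: "T \<in> M" "Q (T (P x)) \<noteq> 0" using nonzero_connection[OF assms] by blast
  let ?A = "Q o\<^sub>L (T o\<^sub>L P)"
  have A: "?A \<in> M" using P Q T by (simp add: M_comp projectionsD)
  have "pleq (supp ?A) P" by (rule supp(3)[OF A P(1)]) (simp add: projectionsD(2)[OF P(1)])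
  moreover have "pleq (rproj ?A) Q" by (rule rproj(3)[OF A Q(1)]) (simp add: projectionsD(2)[OF Q(1)])
  moreover have "supp ?A \<noteq> 0" using supp(4)[OF A, of x] T(2) by auto
  ultimately show ?thesis using that polar[OF A] by blast
qed

text \<open>Sigma-finiteness makes the maximal family countable.\<close>

lemma maximal_family:
  assumes \<Psi>: "\<And>P Q. \<Psi> P Q \<Longrightarrow> P \<in> projections M \<and> Q \<in> projections M \<and> P \<noteq> 0"
  shows "\<exists>P Q. oseq P \<and> oseq Q \<and> (\<forall>n. (P n = 0 \<and> Q n = 0) \<or> \<Psi> (P n) (Q n)) \<and>
    (\<forall>P' Q'. \<Psi> P' Q' \<longrightarrow> (\<forall>n. porth P' (P n)) \<longrightarrow> (\<forall>n. porth Q' (Q n)) \<longrightarrow> False)"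
proof -
  \<comment> \<open>Pairs are compared componentwise, so one construction serves two parallel
    families and, with equal components, a single family.\<close>
  define ok where "ok p q \<longleftrightarrow> porth (fst p) (fst q) \<and> porth (snd p) (snd q)" for p q :: "('a \<Rightarrow>\<^sub>L 'a) \<times> ('a \<Rightarrow>\<^sub>L 'a)"
  define \<F> where "\<F> = {F. (\<forall>p\<in>F. \<Psi> (fst p) (snd p)) \<and> pairwise ok F}"
  have "\<exists>F\<in>\<F>. \<forall>X\<in>\<F>. F \<subseteq> X \<longrightarrow> X = F"
  proof (rule subset_Zorn')
    fix \<C> assume c: "subset.chain \<F> \<C>"
    show "\<Union>\<C> \<in> \<F>"
      unfolding \<F>_def mem_Collect_eq pairwise_def
    proof (intro conjI ballI impI)
      fix p assume "p \<in> \<Union>\<C>"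
      then show "\<Psi> (fst p) (snd p)" using c by (auto simp: subset_chain_def \<F>_def)
    next
      fix p q assume pq: "p \<in> \<Union>\<C>" "q \<in> \<Union>\<C>" "p \<noteq> q"
      then obtain F where "F \<in> \<C>" "p \<in> F" "q \<in> F"
      proof -
        obtain F1 F2 where F12: "F1 \<in> \<C>" "p \<in> F1" "F2 \<in> \<C>" "q \<in> F2" using pq by blast
        then have "F1 \<subseteq> F2 \<or> F2 \<subseteq> F1" using c unfolding subset_chain_def by blast
        then show ?thesis using that F12 by blast
      qed
      then show "ok p q" using c pq(3) by (auto simp: subset_chain_def \<F>_def pairwise_def)
    qed
  qed
  then obtain F where F: "F \<in> \<F>" and max: "\<And>X. X \<in> \<F> \<Longrightarrow> F \<subseteq> X \<Longrightarrow> X = F" by blast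
  have F1: "\<Psi> (fst p) (snd p)" if "p \<in> F" for p using F that by (auto simp: \<F>_def)
  have F2: "ok p q" if "p \<in> F" "q \<in> F" "p \<noteq> q" for p q using F that by (auto simp: \<F>_def pairwise_def)
  \<comment> \<open>Distinct pairs have orthogonal nonzero, hence distinct, first components;
    countability of these carries over to the pairs.\<close>
  have inj: "inj_on fst F"
  proof (rule inj_onI)
    fix p q assume "p \<in> F" "q \<in> F" "fst p = fst q"
    then show "p = q" using F2[of p q] F1[of p] \<Psi> porth_self unfolding ok_def by metis
  qed
  have "countable (fst ` F)"
  proof -
    have "fst ` F \<subseteq> projections M - {0}" using F1 \<Psi> by fastforce
    moreover have "pairwise (\<lambda>P Q. P o\<^sub>L Q = 0) (fst ` F)"
    proof (rule pairwiseI)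
      fix P Q assume "P \<in> fst ` F" "Q \<in> fst ` F" "P \<noteq> Q"
      then have "porth P Q" using F2 unfolding ok_def by blast
      then show "P o\<^sub>L Q = 0" by (intro blinfun_eqI) (simp add: porth_def)
    qed
    ultimately show ?thesis using sf unfolding sigma_finite_def by blast
  qed
  then have cF: "countable F" using inj countable_image_inj_on by blast
  \<comment> \<open>Enumeration by all naturals. Indices that code no member give the zero pair,
    which is why the conclusion allows zero terms.\<close>
  define g where "g n = (if n \<in> to_nat_on F ` F then from_nat_into F n else (0, 0))" for n
  have g_in: "g (to_nat_on F p) = p" if "p \<in> F" for p using cF that by (simp add: g_def)
  have g: "g n = (0, 0) \<or> g n \<in> F" for n using cF by (auto simp: g_def)
  have g_inj: "m = n" if "g m = g n" "g m \<in> F" "m \<in> to_nat_on F ` F" "n \<in> to_nat_on F ` F" for m n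
    using that cF by (auto simp: g_def)
  have \<Psi>0: "\<not> \<Psi> 0 Q" for Q using \<Psi> by blast
  have zF: "(0, 0) \<notin> F" using F1 \<Psi>0 by fastforce
  have gn: "g n \<in> F \<longleftrightarrow> n \<in> to_nat_on F ` F" for n using cF zF by (auto simp: g_def)
  have ok_g: "ok (g m) (g n)" if "m \<noteq> n" for m n
  proof (cases "g m \<in> F \<and> g n \<in> F")
    case True
    then show ?thesis using F2 g_inj gn that by metis
  next
    case False
    then have "g m = (0, 0) \<or> g n = (0, 0)" using g by blast
    then show ?thesis by (auto simp: ok_def porth_0)
  qed
  have proj: "fst (g n) \<in> projections M" "snd (g n) \<in> projections M" for n
    using g[of n] F1[of "g n"] \<Psi> projection_0 by auto
  show ?thesis
  proof (rule exI[of _ "\<lambda>n. fst (g n)"], rule exI[of _ "\<lambda>n. snd (g n)"], intro conjI allI impI)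
    show "oseq (\<lambda>n. fst (g n))" "oseq (\<lambda>n. snd (g n))"
      using proj ok_g by (auto simp: oseq_def ok_def)
    show "(fst (g n) = 0 \<and> snd (g n) = 0) \<or> \<Psi> (fst (g n)) (snd (g n))" for n
      using g[of n] F1[of "g n"] by auto
    fix P' Q' assume h: "\<Psi> P' Q'" "\<forall>n. porth P' (fst (g n))" "\<forall>n. porth Q' (snd (g n))"
    have o: "ok (P', Q') q" "ok q (P', Q')" if "q \<in> F" for q
    proof -
      have "porth P' (fst q)" "porth Q' (snd q)" using spec[OF h(2), of "to_nat_on F q"] spec[OF h(3), of "to_nat_on F q"] g_in[OF that] by auto
      then show "ok (P', Q') q" "ok q (P', Q')"
        using porth_sym \<Psi>[OF h(1)] \<Psi>[OF F1[OF that]] by (auto simp: ok_def)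
    qed
    have "insert (P', Q') F \<in> \<F>"
      unfolding \<F>_def using h(1) F1 F2 o by (auto simp: pairwise_insert pairwise_def)
    then have "(P', Q') \<in> F" using max by blast
    then have "porth P' P'" using spec[OF h(2), of "to_nat_on F (P', Q')"] g_in by simp
    then show False using porth_self[of P'] \<Psi>[OF h(1)] by blast
  qed
qed

text \<open>Take a maximal family of equivalent pairs, orthogonal under P and under Q. Were both
  remainders nonzero, they would have equivalent nonzero subprojections, contradicting maximality;
  so one side is exhausted.\<close>

theorem comparability:
  assumes P: "P \<in> projections M" and Q: "Q \<in> projections M"
  shows "sle P Q \<or> sle Q P"
proof -
  define \<Psi> where "\<Psi> P' Q' \<longleftrightarrow> eqv P' Q' \<and> P' \<noteq> 0 \<and> pleq P' P \<and> pleq Q' Q" for P' Q'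
  have prem: "P1 \<in> projections M \<and> Q1 \<in> projections M \<and> P1 \<noteq> 0" if "\<Psi> P1 Q1" for P1 Q1
    using that eqv_projections sle_projections unfolding \<Psi>_def by blast
  obtain S T where S: "oseq S" and T: "oseq T"
    and ST': "\<forall>n. (S n = 0 \<and> T n = 0) \<or> \<Psi> (S n) (T n)"
    and max': "\<forall>P' Q'. \<Psi> P' Q' \<longrightarrow> (\<forall>n. porth P' (S n)) \<longrightarrow> (\<forall>n. porth Q' (T n)) \<longrightarrow> False"
    using maximal_family[of \<Psi>, OF prem] by blast
  note ST = spec[OF ST', unfolded \<Psi>_def] and max = max'[rule_format, unfolded \<Psi>_def]
  note s = osum_projection[OF S] and t = osum_projection[OF T]
  have e: "eqv (osum S) (osum T)"
    by (rule eqv_osum[OF _ S T]) (metis ST eqv_00)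
  have SP: "pleq (osum S) P" by (rule s(4)) (metis ST zero_pleq)
  have TQ: "pleq (osum T) Q" by (rule t(4)) (metis ST zero_pleq)
  have "P - osum S = 0 \<or> Q - osum T = 0"
  proof (rule ccontr)
    assume nz: "\<not> ?thesis"
    have dP: "P - osum S \<in> projections M" "porth (osum S) (P - osum S)" "pleq (P - osum S) P"
      using projection_diff porth_diff pleq_diff s(2) P SP by auto
    have dQ: "Q - osum T \<in> projections M" "porth (osum T) (Q - osum T)" "pleq (Q - osum T) Q"
      using projection_diff porth_diff pleq_diff t(2) Q TQ by auto
    obtain P' Q' where PQ': "eqv P' Q'" "P' \<noteq> 0" "pleq P' (P - osum S)" "pleq Q' (Q - osum T)"
      using nonzero_equivalent[OF dP(1) _ dQ(1)] nz by blast
    have pr: "P' \<in> projections M" "Q' \<in> projections M" using eqv_projections PQ'(1) by auto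
    have "porth P' (S n)" for n
      by (metis PQ'(3) dP(1,2) porth_pleq porth_pleq2 porth_sym pr(1) s(2,3))
    moreover have "porth Q' (T n)" for n
      by (metis PQ'(4) dQ(1,2) porth_pleq porth_pleq2 porth_sym pr(2) t(2,3))
    ultimately show False using max[of P' Q'] PQ' dP(3) dQ(3) pleq_trans by blast
  qed
  then show ?thesis
  proof
    assume "P - osum S = 0"
    then have "P = osum S" by simp
    then show ?thesis using e TQ Q by (auto simp: sle_def)
  next
    assume "Q - osum T = 0"
    then have "Q = osum T" by simp
    then show ?thesis using eqv_sym[OF e] SP P by (auto simp: sle_def)
  qed
qed

text \<open>Division with remainder: take a maximal orthogonal family of copies of R under S. The
  remainder contains no further copy of R, so by comparability it is subequivalent to R.\<close>

lemma exhaust_by_copies: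
  assumes R: "R \<in> projections M" "R \<noteq> 0" and S: "S \<in> projections M"
  obtains T rest where "oseq T" "\<And>n. T n = 0 \<or> eqv (T n) R" "rest \<in> projections M" "sle rest R"
    "porth rest (osum T)" "S = rest + osum T"
proof -
  define \<Psi> where "\<Psi> P Q \<longleftrightarrow> P = Q \<and> P \<noteq> 0 \<and> eqv P R \<and> pleq P S" for P Q
  have prem: "P1 \<in> projections M \<and> Q1 \<in> projections M \<and> P1 \<noteq> 0" if "\<Psi> P1 Q1" for P1 Q1
    using that eqv_projections sle_projections unfolding \<Psi>_def by blast
  obtain T T' where T: "oseq T" "oseq T'"
    and TT': "\<forall>n. (T n = 0 \<and> T' n = 0) \<or> \<Psi> (T n) (T' n)"
    and max': "\<forall>P' Q'. \<Psi> P' Q' \<longrightarrow> (\<forall>n. porth P' (T n)) \<longrightarrow> (\<forall>n. porth Q' (T' n)) \<longrightarrow> False"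
    using maximal_family[of \<Psi>, OF prem] by blast
  note TT = spec[OF TT', unfolded \<Psi>_def] and max = max'[rule_format, unfolded \<Psi>_def]
  have T'T: "T' n = T n" for n using TT[of n] by auto
  note t = osum_projection[OF T(1)]
  have le: "pleq (osum T) S" by (rule t(4)) (metis TT zero_pleq)
  let ?r = "S - osum T"
  have r: "?r \<in> projections M" "porth (osum T) ?r" "pleq ?r S"
    using projection_diff porth_diff pleq_diff t(2) S le by auto
  have "sle ?r R"
  proof (rule ccontr)
    assume "\<not> sle ?r R"
    then have "sle R ?r" using comparability[OF R(1) r(1)] by blast
    then obtain R' where R': "eqv R R'" "pleq R' ?r" by (auto simp: sle_def)
    have pr: "R' \<in> projections M" using R' eqv_projections by blast
    have "porth R' (T n)" for n by (metis R'(2) r(1,2) porth_pleq porth_pleq2 porth_sym pr t(2,3))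
    moreover have "R' \<noteq> 0" using R(2) eqv_0[OF R'(1)] by blast
    ultimately show False
      using max[of R' R'] R' eqv_sym pleq_trans r(3) T'T by metis
  qed
  moreover have "porth ?r (osum T)" using porth_sym r t(2) by blast
  ultimately show ?thesis using that[of T ?r] T(1) TT r(1) by auto
qed

text \<open>P contains infinitely many copies of some nonzero R 0, and any S consists of countably
  many copies of R 0 and a remainder subequivalent to it. Countability, from sigma-finiteness, is
  what lets S fit.\<close>

lemma inft_absorbs:
  assumes P: "inft P" and S: "S \<in> projections M" shows "sle S P"
proof -
  obtain R where R: "oseq R" "\<And>n. pleq (R n) P" "\<And>n. eqv (R 0) (R n)" "R 0 \<noteq> 0"
    using inft_sequence[OF P] by blast
  obtain T rest where T: "oseq T" "\<And>n. T n = 0 \<or> eqv (T n) (R 0)" "rest \<in> projections M" "sle rest (R 0)"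
    "porth rest (osum T)" "S = rest + osum T"
    using exhaust_by_copies[OF oseqD(1)[OF R(1)] R(4) S] by blast
  \<comment> \<open>\<open>R 0\<close> is reserved for the remainder; the copies go into the later
    terms.\<close>
  have o: "oseq (\<lambda>n. R (Suc n))" by (rule oseq_subseq[OF R(1)]) simp
  have "sle (T n) (R (Suc n))" for n
  proof (cases "T n = 0")
    case True
    then show ?thesis using sle_pleq[OF projection_0 oseqD(1)[OF R(1)] zero_pleq] by simp
  next
    case False
    then show ?thesis using T(2)[of n] R(3)[of "Suc n"] eqv_trans sle_eqv by blast
  qed
  then have "sle (osum T) (osum (\<lambda>n. R (Suc n)))" by (rule sle_osum[OF _ T(1) o])
  then have "sle S (osum R)"
    unfolding T(6) osum_split_first(1)[OF R(1)] using sle_add[OF T(4) _ T(5) osum_split_first(2)[OF R(1)]] by blast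
  moreover have "sle (osum R) P"
    using osum_projection[OF R(1)] R(2) inft_projection[OF P] sle_pleq by blast
  ultimately show ?thesis by (rule sle_trans)
qed

text \<open>Each absorbs the other. All infinite projections thus form a single equivalence class,
  which lets pieces be matched without any computation of dimension.\<close>

lemma inft_eqv_inft: "inft P \<Longrightarrow> inft Q \<Longrightarrow> eqv P Q"
  using cantor_schroeder_bernstein inft_absorbs inft_projection by blast

section \<open>Splitting infinite projections\<close>

lemma oseq_increments:
  assumes S: "\<And>n. S n \<in> projections M" and R: "\<And>n. R n \<in> projections M"
    and step: "\<And>n. S (Suc n) = S n + R n" "\<And>n. porth (S n) (R n)"
  shows "oseq R" "m \<le> n \<Longrightarrow> pleq (S m) (S n)" "pleq (R n) (S (Suc n))"
proof -
  show mono: "pleq (S m) (S n)" if "m \<le> n" for m n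
    using that
  proof (induction rule: dec_induct)
    case base then show ?case using pleq_refl S by blast
  next
    case (step k)
    have "pleq (S k) (S (Suc k))"
      unfolding assms(3) by (rule pleq_add1[OF S R assms(4)])
    then show ?case using step pleq_trans by blast
  qed
  show Rle: "pleq (R n) (S (Suc n))" for n unfolding step by (rule pleq_add2[OF S R step(2)])
  have o1: "porth (R m) (R n)" if "m < n" for m n
  proof -
    have "pleq (R m) (S n)" using Rle[of m] mono[of "Suc m" n] that pleq_trans by simp
    then show ?thesis using porth_pleq[OF step(2)] R S by blast
  qed
  show "oseq R"
    unfolding oseq_def using R o1 porth_sym by (metis nat_neq_iff)
qed

text \<open>Cantor pairing regroups one orthogonal sequence into infinitely many infinite ones with
  the same total sum.\<close>

lemma oseq_blocks:
  assumes R: "oseq R"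
  shows "oseq (\<lambda>k. R (prod_encode (i, k)))" "oseq (\<lambda>i. osum (\<lambda>k. R (prod_encode (i, k))))"
    "osum (\<lambda>i. osum (\<lambda>k. R (prod_encode (i, k)))) = osum R"
proof -
  have inj: "inj (\<lambda>k. prod_encode (i, k))" for i by (auto intro: injI)
  show oi: "oseq (\<lambda>k. R (prod_encode (i, k)))" for i using oseq_subseq[OF R inj] .
  define D where "D i = osum (\<lambda>k. R (prod_encode (i, k)))" for i
  have Dp: "D i \<in> projections M" for i unfolding D_def by (rule osum_projection(2)[OF oi])
  have RD: "pleq (R (prod_encode (i, k))) (D i)" for i k unfolding D_def by (rule osum_projection(3)[OF oi])
  have Do: "oseq D"
    unfolding oseq_def
  proof (intro conjI allI impI Dp)
    fix i j :: nat assume ij: "i \<noteq> j"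
    have "porth (R (prod_encode (i, k))) (D j)" for k
      unfolding D_def by (rule osum_projection(5)[OF oi]) (rule oseqD(2)[OF R], use ij in simp)
    then have "porth (D j) (R (prod_encode (i, k)))" for k using porth_sym Dp oseqD(1)[OF R] by blast
    then have "porth (D j) (D i)" unfolding D_def[of i] by (rule osum_projection(5)[OF oi])
    then show "porth (D i) (D j)" using porth_sym Dp by blast
  qed
  then show "oseq (\<lambda>i. osum (\<lambda>k. R (prod_encode (i, k))))" unfolding D_def[abs_def] .
  have "pleq (D i) (osum R)" for i unfolding D_def by (rule osum_projection(4)[OF oi]) (rule osum_projection(3)[OF R])
  then have 1: "pleq (osum D) (osum R)" by (rule osum_projection(4)[OF Do])
  have "pleq (R n) (osum D)" for n
  proof -
    obtain i k where "n = prod_encode (i, k)" by (metis prod_decode_inverse surj_pair)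
    then show ?thesis using RD[of i k] osum_projection(3)[OF Do, of i] pleq_trans by blast
  qed
  then have 2: "pleq (osum R) (osum D)" by (rule osum_projection(4)[OF R])
  have "osum D = osum R" using pleq_antisym[OF 1 2] osum_projection(2) Do R by blast
  then show "osum (\<lambda>i. osum (\<lambda>k. R (prod_encode (i, k)))) = osum R" unfolding D_def[abs_def] .
qed

lemma inft_blocks:
  assumes R: "oseq R" "\<And>n. eqv (R 0) (R n)" "R 0 \<noteq> 0"
  shows "inft (osum (\<lambda>k. R (prod_encode (i, k))))"
proof (rule sequence_inft[OF oseq_blocks(1)[OF R(1)]])
  note o = oseq_blocks(1)[OF R(1)]
  show "pleq (R (prod_encode (i, n))) (osum (\<lambda>k. R (prod_encode (i, k))))" for n by (rule osum_projection(3)[OF o])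
  show "eqv (R (prod_encode (i, 0))) (R (prod_encode (i, n)))" for n using R(2) eqv_sym eqv_trans by blast
  show "R (prod_encode (i, 0)) \<noteq> 0" using R(2,3) eqv_0 by blast
  show "osum (\<lambda>k. R (prod_encode (i, k))) \<in> projections M" by (rule osum_projection(2)[OF o])
qed

lemma inft_split_sequence:
  assumes P: "inft P"
  obtains E where "oseq E" "\<And>n. inft (E n)" "osum E = P"
proof -
  obtain R where R: "oseq R" "\<And>n. pleq (R n) P" "\<And>n. eqv (R 0) (R n)" "R 0 \<noteq> 0"
    using inft_sequence[OF P] by blast
  define D where "D i = osum (\<lambda>k. R (prod_encode (i, k)))" for i
  have Do: "oseq D" using oseq_blocks(2)[OF R(1)] unfolding D_def[abs_def] .
  have Dp: "D i \<in> projections M" for i using Do by (rule oseqD)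
  have Dinf: "inft (D i)" for i unfolding D_def by (rule inft_blocks[OF R(1,3,4)])
  have DP: "pleq (D i) P" for i unfolding D_def by (rule osum_projection(4)[OF oseq_blocks(1)[OF R(1)]]) (rule R(2))
  have oS: "oseq (\<lambda>n. D (Suc n))" by (rule oseq_subseq[OF Do]) simp
  note dS = osum_projection[OF oS]
  have SP: "pleq (osum (\<lambda>n. D (Suc n))) P" by (rule dS(4)) (rule DP)
  \<comment> \<open>Whatever P has outside the blocks goes into E 0 together with D 0, so that the E
    n sum to P exactly.\<close>
  define E where "E n = (if n = 0 then P - osum (\<lambda>n. D (Suc n)) else D n)" for n
  have PM: "P \<in> projections M" using P by (rule inft_projection)
  have E0: "E 0 \<in> projections M" "porth (osum (\<lambda>n. D (Suc n))) (E 0)"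
    using projection_diff[OF dS(2) PM SP] porth_diff[OF dS(2) PM SP] by (simp_all add: E_def)
  have o0: "porth (E 0) (D (Suc n))" for n using porth_sym[OF E0(2)] E0(1) dS(2,3) porth_pleq2 by blast
  have Eo: "oseq E"
    unfolding oseq_def
  proof (intro conjI allI impI)
    show "E n \<in> projections M" for n using E0(1) Dp by (cases "n = 0") (simp_all add: E_def)
    fix m n :: nat assume mn: "m \<noteq> n"
    have ES: "E (Suc k) = D (Suc k)" for k by (simp add: E_def)
    show "porth (E m) (E n)"
      using mn o0 porth_sym[OF o0 E0(1) Dp] oseqD(2)[OF Do] by (cases m; cases n) (auto simp: ES)
  qed
  have "osum E = E 0 + osum (\<lambda>n. E (Suc n))" by (rule osum_split_first(1)[OF Eo])
  also have "\<dots> = P" by (simp add: E_def)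
  finally have "osum E = P" .
  moreover have "inft (E n)" for n
  proof (cases "n = 0")
    case True
    have "pleq (D 0) (E 0)"
    proof -
      have "porth (D 0) (osum (\<lambda>n. D (Suc n)))" by (rule osum_split_first(2)[OF Do])
      then have "porth (osum (\<lambda>n. D (Suc n))) (D 0)" using porth_sym Dp dS(2) by blast
      then show ?thesis using DP[of 0] by (simp add: E_def pleq_def porth_def blinfun.diff_left)
    qed
    then show ?thesis using True inft_pleq[OF Dinf E0(1)] by simp
  qed (simp add: E_def Dinf)
  ultimately show ?thesis using that Eo by blast
qed

lemma inft_halve:
  assumes P: "inft P"
  obtains P1 P2 where "inft P1" "inft P2" "porth P1 P2" "P = P1 + P2"
proof -
  obtain E where E: "oseq E" "\<And>n. inft (E n)" "osum E = P" using inft_split_sequence[OF P] by blast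
  have oS: "oseq (\<lambda>n. E (Suc n))" by (rule oseq_subseq[OF E(1)]) simp
  have "inft (osum (\<lambda>n. E (Suc n)))"
    using inft_pleq[OF E(2)] osum_projection(2,3)[OF oS] by blast
  then show ?thesis using that[of "E 0" "osum (\<lambda>n. E (Suc n))"] osum_split_first[OF E(1)] E(2,3) by metis
qed

text \<open>Split G1 into I, the meet of E and G1, and G1 - I. On G1 - I the operator 1 - E is
  injective and agrees with F, and its range avoids J, the meet of F and G2, because J lies under G2
  and G2 is orthogonal to G1. So G1 - I fits into F - J, and I fits into J by assumption.\<close>

lemma half_in_summand:
  assumes E: "E \<in> projections M" and F: "F \<in> projections M" and EF: "porth E F"
    and G: "G1 \<in> projections M" "G2 \<in> projections M" "porth G1 G2" "pleq G1 (E + F)"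
    and c: "sle (pinf E G1) (pinf F G2)"
  shows "sle G1 F"
proof -
  let ?I = "pinf E G1" and ?J = "pinf F G2"
  note I = pinf[OF E G(1)] and J = pinf[OF F G(2)]
  have IG: "pleq ?I G1" by (rule pleqI[OF I(1)]) (use I(2) in blast)
  have JF: "pleq ?J F" by (rule pleqI[OF J(1)]) (use J(2) in blast)
  have D: "G1 - ?I \<in> projections M" "porth ?I (G1 - ?I)"
    using projection_diff[OF I(1) G(1) IG] porth_diff[OF I(1) G(1) IG] by auto
  let ?T = "id_blinfun - E"
  have TM: "?T \<in> M" using projection_compl[OF E] by (rule projectionsD)
  have "eqv (G1 - ?I) (rproj (?T o\<^sub>L (G1 - ?I)))"
  proof (rule injective_eqv[OF D(1) TM])
    fix x assume x: "(G1 - ?I) x = x" "?T x = 0"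
    have Ix: "?I x = 0" using porthD[OF D(2), of x] x(1) by simp
    then have "G1 x = x" using x(1) by (simp add: blinfun.diff_left)
    moreover have "E x = x" using x(2) by (simp add: blinfun.diff_left)
    ultimately show "x = 0" using I(2)[of x] Ix by simp
  qed
  moreover
  let ?K = "rproj (?T o\<^sub>L (G1 - ?I))"
  have KM: "?T o\<^sub>L (G1 - ?I) \<in> M" using TM D(1) by (simp add: M_comp projectionsD)
  have DG: "G1 ((G1 - ?I) x) = (G1 - ?I) x" for x
    using pleqD[OF pleq_diff[OF I(1) G(1) IG]] .
  have FJ: "F - ?J \<in> projections M" using projection_diff[OF J(1) F JF] .
  have "pleq ?K (F - ?J)"
  proof (rule rproj(3)[OF KM FJ])
    fix x
    let ?z = "(G1 - ?I) x"
    have "(E + F) ?z = ?z" using pleqD[OF G(4), of ?z] DG by simp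
    then have TF: "?T ?z = F ?z" by (simp add: blinfun.diff_left blinfun.add_left algebra_simps)
    have "w \<bullet> ?J (F ?z) = 0" for w
    proof -
      have "w \<bullet> ?J (F ?z) = F (?J w) \<bullet> ?z" using projectionsD(3)[OF J(1)] projectionsD(3)[OF F] by simp
      also have "\<dots> = ?J w \<bullet> G1 ?z" using pleqD[OF JF] DG by simp
      also have "\<dots> = G1 (?J w) \<bullet> ?z" using projectionsD(3)[OF G(1)] by simp
      also have "?J w = G2 (?J w)" using J(2)[of "?J w"] projectionsD(2)[OF J(1)] by simp
      finally show ?thesis using porthD[OF G(3)] by simp
    qed
    then have "?J (F ?z) = 0" by (rule inner_all_zero)
    then show "(F - ?J) ((?T o\<^sub>L (G1 - ?I)) x) = (?T o\<^sub>L (G1 - ?I)) x"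
      by (simp only: blinfun_apply_blinfun_compose TF) (simp add: blinfun.diff_left projectionsD(2)[OF F])
  qed
  ultimately have s1: "sle (G1 - ?I) (F - ?J)" unfolding sle_def using FJ by blast
  have "sle (?I + (G1 - ?I)) (?J + (F - ?J))"
    using sle_add[OF c s1 D(2)] porth_diff[OF J(1) F JF] by blast
  then show ?thesis by simp
qed

text \<open>An infinite E + F could be halved into infinite G1 and G2. Comparing the meet of E and
  G1 with that of F and G2 puts G1 into F or G2 into E, which are finite.\<close>

lemma finite_add:
  assumes E: "E \<in> projections M" "\<not> inft E" and F: "F \<in> projections M" "\<not> inft F" and EF: "porth E F"
  shows "\<not> inft (E + F)"
proof
  assume "inft (E + F)"
  then obtain G1 G2 where G: "inft G1" "inft G2" "porth G1 G2" "E + F = G1 + G2"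
    using inft_halve by blast
  have pr: "G1 \<in> projections M" "G2 \<in> projections M" using G inft_projection by auto
  have le: "pleq G1 (E + F)" "pleq G2 (F + E)"
    using pleq_add1[OF pr G(3)] pleq_add2[OF pr G(3)] G(4) by (auto simp: add.commute)
  have o: "porth F E" "porth G2 G1" using porth_sym EF E(1) F(1) G(3) pr by auto
  from comparability[OF pinf(1)[OF E(1) pr(1)] pinf(1)[OF F(1) pr(2)]] show False
  proof
    assume "sle (pinf E G1) (pinf F G2)"
    then have "sle G1 F" by (rule half_in_summand[OF E(1) F(1) EF pr G(3) le(1)])
    then show False using inft_sle G(1) F(2) by blast
  next
    assume "sle (pinf F G2) (pinf E G1)"
    then have "sle G2 E" by (rule half_in_summand[OF F(1) E(1) o(1) pr(2,1) o(2) le(2)])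
    then show False using inft_sle G(2) E(2) by blast
  qed
qed

text \<open>T is injective on the part of K outside the meet and maps it into the finite Q. If the
  meet were finite as well, K would be a sum of two finite projections.\<close>

lemma inft_inf_kernel:
  assumes K: "inft K" and T: "T \<in> M" and Q: "Q \<in> projections M" "\<not> inft Q" and QT: "\<And>x. Q (T x) = T x"
  shows "inft (pinf K (null_proj T))"
proof (rule ccontr)
  assume fin: "\<not> inft (pinf K (null_proj T))"
  have KM: "K \<in> projections M" using K by (rule inft_projection)
  note N = null_proj_M[OF T]
  note I = pinf[OF KM N(1)]
  let ?I = "pinf K (null_proj T)"
  have IK: "pleq ?I K" by (rule pleqI[OF I(1)]) (use I(2) in blast)
  have D: "K - ?I \<in> projections M" "porth ?I (K - ?I)"
    using projection_diff[OF I(1) KM IK] porth_diff[OF I(1) KM IK] by auto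
  have "eqv (K - ?I) (rproj (T o\<^sub>L (K - ?I)))"
  proof (rule injective_eqv[OF D(1) T])
    fix x assume x: "(K - ?I) x = x" "T x = 0"
    have Ix: "?I x = 0" using porthD[OF D(2), of x] x(1) by simp
    then have "K x = x" using x(1) by (simp add: blinfun.diff_left)
    then show "x = 0" using I(2)[of x] Ix N(2)[of x] x(2) by simp
  qed
  moreover have "pleq (rproj (T o\<^sub>L (K - ?I))) Q"
    by (rule rproj(3)[OF _ Q(1)]) (use T D(1) QT in \<open>auto simp: M_comp projectionsD(1)\<close>)
  ultimately have "sle (K - ?I) Q" unfolding sle_def using Q(1) by blast
  then have "\<not> inft (K - ?I)" using inft_sle Q(2) by blast
  then have "\<not> inft (?I + (K - ?I))" using finite_add[OF I(1) fin D(1) _ D(2)] by blast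
  then show False using K by simp
qed

lemma inft_inf_compl:
  assumes K: "inft K" and P: "P \<in> projections M" "\<not> inft P"
  shows "inft (pinf K (id_blinfun - P))"
proof -
  have "null_proj P = id_blinfun - P"
  proof (rule projection_eqI[OF null_proj_M(1) projection_compl])
    show "null_proj P x = x \<longleftrightarrow> (id_blinfun - P) x = x" for x
      by (simp add: null_proj_M(2) projectionsD(1)[OF P(1)] blinfun.diff_left)
  qed (use P projectionsD in auto)
  then show ?thesis using inft_inf_kernel[OF K projectionsD(1)[OF P(1)] P projectionsD(2)[OF P(1)]] by simp
qed

text \<open>If S fits into no partial sum, comparability always leaves room in S for the next F n
  beside the previous ones. The whole infinite sum would then embed into the finite S.\<close>

lemma sequence_exceeds_finite:
  assumes F: "oseq F" "inft (osum F)" and S: "S \<in> projections M" "\<not> inft S"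
  shows "\<exists>n. sle S (\<Sum>k<n. F k)"
proof (rule ccontr)
  assume "\<not> ?thesis"
  then have no: "\<not> sle S (\<Sum>k<n. F k)" for n by blast
  \<comment> \<open>The first component is the copy inside S of the first n terms; for n > 0 the
    second is the piece added last, a copy of F (n-1).\<close>
  define good where "good n xs \<longleftrightarrow> fst xs \<in> projections M \<and> pleq (fst xs) S \<and> eqv (\<Sum>k<n. F k) (fst xs)
     \<and> (n > 0 \<longrightarrow> (\<exists>T. fst xs = T + snd xs \<and> porth T (snd xs) \<and> eqv (F (n - 1)) (snd xs)))" for n and xs :: "('a \<Rightarrow>\<^sub>L 'a) \<times> ('a \<Rightarrow>\<^sub>L 'a)"
  have "\<exists>f. \<forall>n. good n (f n) \<and> fst (f (Suc n)) = fst (f n) + snd (f (Suc n)) \<and> porth (fst (f n)) (snd (f (Suc n)))"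
  proof (rule dependent_nat_choice)
    show "\<exists>x. good 0 x" by (rule exI[of _ "(0, 0)"]) (simp add: good_def projection_0 zero_pleq eqv_00)
    fix x n assume g: "good n x"
    let ?T = "fst x"
    have T: "?T \<in> projections M" "pleq ?T S" "eqv (\<Sum>k<n. F k) ?T" using g by (auto simp: good_def)
    have D: "S - ?T \<in> projections M" "porth ?T (S - ?T)" "pleq (S - ?T) S"
      using projection_diff[OF T(1) S(1) T(2)] porth_diff[OF T(1) S(1) T(2)] pleq_diff[OF T(1) S(1) T(2)] by auto
    have oF: "porth (\<Sum>k<n. F k) (F n)"
      unfolding porth_def blinfun.sum_left using porthD[OF oseqD(2)[OF F(1)]] by simp
    have "sle (F n) (S - ?T)"
    proof (rule ccontr)
      assume "\<not> sle (F n) (S - ?T)"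
      then have "sle (S - ?T) (F n)" using comparability[OF oseqD(1)[OF F(1)] D(1)] by blast
      then have "sle (?T + (S - ?T)) ((\<Sum>k<n. F k) + F n)"
        using sle_add[OF sle_eqv[OF eqv_sym[OF T(3)]] _ D(2) oF] by blast
      then show False using no[of "Suc n"] by simp
    qed
    then obtain R where R: "eqv (F n) R" "pleq R (S - ?T)" by (auto simp: sle_def)
    have Rp: "R \<in> projections M" using R eqv_projections by blast
    have o: "porth ?T R" using porth_pleq2[OF D(2) R(2)] .
    have "good (Suc n) (?T + R, R)"
      unfolding good_def
    proof (simp, intro conjI)
      show "?T + R \<in> projections M" by (rule projection_add[OF T(1) Rp o])
      show "pleq (?T + R) S" by (rule pleq_add_least) (use T R D pleq_trans in blast)+
      show "eqv ((\<Sum>k<n. F k) + F n) (?T + R)" by (rule eqv_add[OF T(3) R(1) oF o])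
      show "porth ?T R" by (rule o)
      show "eqv (F n) R" by (rule R(1))
    qed
    then show "\<exists>y. good (Suc n) y \<and> fst y = fst x + snd y \<and> porth (fst x) (snd y)" using o by force
  qed
  then obtain f where f: "\<And>n. good n (f n)" "\<And>n. fst (f (Suc n)) = fst (f n) + snd (f (Suc n))"
    "\<And>n. porth (fst (f n)) (snd (f (Suc n)))" by blast
  define R where "R n = snd (f (Suc n))" for n
  have R: "eqv (F n) (R n)" for n using f(1)[of "Suc n"] by (auto simp: good_def R_def)
  have Rp: "R n \<in> projections M" for n using R eqv_projections by blast
  have fp: "fst (f n) \<in> projections M" "pleq (fst (f n)) S" for n using f(1)[of n] by (auto simp: good_def)
  have step: "fst (f (Suc n)) = fst (f n) + R n" "porth (fst (f n)) (R n)" for n using f(2,3)[of n] by (auto simp: R_def)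
  note inc = oseq_increments[of "\<lambda>n. fst (f n)", OF fp(1) Rp step]
  have oR: "oseq R" and Rle: "pleq (R n) (fst (f (Suc n)))" for n by (rule inc)+
  have "pleq (osum R) S" by (rule osum_projection(4)[OF oR]) (use Rle fp(2) pleq_trans in blast)
  then have "sle (osum F) S"
    unfolding sle_def using eqv_osum[OF R F(1) oR] S(1) by blast
  then show False using inft_sle F(2) S(2) by blast
qed

text \<open>A maximal orthogonal family of nonzero projections under R subequivalent to Q leaves
  nothing over: a nonzero remainder would share an equivalent nonzero piece with Q.\<close>

lemma decompose_small:
  assumes Q: "Q \<in> projections M" "Q \<noteq> 0" and R: "R \<in> projections M"
  obtains T where "oseq T" "\<And>n. sle (T n) Q" "osum T = R"
proof -
  define \<Psi> where "\<Psi> P P' \<longleftrightarrow> P = P' \<and> P \<noteq> 0 \<and> sle P Q \<and> pleq P R" for P P'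
  have prem: "P1 \<in> projections M \<and> Q1 \<in> projections M \<and> P1 \<noteq> 0" if "\<Psi> P1 Q1" for P1 Q1
    using that eqv_projections sle_projections unfolding \<Psi>_def by blast
  obtain T T' where T: "oseq T" "oseq T'"
    and TT': "\<forall>n. (T n = 0 \<and> T' n = 0) \<or> \<Psi> (T n) (T' n)"
    and max': "\<forall>P' Q'. \<Psi> P' Q' \<longrightarrow> (\<forall>n. porth P' (T n)) \<longrightarrow> (\<forall>n. porth Q' (T' n)) \<longrightarrow> False"
    using maximal_family[of \<Psi>, OF prem] by blast
  note TT = spec[OF TT', unfolded \<Psi>_def] and max = max'[rule_format, unfolded \<Psi>_def]
  have T'T: "T' n = T n" for n using TT[of n] by auto
  note t = osum_projection[OF T(1)]
  have le: "pleq (osum T) R" by (rule t(4)) (metis TT zero_pleq)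
  let ?r = "R - osum T"
  have r: "?r \<in> projections M" "porth (osum T) ?r" "pleq ?r R"
    using projection_diff porth_diff pleq_diff t(2) R le by auto
  have "?r = 0"
  proof (rule ccontr)
    assume nz: "?r \<noteq> 0"
    obtain P' Q' where P': "eqv P' Q'" "P' \<noteq> 0" "pleq P' ?r" "pleq Q' Q"
      using nonzero_equivalent[OF r(1) nz Q] by blast
    have pr: "P' \<in> projections M" using P' eqv_projections by blast
    have "porth P' (T n)" for n by (metis P'(3) r(1,2) porth_pleq porth_pleq2 porth_sym pr t(2,3))
    moreover have "sle P' Q" unfolding sle_def using P' Q by blast
    ultimately show False using max[of P' P'] P' pleq_trans r(3) T'T by metis
  qed
  moreover have "sle (T n) Q" for n using TT[of n] sle_pleq[OF projection_0 Q(1) zero_pleq] by auto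
  ultimately show ?thesis using that T(1) by auto
qed

section \<open>Finite subprojections and separating vectors\<close>

lemma inft_id: "inft id_blinfun" using inf_alg by (simp add: infinite_algebra_def)

lemma finite_nonzero_exists:
  obtains P where "P \<in> projections M" "P \<noteq> 0" "\<not> inft P"
proof -
  have "scalar_op 1 = (id_blinfun :: 'a \<Rightarrow>\<^sub>L 'a)"
    by (intro blinfun_eqI) (simp add: scalar_op.rep_eq, metis of_real_1 scaleC_of_real scaleR_one)
  then have "id_blinfun \<in> center M" using trivial_center by (metis rangeI)
  moreover have "is_projection (id_blinfun :: 'a \<Rightarrow>\<^sub>L 'a)" using projection_id by (simp add: projections_def)
  ultimately have "id_blinfun \<in> projections (center M)" by (simp add: projections_def)
  moreover have "id_blinfun \<noteq> (0 :: 'a \<Rightarrow>\<^sub>L 'a)" using inft_id inft_0 by metis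
  ultimately obtain P where P: "finite_proj M P" "P \<noteq> 0" using semi unfolding semifinite_def by blast
  then show ?thesis using that[of P] by (simp add: infinite_proj_def finite_proj_def)
qed

text \<open>Semifiniteness supplies one nonzero finite projection, and in a factor a nonzero piece
  of it is equivalent to a piece of any nonzero Q.\<close>

lemma finite_subprojection:
  assumes Q: "Q \<in> projections M" "Q \<noteq> 0"
  obtains P where "P \<in> projections M" "P \<noteq> 0" "\<not> inft P" "pleq P Q"
proof -
  obtain P0 where P0: "P0 \<in> projections M" "P0 \<noteq> 0" "\<not> inft P0" by (rule finite_nonzero_exists)
  obtain P' Q' where PQ: "eqv P' Q'" "P' \<noteq> 0" "pleq P' Q" "pleq Q' P0"
    using nonzero_equivalent[OF Q P0(1,2)] by blast
  have "sle P' P0" unfolding sle_def using PQ P0 by blast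
  then have "\<not> inft P'" using inft_sle P0(3) by blast
  then show ?thesis using that PQ eqv_projections by blast
qed

text \<open>The sequence generates a maximal orthogonal family of cyclic projections.\<close>

lemma separating_sequence:
  obtains v :: "nat \<Rightarrow> 'a" where "\<And>T. T \<in> M \<Longrightarrow> (\<And>n. T (v n) = 0) \<Longrightarrow> T = 0"
proof -
  define \<Psi> where "\<Psi> P Q \<longleftrightarrow> P = Q \<and> P \<in> projections M \<and> P \<noteq> 0 \<and> (\<exists>x. \<forall>T\<in>M. T x = 0 \<longrightarrow> (\<forall>z. T (P z) = 0))" for P Q
  have prem: "P1 \<in> projections M \<and> Q1 \<in> projections M \<and> P1 \<noteq> 0" if "\<Psi> P1 Q1" for P1 Q1
    using that eqv_projections sle_projections unfolding \<Psi>_def by blast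
  obtain P P' where P: "oseq P" "oseq P'"
    and PP': "\<forall>n. (P n = 0 \<and> P' n = 0) \<or> \<Psi> (P n) (P' n)"
    and max': "\<forall>R R'. \<Psi> R R' \<longrightarrow> (\<forall>n. porth R (P n)) \<longrightarrow> (\<forall>n. porth R' (P' n)) \<longrightarrow> False"
    using maximal_family[of \<Psi>, OF prem] by blast
  note PP = spec[OF PP', unfolded \<Psi>_def] and max = max'[rule_format, unfolded \<Psi>_def]
  have P'P: "P' n = P n" for n using PP[of n] by auto
  note p = osum_projection[OF P(1)]
  let ?R = "id_blinfun - osum P"
  have R: "?R \<in> projections M" by (rule projection_compl[OF p(2)])
  have R0: "?R = 0"
  proof (rule ccontr)
    assume "?R \<noteq> 0"
    then obtain y where y: "?R y \<noteq> 0" by (metis blinfun_eqI zero_blinfun.rep_eq)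
    define x where "x = ?R y"
    have Rx: "?R x = x" unfolding x_def by (rule projectionsD(2)[OF R])
    \<comment> \<open>The orthogonal complement of the orbit of x under the commutant. The
      complementary projection is the cyclic projection of x; an operator of M killing x kills its
      whole range.\<close>
    let ?S = "{z. \<forall>X\<in>commutant M. X x \<bullet> z = 0}"
    have S: "subspace ?S" by (auto simp: subspace_def inner_add_right)
    have "?S = (\<Inter>X\<in>commutant M. {z. blinfun_apply X x \<bullet> z = 0})" by auto
    then have cl: "closed ?S" by (auto intro!: closed_INT closed_Collect_eq continuous_intros)
    have inv: "X z \<in> ?S" if X: "X \<in> commutant M" and z: "z \<in> ?S" for X z
    proof -
      have bo: "X \<in> bounded_ops" using X by (simp add: commutant_def)
      have "Y x \<bullet> X z = 0" if Y: "Y \<in> commutant M" for Y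
      proof -
        have "adj X o\<^sub>L Y \<in> commutant M"
          using commutant_adj[OF X] Y M_bounded_ops unfolding commutant_def
          by (auto simp: bounded_ops_comp intro!: blinfun_eqI) (metis blinfun_apply_blinfun_compose)
        then have "(adj X o\<^sub>L Y) x \<bullet> z = 0" using z by blast
        then show ?thesis by (simp add: adj_inner'[OF bo])
      qed
      then show ?thesis by simp
    qed
    note C = proj_on_projection[OF S cl inv]
    let ?C = "id_blinfun - proj_on ?S"
    have Cp: "?C \<in> projections M" by (rule projection_compl[OF C(1)])
    have idc: "id_blinfun \<in> commutant M"
      by (auto simp: commutant_def bounded_ops_id intro!: blinfun_eqI)
    have "proj_on ?S x \<bullet> proj_on ?S x = x \<bullet> proj_on ?S x"
      using projectionsD(2,3)[OF C(1)] by simp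
    also have "\<dots> = 0"
    proof -
      have "proj_on ?S x \<in> ?S" by (rule proj_on_works(1)[OF S cl])
      then have "id_blinfun x \<bullet> proj_on ?S x = 0" using idc by blast
      then show ?thesis by simp
    qed
    finally have Cx: "?C x = x" by (simp add: blinfun.diff_left)
    have sep: "T (?C z) = 0" if T: "T \<in> M" "T x = 0" for T z
    proof -
      have bo: "T \<in> bounded_ops" using T(1) by (rule M_bounded_ops)
      have "adj T w \<in> ?S" for w
      proof -
        have "X x \<bullet> adj T w = 0" if "X \<in> commutant M" for X
          using commutantD[OF that T(1), of x] T(2) by (simp add: adj_inner[OF bo, symmetric])
        then show ?thesis by blast
      qed
      then have "?C (adj T w) = 0" for w using C(2)[of "adj T w"] by (simp add: blinfun.diff_left)
      then have "w \<bullet> T (?C z) = 0" for w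
        using adj_inner'[OF bo, of w "?C z"] projectionsD(3)[OF Cp, of "adj T w" z] by simp
      then show ?thesis by (rule inner_all_zero)
    qed
    have CR: "porth ?C (P n)" for n
    proof -
      have "P n z \<in> ?S" for z
      proof -
        have "X x \<bullet> P n z = 0" if X: "X \<in> commutant M" for X
        proof -
          have "P n x = 0"
          proof -
            have "P n x = P n (?R x)" using Rx by simp
            also have "\<dots> = 0" using pleqD'[OF p(3) oseqD(1)[OF P(1)] p(2)] by (simp add: blinfun.diff_left blinfun.diff_right)
            finally show ?thesis .
          qed
          then have "P n (X x) = 0" using commutantD[OF X] projectionsD(1)[OF oseqD(1)[OF P(1)]] by simp
          then show ?thesis using projectionsD(3)[OF oseqD(1)[OF P(1), of n], of "X x" z] by simp
        qed
        then show ?thesis by blast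
      qed
      then have "proj_on ?S (P n z) = P n z" for z using C(2) by blast
      then show ?thesis by (simp add: porth_def blinfun.diff_left)
    qed
    have "?C \<noteq> 0" using Cx y by (metis x_def zero_blinfun.rep_eq)
    then show False using max[of ?C ?C] Cp sep CR P'P by auto
  qed
  \<comment> \<open>A separating vector for each cyclic projection, and 0 where the enumeration is
    padded.\<close>
  define v where "v n = (if P n = 0 then 0 else SOME x. \<forall>T\<in>M. T x = 0 \<longrightarrow> (\<forall>z. T (P n z) = 0))" for n
  have v: "T (P n z) = 0" if "T \<in> M" "T (v n) = 0" for T n z
  proof (cases "P n = 0")
    case False
    then have "\<exists>x. \<forall>T\<in>M. T x = 0 \<longrightarrow> (\<forall>z. T (P n z) = 0)" using PP[of n] by blast
    from someI_ex[OF this] show ?thesis using that False by (simp add: v_def)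
  qed simp
  show ?thesis
  proof (rule that[of v])
    fix T assume T: "T \<in> M" "\<And>n. T (v n) = 0"
    show "T = 0"
    proof (rule blinfun_eqI)
      fix z
      have "(\<lambda>n. T (P n z)) sums T (osum P z)" by (rule bounded_linear.sums[OF blinfun.bounded_linear_right p(1)])
      then have "(\<lambda>n. 0 :: 'a) sums T (osum P z)" using v[OF T] by simp
      then have "T (osum P z) = 0" using sums_unique2[OF _ sums_zero] by blast
      moreover have "osum P z = z" using R0 by (metis blinfun.diff_left blinfun_apply_id_blinfun eq_iff_diff_eq_0 id_apply zero_blinfun.rep_eq)
      ultimately show "T z = blinfun_apply 0 z" by simp
    qed
  qed
qed

end

section \<open>Diagonal lower bounds of positive operators\<close>

context sf_factor
begin

text \<open>The difference between D and the sum is fixed by D and annihilated by every R n, so the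
  last premise makes it vanish.\<close>

lemma osum_eq_projectionI:
  assumes R: "oseq R" and D: "D \<in> projections M" and le: "\<And>n. pleq (R n) D"
    and z: "\<And>w. D w = w \<Longrightarrow> (\<And>n. R n w = 0) \<Longrightarrow> w = 0"
  shows "osum R = D"
proof -
  note r = osum_projection[OF R]
  have le': "pleq (osum R) D" by (rule r(4)[OF le])
  have "(D - osum R) x = 0" for x
  proof (rule z)
    show "D ((D - osum R) x) = (D - osum R) x" using pleqD[OF pleq_diff[OF r(2) D le']] .
    fix n
    show "R n ((D - osum R) x) = 0"
      by (simp add: blinfun.diff_left blinfun.diff_right pleqD'[OF le oseqD(1)[OF R] D] pleqD'[OF r(3) oseqD(1)[OF R] r(2)])
  qed
  then show ?thesis by (intro blinfun_eqI) (simp add: blinfun.diff_left)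
qed

lemma osum_add:
  assumes R: "oseq R" and S: "oseq S" and o: "\<And>m n. porth (R m) (S n)"
  shows "oseq (\<lambda>n. R n + S n)" "osum (\<lambda>n. R n + S n) = osum R + osum S" "porth (osum R) (osum S)"
proof -
  note Rp = oseqD(1)[OF R] and Sp = oseqD(1)[OF S]
  have o': "porth (S m) (R n)" for m n using porth_sym[OF o Rp Sp] .
  show "oseq (\<lambda>n. R n + S n)"
    unfolding oseq_def
    using projection_add[OF Rp Sp o] oseqD(2)[OF R] oseqD(2)[OF S] o o' by (auto intro!: porth_add porth_add2)
  show "osum (\<lambda>n. R n + S n) = osum R + osum S"
    by (rule osum_eqI) (simp add: blinfun.add_left sums_add osum_projection(1)[OF R] osum_projection(1)[OF S])
  have "porth (R m) (osum S)" for m by (rule osum_projection(5)[OF S o])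
  then have "porth (osum S) (R m)" for m using porth_sym Rp osum_projection(2)[OF S] by blast
  then have "porth (osum S) (osum R)" by (rule osum_projection(5)[OF R])
  then show "porth (osum R) (osum S)" using porth_sym osum_projection(2) R S by blast
qed

lemma null_proj_pos:
  assumes A: "pos A" shows "A (null_proj A x) = 0" "null_proj A (A x) = 0"
proof -
  note N = null_proj_M[OF posD(1)[OF A]]
  show AN: "A (null_proj A x) = 0" for x using N(2) projectionsD(2)[OF N(1)] by blast
  show "null_proj A (A x) = 0"
  proof (rule inner_all_zero)
    fix w
    show "w \<bullet> null_proj A (A x) = 0"
      using projectionsD(3)[OF N(1), of w "A x"] posD(2)[OF A, of "null_proj A w" x] AN by simp
  qed
qed

lemma spg_pleq_supp:
  assumes A: "pos A" and t: "t > 0" shows "pleq (spg A t) (supp A)"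
proof -
  note N = null_proj_M[OF posD(1)[OF A]] and AN = null_proj_pos(1)[OF A] and NA = null_proj_pos(2)[OF A]
  have comm: "spg A t (null_proj A x) = null_proj A (spg A t x)" for x
    by (rule spg(2)[OF A]) (simp_all add: AN NA projectionsD(3)[OF N(1)])
  have "null_proj A (spg A t x) = 0" for x
  proof -
    let ?y = "null_proj A (spg A t x)"
    have "spg A t ?y = ?y" using comm[of "spg A t x"] projectionsD(2)[OF spg(1)[OF A]] by simp
    then have "t * (norm ?y)\<^sup>2 \<le> 0" using spg(3)[OF A, of t ?y] AN by simp
    then have "(norm ?y)\<^sup>2 \<le> 0" using t by (simp add: mult_le_0_iff)
    then show ?thesis by simp
  qed
  then show ?thesis by (simp add: pleq_def supp_def blinfun.diff_left)
qed

lemma spg_vanishing: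
  assumes A: "pos A" and e: "e \<longlonglongrightarrow> 0" and z: "\<And>n. spg A (e n) x = 0"
  shows "A x = 0"
proof -
  have "A x \<bullet> x \<le> e n * (norm x)\<^sup>2" for n by (rule spg_le[OF A z])
  moreover have "(\<lambda>n. e n * (norm x)\<^sup>2) \<longlonglongrightarrow> 0 * (norm x)\<^sup>2" by (intro tendsto_intros e)
  ultimately have "A x \<bullet> x \<le> 0" using LIMSEQ_le_const[of "\<lambda>n. e n * (norm x)\<^sup>2"] by auto
  then show ?thesis using pos_zero[OF A] posD(3)[OF A, of x] by simp
qed

text \<open>R n is the spectral band from e (n+1) up to e n. The bands exhaust the support below e 0
  because a vector missed by all levels is in the kernel of A.\<close>

lemma spg_bands:
  assumes A: "pos A" and dec: "decseq e" and pos: "\<And>n. e n > 0" and e: "e \<longlonglongrightarrow> 0"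
  defines "R \<equiv> \<lambda>n. spg A (e (Suc n)) - spg A (e n)"
  shows "oseq R" "(\<Sum>k<n. R k) = spg A (e n) - spg A (e 0)" "osum R = supp A - spg A (e 0)"
    "\<And>n. porth (R n) (spg A (e 0))"
proof -
  note G = spg(1)[OF A]
  have le: "pleq (spg A (e n)) (spg A (e (Suc n)))" for n
    using spg_antimono[OF A] dec by (simp add: decseq_Suc_iff)
  have Rp: "R n \<in> projections M" for n unfolding R_def using projection_diff[OF G G le] .
  have step: "spg A (e (Suc n)) = spg A (e n) + R n" for n by (simp add: R_def)
  have o: "porth (spg A (e n)) (R n)" for n unfolding R_def by (rule porth_diff[OF G G le])
  note inc = oseq_increments[of "\<lambda>n. spg A (e n)", OF G Rp step o]
  show R: "oseq R" by (rule inc)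
  show "(\<Sum>k<n. R k) = spg A (e n) - spg A (e 0)" unfolding R_def by (rule sum_lessThan_telescope)
  have o0: "porth (spg A (e 0)) (R n)" for n
    using porth_pleq[OF o inc(2)[of 0 n]] G by blast
  then show o0': "porth (R n) (spg A (e 0))" for n using porth_sym G Rp by blast
  have sle: "pleq (spg A (e n)) (supp A)" for n by (rule spg_pleq_supp[OF A pos])
  have sp: "supp A \<in> projections M" by (rule supp(1)[OF posD(1)[OF A]])
  show "osum R = supp A - spg A (e 0)"
  proof (rule osum_eq_projectionI[OF R])
    show D: "supp A - spg A (e 0) \<in> projections M" by (rule projection_diff[OF G sp sle])
    fix n
    have "pleq (R n) (supp A)" using inc(3) sle pleq_trans by blast
    then show "pleq (R n) (supp A - spg A (e 0))"
      using o0 by (simp add: pleq_def porth_def blinfun.diff_left)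
  next
    fix w assume w: "(supp A - spg A (e 0)) w = w" "\<And>n. R n w = 0"
    have w0: "spg A (e 0) w = 0"
      using pleqD'[OF sle G sp, of 0 w] w(1) projectionsD(2)[OF G, of "e 0" w]
      by (metis blinfun.diff_left blinfun.diff_right diff_self)
    have "spg A (e n) w = 0" for n
      by (induction n) (simp_all add: w0 w(2) step blinfun.add_left)
    then have "A w = 0" by (rule spg_vanishing[OF A e])
    then have "supp A w = 0" using supp(4)[OF posD(1)[OF A]] by blast
    then show "w = 0" using w(1) w0 by (simp add: blinfun.diff_left)
  qed
qed

text \<open>A nonzero vector killed by \<open>spg A t\<close> has form strictly below t times its
  squared norm, so \<open>spg A t\<close> is injective on K and K embeds into it.\<close>

lemma compression_inft_spg:
  assumes A: "pos A" and K: "inft K" and ge: "\<And>x. K x = x \<Longrightarrow> t * (norm x)\<^sup>2 \<le> A x \<bullet> x"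
  shows "inft (spg A t)"
proof -
  note G = spg(1)[OF A, of t]
  have KM: "K \<in> projections M" using K by (rule inft_projection)
  have "eqv K (rproj (spg A t o\<^sub>L K))"
  proof (rule injective_eqv[OF KM projectionsD(1)[OF G]])
    fix x assume x: "K x = x" "spg A t x = 0"
    show "x = 0" using spg(4)[OF A x(2)] ge[OF x(1)] by force
  qed
  moreover have "pleq (rproj (spg A t o\<^sub>L K)) (spg A t)"
    by (rule rproj(3)[OF _ G]) (simp_all add: M_comp projectionsD(1,2)[OF G] projectionsD(1)[OF KM])
  ultimately have "sle K (spg A t)" unfolding sle_def using G by blast
  then show ?thesis using inft_sle K by blast
qed

text \<open>\<open>K\<close> is not asked to commute with \<open>A\<close>. In this form the
  property passes to Schur complements and remainders by comparing quadratic forms, while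
  \<open>compression_inft_spg\<close> still recovers infinite spectral projections.\<close>

definition good :: "(nat \<Rightarrow> real) \<Rightarrow> ('a \<Rightarrow>\<^sub>L 'a) \<Rightarrow> bool" where
  "good \<beta> A \<longleftrightarrow> (\<forall>n. \<exists>K. inft K \<and> (\<forall>x. K x = x \<longrightarrow> \<beta> n * (norm x)\<^sup>2 \<le> A x \<bullet> x))"

text \<open>A Schur complement: \<open>X\<close> is the largest operator below \<open>A - (s/2) P\<close> that is supported off \<open>P\<close>.\<close>

lemma decouple:
  assumes A: "pos A" and P: "P \<in> projections M" "\<not> inft P" and s: "s > 0"
    and sP: "\<And>x. s * (norm (P x))\<^sup>2 \<le> A x \<bullet> x" and g: "good \<beta> A"
  obtains X where "pos X" "\<And>x. X (P x) = 0" "\<And>x. s / 2 * (norm (P x))\<^sup>2 + X x \<bullet> x \<le> A x \<bullet> x"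
    "good \<beta> X" "\<And>x. X x = 0 \<Longrightarrow> A (x - P x) = 0"
proof -
  \<comment> \<open>Half of s P is withheld. Since A dominates s P, A' stays above A / 2; this keeps
    A' positive and keeps its kernel inside that of A.\<close>
  define A' where "A' = A - (s / 2) *\<^sub>R P"
  have A'x: "A' x \<bullet> x = A x \<bullet> x - s / 2 * (norm (P x))\<^sup>2" for x
    by (simp add: A'_def blinfun.diff_left blinfun.scaleR_left inner_diff_left projectionsD(4)[OF P(1)])
  have half: "A x \<bullet> x / 2 \<le> A' x \<bullet> x" for x using sP[of x] by (simp add: A'x)
  have A': "pos A'"
  proof (rule posI)
    show "A' \<in> M" by (simp add: A'_def M_diff M_scaleR posD(1)[OF A] projectionsD(1)[OF P(1)])
    show "A' x \<bullet> y = x \<bullet> A' y" for x y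
      by (simp add: A'_def blinfun.diff_left blinfun.scaleR_left inner_diff_left inner_diff_right posD(2)[OF A] projectionsD(3)[OF P(1)])
    show "0 \<le> A' x \<bullet> x" for x using half[of x] posD(3)[OF A, of x] by simp
  qed
  define H where "H = sqrtop A'"
  note h = sqrtop[OF A', folded H_def]
  have HM: "H \<in> M" using h(1) by (rule posD)
  \<comment> \<open>The image of the range of P under H. It is closed because H is bounded below by
    sqrt (s / 2) on the range of P.\<close>
  define S where "S = H ` {x. P x = x}"
  have subP: "subspace {x. P x = x}"
    by (auto simp: subspace_def blinfun.add_right blinfun.scaleR_right)
  have clP: "closed {x. P x = x}" by (intro closed_Collect_eq continuous_intros)
  have S: "subspace S"
    unfolding S_def by (rule linear_subspace_image[OF bounded_linear.linear[OF blinfun.bounded_linear_right] subP])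
  have lower: "sqrt (s / 2) * norm x \<le> norm (H x)" if "P x = x" for x
  proof -
    have "(sqrt (s / 2) * norm x)\<^sup>2 \<le> (norm (H x))\<^sup>2"
      using sP[of x] h(4)[of x] A'x[of x] that s by (simp add: power_mult_distrib)
    then show ?thesis by (rule power2_le_imp_le) simp
  qed
  have cl: "closed S"
    unfolding S_def
  proof (rule complete_imp_closed, rule complete_isometric_image[OF _ subP blinfun.bounded_linear_right])
    show "0 < sqrt (s / 2)" using s by simp
    show "\<forall>x\<in>{x. P x = x}. sqrt (s / 2) * norm x \<le> norm (H x)" using lower by auto
    show "complete {x. P x = x}" using clP complete_eq_closed by blast
  qed
  have inv: "X x \<in> S" if X: "X \<in> commutant M" and x: "x \<in> S" for X x
  proof -
    obtain y where y: "x = H y" "P y = y" using x by (auto simp: S_def)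
    have "X x = H (X y)" "P (X y) = X y"
      using y commutantD[OF X HM] commutantD[OF X projectionsD(1)[OF P(1)], of y] by auto
    then show ?thesis by (auto simp: S_def)
  qed
  define Z where "Z = proj_on S"
  have Z: "Z \<in> projections M" "Z x = x \<longleftrightarrow> x \<in> S" for x
    unfolding Z_def by (rule proj_on_projection[OF S cl], erule (1) inv)+
  note z = projectionsD[OF Z(1)]
  have ZHP: "Z (H (P x)) = H (P x)" for x
    using Z(2)[of "H (P x)"] projectionsD(2)[OF P(1)] by (auto simp: S_def)
  have Zfin: "\<not> inft Z"
  proof -
    have "eqv P (rproj (H o\<^sub>L P))"
    proof (rule injective_eqv[OF P(1) HM])
      fix x assume "P x = x" "H x = 0"
      then have "sqrt (s / 2) * norm x \<le> 0" using lower[of x] by simp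
      then show "x = 0" using s by (simp add: mult_le_0_iff)
    qed
    moreover have "rproj (H o\<^sub>L P) = Z"
    proof (rule pleq_antisym[OF _ _ rproj(1) Z(1)])
      have HP: "H o\<^sub>L P \<in> M" using HM projectionsD(1)[OF P(1)] by (rule M_comp)
      show "H o\<^sub>L P \<in> M" by (rule HP)
      have "Z ((H o\<^sub>L P) x) = (H o\<^sub>L P) x" for x using ZHP[of x] by simp
      then show "pleq (rproj (H o\<^sub>L P)) Z" by (rule rproj(3)[OF HP Z(1)])
      show "pleq Z (rproj (H o\<^sub>L P))"
      proof (rule pleqI[OF Z(1)])
        fix x assume "Z x = x"
        then obtain y where "x = H y" "P y = y" using Z(2)[of x] by (auto simp: S_def)
        then have "x = (H o\<^sub>L P) y" by simp
        then show "rproj (H o\<^sub>L P) x = x" using rproj(2)[OF HP, of y] by simp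
      qed
    qed
    ultimately show ?thesis using P(2) inft_eqv eqv_sym by metis
  qed
  \<comment> \<open>With Z the projection onto H P, the form of X at x is the minimum of the form of
    A' over all x + P y.\<close>
  define X where "X = H o\<^sub>L ((id_blinfun - Z) o\<^sub>L H)"
  have Xap: "X x = H (H x - Z (H x))" for x by (simp add: X_def blinfun.diff_left)
  have Xx: "X x \<bullet> x = (norm (H x - Z (H x)))\<^sup>2" for x
  proof -
    have "X x \<bullet> x = (id_blinfun - Z) (H x) \<bullet> H x" using posD(2)[OF h(1)] by (simp add: X_def)
    also have "\<dots> = (norm ((id_blinfun - Z) (H x)))\<^sup>2" by (rule projectionsD(4)[OF projection_compl[OF Z(1)]])
    finally show ?thesis by (simp add: blinfun.diff_left)
  qed
  have Xn: "X x \<bullet> x = A' x \<bullet> x - (norm (Z (H x)))\<^sup>2" for x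
    unfolding Xx using norm_compl[OF Z(1) projection_id, of "H x"] h(4)[of x]
    by (simp add: blinfun.diff_left pleq_def)
  have "pos X"
  proof (rule posI)
    show "X \<in> M" by (simp add: X_def M_comp M_diff M_id HM z(1))
    show "X x \<bullet> y = x \<bullet> X y" for x y
      using projectionsD(3)[OF projection_compl[OF Z(1)]] posD(2)[OF h(1)] by (simp add: X_def)
    show "0 \<le> X x \<bullet> x" for x by (simp add: Xx)
  qed
  moreover have "X (P x) = 0" for x by (simp add: Xap ZHP)
  moreover have "s / 2 * (norm (P x))\<^sup>2 + X x \<bullet> x \<le> A x \<bullet> x" for x
    using A'x[of x] by (simp add: Xn)
  moreover have "good \<beta> X"
    unfolding good_def
  proof
    fix n
    obtain K where K: "inft K" "\<And>x. K x = x \<Longrightarrow> \<beta> n * (norm x)\<^sup>2 \<le> A x \<bullet> x" using g by (auto simp: good_def)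
    \<comment> \<open>Where both Z (H x) and P x vanish, X and A have the same form. Each condition
      costs only a finite projection, so an infinite part of K is left.\<close>
    let ?K1 = "pinf K (null_proj (Z o\<^sub>L H))" let ?K2 = "pinf ?K1 (id_blinfun - P)"
    have ZH: "Z o\<^sub>L H \<in> M" using z(1) HM by (rule M_comp)
    have K1: "inft ?K1" by (rule inft_inf_kernel[OF K(1) ZH Z(1) Zfin]) (simp add: z(2))
    have K2: "inft ?K2" by (rule inft_inf_compl[OF K1 P])
    have "\<beta> n * (norm x)\<^sup>2 \<le> X x \<bullet> x" if x: "?K2 x = x" for x
    proof -
      have x1: "?K1 x = x" "P x = 0"
        using x pinf(2)[OF inft_projection[OF K1] projection_compl[OF P(1)], of x] by (auto simp: blinfun.diff_left)
      then have "K x = x" "Z (H x) = 0"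
        using pinf(2)[OF inft_projection[OF K(1)] null_proj_M(1)[OF ZH], of x] null_proj_M(2)[OF ZH, of x] by auto
      then show ?thesis using K(2) x1(2) by (simp add: Xn A'x)
    qed
    then show "\<exists>K. inft K \<and> (\<forall>x. K x = x \<longrightarrow> \<beta> n * (norm x)\<^sup>2 \<le> X x \<bullet> x)" using K2 by blast
  qed
  moreover have "A (x - P x) = 0" if "X x = 0" for x
  proof -
    have "H x - Z (H x) = 0" using Xx[of x] that by simp
    then have "Z (H x) = H x" by simp
    then obtain y where y: "H x = H y" "P y = y" using Z(2)[of "H x"] by (auto simp: S_def)
    have "H (x - y) = 0" by (simp add: blinfun.diff_right y)
    then have "A' (x - y) \<bullet> (x - y) = 0" using h(4)[of "x - y"] by simp
    then have "A (x - y) \<bullet> (x - y) = 0" using half[of "x - y"] posD(3)[OF A, of "x - y"] by simp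
    then have "A (x - y) = 0" "P (x - y) = 0"
      using pos_zero[OF A] sP[of "x - y"] s by (auto simp: mult_le_0_iff)
    moreover have "P x = y" using calculation(2) y(2) by (simp add: blinfun.diff_right)
    ultimately show ?thesis by simp
  qed
  ultimately show ?thesis using that by blast
qed

section \<open>Energies of spectral parts and the diagonal lower bound\<close>

definition energy :: "('a \<Rightarrow>\<^sub>L 'a) \<Rightarrow> real \<Rightarrow> 'a \<Rightarrow> real" where
  "energy A t x = A (spg A t x) \<bullet> spg A t x"

lemma energy_ge: "pos A \<Longrightarrow> t * (norm (spg A t x))\<^sup>2 \<le> energy A t x"
  by (simp add: energy_def spg_ge)

lemma energy_split:
  assumes A: "pos A" and Q: "Q \<in> projections M" and comm: "\<And>x. Q (A x) = A (Q x)"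
  shows "A x \<bullet> x = A (Q x) \<bullet> Q x + A (x - Q x) \<bullet> (x - Q x)"
proof -
  have "A (Q x) \<bullet> (x - Q x) = 0"
    using comm projectionsD(2,3)[OF Q] by (metis blinfun.diff_right diff_self inner_zero_right)
  then show ?thesis
    by (simp add: blinfun.diff_right inner_diff_left inner_diff_right posD(2)[OF A] inner_commute)
qed

lemma energy_le: "pos A \<Longrightarrow> energy A t x \<le> A x \<bullet> x"
proof -
  assume A: "pos A"
  show ?thesis using energy_split[OF A spg(1)[OF A] spg_comm[OF A], of x t] posD(3)[OF A, of "x - spg A t x"]
    by (simp add: energy_def)
qed

text \<open>The form splits across the band between s and t, which contributes at least s times its
  squared mass.\<close>

lemma energy_band:
  assumes A: "pos A" and st: "s \<le> t"
  shows "s * ((norm (spg A s x))\<^sup>2 - (norm (spg A t x))\<^sup>2) + energy A t x \<le> energy A s x"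
proof -
  note G = spg(1)[OF A]
  let ?w = "spg A s x - spg A t x"
  note le = spg_antimono[OF A st]
  have ts: "spg A t (spg A s x) = spg A t x" "spg A s (spg A t x) = spg A t x"
    using pleqD'[OF le G G] pleqD[OF le] by auto
  have "energy A s x = energy A t x + A ?w \<bullet> ?w"
    using energy_split[OF A G[of t] spg_comm[OF A], of "spg A s x"] by (simp add: energy_def ts)
  moreover have "s * (norm ?w)\<^sup>2 \<le> A ?w \<bullet> ?w"
    by (rule spg(3)[OF A]) (simp add: blinfun.diff_right ts projectionsD(2)[OF G])
  moreover have "(norm ?w)\<^sup>2 = (norm (spg A s x))\<^sup>2 - (norm (spg A t x))\<^sup>2"
    using norm_compl[OF G G le, of x] by (simp add: blinfun.diff_left)
  ultimately show ?thesis by simp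
qed

text \<open>Copies of a fixed finite R are chosen one at a time. At each stage only a finite
  projection is used up, so the G n whose turn it is still has room beside it; grouping the copies
  by index then gives the infinite E n.\<close>

lemma orthogonal_infinite_below:
  assumes G: "\<And>n. inft (G n)"
  obtains E where "oseq E" "\<And>n. inft (E n)" "\<And>n. pleq (E n) (G n)"
proof -
  obtain R where R: "R \<in> projections M" "R \<noteq> 0" "\<not> inft R" by (rule finite_nonzero_exists)
  \<comment> \<open>Takes every value infinitely often, so each G n receives infinitely many copies
    of R.\<close>
  define idx where "idx n = fst (prod_decode n)" for n
  define ok where "ok n y \<longleftrightarrow> fst y \<in> projections M \<and> \<not> inft (fst y) \<and> (n > 0 \<longrightarrow> eqv R (snd y) \<and> pleq (snd y) (G (idx (n - 1))))"
    for n and y :: "('a \<Rightarrow>\<^sub>L 'a) \<times> ('a \<Rightarrow>\<^sub>L 'a)"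
  have "\<exists>f. \<forall>n. ok n (f n) \<and> fst (f (Suc n)) = fst (f n) + snd (f (Suc n)) \<and> porth (fst (f n)) (snd (f (Suc n)))"
  proof (rule dependent_nat_choice)
    show "\<exists>x. ok 0 x" by (rule exI[of _ "(0, 0)"]) (simp add: ok_def projection_0 inft_0)
    fix y n assume "ok n y"
    then have y: "fst y \<in> projections M" "\<not> inft (fst y)" by (auto simp: ok_def)
    let ?K = "pinf (G (idx n)) (id_blinfun - fst y)"
    have "inft ?K" by (rule inft_inf_compl[OF G y])
    then have "sle R ?K" using inft_absorbs R(1) by blast
    then obtain D where D: "eqv R D" "pleq D ?K" by (auto simp: sle_def)
    have Dp: "D \<in> projections M" using D eqv_projections by blast
    note I = pinf[OF inft_projection[OF G] projection_compl[OF y(1)], of "idx n"]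
    have DI: "?K (D x) = D x" for x using pleqD[OF D(2)] .
    have DG: "pleq D (G (idx n))" using DI I(2) by (simp add: pleq_def)
    have o: "porth (fst y) D" unfolding porth_compl[OF y(1)] using DI I(2) by (simp add: pleq_def)
    have "\<not> inft D" using R(3) D(1) inft_eqv eqv_sym by blast
    then have "ok (Suc n) (fst y + D, D)"
      using projection_add[OF y(1) Dp o] finite_add[OF y Dp _ o] D(1) DG by (simp add: ok_def)
    then show "\<exists>z. ok (Suc n) z \<and> fst z = fst y + snd z \<and> porth (fst y) (snd z)" using o by force
  qed
  then obtain f where f: "\<And>n. ok n (f n)" "\<And>n. fst (f (Suc n)) = fst (f n) + snd (f (Suc n))"
    "\<And>n. porth (fst (f n)) (snd (f (Suc n)))" by blast
  define D where "D n = snd (f (Suc n))" for n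
  have RD: "eqv R (D n)" and DG: "pleq (D n) (G (idx n))" for n
    using f(1)[of "Suc n"] by (auto simp: ok_def D_def)
  have Dp: "D n \<in> projections M" for n using RD eqv_projections by blast
  have fp: "fst (f n) \<in> projections M" for n using f(1)[of n] by (simp add: ok_def)
  have D: "oseq D"
    by (rule oseq_increments(1)[of "\<lambda>n. fst (f n)", OF fp Dp]) (simp_all add: D_def f(2,3))
  have D1: "eqv (D 0) (D n)" for n using RD eqv_sym eqv_trans by blast
  have D0: "D 0 \<noteq> 0" using R(2) eqv_0[OF RD] by blast
  show ?thesis
  proof (rule that)
    show "oseq (\<lambda>i. osum (\<lambda>k. D (prod_encode (i, k))))" by (rule oseq_blocks(2)[OF D])
    show "inft (osum (\<lambda>k. D (prod_encode (n, k))))" for n by (rule inft_blocks[OF D D1 D0])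
    show "pleq (osum (\<lambda>k. D (prod_encode (n, k)))) (G n)" for n
    proof (rule osum_projection(4)[OF oseq_blocks(1)[OF D]])
      show "pleq (D (prod_encode (n, k))) (G n)" for k using DG[of "prod_encode (n, k)"] by (simp add: idx_def)
    qed
  qed
qed

text \<open>The E n lie under the decreasing spectral projections G n but need not commute with X,
  so their weights are collected by Abel summation over the energies of the G n. What the E n leave
  of G 0 and the bands below \<beta> 0 supply the Q n.\<close>

lemma diagonal_lower_bound:
  assumes X: "pos X" and g: "good \<beta> X" and inc: "incseq \<beta>" and pos: "\<beta> 0 > 0"
  obtains E Q c where "oseq E" "\<And>n. inft (E n)" "oseq Q" "\<And>m n. porth (E m) (Q n)" "\<And>n. (c n :: real) > 0"
    "osum E + osum Q = supp X"
    "\<And>x N. (\<Sum>n<N. \<beta> n * (norm (E n x))\<^sup>2) + (\<Sum>n<N. c n * (norm (Q n x))\<^sup>2) \<le> X x \<bullet> x"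
proof -
  define G where "G n = spg X (\<beta> n)" for n
  have Gp: "G n \<in> projections M" for n unfolding G_def by (rule spg(1)[OF X])
  have Ginf: "inft (G n)" for n
    unfolding G_def using g compression_inft_spg[OF X] by (auto simp: good_def)
  have Gle: "pleq (G n) (G m)" if "m \<le> n" for m n
    unfolding G_def using spg_antimono[OF X] inc that by (simp add: incseqD)
  obtain E where E: "oseq E" "\<And>n. inft (E n)" "\<And>n. pleq (E n) (G n)"
    using orthogonal_infinite_below[of G, OF Ginf] by blast
  note Ep = oseqD(1)[OF E(1)] and e = osum_projection[OF E(1)]
  have EG0: "pleq (E n) (G 0)" for n using E(3) Gle[of 0 n] pleq_trans by blast
  have SG0: "pleq (osum E) (G 0)" by (rule e(4)[OF EG0])
  define lev where "lev n = \<beta> 0 / 2 ^ n" for n :: nat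
  have lev: "decseq lev" "\<And>n. lev n > 0" "lev \<longlonglongrightarrow> 0"
  proof -
    show "decseq lev" unfolding decseq_Suc_iff lev_def using pos by (simp add: field_simps)
    show "lev n > 0" for n using pos by (simp add: lev_def)
    have "(\<lambda>n. \<beta> 0 * (1 / 2) ^ n) \<longlonglongrightarrow> \<beta> 0 * 0" by (intro tendsto_mult tendsto_const LIMSEQ_power_zero) simp
    then show "lev \<longlonglongrightarrow> 0" by (simp add: lev_def[abs_def] power_divide)
  qed
  have lev0: "lev 0 = \<beta> 0" by (simp add: lev_def)
  define B where "B = (\<lambda>n. spg X (lev (Suc n)) - spg X (lev n))"
  note b = spg_bands[OF X lev, folded B_def, unfolded lev0, folded G_def]
  \<comment> \<open>Index 0 is what the E n leave of G 0, charged at \<beta> 0. Index k + 1 is the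
    band from lev (k+1) to lev k, charged at its lower edge.\<close>
  define Q where "Q n = (case n of 0 \<Rightarrow> G 0 - osum E | Suc k \<Rightarrow> B k)" for n
  define c where "c n = (case n of 0 \<Rightarrow> \<beta> 0 | Suc k \<Rightarrow> lev (Suc k))" for n
  have Q0: "Q 0 = G 0 - osum E" and QS: "Q (Suc k) = B k" for k by (simp_all add: Q_def)
  have Q0p: "Q 0 \<in> projections M" unfolding Q0 by (rule projection_diff[OF e(2) Gp SG0])
  have Bp: "B k \<in> projections M" for k using b(1) by (rule oseqD)
  have Q0G: "pleq (Q 0) (G 0)" unfolding Q0 by (rule pleq_diff[OF e(2) Gp SG0])
  have BG: "porth (B k) (G 0)" for k using b(4)[of k] by (simp add: G_def B_def lev0)
  have BQ0: "porth (B k) (Q 0)" for k using porth_pleq2[OF BG Q0G] .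
  have Qo: "oseq Q"
    unfolding oseq_def
  proof (intro conjI allI impI)
    show "Q n \<in> projections M" for n by (cases n) (simp_all add: Q0p QS Bp)
    fix m n :: nat assume "m \<noteq> n"
    then show "porth (Q m) (Q n)"
      using BQ0 porth_sym[OF BQ0 Bp Q0p] oseqD(2)[OF b(1)] by (cases m; cases n) (auto simp: QS)
  qed
  have EQ: "porth (E m) (Q n)" for m n
  proof (cases n)
    case 0
    have "porth (osum E) (Q 0)" unfolding Q0 by (rule porth_diff[OF e(2) Gp SG0])
    then show ?thesis using porth_pleq[OF _ e(3) Ep e(2)] 0 by blast
  next
    case (Suc k)
    have "porth (B k) (E m)" using porth_pleq2[OF BG EG0] .
    then show ?thesis using porth_sym Bp Ep Suc QS by metis
  qed
  have sum: "osum E + osum Q = supp X"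
    using osum_split_first(1)[OF Qo] b(3) by (simp add: Q0 QS)
  have En: "(\<Sum>m<N. (norm (E m x))\<^sup>2) \<le> (norm (osum E x))\<^sup>2" for N x
    using sum_le_suminf[OF sums_summable[OF e(6)[of x]], of "{..<N}"] sums_unique[OF e(6)[of x]] by auto
  \<comment> \<open>All E m with m \<ge> n lie under G n, which bounds their total mass by that of G
    n.\<close>
  have tail: "(\<Sum>m\<in>{n..<N}. (norm (E m x))\<^sup>2) \<le> (norm (G n x))\<^sup>2" for n N x
  proof -
    let ?S = "\<Sum>m\<in>{n..<N}. E m x"
    have a: "(norm ?S)\<^sup>2 = (\<Sum>m\<in>{n..<N}. (norm (E m x))\<^sup>2)"
      by (rule norm_sum_Pythagorean) (auto simp: pairwise_def orthogonal_def oseq_inner[OF E(1)])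
    have "E m x \<bullet> x = E m x \<bullet> G n x" if "m \<in> {n..<N}" for m
    proof -
      have "pleq (E m) (G n)" using E(3) Gle[of n m] that pleq_trans by auto
      then show ?thesis using pleqD projectionsD(3)[OF Gp] by metis
    qed
    then have "(norm ?S)\<^sup>2 = ?S \<bullet> G n x"
      unfolding a by (simp add: inner_sum_left projectionsD(4)[OF Ep, symmetric])
    also have "\<dots> \<le> norm ?S * norm (G n x)" by (rule norm_cauchy_schwarz)
    finally have "norm ?S \<le> norm (G n x)" by (cases "?S = 0") (auto simp: power2_eq_square)
    then show ?thesis unfolding a[symmetric] by simp
  qed
  \<comment> \<open>Downward induction from N: the mass of G n not taken by later E m is charged at
    \<beta> n, which is nonnegative by \<open>tail\<close> and can be recharged at \<beta> (n+1) one
    level up.\<close>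
  have abel: "(\<Sum>m\<in>{n..<N}. \<beta> m * (norm (E m x))\<^sup>2) + \<beta> n * ((norm (G n x))\<^sup>2 - (\<Sum>m\<in>{n..<N}. (norm (E m x))\<^sup>2)) \<le> energy X (\<beta> n) x"
    if "n \<le> N" for n N x
    using that
  proof (induction rule: inc_induct)
    case base
    then show ?case using energy_ge[OF X, of "\<beta> N" x] by (simp add: G_def)
  next
    case (step n)
    let ?S = "\<Sum>m\<in>{Suc n..<N}. \<beta> m * (norm (E m x))\<^sup>2" and ?T = "\<Sum>m\<in>{Suc n..<N}. (norm (E m x))\<^sup>2"
    have b: "\<beta> n \<le> \<beta> (Suc n)" using inc by (simp add: incseq_SucD)
    have 1: "\<beta> n * ((norm (G n x))\<^sup>2 - (norm (G (Suc n) x))\<^sup>2) + energy X (\<beta> (Suc n)) x \<le> energy X (\<beta> n) x"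
      unfolding G_def by (rule energy_band[OF X b])
    have 2: "\<beta> n * ((norm (G (Suc n) x))\<^sup>2 - ?T) \<le> \<beta> (Suc n) * ((norm (G (Suc n) x))\<^sup>2 - ?T)"
      by (rule mult_right_mono[OF b]) (use tail[where n = "Suc n"] in simp)
    have s: "(\<Sum>m\<in>{n..<N}. h m) = h n + (\<Sum>m\<in>{Suc n..<N}. h m)" for h :: "nat \<Rightarrow> real"
      using step(2) by (simp add: sum.atLeast_Suc_lessThan)
    show ?case unfolding s using 1 2 step(3) by (simp add: algebra_simps)
  qed
  have bands: "(\<Sum>k<N. lev (Suc k) * (norm (B k x))\<^sup>2) + energy X (\<beta> 0) x \<le> energy X (lev N) x" for N x
  proof (induction N)
    case 0 then show ?case by (simp add: lev0)
  next
    case (Suc N)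
    have l: "lev (Suc N) \<le> lev N" using lev(1) by (simp add: decseq_Suc_iff)
    have "(norm (B N x))\<^sup>2 = (norm (spg X (lev (Suc N)) x))\<^sup>2 - (norm (spg X (lev N) x))\<^sup>2"
      unfolding B_def by (rule norm_compl[OF spg(1)[OF X] spg(1)[OF X] spg_antimono[OF X l]])
    then show ?case using Suc energy_band[OF X l, of x] by simp
  qed
  have "(\<Sum>n<N. \<beta> n * (norm (E n x))\<^sup>2) + (\<Sum>n<N. c n * (norm (Q n x))\<^sup>2) \<le> X x \<bullet> x" for N x
  proof (cases N)
    case 0 then show ?thesis using posD(3)[OF X] by simp
  next
    case (Suc k)
    have n0: "(norm (Q 0 x))\<^sup>2 = (norm (G 0 x))\<^sup>2 - (norm (osum E x))\<^sup>2"
      unfolding Q0 by (rule norm_compl[OF e(2) Gp SG0])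
    have "(norm (Q 0 x))\<^sup>2 \<le> (norm (G 0 x))\<^sup>2 - (\<Sum>m<N. (norm (E m x))\<^sup>2)"
      using n0 En[where N = N and x = x] by simp
    then have "\<beta> 0 * (norm (Q 0 x))\<^sup>2 \<le> \<beta> 0 * ((norm (G 0 x))\<^sup>2 - (\<Sum>m<N. (norm (E m x))\<^sup>2))"
      using pos by (intro mult_left_mono) auto
    moreover have "(\<Sum>m<N. \<beta> m * (norm (E m x))\<^sup>2) + \<beta> 0 * ((norm (G 0 x))\<^sup>2 - (\<Sum>m<N. (norm (E m x))\<^sup>2)) \<le> energy X (\<beta> 0) x"
      using abel[where n = 0 and N = N and x = x] by (simp add: lessThan_atLeast0)
    moreover have "(\<Sum>n<N. c n * (norm (Q n x))\<^sup>2) = \<beta> 0 * (norm (Q 0 x))\<^sup>2 + (\<Sum>n<k. lev (Suc n) * (norm (B n x))\<^sup>2)"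
      unfolding Suc sum.lessThan_Suc_shift by (simp add: c_def QS)
    ultimately show ?thesis using bands[where N = k and x = x] energy_le[OF X, of "lev k" x] by linarith
  qed
  moreover have "c n > 0" for n using pos lev(2) by (simp add: c_def split: nat.split)
  ultimately show ?thesis using that[OF E(1,2) Qo EQ _ sum] by blast
qed

end

section \<open>Filling the complement with the small part of an operator\<close>

context sf_factor
begin

lemma adj_add: "S \<in> M \<Longrightarrow> T \<in> M \<Longrightarrow> adj (S + T) = adj S + adj T"
  by (rule adj_eqI) (auto simp: M_bounded_ops M_add blinfun.add_left inner_add_left inner_add_right adj_inner)

lemma oseq_partial_sum: "oseq P \<Longrightarrow> (\<Sum>k<N. (norm (P k x))\<^sup>2) \<le> (norm (osum P x))\<^sup>2"
  using sum_le_suminf[OF sums_summable[OF osum_projection(6)[of P x]], of "{..<N}"]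
    sums_unique[OF osum_projection(6)[of P x]] by auto

lemma partiso_osum_component:
  assumes V: "\<And>n. partiso (V n) (P n) (Q n)" and P: "oseq P" and Q: "oseq Q"
  shows "P n (adj (osum V) x) = adj (V n) x"
proof -
  have "(\<lambda>k. P n (adj (V k) x)) sums P n (adj (osum V) x)"
    by (rule bounded_linear.sums[OF blinfun.bounded_linear_right partiso_osum(5)[OF V P Q]])
  moreover have "(\<lambda>k. P n (adj (V k) x)) = (\<lambda>k. if k = n then adj (V n) x else 0)"
  proof
    fix k
    show "P n (adj (V k) x) = (if k = n then adj (V n) x else 0)"
    proof (cases "k = n")
      case False
      have "P n (adj (V k) x) = P n (P k (adj (V k) x))" by (simp add: partisoD(8)[OF V])
      then show ?thesis using porthD[OF oseqD(2)[OF P, of n k]] False by simp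
    qed (simp add: partisoD(8)[OF V])
  qed
  ultimately have "(\<lambda>k. if k = n then adj (V n) x else 0) sums P n (adj (osum V) x)" by simp
  from sums_unique2[OF this sums_single] show ?thesis .
qed

text \<open>Restricting one partial isometry to two orthogonal summands keeps their images
  orthogonal.\<close>

lemma split_image:
  assumes le: "sle (P + Q) F" and o: "porth P Q" and P: "P \<in> projections M" and Q: "Q \<in> projections M"
  shows "\<exists>P' Q'. eqv P P' \<and> pleq P' F \<and> eqv Q Q' \<and> pleq Q' (F - P')"
proof -
  obtain G where G: "eqv (P + Q) G" "pleq G F" and F: "F \<in> projections M" using le by (auto simp: sle_def)
  obtain V where V: "partiso V (P + Q) G" using G by (auto simp: eqv_def)
  note p = partiso_restrict[OF V P pleq_add1[OF P Q o]] and q = partiso_restrict[OF V Q pleq_add2[OF P Q o]]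
  let ?P = "V o\<^sub>L P o\<^sub>L adj V" and ?Q = "V o\<^sub>L Q o\<^sub>L adj V"
  have e: "eqv P ?P" "eqv Q ?Q" using p(1) q(1) by (auto simp: eqv_def)
  have le: "pleq ?P F" "pleq ?Q F" using p(2) q(2) G(2) pleq_trans by blast+
  have "porth ?P ?Q"
    unfolding porth_def
  proof
    fix x
    have "?P (?Q x) = V (P (Q (adj V x)))"
      using p(3)[of "Q (adj V x)"] by simp
    then show "?P (?Q x) = 0" using porthD[OF o] by simp
  qed
  then have "pleq ?Q (F - ?P)" using le(2) by (simp add: pleq_def porth_def blinfun.diff_left)
  then show ?thesis using e le(1) by blast
qed

lemma tail_filler_finite:
  assumes B: "pos B" and tl: "\<And>e. e > 0 \<Longrightarrow> inft (supp B - spg B e)"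
    and N0: "sle N0 (null_proj B)" and S: "oseq S" "\<And>n. \<not> inft (S n)" and oN: "\<And>n. porth N0 (S n)"
    and \<zeta>: "\<zeta> > 0" and \<tau>: "\<And>n. \<tau> n > 0" and \<delta>: "\<delta> > 0"
  shows "\<exists>e. 0 < e \<and> e \<le> \<delta> \<and> (\<forall>Z. inft Z \<and> porth N0 Z \<and> (\<forall>n. porth Z (S n)) \<longrightarrow>
    (\<exists>u. partiso u (id_blinfun - spg B e) (N0 + Z + osum S) \<and>
    (\<forall>x c. (\<forall>N. \<zeta> * (norm (Z x))\<^sup>2 + (\<Sum>n<N. \<tau> n * (norm (S n x))\<^sup>2) \<le> c) \<longrightarrow> B (adj u x) \<bullet> adj u x \<le> c)))"
proof -
  define nb where "nb = null_proj B"
  have BM: "B \<in> M" using B by (rule posD)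
  note nb = null_proj_M[OF BM, folded nb_def]
  have Bnb: "B (nb x) = 0" for x using nb(2) projectionsD(2)[OF nb(1)] by blast
  have sB: "supp B = id_blinfun - nb" by (simp add: supp_def nb_def)
  note G = spg(1)[OF B]
  have Sp: "S n \<in> projections M" for n using S(1) by (rule oseqD)
  obtain R where R: "R \<in> projections M" "R \<noteq> 0" "\<not> inft R" by (rule finite_nonzero_exists)
  \<comment> \<open>A spare copy of a fixed nonzero R beside each S n. Infinitely many of them make
    the surpluses F2 n sum to an infinite projection.\<close>
  have "\<exists>RZ. eqv R RZ \<and> porth (S n) RZ" for n
  proof -
    have "inft (pinf id_blinfun (id_blinfun - S n))" by (rule inft_inf_compl[OF inft_id Sp S(2)])
    then obtain RZ where RZ: "eqv R RZ" "pleq RZ (pinf id_blinfun (id_blinfun - S n))"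
      using inft_absorbs[OF _ R(1)] unfolding sle_def by blast
    have "pleq (pinf id_blinfun (id_blinfun - S n)) (id_blinfun - S n)"
      using pinf[OF projection_id projection_compl[OF Sp]] by (intro pleqI) blast+
    then show ?thesis using RZ pleq_trans unfolding porth_compl[OF Sp] by blast
  qed
  then obtain RZ where RZ: "\<And>n. eqv R (RZ n)" and oSR: "\<And>n. porth (S n) (RZ n)" by metis
  have RZp: "RZ n \<in> projections M" for n using RZ eqv_projections by blast
  have RZf: "\<not> inft (RZ n)" for n using R(3) RZ inft_eqv eqv_sym by blast
  \<comment> \<open>The bands below e have an infinite sum, so finitely many of them already hold
    the finite S n + RZ n. The clause with e / 2 drives the levels to 0.\<close>
  have next_level: "\<exists>e'>0. e' \<le> t \<and> e' \<le> e / 2 \<and> sle (S n + RZ n) (spg B e' - spg B e)" if "e > 0" "t > 0" for e t n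
  proof -
    define lev where "lev k = e / 2 ^ k" for k :: nat
    have lev: "decseq lev" "\<And>k. lev k > 0" "lev \<longlonglongrightarrow> 0"
    proof -
      show "decseq lev" unfolding decseq_Suc_iff lev_def using \<open>e > 0\<close> by (simp add: field_simps)
      show "lev k > 0" for k using \<open>e > 0\<close> by (simp add: lev_def)
      have "(\<lambda>n. e * (1 / 2) ^ n) \<longlonglongrightarrow> e * 0" by (intro tendsto_mult tendsto_const LIMSEQ_power_zero) simp
      then show "lev \<longlonglongrightarrow> 0" by (simp add: lev_def[abs_def] power_divide)
    qed
    note b = spg_bands[OF B lev]
    have lev0: "lev 0 = e" by (simp add: lev_def)
    have SR: "S n + RZ n \<in> projections M" "\<not> inft (S n + RZ n)"
      using projection_add[OF Sp RZp oSR] finite_add[OF Sp S(2) RZp RZf oSR] by auto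
    have "inft (osum (\<lambda>k. spg B (lev (Suc k)) - spg B (lev k)))" unfolding b(3) lev0 by (rule tl[OF \<open>e > 0\<close>])
    then obtain m where m: "sle (S n + RZ n) (spg B (lev m) - spg B e)"
      using sequence_exceeds_finite[OF b(1) _ SR] unfolding b(2) lev0 by blast
    define e' where "e' = min (lev (Suc m)) t"
    have e': "e' > 0" "e' \<le> t" "e' \<le> lev m" "e' \<le> e / 2"
    proof -
      show "e' > 0" "e' \<le> t" using lev(2) that by (auto simp: e'_def)
      have "lev (Suc m) \<le> lev m" using lev(1) by (simp add: decseq_Suc_iff)
      then show "e' \<le> lev m" by (simp add: e'_def)
      have "lev (Suc m) \<le> lev 1" using lev(1) by (auto simp: decseq_def)
      then show "e' \<le> e / 2" by (simp add: e'_def lev_def)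
    qed
    have le1: "pleq (spg B (lev m)) (spg B e')" by (rule spg_antimono[OF B e'(3)])
    have le2: "pleq (spg B e) (spg B (lev m))"
      using spg_antimono[OF B] lev(1) lev0 unfolding decseq_def by (metis le0)
    have le3: "pleq (spg B e) (spg B e')" using le1 le2 pleq_trans by blast
    have "pleq (spg B (lev m) - spg B e) (spg B e' - spg B e)"
      unfolding pleq_def
    proof
      fix x
      have "spg B e (spg B (lev m) x) = spg B e x" by (rule pleqD'[OF le2 G G])
      then show "(spg B e' - spg B e) ((spg B (lev m) - spg B e) x) = (spg B (lev m) - spg B e) x"
        using pleqD[OF le1] pleqD[OF le3] by (simp add: blinfun.diff_left blinfun.diff_right projectionsD(2)[OF G])
    qed
    then have "sle (spg B (lev m) - spg B e) (spg B e' - spg B e)"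
      using sle_pleq projection_diff[OF G G le2] projection_diff[OF G G le3] by blast
    then show ?thesis using m sle_trans e' by blast
  qed
  \<comment> \<open>Below all three weights: \<tau> n for the copy of S n, \<zeta> for the surplus
    sent to Z, and \<delta> for the threshold itself.\<close>
  define cap where "cap n = min (\<tau> n) (min \<zeta> \<delta>)" for n
  have cap: "cap n > 0" for n using \<tau> \<zeta> \<delta> by (simp add: cap_def)
  have "\<exists>e. \<forall>n. (e n > 0 \<and> e n \<le> cap n) \<and> (e (Suc n) \<le> e n / 2 \<and> sle (S n + RZ n) (spg B (e (Suc n)) - spg B (e n)))"
  proof (rule dependent_nat_choice)
    show "\<exists>x. 0 < x \<and> x \<le> cap 0" using cap[of 0] by blast
    fix x n assume "0 < x \<and> x \<le> cap n"
    then show "\<exists>y. (0 < y \<and> y \<le> cap (Suc n)) \<and> y \<le> x / 2 \<and> sle (S n + RZ n) (spg B y - spg B x)"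
      using next_level[OF _ cap[of "Suc n"], of x n] by blast
  qed
  then obtain e where e: "\<And>n. e n > 0" "\<And>n. e n \<le> cap n" "\<And>n. e (Suc n) \<le> e n / 2"
    "\<And>n. sle (S n + RZ n) (spg B (e (Suc n)) - spg B (e n))" by blast
  have edec: "decseq e" unfolding decseq_Suc_iff using e(1,3) by (smt (verit) field_sum_of_halves)
  have elim: "e \<longlonglongrightarrow> 0"
  proof (rule tendsto_sandwich[of "\<lambda>_. 0" _ _ "\<lambda>n. e 0 * (1 / 2) ^ n"])
    have "e n \<le> e 0 * (1 / 2) ^ n" for n
    proof (induction n)
      case (Suc n) then show ?case using e(3)[of n] by simp
    qed simp
    then show "\<forall>\<^sub>F n in sequentially. e n \<le> e 0 * (1 / 2) ^ n" by simp
    show "\<forall>\<^sub>F n in sequentially. 0 \<le> e n" by (simp add: less_imp_le[OF e(1)])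
    have "(\<lambda>n. e 0 * (1 / 2) ^ n) \<longlonglongrightarrow> e 0 * 0" by (intro tendsto_mult tendsto_const LIMSEQ_power_zero) simp
    then show "(\<lambda>n. e 0 * (1 / 2) ^ n) \<longlonglongrightarrow> 0" by simp
  qed simp
  define F where "F = (\<lambda>n. spg B (e (Suc n)) - spg B (e n))"
  note bands = spg_bands[OF B edec e(1) elim, folded F_def]
  have F: "oseq F" by (rule bands(1))
  have Fp: "F n \<in> projections M" for n using F by (rule oseqD)
  have "\<forall>n. \<exists>P' Q'. eqv (S n) P' \<and> pleq P' (F n) \<and> eqv (RZ n) Q' \<and> pleq Q' (F n - P')"
    using split_image[OF e(4) oSR Sp RZp] by (simp add: F_def)
  then obtain F1 R2 where F1: "\<And>n. eqv (S n) (F1 n)" "\<And>n. pleq (F1 n) (F n)"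
    and R2: "\<And>n. eqv (RZ n) (R2 n)" "\<And>n. pleq (R2 n) (F n - F1 n)" by metis
  define F2 where "F2 n = F n - F1 n" for n
  have F1p: "F1 n \<in> projections M" for n using F1(1) eqv_projections by blast
  have F2p: "F2 n \<in> projections M" "pleq (F2 n) (F n)" for n
    unfolding F2_def using projection_diff[OF F1p Fp F1(2)] pleq_diff[OF F1p Fp F1(2)] by auto
  have F1o: "oseq F1" by (rule oseq_pleq[OF F F1p F1(2)])
  have F2o: "oseq F2" by (rule oseq_pleq[OF F F2p])
  have o12: "porth (F1 m) (F2 n)" for m n
  proof (cases "m = n")
    case True then show ?thesis unfolding F2_def using porth_diff[OF F1p Fp F1(2)] by simp
  next
    case False
    then have "porth (F m) (F n)" by (rule oseqD(2)[OF F])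
    then show ?thesis using porth_pleq[OF _ F1(2) F1p Fp] porth_pleq2[OF _ F2p(2)] by blast
  qed
  note f1 = osum_projection[OF F1o] and f2 = osum_projection[OF F2o]
  note add = osum_add[OF F1o F2o o12]
  have FF: "F = (\<lambda>n. F1 n + F2 n)" by (simp add: F2_def)
  have sumF: "osum F1 + osum F2 = supp B - spg B (e 0)" using add(2) bands(3) FF by simp
  have R2o: "oseq R2"
    by (rule oseq_pleq[OF F2o]) (use R2 eqv_projections F2_def in auto)
  have F2inf: "inft (osum F2)"
  proof (rule sequence_inft[OF R2o _ _ _ f2(2)])
    show "pleq (R2 n) (osum F2)" for n using R2(2)[of n] f2(3)[of n] pleq_trans by (auto simp: F2_def)
    show "eqv (R2 0) (R2 n)" for n using RZ R2(1) eqv_sym eqv_trans by meson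
    show "R2 0 \<noteq> 0" using R(2) eqv_0[OF RZ] eqv_0[OF R2(1)] by blast
  qed
  obtain nb1 where nb1: "eqv N0 nb1" "pleq nb1 nb" using N0 by (auto simp: sle_def nb_def)
  have nb1p: "nb1 \<in> projections M" using nb1(1) eqv_projections by auto
  define nb2 where "nb2 = nb - nb1"
  have nb2p: "nb2 \<in> projections M" "porth nb1 nb2" "pleq nb2 nb"
    unfolding nb2_def using projection_diff[OF nb1p nb(1) nb1(2)] porth_diff[OF nb1p nb(1) nb1(2)] pleq_diff[OF nb1p nb(1) nb1(2)] by auto
  have onF: "porth nb (F n)" for n
  proof -
    have "pleq (F n) (supp B)"
      using osum_projection(3)[OF F, of n] pleq_diff[OF G supp(1)[OF BM] spg_pleq_supp[OF B e(1)]] pleq_trans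
      unfolding bands(3) by blast
    then show ?thesis unfolding porth_compl[OF nb(1)] sB .
  qed
  have on: "porth nb (osum F1)" "porth nb (osum F2)"
    by (rule osum_projection(5)[OF F1o], rule porth_pleq2[OF onF F1(2)],
        rule osum_projection(5)[OF F2o], rule porth_pleq2[OF onF F2p(2)])
  have o2: "porth nb2 (osum F2)" using porth_pleq[OF on(2) nb2p(3) nb2p(1) nb(1)] .
  \<comment> \<open>Surplus of the bands together with the part of the null space not taken by N0;
    being infinite it is equivalent to every infinite Z.\<close>
  define F3 where "F3 = nb2 + osum F2"
  have F3p: "F3 \<in> projections M" unfolding F3_def by (rule projection_add[OF nb2p(1) f2(2) o2])
  have F3inf: "inft F3" using inft_pleq[OF F2inf F3p] pleq_add2[OF nb2p(1) f2(2) o2] by (simp add: F3_def)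
  obtain w where w: "partiso w nb1 N0" using nb1(1) eqv_sym unfolding eqv_def by blast
  obtain u1 where u1: "\<And>n. partiso (u1 n) (F1 n) (S n)" using eqv_sym[OF F1(1)] unfolding eqv_def by metis
  note U1 = partiso_osum(4)[OF u1 F1o S(1)]
  have o13: "porth (osum F1) F3"
    unfolding F3_def
  proof (rule porth_add2)
    have "porth nb2 (osum F1)" using porth_pleq[OF on(1) nb2p(3) nb2p(1) nb(1)] .
    then show "porth (osum F1) nb2" using porth_sym nb2p(1) f1(2) by blast
    show "porth (osum F1) (osum F2)" by (rule add(3))
  qed
  have ow1: "porth nb1 (osum F1)" using porth_pleq[OF on(1) nb1(2) nb1p nb(1)] .
  have ow3: "porth nb1 F3"
    unfolding F3_def by (rule porth_add2[OF nb2p(2)]) (rule porth_pleq[OF on(2) nb1(2) nb1p nb(1)])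
  have main: "\<exists>u. partiso u (id_blinfun - spg B (e 0)) (N0 + Z + osum S) \<and>
    (\<forall>x c. (\<forall>N. \<zeta> * (norm (Z x))\<^sup>2 + (\<Sum>n<N. \<tau> n * (norm (S n x))\<^sup>2) \<le> c) \<longrightarrow> B (adj u x) \<bullet> adj u x \<le> c)"
    if Z: "inft Z" and o: "porth N0 Z" "\<And>n. porth N0 (S n)" "\<And>n. porth Z (S n)" for Z
  proof -
  obtain v where v: "partiso v F3 Z" using inft_eqv_inft[OF F3inf Z] unfolding eqv_def by blast
  have oS: "porth N0 (osum S)" "porth Z (osum S)" using osum_projection(5)[OF S(1)] o(2,3) by auto
  have wv: "partiso (w + v) (nb1 + F3) (N0 + Z)" by (rule partiso_add[OF w v ow3 o(1)])
  define u where "u = (w + v) + osum u1"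
  have u: "partiso u ((nb1 + F3) + osum F1) ((N0 + Z) + osum S)"
    unfolding u_def
    by (rule partiso_add[OF wv U1]) (use porth_add ow1 porth_sym[OF o13 f1(2) F3p] oS in blast)+
  have dom: "(nb1 + F3) + osum F1 = id_blinfun - spg B (e 0)"
  proof -
    have "(nb1 + F3) + osum F1 = nb + (osum F1 + osum F2)" by (simp add: F3_def nb2_def)
    then show ?thesis unfolding sumF sB by simp
  qed
  have adju: "adj u x = adj w x + adj v x + adj (osum u1) x" for x
    by (simp add: u_def adj_add M_add partisoD(1)[OF w] partisoD(1)[OF v] partisoD(1)[OF U1] blinfun.add_left)
  have F1y: "F1 n (adj u x) = adj (u1 n) x" for n x
  proof -
    have F1F: "pleq (F1 n) (osum F1)" by (rule f1(3))
    have "porth (F1 n) nb1" using porth_pleq[OF porth_sym[OF ow1 nb1p f1(2)] F1F F1p f1(2)] .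
    then have "F1 n (adj w x) = 0" using porthD[of "F1 n" nb1 "adj w x"] by (simp add: partisoD(8)[OF w])
    moreover have "porth (F1 n) F3" using porth_pleq[OF o13 F1F F1p f1(2)] .
    then have "F1 n (adj v x) = 0" using porthD[of "F1 n" F3 "adj v x"] by (simp add: partisoD(8)[OF v])
    ultimately show ?thesis
      by (simp add: adju blinfun.add_right partiso_osum_component[OF u1 F1o S(1)])
  qed
  have F2y: "F2 n (adj u x) = F2 n (adj v x)" for n x
  proof -
    have F2F: "pleq (F2 n) (osum F2)" by (rule f2(3))
    have "porth (osum F2) nb1" using porth_sym[OF porth_pleq[OF on(2) nb1(2) nb1p nb(1)] nb1p f2(2)] .
    then have "porth (F2 n) nb1" using porth_pleq[OF _ F2F F2p(1) f2(2)] by blast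
    then have "F2 n (adj w x) = 0" using porthD[of "F2 n" nb1 "adj w x"] by (simp add: partisoD(8)[OF w])
    moreover have "porth (F2 n) (osum F1)"
      using porth_pleq[OF porth_sym[OF add(3) f1(2) f2(2)] F2F F2p(1) f2(2)] .
    then have "F2 n (adj (osum u1) x) = 0" using porthD[of "F2 n" "osum F1" "adj (osum u1) x"] by (simp add: partisoD(8)[OF U1])
    ultimately show ?thesis by (simp add: adju blinfun.add_right)
  qed
  have bound: "B (adj u x) \<bullet> adj u x \<le> c"
    if c: "\<forall>N. \<zeta> * (norm (Z x))\<^sup>2 + (\<Sum>n<N. \<tau> n * (norm (S n x))\<^sup>2) \<le> c" for x c
  proof -
    let ?y = "adj u x"
    have "(id_blinfun - spg B (e 0)) ?y = ?y" using partisoD(8)[OF u, of x] unfolding dom .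
    then have g0: "spg B (e 0) ?y = 0" by (simp add: blinfun.diff_left)
    have "(\<lambda>n. B ?y \<bullet> F n ?y) sums (B ?y \<bullet> osum F ?y)"
      using osum_projection(1)[OF F] by (rule bounded_linear.sums[OF bounded_linear_inner_right])
    moreover have "osum F ?y = ?y - nb ?y" using g0 by (simp add: bands(3) sB blinfun.diff_left)
    moreover have "B ?y \<bullet> nb ?y = 0" by (simp add: posD(2)[OF B] Bnb)
    ultimately have sums: "(\<lambda>n. B ?y \<bullet> F n ?y) sums (B ?y \<bullet> ?y)" by (simp add: inner_diff_right)
    have trm: "B ?y \<bullet> F n ?y \<le> e n * (norm (F n ?y))\<^sup>2" for n
    proof -
      have comm: "F n (B z) = B (F n z)" for z by (simp add: F_def blinfun.diff_left blinfun.diff_right spg_comm[OF B])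
      have "B ?y \<bullet> F n ?y = F n (B ?y) \<bullet> F n ?y" by (simp add: projectionsD(2,3)[OF Fp])
      then have 1: "B ?y \<bullet> F n ?y = B (F n ?y) \<bullet> F n ?y" by (simp add: comm)
      have le: "pleq (spg B (e n)) (spg B (e (Suc n)))" using spg_antimono[OF B] edec by (simp add: decseq_Suc_iff)
      have "spg B (e n) (F n ?y) = 0"
        by (simp add: F_def blinfun.diff_left blinfun.diff_right pleqD'[OF le G G] projectionsD(2)[OF G])
      then show ?thesis unfolding 1 by (rule spg_le[OF B])
    qed
    have part: "(\<Sum>n<N. B ?y \<bullet> F n ?y) \<le> c" for N
    proof -
      have "(\<Sum>n<N. B ?y \<bullet> F n ?y) \<le> (\<Sum>n<N. \<tau> n * (norm (S n x))\<^sup>2 + \<zeta> * (norm (F2 n (adj v x)))\<^sup>2)"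
      proof (rule sum_mono)
        fix n
        have "(norm (F n ?y))\<^sup>2 = (norm (F1 n ?y))\<^sup>2 + (norm (F2 n ?y))\<^sup>2"
          using porth_add_norm[OF F1p F2p(1) o12, of n n ?y] by (simp add: F2_def)
        also have "\<dots> = (norm (S n x))\<^sup>2 + (norm (F2 n (adj v x)))\<^sup>2"
          unfolding F1y F2y using partisoD(13)[OF u1] by simp
        finally have "e n * (norm (F n ?y))\<^sup>2 = e n * (norm (S n x))\<^sup>2 + e n * (norm (F2 n (adj v x)))\<^sup>2"
          by (simp add: distrib_left)
        moreover have "e n * (norm (S n x))\<^sup>2 \<le> \<tau> n * (norm (S n x))\<^sup>2"
          using e(2)[of n] by (intro mult_right_mono) (auto simp: cap_def)
        moreover have "e n * (norm (F2 n (adj v x)))\<^sup>2 \<le> \<zeta> * (norm (F2 n (adj v x)))\<^sup>2"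
          using e(2)[of n] by (intro mult_right_mono) (auto simp: cap_def)
        ultimately show "B ?y \<bullet> F n ?y \<le> \<tau> n * (norm (S n x))\<^sup>2 + \<zeta> * (norm (F2 n (adj v x)))\<^sup>2"
          using trm[of n] by linarith
      qed
      also have "\<dots> = (\<Sum>n<N. \<tau> n * (norm (S n x))\<^sup>2) + \<zeta> * (\<Sum>n<N. (norm (F2 n (adj v x)))\<^sup>2)"
        by (simp add: sum.distrib sum_distrib_left)
      also have "\<dots> \<le> (\<Sum>n<N. \<tau> n * (norm (S n x))\<^sup>2) + \<zeta> * (norm (Z x))\<^sup>2"
        using mult_left_mono[OF oseq_bessel[OF F2o, where n = N and x = "adj v x"], of \<zeta>] \<zeta> by (simp add: partisoD(13)[OF v])
      also have "\<dots> \<le> c" using c by (simp add: add.commute)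
      finally show ?thesis .
    qed
    show ?thesis
      by (rule LIMSEQ_le_const2[OF sums[unfolded sums_def]]) (use part in blast)
  qed
  show ?thesis using u bound unfolding dom by blast
  qed
  show ?thesis
  proof (rule exI[of _ "e 0"], intro conjI)
    show "0 < e 0" by (rule e(1))
    show "e 0 \<le> \<delta>" using e(2)[of 0] by (simp add: cap_def)
  qed (use main oN in blast)
qed

text \<open>Reduction to finite pieces: each S m is cut into finite T m k, re-enumerated as one
  sequence by Cantor pairing, with every piece inheriting the weight of its S m.\<close>

lemma tail_filler:
  assumes B: "pos B" and tl: "\<And>e. e > 0 \<Longrightarrow> inft (supp B - spg B e)"
    and N0: "sle N0 (null_proj B)" and S: "oseq S" and oN: "\<And>n. porth N0 (S n)"
    and \<zeta>: "\<zeta> > 0" and \<tau>: "\<And>n. \<tau> n > 0" and \<delta>: "\<delta> > 0"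
  shows "\<exists>e. 0 < e \<and> e \<le> \<delta> \<and> (\<forall>Z. inft Z \<and> porth N0 Z \<and> (\<forall>n. porth Z (S n)) \<longrightarrow>
    (\<exists>u. partiso u (id_blinfun - spg B e) (N0 + Z + osum S) \<and>
    (\<forall>x c. (\<forall>N. \<zeta> * (norm (Z x))\<^sup>2 + (\<Sum>n<N. \<tau> n * (norm (S n x))\<^sup>2) \<le> c) \<longrightarrow> B (adj u x) \<bullet> adj u x \<le> c)))"
proof -
  obtain Q0 where Q0: "Q0 \<in> projections M" "Q0 \<noteq> 0" "\<not> inft Q0" by (rule finite_nonzero_exists)
  have "\<forall>m. \<exists>T. oseq T \<and> (\<forall>n. sle (T n) Q0) \<and> osum T = S m"
    using decompose_small[OF Q0(1,2) oseqD(1)[OF S]] by metis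
  then obtain T where T: "\<And>m. oseq (T m)" "\<And>m n. sle (T m n) Q0" "\<And>m. osum (T m) = S m" by metis
  have TS: "pleq (T m k) (S m)" for m k using osum_projection(3)[OF T(1)] by (simp add: T(3)[symmetric])
  have Tp: "T m k \<in> projections M" for m k using T(1) by (rule oseqD)
  define T' where "T' n = T (fst (prod_decode n)) (snd (prod_decode n))" for n
  have T'o: "oseq T'"
    unfolding oseq_def
  proof (intro conjI allI impI)
    show "T' n \<in> projections M" for n by (simp add: T'_def Tp)
    fix m n :: nat assume mn: "m \<noteq> n"
    obtain a b c d where ab: "prod_decode m = (a, b)" and cd: "prod_decode n = (c, d)" by (metis surj_pair)
    have "(a, b) \<noteq> (c, d)" using mn ab cd by (metis prod_decode_inverse)
    then consider "a \<noteq> c" | "a = c" "b \<noteq> d" by blast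
    then have "porth (T a b) (T c d)"
    proof cases
      case 1
      then show ?thesis
        using porth_pleq[OF oseqD(2)[OF S] TS Tp oseqD(1)[OF S]] porth_pleq2[OF _ TS] by blast
    next
      case 2 then show ?thesis using oseqD(2)[OF T(1)] by blast
    qed
    then show "porth (T' m) (T' n)" by (simp add: T'_def ab cd)
  qed
  have T'S: "osum T' = osum S" using oseq_blocks(3)[OF T'o] by (simp add: T'_def T(3))
  have fin: "\<not> inft (T' n)" for n using T(2) inft_sle Q0(3) by (auto simp: T'_def)
  have oT: "porth N0 (T' n)" for n using porth_pleq2[OF oN TS] by (simp add: T'_def)
  define \<tau>' where "\<tau>' n = \<tau> (fst (prod_decode n))" for n
  have \<tau>': "\<tau>' n > 0" for n by (simp add: \<tau>'_def \<tau>)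
  obtain e where e: "0 < e" "e \<le> \<delta>" and fill: "\<And>Z. inft Z \<Longrightarrow> porth N0 Z \<Longrightarrow> (\<forall>n. porth Z (T' n)) \<Longrightarrow>
    (\<exists>u. partiso u (id_blinfun - spg B e) (N0 + Z + osum T') \<and>
    (\<forall>x c. (\<forall>N. \<zeta> * (norm (Z x))\<^sup>2 + (\<Sum>n<N. \<tau>' n * (norm (T' n x))\<^sup>2) \<le> c) \<longrightarrow> B (adj u x) \<bullet> adj u x \<le> c))"
    using tail_filler_finite[of B N0 T' \<zeta> \<tau>' \<delta>, OF B tl N0 T'o fin oT \<zeta> \<tau>' \<delta>] by blast
  have le: "(\<Sum>n<N. \<tau>' n * (norm (T' n x))\<^sup>2) \<le> (\<Sum>n<N. \<tau> n * (norm (S n x))\<^sup>2)" for N x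
  proof -
    define h where "h p = \<tau> (fst p) * (norm (T (fst p) (snd p) x))\<^sup>2" for p
    have "(\<Sum>n<N. \<tau>' n * (norm (T' n x))\<^sup>2) = (\<Sum>n<N. h (prod_decode n))"
      by (simp add: h_def \<tau>'_def T'_def)
    also have "\<dots> = sum h (prod_decode ` {..<N})"
      by (subst sum.reindex) (simp_all add: inj_prod_decode)
    \<comment> \<open>The first N codes decode into the N by N square, and row m of the square has
      total mass at most that of S m.\<close>
    also have "\<dots> \<le> sum h ({..<N} \<times> {..<N})"
    proof (rule sum_mono2)
      show "prod_decode ` {..<N} \<subseteq> {..<N} \<times> {..<N}"
      proof (clarsimp)
        fix n a b assume "n < N" "(a, b) = prod_decode n"
        then have "n = prod_encode (a, b)" by (metis prod_decode_inverse)
        then show "a < N \<and> b < N" using \<open>n < N\<close> le_prod_encode_1[of a b] le_prod_encode_2[of b a] by simp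
      qed
      show "0 \<le> h p" for p by (simp add: h_def less_imp_le[OF \<tau>])
    qed simp
    also have "\<dots> = (\<Sum>m<N. \<tau> m * (\<Sum>k<N. (norm (T m k x))\<^sup>2))"
      by (simp add: h_def sum.cartesian_product sum_distrib_left case_prod_beta)
    also have "\<dots> \<le> (\<Sum>m<N. \<tau> m * (norm (S m x))\<^sup>2)"
      using oseq_partial_sum[OF T(1)] by (intro sum_mono mult_left_mono) (auto simp: T(3)[symmetric] less_imp_le[OF \<tau>])
    finally show ?thesis .
  qed
  show ?thesis
  proof (rule exI[of _ e], intro conjI e allI impI; (elim conjE)?)
    fix Z assume Z: "inft Z" "porth N0 Z" "\<forall>n. porth Z (S n)"
    have "\<forall>n. porth Z (T' n)" using Z(3) porth_pleq2[OF _ TS] by (simp add: T'_def)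
    from fill[OF Z(1,2) this] obtain u where u: "partiso u (id_blinfun - spg B e) (N0 + Z + osum S)"
      "\<And>x c. (\<forall>N. \<zeta> * (norm (Z x))\<^sup>2 + (\<Sum>n<N. \<tau>' n * (norm (T' n x))\<^sup>2) \<le> c) \<Longrightarrow> B (adj u x) \<bullet> adj u x \<le> c"
      unfolding T'S by blast
    have "B (adj u x) \<bullet> adj u x \<le> c" if c: "\<forall>N. \<zeta> * (norm (Z x))\<^sup>2 + (\<Sum>n<N. \<tau> n * (norm (S n x))\<^sup>2) \<le> c" for x c
      by (rule u(2)) (use c le in \<open>meson add_left_mono order_trans\<close>)
    then show "\<exists>u. partiso u (id_blinfun - spg B e) (N0 + Z + osum S) \<and>
      (\<forall>x c. (\<forall>N. \<zeta> * (norm (Z x))\<^sup>2 + (\<Sum>n<N. \<tau> n * (norm (S n x))\<^sup>2) \<le> c) \<longrightarrow> B (adj u x) \<bullet> adj u x \<le> c)"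
      using u(1) by blast
  qed
qed

text \<open>\<open>T\<close> is the part of \<open>B\<close> that can be moved onto \<open>N0 + Z + Y + \<Sigma> S\<close> below the given weights.\<close>

definition fillable :: "(nat \<Rightarrow> real) \<Rightarrow> ('a \<Rightarrow>\<^sub>L 'a) \<Rightarrow> ('a \<Rightarrow>\<^sub>L 'a) \<Rightarrow> bool" where
  "fillable \<beta> B T \<longleftrightarrow> T \<in> projections M \<and> (\<forall>x. T (B x) = B (T x)) \<and>
    (\<forall>N0 Z Y S \<tau> \<zeta>. sle N0 (null_proj B) \<and> inft Z \<and> inft Y \<and> oseq S \<and> porth N0 Z \<and> porth N0 Y \<and> porth Z Y \<and>
      (\<forall>n. porth N0 (S n)) \<and> (\<forall>n. porth Z (S n)) \<and> (\<forall>n. porth Y (S n)) \<and> 0 < \<zeta> \<and> (\<forall>n. 0 \<le> \<tau> n) \<and>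
      (strict_mono \<beta> \<longrightarrow> (\<forall>n. 0 < \<tau> n)) \<longrightarrow>
    (\<exists>u. partiso u T (N0 + Z + Y + osum S) \<and>
      (\<forall>x c. (\<forall>N. \<beta> 0 * (norm (Y x))\<^sup>2 + \<zeta> * (norm (Z x))\<^sup>2 + (\<Sum>n<N. \<tau> n * (norm (S n x))\<^sup>2) \<le> c) \<longrightarrow>
        B (adj u x) \<bullet> adj u x \<le> c)))"

text \<open>The target contains the infinite Y, so it is equivalent to the infinite null projection,
  on which the form of B is 0.\<close>

lemma fillable_infinite_null:
  assumes B: "pos B" and nb: "inft (null_proj B)" and \<beta>: "\<beta> 0 \<ge> 0"
  shows "fillable \<beta> B (null_proj B)"
proof -
  note N = null_proj_M[OF posD(1)[OF B]] and BN = null_proj_pos(1)[OF B] and NB = null_proj_pos(2)[OF B]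
  show ?thesis
    unfolding fillable_def
  proof (intro conjI allI impI; (elim conjE)?)
    fix N0 Z Y S and \<tau> :: "nat \<Rightarrow> real" and \<zeta> :: real
    assume N0: "sle N0 (null_proj B)" and Z: "inft Z" and Y: "inft Y" and S: "oseq S" and o: "porth N0 Z" "porth N0 Y" "porth Z Y"
      "\<forall>n. porth N0 (S n)" "\<forall>n. porth Z (S n)" "\<forall>n. porth Y (S n)" and \<zeta>: "0 < \<zeta>" and \<tau>: "\<forall>n. 0 \<le> \<tau> n"
    have p: "Z \<in> projections M" "N0 \<in> projections M" "Y \<in> projections M" using Z Y inft_projection N0 sle_projections by auto
    have 1: "N0 + Z \<in> projections M" "porth (N0 + Z) Y" using projection_add[OF p(2,1) o(1)] porth_add o(2,3) by auto
    have 2: "N0 + Z + Y \<in> projections M" "pleq Y (N0 + Z + Y)" using projection_add[OF 1(1) p(3) 1(2)] pleq_add2[OF 1(1) p(3) 1(2)] by auto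
    have oS: "porth (N0 + Z + Y) (osum S)" using osum_projection(5)[OF S] o(4-6) by (intro porth_add) auto
    have "inft (N0 + Z + Y + osum S)"
      using inft_pleq[OF Y projection_add[OF 2(1) osum_projection(2)[OF S] oS]]
        pleq_trans[OF 2(2) pleq_add1[OF 2(1) osum_projection(2)[OF S] oS]] by blast
    then obtain u where u: "partiso u (null_proj B) (N0 + Z + Y + osum S)"
      using inft_eqv_inft[OF nb] unfolding eqv_def by blast
    have "B (adj u x) \<bullet> adj u x \<le> c"
      if c: "\<forall>N. \<beta> 0 * (norm (Y x))\<^sup>2 + \<zeta> * (norm (Z x))\<^sup>2 + (\<Sum>n<N. \<tau> n * (norm (S n x))\<^sup>2) \<le> c" for x c
    proof -
      have "B (adj u x) = 0" using BN[of "adj u x"] by (simp add: partisoD(8)[OF u])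
      moreover have "0 \<le> \<beta> 0 * (norm (Y x))\<^sup>2 + \<zeta> * (norm (Z x))\<^sup>2" using \<beta> \<zeta> by simp
      ultimately show ?thesis using spec[OF c, of 0] by simp
    qed
    then show "\<exists>u. partiso u (null_proj B) (N0 + Z + Y + osum S) \<and>
      (\<forall>x c. (\<forall>N. \<beta> 0 * (norm (Y x))\<^sup>2 + \<zeta> * (norm (Z x))\<^sup>2 + (\<Sum>n<N. \<tau> n * (norm (S n x))\<^sup>2) \<le> c) \<longrightarrow>
        B (adj u x) \<bullet> adj u x \<le> c)" using u by blast
  qed (simp_all add: N(1) BN NB)
qed

text \<open>\<open>tail_filler\<close> returns a threshold e that may lie below \<delta>. The band
  from e to \<delta> is sent into Y, where the available height \<beta> 0 is at least \<delta>, and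
  the rest of Y joins Z. Strict monotonicity of \<beta> makes the weights \<tau> n positive, as the
  filler requires.\<close>

lemma fillable_small_tail:
  assumes B: "pos B" and tl: "\<And>e. e > 0 \<Longrightarrow> inft (supp B - spg B e)" and sm: "strict_mono \<beta>"
    and \<delta>: "\<delta> > 0" "\<delta> \<le> \<beta> 0"
  shows "fillable \<beta> B (id_blinfun - spg B \<delta>)"
  unfolding fillable_def
proof (intro conjI allI impI; (elim conjE)?)
  note G = spg(1)[OF B]
  show "id_blinfun - spg B \<delta> \<in> projections M" by (rule projection_compl[OF G])
  show "(id_blinfun - spg B \<delta>) (B x) = B ((id_blinfun - spg B \<delta>) x)" for x
    by (simp add: blinfun.diff_left blinfun.diff_right spg_comm[OF B])
  fix N0 Z Y S and \<tau> :: "nat \<Rightarrow> real" and \<zeta> :: real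
  assume h: "sle N0 (null_proj B)" "inft Z" "inft Y" "oseq S" "porth N0 Z" "porth N0 Y" "porth Z Y"
    "\<forall>n. porth N0 (S n)" "\<forall>n. porth Z (S n)" "\<forall>n. porth Y (S n)" "0 < \<zeta>" "strict_mono \<beta> \<longrightarrow> (\<forall>n. 0 < \<tau> n)"
  define \<zeta>' where "\<zeta>' = min \<zeta> \<delta>"
  have \<zeta>': "\<zeta>' > 0" "\<zeta>' \<le> \<zeta>" "\<zeta>' \<le> \<delta>" using h(11) \<delta> by (auto simp: \<zeta>'_def)
  obtain e where e: "0 < e" "e \<le> \<delta>" and fill: "\<And>Z. inft Z \<Longrightarrow> porth N0 Z \<Longrightarrow> (\<forall>n. porth Z (S n)) \<Longrightarrow>
    (\<exists>u. partiso u (id_blinfun - spg B e) (N0 + Z + osum S) \<and>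
    (\<forall>x c. (\<forall>N. \<zeta>' * (norm (Z x))\<^sup>2 + (\<Sum>n<N. \<tau> n * (norm (S n x))\<^sup>2) \<le> c) \<longrightarrow> B (adj u x) \<bullet> adj u x \<le> c))"
    using tail_filler[of B N0 S \<zeta>' \<tau> \<delta>, OF B tl h(1,4) _ \<zeta>'(1) _ \<delta>(1)] h(8,12) sm by blast
  have le: "pleq (spg B \<delta>) (spg B e)" by (rule spg_antimono[OF B e(2)])
  define D where "D = spg B e - spg B \<delta>"
  have D: "D \<in> projections M" "porth (spg B \<delta>) D" "pleq D (spg B e)"
    unfolding D_def using projection_diff[OF G G le] porth_diff[OF G G le] pleq_diff[OF G G le] by auto
  obtain Y1 Y2 where Y12: "inft Y1" "inft Y2" "porth Y1 Y2" "Y = Y1 + Y2" using inft_halve[OF h(3)] by blast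
  note Yp = inft_projection[OF h(3)] and Y1p = inft_projection[OF Y12(1)] and Y2p = inft_projection[OF Y12(2)]
  obtain D' where D': "eqv D D'" "pleq D' Y1" using inft_absorbs[OF Y12(1) D(1)] by (auto simp: sle_def)
  have D'p: "D' \<in> projections M" using D'(1) eqv_projections by blast
  have D'Y: "pleq D' Y" using D'(2) pleq_add1[OF Y1p Y2p Y12(3)] pleq_trans unfolding Y12(4) by blast
  define Y' where "Y' = Y - D'"
  have Y': "Y' \<in> projections M" "porth D' Y'" "pleq Y' Y"
    unfolding Y'_def using projection_diff[OF D'p Yp D'Y] porth_diff[OF D'p Yp D'Y] pleq_diff[OF D'p Yp D'Y] by auto
  define Z' where "Z' = Z + Y'"
  note Zp = inft_projection[OF h(2)]
  have ZY': "porth Z Y'" by (rule porth_pleq2[OF h(7) Y'(3)])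
  have Z'p: "Z' \<in> projections M" unfolding Z'_def by (rule projection_add[OF Zp Y'(1) ZY'])
  have Z'inf: "inft Z'" using inft_pleq[OF h(2) Z'p] pleq_add1[OF Zp Y'(1) ZY'] by (simp add: Z'_def)
  have NZ': "porth N0 Z'" unfolding Z'_def by (rule porth_add2[OF h(5) porth_pleq2[OF h(6) Y'(3)]])
  have Y'S: "porth Y' (S n)" for n using porth_pleq[OF _ Y'(3) Y'(1) Yp] h(10) by blast
  have Z'S: "porth Z' (S n)" for n unfolding Z'_def using porth_add h(9) Y'S by blast
  obtain u where u: "partiso u (id_blinfun - spg B e) (N0 + Z' + osum S)"
    and ub: "\<And>x c. (\<forall>N. \<zeta>' * (norm (Z' x))\<^sup>2 + (\<Sum>n<N. \<tau> n * (norm (S n x))\<^sup>2) \<le> c) \<Longrightarrow> B (adj u x) \<bullet> adj u x \<le> c"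
    using fill[OF Z'inf NZ'] Z'S by blast
  obtain d where d: "partiso d D D'" using D'(1) by (auto simp: eqv_def)
  have oD: "porth (id_blinfun - spg B e) D" using D(3) by (simp add: porth_def pleq_def blinfun.diff_left)
  have oR: "porth (N0 + Z' + osum S) D'"
  proof (intro porth_add)
    show "porth N0 D'" by (rule porth_pleq2[OF h(6) D'Y])
    show "porth Z' D'"
      unfolding Z'_def by (rule porth_add[OF porth_pleq2[OF h(7) D'Y] porth_sym[OF Y'(2) D'p Y'(1)]])
    have "porth D' (osum S)" by (rule osum_projection(5)[OF h(4)]) (use porth_pleq[OF _ D'Y D'p Yp] h(10) in blast)
    then show "porth (osum S) D'" using porth_sym D'p osum_projection(2)[OF h(4)] by blast
  qed
  have "partiso (u + d) ((id_blinfun - spg B e) + D) ((N0 + Z' + osum S) + D')"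
    by (rule partiso_add[OF u d oD oR])
  moreover have "(id_blinfun - spg B e) + D = id_blinfun - spg B \<delta>" by (simp add: D_def)
  moreover have "(N0 + Z' + osum S) + D' = N0 + Z + Y + osum S" by (simp add: Z'_def Y'_def)
  ultimately have ud': "partiso (u + d) (id_blinfun - spg B \<delta>) (N0 + Z + Y + osum S)" by simp
  have "B (adj (u + d) x) \<bullet> adj (u + d) x \<le> c"
    if c: "\<forall>N. \<beta> 0 * (norm (Y x))\<^sup>2 + \<zeta> * (norm (Z x))\<^sup>2 + (\<Sum>n<N. \<tau> n * (norm (S n x))\<^sup>2) \<le> c" for x c
  proof -
    let ?y = "adj (u + d) x"
    have ad: "?y = adj u x + adj d x" by (simp add: adj_add partisoD(1)[OF u] partisoD(1)[OF d] blinfun.add_left)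
    have "D (adj u x) = 0"
      using porthD[OF porth_sym[OF oD projection_compl[OF G] D(1)], of "adj u x"] by (simp add: partisoD(8)[OF u])
    then have Dy: "D ?y = adj d x" "?y - D ?y = adj u x" by (simp_all add: ad blinfun.add_right partisoD(8)[OF d])
    have Dc: "D (B z) = B (D z)" for z by (simp add: D_def blinfun.diff_left blinfun.diff_right spg_comm[OF B])
    have 1: "B ?y \<bullet> ?y = B (adj d x) \<bullet> adj d x + B (adj u x) \<bullet> adj u x"
      using energy_split[OF B D(1) Dc, of ?y] unfolding Dy(2) unfolding Dy(1) .
    have "spg B \<delta> (adj d x) = 0" using porthD[OF D(2), of "adj d x"] by (simp add: partisoD(8)[OF d])
    then have 2: "B (adj d x) \<bullet> adj d x \<le> \<delta> * (norm (D' x))\<^sup>2"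
      using spg_le[OF B] partisoD(13)[OF d, of x] by metis
    have nY: "(norm (Y x))\<^sup>2 = (norm (D' x))\<^sup>2 + (norm (Y' x))\<^sup>2"
      using norm_compl[OF D'p Yp D'Y, of x] by (simp add: Y'_def)
    have nZ: "(norm (Z' x))\<^sup>2 = (norm (Z x))\<^sup>2 + (norm (Y' x))\<^sup>2"
      unfolding Z'_def by (rule porth_add_norm[OF Zp Y'(1) ZY'])
    have m: "\<zeta>' * (norm (Z x))\<^sup>2 \<le> \<zeta> * (norm (Z x))\<^sup>2" "\<zeta>' * (norm (Y' x))\<^sup>2 \<le> \<beta> 0 * (norm (Y' x))\<^sup>2"
      "\<delta> * (norm (D' x))\<^sup>2 \<le> \<beta> 0 * (norm (D' x))\<^sup>2"
      using \<zeta>' \<delta> by (intro mult_right_mono; simp)+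
    have "B (adj u x) \<bullet> adj u x \<le> c - \<delta> * (norm (D' x))\<^sup>2"
    proof (rule ub, rule allI)
      fix N
      have "\<beta> 0 * (norm (Y x))\<^sup>2 = \<beta> 0 * (norm (D' x))\<^sup>2 + \<beta> 0 * (norm (Y' x))\<^sup>2"
        "\<zeta>' * (norm (Z' x))\<^sup>2 = \<zeta>' * (norm (Z x))\<^sup>2 + \<zeta>' * (norm (Y' x))\<^sup>2"
        by (simp_all add: nY nZ distrib_left)
      then show "\<zeta>' * (norm (Z' x))\<^sup>2 + (\<Sum>n<N. \<tau> n * (norm (S n x))\<^sup>2) \<le> c - \<delta> * (norm (D' x))\<^sup>2"
        using spec[OF c, of N] m by linarith
    qed
    then show ?thesis using 1 2 by simp
  qed
  then show "\<exists>u. partiso u (id_blinfun - spg B \<delta>) (N0 + Z + Y + osum S) \<and>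
      (\<forall>x c. (\<forall>N. \<beta> 0 * (norm (Y x))\<^sup>2 + \<zeta> * (norm (Z x))\<^sup>2 + (\<Sum>n<N. \<tau> n * (norm (S n x))\<^sup>2) \<le> c) \<longrightarrow>
        B (adj u x) \<bullet> adj u x \<le> c)" using ud' by blast
qed

end

section \<open>Removing one copy\<close>

text \<open>Cauchy-Schwarz with weights: the squared sum is at most (p/\<sigma> + q/\<beta>) times
  the right-hand side, and the first factor is at most 1/f.\<close>

lemma weighted_two_square:
  fixes a c :: "'a::real_inner"
  assumes s: "\<sigma> > 0" "\<beta> > 0" "f > 0" and p: "p \<ge> 0" "q \<ge> 0" and pq: "p / \<sigma> + q / \<beta> \<le> 1 / f"
  shows "f * (norm (sqrt p *\<^sub>R a + sqrt q *\<^sub>R c))\<^sup>2 \<le> \<sigma> * (norm a)\<^sup>2 + \<beta> * (norm c)\<^sup>2"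
proof -
  define x y where "x = norm a" and "y = norm c"
  have "norm (sqrt p *\<^sub>R a + sqrt q *\<^sub>R c) \<le> sqrt p * x + sqrt q * y"
    using norm_triangle_ineq[of "sqrt p *\<^sub>R a" "sqrt q *\<^sub>R c"] p by (simp add: x_def y_def)
  then have 1: "(norm (sqrt p *\<^sub>R a + sqrt q *\<^sub>R c))\<^sup>2 \<le> (sqrt p * x + sqrt q * y)\<^sup>2" by (rule power_mono) simp
  \<comment> \<open>The defect in the weighted Cauchy-Schwarz inequality, written as a
    square.\<close>
  have "0 \<le> (sqrt p * \<beta> * y - sqrt q * \<sigma> * x)\<^sup>2 / (\<sigma> * \<beta>)" using s by simp
  also have "(sqrt p * \<beta> * y - sqrt q * \<sigma> * x)\<^sup>2 / (\<sigma> * \<beta>)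
      = (p / \<sigma> + q / \<beta>) * (\<sigma> * x\<^sup>2 + \<beta> * y\<^sup>2) - (sqrt p * x + sqrt q * y)\<^sup>2"
    using s p by (simp add: field_simps power2_eq_square)
  finally have "(sqrt p * x + sqrt q * y)\<^sup>2 \<le> (p / \<sigma> + q / \<beta>) * (\<sigma> * x\<^sup>2 + \<beta> * y\<^sup>2)" by simp
  also have "\<dots> \<le> 1 / f * (\<sigma> * x\<^sup>2 + \<beta> * y\<^sup>2)"
    using pq s by (intro mult_right_mono) auto
  finally have "f * (sqrt p * x + sqrt q * y)\<^sup>2 \<le> \<sigma> * x\<^sup>2 + \<beta> * y\<^sup>2" using s by (simp add: field_simps)
  moreover have "f * (norm (sqrt p *\<^sub>R a + sqrt q *\<^sub>R c))\<^sup>2 \<le> f * (sqrt p * x + sqrt q * y)\<^sup>2"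
    using 1 s by (intro mult_left_mono) auto
  ultimately show ?thesis by (simp add: x_def y_def)
qed

context sf_factor
begin

lemma partisoI:
  assumes V: "V \<in> M" and P: "P \<in> projections M" and VV: "\<And>x. adj V (V x) = P x"
  shows "partiso V P (V o\<^sub>L adj V)"
proof -
  have bo: "V \<in> bounded_ops" using V by (rule M_bounded_ops)
  have n: "norm (V x) = norm (P x)" for x
  proof -
    have "(norm (V x))\<^sup>2 = (norm (P x))\<^sup>2"
      using projectionsD(4)[OF P, of x] VV[of x] adj_inner'[OF bo, of "V x" x] by (simp add: power2_norm_eq_inner)
    then show ?thesis by simp
  qed
  have VP: "V (P x) = V x" for x
  proof -
    have "norm (V (P x - x)) = 0" unfolding n by (simp add: blinfun.diff_right projectionsD(2)[OF P])
    then show ?thesis by (simp add: blinfun.diff_right)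
  qed
  have "V o\<^sub>L adj V \<in> projections M"
    by (rule projectionsI) (simp_all add: M_comp V M_adj VV VP adj_inner[OF bo] adj_inner'[OF bo, symmetric])
  then show ?thesis unfolding partiso_def using V P VV by simp
qed

text \<open>A copy of \<open>P\<close> tilted towards \<open>V0\<close>. It fits below \<open>s P + b V0\<close> although its weight \<open>f\<close> may exceed \<open>s\<close>.\<close>

lemma tilted_copy:
  assumes P: "P \<in> projections M" and PV: "eqv P V0" "porth P V0"
    and c: "0 < s" "s \<le> f" "0 < f" "f < b"
  obtains W where "eqv P W" "pleq W (P + V0)"
    "\<And>y. f * (norm (W y))\<^sup>2 \<le> s / 4 * (norm (P y))\<^sup>2 + b * (norm (V0 y))\<^sup>2"
    "s / 4 * (1 / f - 1 / b) * (norm (P x))\<^sup>2 \<le> (norm (W x))\<^sup>2"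
proof -
  obtain v0 where v0: "partiso v0 P V0" using PV by (auto simp: eqv_def)
  \<comment> \<open>v0 or - v0, whichever makes the cross term at x nonnegative, so that the tilt
    cannot cancel P x.\<close>
  obtain v where v: "partiso v P V0" and sgn: "0 \<le> P x \<bullet> adj v x"
  proof (cases "0 \<le> P x \<bullet> adj v0 x")
    case True then show ?thesis using that v0 by blast
  next
    case False
    note d = partisoD[OF v0]
    have a: "adj (- v0) = - adj v0"
      by (rule adj_eqI) (use M_scaleR[OF d(1), of "-1"] in \<open>auto simp: M_bounded_ops blinfun.minus_left d(10)\<close>)
    have "partiso (- v0) P V0"
      unfolding partiso_def a using M_scaleR[OF d(1), of "-1"]
      by (simp add: blinfun.minus_left blinfun.minus_right d(2-5))
    then show ?thesis using that[of "- v0"] False a by (simp add: blinfun.minus_left)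
  qed
  note d = partisoD[OF v]
  \<comment> \<open>Chosen so that p / (s/4) = 1/f - 1/b. With q \<le> 1 the V0 component costs at
    most 1/b, and the two costs add up to at most 1/f.\<close>
  define p where "p = s / 4 * (1 / f - 1 / b)"
  have fb: "0 < 1 / f - 1 / b" using c by (simp add: field_simps)
  have p0: "0 < p" using fb c by (simp add: p_def)
  have "p \<le> s / 4 * (1 / f)" unfolding p_def using c by (intro mult_left_mono) auto
  also have "\<dots> \<le> 1 / 4" using c by (simp add: field_simps)
  finally have p1: "p \<le> 1" by simp
  define q where "q = 1 - p"
  have q0: "0 \<le> q" "q \<le> 1" using p0 p1 by (auto simp: q_def)
  define w where "w = sqrt p *\<^sub>R P + sqrt q *\<^sub>R v"
  have wM: "w \<in> M" by (simp add: w_def M_add M_scaleR d(1) projectionsD(1)[OF P])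
  have wx: "w y = sqrt p *\<^sub>R P y + sqrt q *\<^sub>R v y" for y by (simp add: w_def blinfun.add_left blinfun.scaleR_left)
  have adjw: "adj w = sqrt p *\<^sub>R P + sqrt q *\<^sub>R adj v"
    by (rule adj_eqI[OF M_bounded_ops[OF wM]])
      (simp add: wx blinfun.add_left blinfun.scaleR_left inner_add_left inner_add_right d(10) projectionsD(3)[OF P])
  have aw: "adj w y = sqrt p *\<^sub>R P y + sqrt q *\<^sub>R adj v y" for y by (simp add: adjw blinfun.add_left blinfun.scaleR_left)
  have Pv: "P (v y) = 0" for y using porthD[OF PV(2), of "v y"] by (simp add: d(7))
  have avP: "adj v (P y) = 0" for y
    using porthD[OF porth_sym[OF PV(2) P d(3)], of y] d(9)[of "P y"] by simp
  have ww: "adj w (w y) = P y" for y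
  proof -
    have "adj w (w y) = (sqrt p * sqrt p) *\<^sub>R P y + (sqrt q * sqrt q) *\<^sub>R P y"
      by (simp add: aw wx blinfun.add_right blinfun.scaleR_right Pv avP d(4) projectionsD(2)[OF P])
    also have "\<dots> = (p + q) *\<^sub>R P y" using p0 q0 by (simp add: scaleR_add_left)
    finally show ?thesis by (simp add: q_def)
  qed
  define W where "W = w o\<^sub>L adj w"
  have W: "partiso w P W" unfolding W_def by (rule partisoI[OF wM P ww])
  have nW: "norm (W y) = norm (sqrt p *\<^sub>R P y + sqrt q *\<^sub>R adj v y)" for y
    using partisoD(13)[OF W, of y] by (simp add: aw)
  have nv: "norm (adj v y) = norm (V0 y)" for y by (rule d(13))
  show ?thesis
  proof (rule that)
    show "eqv P W" using W by (auto simp: eqv_def)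
    show "pleq W (P + V0)"
      using Pv porthD[OF porth_sym[OF PV(2) P d(3)]]
      by (simp add: pleq_def W_def wx blinfun.add_left blinfun.add_right blinfun.scaleR_right d(7) projectionsD(2)[OF P])
    show "f * (norm (W y))\<^sup>2 \<le> s / 4 * (norm (P y))\<^sup>2 + b * (norm (V0 y))\<^sup>2" for y
      unfolding nW nv[symmetric]
    proof (rule weighted_two_square)
      have "p / (s / 4) = 1 / f - 1 / b" using c by (simp add: p_def)
      moreover have "q / b \<le> 1 / b" using q0 c by (intro divide_right_mono) auto
      ultimately show "p / (s / 4) + q / b \<le> 1 / f" by simp
    qed (use c p0 q0 in auto)
    have "p * (norm (P x))\<^sup>2 \<le> (norm (sqrt p *\<^sub>R P x + sqrt q *\<^sub>R adj v x))\<^sup>2"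
    proof -
      have "(norm (sqrt p *\<^sub>R P x + sqrt q *\<^sub>R adj v x))\<^sup>2
          = p * (norm (P x))\<^sup>2 + 2 * (sqrt p * sqrt q * (P x \<bullet> adj v x)) + q * (norm (adj v x))\<^sup>2"
        using p0 q0 unfolding power2_norm_eq_inner by (simp add: algebra_simps inner_commute) (simp add: mult.assoc[symmetric])
      moreover have "0 \<le> sqrt p * sqrt q * (P x \<bullet> adj v x)" using sgn p0 q0 by simp
      moreover have "0 \<le> q * (norm (adj v x))\<^sup>2" using q0 by simp
      ultimately show ?thesis by linarith
    qed
    then show "s / 4 * (1 / f - 1 / b) * (norm (P x))\<^sup>2 \<le> (norm (W x))\<^sup>2" by (simp add: nW p_def)
  qed
qed

text \<open>The F n and T commute with B and sum to the identity, so the form of B is the sum of its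
  forms on the pieces.\<close>

lemma quadratic_form_pieces:
  assumes B: "pos B" and F: "oseq F" "osum F = id_blinfun - T" and Fc: "\<And>n x. F n (B x) = B (F n x)"
    and T: "T \<in> projections M" "\<And>x. T (B x) = B (T x)"
  shows "B (F n y) \<bullet> F n y \<le> B y \<bullet> y"
    "(\<And>N. (\<Sum>n<N. B (F n y) \<bullet> F n y) + B (T y) \<bullet> T y \<le> c) \<Longrightarrow> B y \<bullet> y \<le> c"
proof -
  note Fp = oseqD(1)[OF F(1)]
  show "B (F n y) \<bullet> F n y \<le> B y \<bullet> y"
    using energy_split[OF B Fp Fc, of y n] posD(3)[OF B] by (simp add: add_increasing2)
  assume c: "\<And>N. (\<Sum>n<N. B (F n y) \<bullet> F n y) + B (T y) \<bullet> T y \<le> c"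
  have "(\<lambda>n. B y \<bullet> F n y) sums (B y \<bullet> osum F y)"
    using osum_projection(1)[OF F(1)] by (rule bounded_linear.sums[OF bounded_linear_inner_right])
  moreover have "B y \<bullet> F n y = B (F n y) \<bullet> F n y" for n
    by (metis Fc projectionsD(2,3)[OF Fp])
  moreover have "B y \<bullet> T y = B (T y) \<bullet> T y" by (metis T projectionsD(2,3)[OF T(1)])
  then have "B y \<bullet> osum F y = B y \<bullet> y - B (T y) \<bullet> T y" by (simp add: F(2) blinfun.diff_left inner_diff_right)
  ultimately have "(\<lambda>n. B (F n y) \<bullet> F n y) sums (B y \<bullet> y - B (T y) \<bullet> T y)" by simp
  then have "B y \<bullet> y - B (T y) \<bullet> T y \<le> c - B (T y) \<bullet> T y"
    unfolding sums_def by (rule LIMSEQ_le_const2) (use c in \<open>simp add: le_diff_eq\<close>)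
  then show "B y \<bullet> y \<le> c" by simp
qed

text \<open>A budget over the decomposition of the space into N0, P, the E n and the Q n. F 0 goes
  to W + K0 inside P + E 0, F (n+1) to K n inside E (n+2), and T is spread over N0, the leftover Z
  of P + E 0, E 1, and S n = J n + Q n. What A retains is bounded below by L, which keeps \<beta> n
  on the infinite J n, so the step can be repeated.\<close>

lemma remove_copy:
  assumes A: "pos A" and B: "pos B" and g: "good \<beta> A" and inc: "incseq \<beta>" and fill: "fillable \<beta> B T"
    and F: "oseq F" "osum F = id_blinfun - T" and Fc: "\<And>n x. F n (B x) = B (F n x)"
    and Fb: "\<And>n x. F (Suc n) x = x \<Longrightarrow> B x \<bullet> x \<le> \<beta> n * (norm x)\<^sup>2"
    and F0: "\<And>x. F 0 x = x \<Longrightarrow> \<delta> * (norm x)\<^sup>2 \<le> B x \<bullet> x" "\<And>x. F 0 x = x \<Longrightarrow> B x \<bullet> x \<le> f * (norm x)\<^sup>2"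
      "0 < \<delta>" "0 < f" "f < \<beta> 0"
    and Q0: "Q0 \<in> projections M" "\<not> inft Q0" "pleq Q0 (F 0)"
    and P: "sle P Q0" and s: "0 < s" "s \<le> f" "\<And>y. s * (norm (P y))\<^sup>2 \<le> A y \<bullet> y"
    and N: "sle (null_proj A) (null_proj B)"
  shows "\<exists>C. unitarily_equiv M C B \<and> pos (A - C) \<and> good \<beta> (A - C) \<and>
    (strict_mono \<beta> \<longrightarrow> null_proj (A - C) = null_proj A) \<and>
    \<delta> * (1 / f - 2 / (f + \<beta> 0)) / 4 * (s * (norm (P x))\<^sup>2) \<le> C x \<bullet> x"
proof -
  \<comment> \<open>Strictly between f and \<beta> 0: height b pays for the tilt, and \<beta> 0 - b
    is a reserve on E 0.\<close>
  define b where "b = (f + \<beta> 0) / 2"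
  have b: "f < b" "b < \<beta> 0" using F0(5) by (auto simp: b_def)
  have Pp: "P \<in> projections M" using P sle_projections by blast
  have Pf: "\<not> inft P" using P Q0(2) inft_sle by blast
  have \<beta>pos: "0 < \<beta> n" for n using F0(4,5) inc incseqD[OF inc, of 0 n] by simp
  have AM: "A \<in> M" and BM: "B \<in> M" using A B posD by auto
  obtain X where X: "pos X" and XP: "\<And>x. X (P x) = 0"
    and AX: "\<And>x. s / 2 * (norm (P x))\<^sup>2 + X x \<bullet> x \<le> A x \<bullet> x" and gX: "good \<beta> X"
    and kX: "\<And>x. X x = 0 \<Longrightarrow> A (x - P x) = 0"
    using decouple[OF A Pp Pf s(1,3) g] by blast
  have XM: "X \<in> M" using X by (rule posD)
  define N0 where "N0 = null_proj A"
  note N0 = null_proj_M[OF AM, folded N0_def]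
  define SX where "SX = supp X"
  have oNP: "porth N0 P"
  proof -
    have "P (N0 x) = 0" for x
    proof -
      have "A (N0 x) = 0" using N0 projectionsD(2)[OF N0(1)] by blast
      then have "s * (norm (P (N0 x)))\<^sup>2 \<le> 0" using s(3)[of "N0 x"] by simp
      then show ?thesis using s(1) by (simp add: mult_le_0_iff)
    qed
    then have "porth P N0" by (simp add: porth_def)
    then show ?thesis using porth_sym Pp N0(1) by blast
  qed
  have nullX: "null_proj X = N0 + P"
  proof (rule projection_eqI[OF null_proj_M(1)[OF XM] projection_add[OF N0(1) Pp oNP]])
    fix x
    show "null_proj X x = x \<longleftrightarrow> (N0 + P) x = x"
    proof
      assume "null_proj X x = x"
      then have "N0 (x - P x) = x - P x" using kX N0(2) null_proj_M(2)[OF XM] by blast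
      then show "(N0 + P) x = x" using porthD[OF oNP, of x] by (simp add: blinfun.add_left blinfun.diff_right)
    next
      assume x: "(N0 + P) x = x"
      have "X (N0 x) = 0"
      proof -
        have "A (N0 x) = 0" using N0 projectionsD(2)[OF N0(1)] by blast
        then have "X (N0 x) \<bullet> N0 x \<le> 0" using AX[of "N0 x"] s(1) by (smt (verit) inner_zero_left mult_nonneg_nonneg zero_le_power2 half_gt_zero)
        then show ?thesis using pos_zero[OF X] posD(3)[OF X, of "N0 x"] by simp
      qed
      then have "X ((N0 + P) x) = 0" by (simp add: blinfun.add_left blinfun.add_right XP)
      then show "null_proj X x = x" using x null_proj_M(2)[OF XM] by simp
    qed
  qed
  have total: "N0 + P + SX = id_blinfun" by (simp add: SX_def supp_def nullX)
  have oNPX: "porth (N0 + P) SX" unfolding SX_def supp_def nullX by (simp add: porth_def blinfun.diff_left blinfun.diff_right projectionsD(2)[OF projection_add[OF N0(1) Pp oNP]])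
  have oNX: "porth N0 SX" using porth_pleq[OF oNPX pleq_add1[OF N0(1) Pp oNP] N0(1) projection_add[OF N0(1) Pp oNP]] .
  have oPX: "porth P SX" using porth_pleq[OF oNPX pleq_add2[OF N0(1) Pp oNP] Pp projection_add[OF N0(1) Pp oNP]] .
  obtain E Q c where E: "oseq E" "\<And>n. inft (E n)" and Q: "oseq Q" and EQ: "\<And>m n. porth (E m) (Q n)"
    and c: "\<And>n. (c n :: real) > 0" and EQX: "osum E + osum Q = SX"
    and XEQ: "\<And>x N. (\<Sum>n<N. \<beta> n * (norm (E n x))\<^sup>2) + (\<Sum>n<N. c n * (norm (Q n x))\<^sup>2) \<le> X x \<bullet> x"
    unfolding SX_def using diagonal_lower_bound[OF X gX inc \<beta>pos] by blast
  note Ep = oseqD(1)[OF E(1)] and Qp = oseqD(1)[OF Q]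
  note sumE = osum_projection[OF E(1)] and sumQ = osum_projection[OF Q]
  have oEQ: "porth (osum E) (osum Q)" by (rule osum_add(3)[OF E(1) Q EQ])
  have EX: "pleq (E n) SX" and QX: "pleq (Q n) SX" for n
    using pleq_trans[OF sumE(3) pleq_add1[OF sumE(2) sumQ(2) oEQ]] pleq_trans[OF sumQ(3) pleq_add2[OF sumE(2) sumQ(2) oEQ]]
    unfolding EQX by auto
  have oNE: "porth N0 (E n)" and oNQ: "porth N0 (Q n)" and oPE: "porth P (E n)" and oPQ: "porth P (Q n)" for n
    using porth_pleq2[OF oNX EX] porth_pleq2[OF oNX QX] porth_pleq2[OF oPX EX] porth_pleq2[OF oPX QX] by auto
  \<comment> \<open>G1 provides the direction V0 of the tilt and an infinite leftover; G2 provides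
    room for the part of F 0 outside F'.\<close>
  obtain G1 G2 where G: "inft G1" "inft G2" "porth G1 G2" "E 0 = G1 + G2" using inft_halve[OF E(2)] by blast
  note G1p = inft_projection[OF G(1)] and G2p = inft_projection[OF G(2)]
  have GE: "pleq G1 (E 0)" "pleq G2 (E 0)"
    unfolding G(4) using pleq_add1[OF G1p G2p G(3)] pleq_add2[OF G1p G2p G(3)] by auto
  obtain V0 where V0: "eqv P V0" "pleq V0 G1" using inft_absorbs[OF G(1) Pp] by (auto simp: sle_def)
  have V0p: "V0 \<in> projections M" using V0(1) eqv_projections by blast
  have V0E: "pleq V0 (E 0)" using V0(2) GE(1) pleq_trans by blast
  have oPV: "porth P V0" by (rule porth_pleq2[OF oPE V0E])
  obtain W where W: "eqv P W" "pleq W (P + V0)"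
    and Wb: "\<And>y. f * (norm (W y))\<^sup>2 \<le> s / 4 * (norm (P y))\<^sup>2 + b * (norm (V0 y))\<^sup>2"
    and Wx: "s / 4 * (1 / f - 1 / b) * (norm (P x))\<^sup>2 \<le> (norm (W x))\<^sup>2"
    using tilted_copy[OF Pp V0(1) oPV s(1,2) F0(4) b(1), of x] by blast
  have Wp: "W \<in> projections M" using W(1) eqv_projections by blast
  \<comment> \<open>The part of F 0 that is carried to the tilted W; through it the lower bound
    \<delta> of B on F 0 is felt at x.\<close>
  obtain F' where F': "eqv P F'" "pleq F' Q0" using P by (auto simp: sle_def)
  have F'p: "F' \<in> projections M" using F'(1) eqv_projections by blast
  have F'0: "pleq F' (F 0)" using F'(2) Q0(3) pleq_trans by blast
  note F0p = oseqD(1)[OF F(1), of 0]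
  have F0F': "F 0 - F' \<in> projections M" "porth F' (F 0 - F')"
    using projection_diff[OF F'p F0p F'0] porth_diff[OF F'p F0p F'0] by auto
  obtain K0 where K0: "eqv (F 0 - F') K0" "pleq K0 G2" using inft_absorbs[OF G(2) F0F'(1)] by (auto simp: sle_def)
  have K0p: "K0 \<in> projections M" using K0(1) eqv_projections by blast
  have K0E: "pleq K0 (E 0)" using K0(2) GE(2) pleq_trans by blast
  have oVK: "porth V0 K0" using porth_pleq2[OF porth_pleq[OF G(3) V0(2) V0p G1p] K0(2)] .
  have PVp: "P + V0 \<in> projections M" by (rule projection_add[OF Pp V0p oPV])
  have oWK: "porth W K0"
    by (rule porth_pleq[OF porth_add[OF porth_pleq2[OF oPE K0E] oVK] W(2) Wp PVp])
  define WK where "WK = W + K0"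
  have WKp: "WK \<in> projections M" unfolding WK_def by (rule projection_add[OF Wp K0p oWK])
  have "eqv F' W" using F'(1) W(1) eqv_sym eqv_trans by blast
  then have "eqv (F' + (F 0 - F')) WK" unfolding WK_def by (rule eqv_add[OF _ K0(1) F0F'(2) oWK])
  then have FWK: "eqv (F 0) WK" by simp
  define PE where "PE = P + E 0"
  have PEp: "PE \<in> projections M" unfolding PE_def by (rule projection_add[OF Pp Ep oPE])
  have PPE: "pleq P PE" "pleq (E 0) PE" unfolding PE_def by (rule pleq_add1[OF Pp Ep oPE], rule pleq_add2[OF Pp Ep oPE])
  have WPE: "pleq W PE" using W(2) pleq_add_least[OF PPE(1) pleq_trans[OF V0E PPE(2)]] pleq_trans by blast
  have WKPE: "pleq WK PE" unfolding WK_def by (rule pleq_add_least[OF WPE pleq_trans[OF K0E PPE(2)]])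
  \<comment> \<open>What W and K0 leave of P + E 0. It is infinite because it contains G1 - V0, and
    V0 is finite.\<close>
  define Z where "Z = PE - WK"
  have Zp: "Z \<in> projections M" and WKZ: "porth WK Z" and ZPE: "pleq Z PE"
    unfolding Z_def using projection_diff[OF WKp PEp WKPE] porth_diff[OF WKp PEp WKPE] pleq_diff[OF WKp PEp WKPE] by auto
  have Zinf: "inft Z"
  proof -
    have d: "G1 - V0 \<in> projections M" "porth V0 (G1 - V0)" "pleq (G1 - V0) G1"
      using projection_diff[OF V0p G1p V0(2)] porth_diff[OF V0p G1p V0(2)] pleq_diff[OF V0p G1p V0(2)] by auto
    have "\<not> inft V0" using V0(1) Pf inft_eqv eqv_sym by blast
    then have inf: "inft (G1 - V0)" using finite_add[OF V0p _ d(1) _ d(2)] G(1) by force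
    have dE: "pleq (G1 - V0) (E 0)" using d(3) GE(1) pleq_trans by blast
    have "porth W (G1 - V0)"
      by (rule porth_pleq[OF porth_add[OF porth_pleq2[OF oPE dE] d(2)] W(2) Wp PVp])
    moreover have "porth K0 (G1 - V0)"
      using porth_pleq[OF porth_pleq2[OF porth_sym[OF G(3) G1p G2p] d(3)] K0(2) K0p G2p] .
    ultimately have "porth WK (G1 - V0)" unfolding WK_def by (rule porth_add)
    moreover have "pleq (G1 - V0) PE" using dE PPE(2) pleq_trans by blast
    ultimately have "pleq (G1 - V0) Z" by (simp add: Z_def pleq_def porth_def blinfun.diff_left)
    then show ?thesis by (rule inft_pleq[OF inf Zp])
  qed
  \<comment> \<open>The copy of F (n+1) is confined to one half of E (n+2), so the other half keeps
    the complement infinite.\<close>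
  have "\<forall>n. \<exists>K. eqv (F (Suc n)) K \<and> pleq K (E (Suc (Suc n))) \<and> inft (E (Suc (Suc n)) - K)"
  proof
    fix n
    obtain H1 H2 where H: "inft H1" "inft H2" "porth H1 H2" "E (Suc (Suc n)) = H1 + H2" using inft_halve[OF E(2)] by blast
    note H1p = inft_projection[OF H(1)] and H2p = inft_projection[OF H(2)]
    obtain K where K: "eqv (F (Suc n)) K" "pleq K H1" using inft_absorbs[OF H(1) oseqD(1)[OF F(1)]] by (auto simp: sle_def)
    have Kp: "K \<in> projections M" using K(1) eqv_projections by blast
    have KE: "pleq K (E (Suc (Suc n)))" using pleq_trans[OF K(2) pleq_add1[OF H1p H2p H(3)]] unfolding H(4) .
    have "porth K H2" using porth_pleq[OF H(3) K(2) Kp H1p] .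
    then have "pleq H2 (E (Suc (Suc n)) - K)"
      using pleq_add2[OF H1p H2p H(3)] unfolding H(4) by (simp add: pleq_def porth_def blinfun.diff_left)
    then have "inft (E (Suc (Suc n)) - K)" by (rule inft_pleq[OF H(2) projection_diff[OF Kp Ep KE]])
    then show "\<exists>K. eqv (F (Suc n)) K \<and> pleq K (E (Suc (Suc n))) \<and> inft (E (Suc (Suc n)) - K)" using K KE by blast
  qed
  then obtain K where K: "\<And>n. eqv (F (Suc n)) (K n)" "\<And>n. pleq (K n) (E (Suc (Suc n)))" "\<And>n. inft (E (Suc (Suc n)) - K n)"
    by metis
  define J where "J n = E (Suc (Suc n)) - K n" for n
  have Kp: "K n \<in> projections M" for n using K(1) eqv_projections by blast
  have Jp: "J n \<in> projections M" and JE: "pleq (J n) (E (Suc (Suc n)))" and KJ0: "porth (K n) (J n)" for n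
    unfolding J_def using projection_diff[OF Kp Ep K(2)] pleq_diff[OF Kp Ep K(2)] porth_diff[OF Kp Ep K(2)] by auto
  have oE2: "oseq (\<lambda>n. E (Suc (Suc n)))" by (rule oseq_subseq[OF E(1)]) (simp add: inj_def)
  have Ko: "oseq K" by (rule oseq_pleq[OF oE2 Kp K(2)])
  have Jo: "oseq J" by (rule oseq_pleq[OF oE2 Jp JE])
  have KJ: "porth (K m) (J n)" for m n
  proof (cases "m = n")
    case True then show ?thesis using KJ0 by simp
  next
    case False
    then have "porth (E (Suc (Suc m))) (E (Suc (Suc n)))" by (intro oseqD(2)[OF E(1)]) simp
    then show ?thesis using porth_pleq[OF _ K(2) Kp Ep] porth_pleq2[OF _ JE] by blast
  qed
  have JQ: "porth (J m) (Q n)" and KQ: "porth (K m) (Q n)" for m n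
    using porth_pleq[OF EQ JE Jp Ep] porth_pleq[OF EQ K(2) Kp Ep] by auto
  define S where "S n = J n + Q n" for n
  have So: "oseq S" and sumS: "osum S = osum J + osum Q"
    unfolding S_def using osum_add[OF Jo Q JQ] by auto
  have oPEE: "porth PE (E (Suc n))" and oPEQ: "porth PE (Q n)" for n
    unfolding PE_def using porth_add[OF oPE oseqD(2)[OF E(1), of 0 "Suc n"]] porth_add[OF oPQ EQ] by auto
  have oPEJ: "porth PE (J n)" and oPEK: "porth PE (K n)" for n
    using porth_pleq2[OF oPEE JE] porth_pleq2[OF oPEE K(2)] by auto
  have oPES: "porth PE (S n)" for n unfolding S_def by (rule porth_add2[OF oPEJ oPEQ])
  have oNPE: "porth N0 PE" unfolding PE_def by (rule porth_add2[OF oNP oNE])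
  have oNS: "porth N0 (S n)" for n unfolding S_def by (rule porth_add2[OF porth_pleq2[OF oNE JE] oNQ])
  have E1S: "porth (E 1) (S n)" for n
    unfolding S_def by (rule porth_add2[OF porth_pleq2[OF oseqD(2)[OF E(1)] JE] EQ]) simp
  have ZS: "porth Z (S n)" and ZE1: "porth Z (E 1)" for n
    using porth_pleq[OF oPES ZPE Zp PEp] porth_pleq[OF oPEE[of 0] ZPE Zp PEp] by auto
  have NZ: "porth N0 Z" by (rule porth_pleq2[OF oNPE ZPE])
  \<comment> \<open>Of the s/2 available on P the tilt uses s/4, Z uses at most s/8, and s/8 is
    left; on E 0 the filler gets half of the reserve.\<close>
  define \<zeta> where "\<zeta> = min (s / 8) ((\<beta> 0 - b) / 2)"
  have \<zeta>: "0 < \<zeta>" "\<zeta> \<le> s / 8" "\<zeta> \<le> (\<beta> 0 - b) / 2"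
    unfolding \<zeta>_def using s(1) b by - (simp, rule min.cobounded1, rule min.cobounded2)
  \<comment> \<open>On J n at most the gap between \<beta> n and \<beta> (n+2), on Q n at most half
    of its weight; so \<beta> n remains on J n and c n / 2 on Q n.\<close>
  define \<tau> where "\<tau> n = min (\<beta> (Suc (Suc n)) - \<beta> n) (c n / 2)" for n
  have \<tau>le: "\<tau> n \<le> \<beta> (Suc (Suc n)) - \<beta> n" "\<tau> n \<le> c n / 2" for n
    unfolding \<tau>_def by (rule min.cobounded1, rule min.cobounded2)
  have \<tau>0: "0 \<le> \<tau> n" for n using incseqD[OF inc, of n "Suc (Suc n)"] c[of n] by (simp add: \<tau>_def)
  have \<tau>1: "strict_mono \<beta> \<longrightarrow> (\<forall>n. 0 < \<tau> n)"
    using c by (auto simp: \<tau>_def strict_mono_less)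
  obtain ut where ut: "partiso ut T (N0 + Z + E 1 + osum S)"
    and utb: "\<And>x d. (\<forall>N. \<beta> 0 * (norm (E 1 x))\<^sup>2 + \<zeta> * (norm (Z x))\<^sup>2 + (\<Sum>n<N. \<tau> n * (norm (S n x))\<^sup>2) \<le> d) \<Longrightarrow>
        B (adj ut x) \<bullet> adj ut x \<le> d"
    using fill NZ oNE[of 1] ZE1 oNS ZS E1S \<zeta>(1) \<tau>0 \<tau>1 Zinf E(2)[of 1] So N
    unfolding fillable_def N0_def by blast
  have Tp: "T \<in> projections M" and Tc: "\<And>x. T (B x) = B (T x)" using fill by (auto simp: fillable_def)
  define R where "R n = (case n of 0 \<Rightarrow> WK | Suc k \<Rightarrow> K k)" for n
  have FR: "eqv (F n) (R n)" for n using FWK K(1) by (auto simp: R_def split: nat.split)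
  have Rp: "R n \<in> projections M" for n using FR eqv_projections by blast
  have oWKK: "porth WK (K n)" for n by (rule porth_pleq[OF oPEK WKPE WKp PEp])
  have Ro: "oseq R"
    unfolding oseq_def
  proof (intro conjI allI impI Rp)
    fix m n :: nat assume "m \<noteq> n"
    then show "porth (R m) (R n)"
      using oWKK porth_sym[OF oWKK WKp Kp] oseqD(2)[OF Ko] by (cases m; cases n) (auto simp: R_def)
  qed
  obtain V where V: "\<And>n. partiso (V n) (F n) (R n)" using FR unfolding eqv_def by metis
  note UF = partiso_osum(4)[OF V F(1) Ro]
  have sumR: "osum R = WK + osum K" using osum_split_first(1)[OF Ro] by (simp add: R_def)
  have oR: "porth (N0 + Z + E 1 + osum S) (R n)" for n
  proof (intro porth_add)
    have sS: "osum S \<in> projections M" using So by (rule osum_projection)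
    show "porth N0 (R n)"
      using porth_pleq2[OF oNPE WKPE] porth_pleq2[OF oNE K(2)] by (auto simp: R_def split: nat.split)
    show "porth Z (R n)"
      using porth_sym[OF WKZ WKp Zp] porth_pleq[OF oPEK ZPE Zp PEp] by (auto simp: R_def split: nat.split)
    have "porth (E 1) WK" using porth_pleq2[OF porth_sym[OF oPEE[of 0] PEp Ep] WKPE] by simp
    moreover have "porth (E 1) (K k)" for k using porth_pleq2[OF oseqD(2)[OF E(1)] K(2)] by simp
    ultimately show "porth (E 1) (R n)" by (auto simp: R_def split: nat.split)
    have "porth (R n) (S m)" for m
    proof (cases n)
      case 0 then show ?thesis using porth_pleq[OF oPES WKPE WKp PEp] by (simp add: R_def)
    next
      case (Suc k) then show ?thesis unfolding S_def using porth_add2[OF KJ KQ] by (simp add: R_def)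
    qed
    then have "porth (R n) (osum S)" by (rule osum_projection(5)[OF So])
    then show "porth (osum S) (R n)" using porth_sym Rp sS by blast
  qed
  have oTF: "porth T (osum F)" by (simp add: F(2) porth_def blinfun.diff_left blinfun.diff_right projectionsD(2)[OF Tp])
  define U where "U = ut + osum V"
  have U: "partiso U (T + osum F) ((N0 + Z + E 1 + osum S) + osum R)"
    unfolding U_def by (rule partiso_add[OF ut UF oTF osum_projection(5)[OF Ro oR]])
  have dom: "T + osum F = id_blinfun" by (simp add: F(2))
  \<comment> \<open>The pieces on the target side also exhaust the space, so U is unitary and not
    merely an isometry onto a part.\<close>
  have ran: "(N0 + Z + E 1 + osum S) + osum R = id_blinfun"
  proof -
    have "osum (\<lambda>n. K n + J n) = osum K + osum J" by (rule osum_add(2)[OF Ko Jo KJ])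
    then have "osum (\<lambda>n. E (Suc (Suc n))) = osum K + osum J" by (simp add: J_def)
    moreover have "osum E = E 0 + (E 1 + osum (\<lambda>n. E (Suc (Suc n))))"
      using osum_split_first(1)[OF E(1)] osum_split_first(1)[OF oseq_subseq[OF E(1), of Suc]] by simp
    ultimately have "(N0 + Z + E 1 + osum S) + osum R = N0 + P + SX"
      by (simp add: sumS sumR Z_def PE_def EQX[symmetric])
    then show ?thesis using total by simp
  qed
  note U' = U[unfolded dom ran]
  have UM: "U \<in> M" using U by (rule partisoD)
  define C where "C = U o\<^sub>L B o\<^sub>L adj U"
  have ue: "unitarily_equiv M C B"
    unfolding unitarily_equiv_def C_def
    by (rule bexI[OF _ UM]) (auto intro!: blinfun_eqI simp: partisoD(4,5)[OF U'])
  have Cx: "C y \<bullet> y = B (adj U y) \<bullet> adj U y" for y by (simp add: C_def partisoD(10)[OF U'])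
  have adjU: "adj U y = adj ut y + adj (osum V) y" for y
    by (simp add: U_def adj_add partisoD(1)[OF ut] partisoD(1)[OF UF] blinfun.add_left)
  have TU: "T (adj U y) = adj ut y" for y
    using porthD[OF oTF, of "adj (osum V) y"] by (simp add: adjU blinfun.add_right partisoD(8)[OF ut] partisoD(8)[OF UF])
  have FU: "F n (adj U y) = adj (V n) y" for n y
  proof -
    have "porth (osum F) T" using porth_sym[OF oTF Tp] osum_projection(2)[OF F(1)] by blast
    then have "porth (F n) T" using porth_pleq[OF _ osum_projection(3)[OF F(1)] oseqD(1)[OF F(1)] osum_projection(2)[OF F(1)]] by blast
    then have "F n (adj ut y) = 0" using porthD[of "F n" T "adj ut y"] by (simp add: partisoD(8)[OF ut])
    then show ?thesis by (simp add: adjU blinfun.add_right partiso_osum_component[OF V F(1) Ro])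
  qed
  have nFU: "norm (F n (adj U y)) = norm (R n y)" for n y unfolding FU by (rule partisoD(13)[OF V])
  note qf = quadratic_form_pieces[OF B F Fc Tp Tc]
  have lower: "\<delta> * (1 / f - 2 / (f + \<beta> 0)) / 4 * (s * (norm (P x))\<^sup>2) \<le> C x \<bullet> x"
  proof -
    have "\<delta> * (1 / f - 2 / (f + \<beta> 0)) / 4 * (s * (norm (P x))\<^sup>2) = \<delta> * (s / 4 * (1 / f - 1 / b) * (norm (P x))\<^sup>2)"
      by (simp add: b_def)
    also have "\<dots> \<le> \<delta> * (norm (W x))\<^sup>2" using Wx F0(3) by (intro mult_left_mono) auto
    also have "\<dots> \<le> \<delta> * (norm (WK x))\<^sup>2"
      using porth_add_norm[OF Wp K0p oWK, of x] F0(3) by (intro mult_left_mono) (auto simp: WK_def)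
    also have "\<dots> = \<delta> * (norm (F 0 (adj U x)))\<^sup>2" using nFU[of 0 x] by (simp add: R_def)
    also have "\<dots> \<le> B (F 0 (adj U x)) \<bullet> F 0 (adj U x)" by (rule F0(1)) (rule projectionsD(2)[OF F0p])
    also have "\<dots> \<le> C x \<bullet> x" unfolding Cx by (rule qf(1))
    finally show ?thesis .
  qed
  \<comment> \<open>The unspent part of the budget, truncated at N: a lower bound for the form of A
    - C.\<close>
  define L where "L N y = s / 8 * (norm (P y))\<^sup>2 + (\<beta> 0 - b) / 2 * (norm (E 0 y))\<^sup>2 + (\<beta> 1 - \<beta> 0) * (norm (E 1 y))\<^sup>2
      + (\<Sum>n<N. \<beta> n * (norm (J n y))\<^sup>2 + (\<beta> (Suc (Suc n)) - \<beta> n) * (norm (K n y))\<^sup>2 + c n / 2 * (norm (Q n y))\<^sup>2)" for N y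
  have \<beta>2: "0 \<le> \<beta> (Suc (Suc n)) - \<beta> n" for n using incseqD[OF inc, of n "Suc (Suc n)"] by simp
  have trm0: "0 \<le> \<beta> n * (norm (J n y))\<^sup>2 + (\<beta> (Suc (Suc n)) - \<beta> n) * (norm (K n y))\<^sup>2 + c n / 2 * (norm (Q n y))\<^sup>2" for n y
    using \<beta>pos[of n] \<beta>2[of n] c[of n] by simp
  have Lmono: "L N y \<le> L N' y" if "N \<le> N'" for N N' y
    unfolding L_def using trm0 that by (intro add_left_mono sum_mono2) auto
  have Elow: "s / 2 * (norm (P y))\<^sup>2 + \<beta> 0 * (norm (E 0 y))\<^sup>2 + \<beta> 1 * (norm (E 1 y))\<^sup>2
      + (\<Sum>n<N. \<beta> (Suc (Suc n)) * ((norm (K n y))\<^sup>2 + (norm (J n y))\<^sup>2)) + (\<Sum>n<N. c n * (norm (Q n y))\<^sup>2) \<le> A y \<bullet> y" for N y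
  proof -
    have "(norm (E (Suc (Suc n)) y))\<^sup>2 = (norm (K n y))\<^sup>2 + (norm (J n y))\<^sup>2" for n
      using norm_compl[OF Kp Ep K(2), of n y] by (simp add: J_def)
    then have 1: "(\<Sum>n<Suc (Suc N). \<beta> n * (norm (E n y))\<^sup>2) = \<beta> 0 * (norm (E 0 y))\<^sup>2 + \<beta> 1 * (norm (E 1 y))\<^sup>2
        + (\<Sum>n<N. \<beta> (Suc (Suc n)) * ((norm (K n y))\<^sup>2 + (norm (J n y))\<^sup>2))"
      by (simp add: sum.lessThan_Suc_shift del: sum.lessThan_Suc)
    have 2: "(\<Sum>n<N. c n * (norm (Q n y))\<^sup>2) \<le> (\<Sum>n<Suc (Suc N). c n * (norm (Q n y))\<^sup>2)"
      using c by (intro sum_mono2) (auto simp: less_imp_le)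
    show ?thesis using XEQ[where N = "Suc (Suc N)" and x = y] AX[of y] 1 2 by linarith
  qed
  have upper: "L N y + C y \<bullet> y \<le> A y \<bullet> y" for N y
  proof -
    let ?z = "adj U y"
    have "B ?z \<bullet> ?z \<le> A y \<bullet> y - L N y"
    proof (rule qf(2))
      fix N1
      have "B (adj ut y) \<bullet> adj ut y \<le> A y \<bullet> y - L N y - (\<Sum>n<N1. B (F n ?z) \<bullet> F n ?z)"
      proof (rule utb, rule allI)
        fix N2
        define m where "m = max N (max N1 N2)"
        have m: "N \<le> m" "N1 \<le> Suc m" "N2 \<le> m" by (auto simp: m_def)
        have i: "(\<Sum>n<N1. B (F n ?z) \<bullet> F n ?z) \<le> f * ((norm (W y))\<^sup>2 + (norm (K0 y))\<^sup>2) + (\<Sum>n<m. \<beta> n * (norm (K n y))\<^sup>2)"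
        proof -
          have "(\<Sum>n<N1. B (F n ?z) \<bullet> F n ?z) \<le> (\<Sum>n<Suc m. B (F n ?z) \<bullet> F n ?z)"
            using m posD(3)[OF B] by (intro sum_mono2) auto
          also have "\<dots> = B (F 0 ?z) \<bullet> F 0 ?z + (\<Sum>n<m. B (F (Suc n) ?z) \<bullet> F (Suc n) ?z)"
            by (rule sum.lessThan_Suc_shift)
          also have "B (F 0 ?z) \<bullet> F 0 ?z \<le> f * (norm (F 0 ?z))\<^sup>2" by (rule F0(2)) (rule projectionsD(2)[OF F0p])
          also have "(norm (F 0 ?z))\<^sup>2 = (norm (W y))\<^sup>2 + (norm (K0 y))\<^sup>2"
            unfolding nFU using porth_add_norm[OF Wp K0p oWK, of y] by (simp add: R_def WK_def)
          also have "(\<Sum>n<m. B (F (Suc n) ?z) \<bullet> F (Suc n) ?z) \<le> (\<Sum>n<m. \<beta> n * (norm (K n y))\<^sup>2)"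
          proof (rule sum_mono)
            fix n
            have "B (F (Suc n) ?z) \<bullet> F (Suc n) ?z \<le> \<beta> n * (norm (F (Suc n) ?z))\<^sup>2"
              by (rule Fb) (rule projectionsD(2)[OF oseqD(1)[OF F(1)]])
            then show "B (F (Suc n) ?z) \<bullet> F (Suc n) ?z \<le> \<beta> n * (norm (K n y))\<^sup>2" unfolding nFU by (simp add: R_def)
          qed
          finally show ?thesis by simp
        qed
        have ii: "(\<Sum>n<N2. \<tau> n * (norm (S n y))\<^sup>2) \<le> (\<Sum>n<m. (\<beta> (Suc (Suc n)) - \<beta> n) * (norm (J n y))\<^sup>2 + c n / 2 * (norm (Q n y))\<^sup>2)"
        proof -
          have "(\<Sum>n<N2. \<tau> n * (norm (S n y))\<^sup>2) \<le> (\<Sum>n<m. \<tau> n * (norm (S n y))\<^sup>2)"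
            using m \<tau>0 by (intro sum_mono2) auto
          also have "\<dots> \<le> (\<Sum>n<m. (\<beta> (Suc (Suc n)) - \<beta> n) * (norm (J n y))\<^sup>2 + c n / 2 * (norm (Q n y))\<^sup>2)"
          proof (rule sum_mono)
            fix n
            have "\<tau> n * (norm (S n y))\<^sup>2 = \<tau> n * (norm (J n y))\<^sup>2 + \<tau> n * (norm (Q n y))\<^sup>2"
              using porth_add_norm[OF Jp Qp JQ, of n n y] by (simp add: S_def distrib_left)
            moreover have "\<tau> n * (norm (J n y))\<^sup>2 \<le> (\<beta> (Suc (Suc n)) - \<beta> n) * (norm (J n y))\<^sup>2"
              "\<tau> n * (norm (Q n y))\<^sup>2 \<le> c n / 2 * (norm (Q n y))\<^sup>2"
              by (intro mult_right_mono \<tau>le; simp)+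
            ultimately show "\<tau> n * (norm (S n y))\<^sup>2 \<le> (\<beta> (Suc (Suc n)) - \<beta> n) * (norm (J n y))\<^sup>2 + c n / 2 * (norm (Q n y))\<^sup>2"
              by linarith
          qed
          finally show ?thesis .
        qed
        have iii: "L N y \<le> L m y" by (rule Lmono[OF m(1)])
        \<comment> \<open>On K n the copy of F (n+1) spends \<beta> n and the gap remains; on J n
          the filler spends the gap and \<beta> n remains. Both add up to \<beta> (n+2).\<close>
        have iv: "(\<Sum>n<m. \<beta> n * (norm (K n y))\<^sup>2) + (\<Sum>n<m. (\<beta> (Suc (Suc n)) - \<beta> n) * (norm (J n y))\<^sup>2 + c n / 2 * (norm (Q n y))\<^sup>2)
          + (\<Sum>n<m. \<beta> n * (norm (J n y))\<^sup>2 + (\<beta> (Suc (Suc n)) - \<beta> n) * (norm (K n y))\<^sup>2 + c n / 2 * (norm (Q n y))\<^sup>2)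
          = (\<Sum>n<m. \<beta> (Suc (Suc n)) * ((norm (K n y))\<^sup>2 + (norm (J n y))\<^sup>2)) + (\<Sum>n<m. c n * (norm (Q n y))\<^sup>2)"
          by (simp add: sum.distrib[symmetric] algebra_simps)
        have v: "\<zeta> * (norm (Z y))\<^sup>2 \<le> s / 8 * (norm (P y))\<^sup>2 + (\<beta> 0 - b) / 2 * (norm (E 0 y))\<^sup>2"
        proof -
          have "(norm (Z y))\<^sup>2 \<le> (norm (PE y))\<^sup>2" by (rule power_mono[OF pleq_norm[OF ZPE Zp PEp]]) simp
          then have "(norm (Z y))\<^sup>2 \<le> (norm (P y))\<^sup>2 + (norm (E 0 y))\<^sup>2"
            unfolding PE_def porth_add_norm[OF Pp Ep oPE] .
          then have "\<zeta> * (norm (Z y))\<^sup>2 \<le> \<zeta> * ((norm (P y))\<^sup>2 + (norm (E 0 y))\<^sup>2)" using \<zeta>(1) by (intro mult_left_mono) auto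
          moreover have "\<zeta> * (norm (P y))\<^sup>2 \<le> s / 8 * (norm (P y))\<^sup>2" "\<zeta> * (norm (E 0 y))\<^sup>2 \<le> (\<beta> 0 - b) / 2 * (norm (E 0 y))\<^sup>2"
            using \<zeta> by (intro mult_right_mono; simp)+
          ultimately show ?thesis by (simp add: distrib_left)
        qed
        have vi: "b * (norm (V0 y))\<^sup>2 + f * (norm (K0 y))\<^sup>2 \<le> b * (norm (E 0 y))\<^sup>2"
        proof -
          have "(norm ((V0 + K0) y))\<^sup>2 \<le> (norm (E 0 y))\<^sup>2"
            by (rule power_mono[OF pleq_norm[OF pleq_add_least[OF V0E K0E] projection_add[OF V0p K0p oVK] Ep]]) simp
          then have "(norm (V0 y))\<^sup>2 + (norm (K0 y))\<^sup>2 \<le> (norm (E 0 y))\<^sup>2" unfolding porth_add_norm[OF V0p K0p oVK] .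
          then have "b * ((norm (V0 y))\<^sup>2 + (norm (K0 y))\<^sup>2) \<le> b * (norm (E 0 y))\<^sup>2" using b F0(4) by (intro mult_left_mono) auto
          moreover have "f * (norm (K0 y))\<^sup>2 \<le> b * (norm (K0 y))\<^sup>2" using b by (intro mult_right_mono) auto
          ultimately show ?thesis by (simp add: distrib_left)
        qed
        have vii: "f * ((norm (W y))\<^sup>2 + (norm (K0 y))\<^sup>2) = f * (norm (W y))\<^sup>2 + f * (norm (K0 y))\<^sup>2"
          "(\<beta> 0 - b) / 2 * (norm (E 0 y))\<^sup>2 = \<beta> 0 * (norm (E 0 y))\<^sup>2 / 2 - b * (norm (E 0 y))\<^sup>2 / 2"
          "(\<beta> 1 - \<beta> 0) * (norm (E 1 y))\<^sup>2 = \<beta> 1 * (norm (E 1 y))\<^sup>2 - \<beta> 0 * (norm (E 1 y))\<^sup>2"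
          by (simp_all add: algebra_simps diff_divide_distrib)
        show "\<beta> 0 * (norm (E 1 y))\<^sup>2 + \<zeta> * (norm (Z y))\<^sup>2 + (\<Sum>n<N2. \<tau> n * (norm (S n y))\<^sup>2)
            \<le> A y \<bullet> y - L N y - (\<Sum>n<N1. B (F n ?z) \<bullet> F n ?z)"
          using i ii iii[unfolded L_def[of m]] iv v vi vii Wb[of y] Elow[of y m] by linarith
      qed
      then show "(\<Sum>n<N1. B (F n ?z) \<bullet> F n ?z) + B (T ?z) \<bullet> T ?z \<le> A y \<bullet> y - L N y" unfolding TU by simp
    qed
    then show ?thesis by (simp add: Cx)
  qed
  have L0: "0 \<le> L N y" for N y
  proof -
    have "0 \<le> s / 8 * (norm (P y))\<^sup>2" "0 \<le> (\<beta> 0 - b) / 2 * (norm (E 0 y))\<^sup>2" "0 \<le> (\<beta> 1 - \<beta> 0) * (norm (E 1 y))\<^sup>2"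
      using s(1) b incseqD[OF inc, of 0 1] by auto
    then show ?thesis unfolding L_def using sum_nonneg[OF trm0] by (intro add_nonneg_nonneg)
  qed
  have Cp: "pos C"
  proof (rule posI)
    show "0 \<le> C y \<bullet> y" for y unfolding Cx by (rule posD(3)[OF B])
  qed (simp_all add: C_def M_comp M_adj UM BM partisoD(10,11)[OF U'] posD(2)[OF B])
  have ACx: "(A - C) y \<bullet> y = A y \<bullet> y - C y \<bullet> y" for y by (simp add: blinfun.diff_left inner_diff_left)
  have AC: "pos (A - C)"
  proof (rule posI)
    show "A - C \<in> M" using AM Cp by (simp add: M_diff posD)
    show "(A - C) y \<bullet> z = y \<bullet> (A - C) z" for y z
      by (simp add: blinfun.diff_left inner_diff_left inner_diff_right posD(2)[OF A] posD(2)[OF Cp])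
    show "0 \<le> (A - C) y \<bullet> y" for y using upper[of 0 y] L0[of 0 y] by (simp add: ACx)
  qed
  have "good \<beta> (A - C)"
    unfolding good_def
  proof
    fix n
    have "\<beta> n * (norm y)\<^sup>2 \<le> (A - C) y \<bullet> y" if y: "J n y = y" for y
    proof -
      have "\<beta> n * (norm (J n y))\<^sup>2 \<le> L (Suc n) y"
      proof -
        have "\<beta> n * (norm (J n y))\<^sup>2 \<le> \<beta> n * (norm (J n y))\<^sup>2 + (\<beta> (Suc (Suc n)) - \<beta> n) * (norm (K n y))\<^sup>2 + c n / 2 * (norm (Q n y))\<^sup>2"
          using \<beta>2[of n] c[of n] by simp
        moreover have "L (Suc n) y = L n y + (\<beta> n * (norm (J n y))\<^sup>2 + (\<beta> (Suc (Suc n)) - \<beta> n) * (norm (K n y))\<^sup>2 + c n / 2 * (norm (Q n y))\<^sup>2)"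
          by (simp add: L_def)
        ultimately show ?thesis using L0[of n y] by linarith
      qed
      then show ?thesis using upper[of "Suc n" y] y by (simp add: ACx)
    qed
    moreover have "inft (J n)" unfolding J_def by (rule K(3))
    ultimately show "\<exists>K. inft K \<and> (\<forall>y. K y = y \<longrightarrow> \<beta> n * (norm y)\<^sup>2 \<le> (A - C) y \<bullet> y)" by blast
  qed
  \<comment> \<open>For strictly increasing \<beta> all coefficients in L are positive, so a vector
    annihilated by A - C has no component outside N0.\<close>
  moreover have "null_proj (A - C) = null_proj A" if sm: "strict_mono \<beta>"
  proof (rule projection_eqI[OF null_proj_M(1)[OF posD(1)[OF AC]] null_proj_M(1)[OF AM]])
    fix y
    have "(A - C) y = 0 \<longleftrightarrow> A y = 0"
    proof
      assume "A y = 0"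
      then have "(A - C) y \<bullet> y \<le> 0" using posD(3)[OF Cp, of y] by (simp add: ACx)
      then show "(A - C) y = 0" using pos_zero[OF AC] posD(3)[OF AC, of y] by simp
    next
      assume "(A - C) y = 0"
      then have L: "L N y \<le> 0" for N using upper[of N y] ACx[of y] by simp
      have base: "s / 8 * (norm (P y))\<^sup>2 + (\<beta> 0 - b) / 2 * (norm (E 0 y))\<^sup>2 + (\<beta> 1 - \<beta> 0) * (norm (E 1 y))\<^sup>2 \<le> 0"
        using L[of 0] by (simp add: L_def)
      have \<beta>1: "0 < \<beta> 1 - \<beta> 0" using strict_monoD[OF sm, of 0 1] by simp
      have nn: "0 \<le> s / 8 * (norm (P y))\<^sup>2" "0 \<le> (\<beta> 0 - b) / 2 * (norm (E 0 y))\<^sup>2" "0 \<le> (\<beta> 1 - \<beta> 0) * (norm (E 1 y))\<^sup>2"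
        using s(1) b \<beta>1 by auto
      have z0: "s / 8 * (norm (P y))\<^sup>2 = 0" "(\<beta> 0 - b) / 2 * (norm (E 0 y))\<^sup>2 = 0" "(\<beta> 1 - \<beta> 0) * (norm (E 1 y))\<^sup>2 = 0"
        using base nn by linarith+
      have Py: "P y = 0" and E0: "E 0 y = 0" and E1: "E 1 y = 0" using z0 s(1) b \<beta>1 by auto
      have KJQ: "K n y = 0 \<and> J n y = 0 \<and> Q n y = 0" for n
      proof -
        have "L (Suc n) y = L n y + (\<beta> n * (norm (J n y))\<^sup>2 + (\<beta> (Suc (Suc n)) - \<beta> n) * (norm (K n y))\<^sup>2 + c n / 2 * (norm (Q n y))\<^sup>2)"
          by (simp add: L_def)
        then have le: "\<beta> n * (norm (J n y))\<^sup>2 + (\<beta> (Suc (Suc n)) - \<beta> n) * (norm (K n y))\<^sup>2 + c n / 2 * (norm (Q n y))\<^sup>2 \<le> 0"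
          using L[of "Suc n"] L0[of n y] by linarith
        have p: "0 < \<beta> (Suc (Suc n)) - \<beta> n" using strict_monoD[OF sm, of n "Suc (Suc n)"] by simp
        have nn: "0 \<le> \<beta> n * (norm (J n y))\<^sup>2" "0 \<le> (\<beta> (Suc (Suc n)) - \<beta> n) * (norm (K n y))\<^sup>2" "0 \<le> c n / 2 * (norm (Q n y))\<^sup>2"
          using \<beta>pos[of n] p c[of n] by auto
        have "\<beta> n * (norm (J n y))\<^sup>2 = 0" "(\<beta> (Suc (Suc n)) - \<beta> n) * (norm (K n y))\<^sup>2 = 0" "c n / 2 * (norm (Q n y))\<^sup>2 = 0"
          using le nn by linarith+
        then show ?thesis using \<beta>pos[of n] p c[of n] by auto
      qed
      have Ey: "E n y = 0" for n
      proof -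
        consider "n = 0" | "n = 1" | k where "n = Suc (Suc k)" by (metis One_nat_def not0_implies_Suc)
        then show ?thesis
        proof cases
          case 3
          have "E (Suc (Suc k)) y = J k y + K k y" by (simp add: J_def blinfun.diff_left)
          then show ?thesis using KJQ[of k] 3 by simp
        qed (use E0 E1 in simp_all)
      qed
      have "osum E y = 0" using sums_unique2[OF sumE(1)[of y]] Ey by simp
      moreover have "osum Q y = 0" using sums_unique2[OF sumQ(1)[of y]] KJQ by simp
      ultimately have "SX y = 0" by (simp add: EQX[symmetric] blinfun.add_left)
      then have "N0 y = y" using arg_cong[OF total, of "\<lambda>T. T y"] Py by (simp add: blinfun.add_left)
      then show "A y = 0" using N0(2) by blast
    qed
    then show "null_proj (A - C) y = y \<longleftrightarrow> null_proj A y = y"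
      using null_proj_M(2)[OF posD(1)[OF AC]] null_proj_M(2)[OF AM] by simp
  qed
  ultimately show ?thesis using ue AC lower by blast
qed

end

section \<open>Exhausting by copies\<close>

context sf_factor
begin

lemma pos_unitarily_equiv:
  assumes "unitarily_equiv M C B" and B: "pos B" shows "pos C"
proof -
  obtain U where U: "U \<in> M" "C = U o\<^sub>L B o\<^sub>L adj U" using assms by (auto simp: unitarily_equiv_def)
  note i = adj_inner[OF M_bounded_ops[OF U(1)]]
  have Cx: "C x \<bullet> y = B (adj U x) \<bullet> adj U y" for x y by (simp add: U(2) i)
  show ?thesis
  proof (rule posI)
    show "C \<in> M" by (simp add: U M_comp M_adj posD(1)[OF B])
    show "C x \<bullet> y = x \<bullet> C y" for x y using Cx[of x y] Cx[of y x] posD(2)[OF B, of "adj U x" "adj U y"] by (simp add: inner_commute)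
    show "0 \<le> C x \<bullet> x" for x unfolding Cx by (rule posD(3)[OF B])
  qed
qed

text \<open>As A x is nonzero, some positive spectral level of A sees x. Cutting that spectral
  projection into pieces subequivalent to Q0, at least one piece sees x.\<close>

lemma small_projection_below:
  assumes A: "pos A" and x: "A x \<noteq> 0" and Q0: "Q0 \<in> projections M" "Q0 \<noteq> 0" and f: "f > 0"
  obtains s P where "sle P Q0" "0 < s" "s \<le> f" "\<And>y. s * (norm (P y))\<^sup>2 \<le> A y \<bullet> y" "P x \<noteq> 0"
proof -
  have "\<exists>n. spg A (f / real (Suc n)) x \<noteq> 0"
  proof (rule ccontr)
    assume "\<not> ?thesis"
    then have z: "spg A (f / real (Suc n)) x = 0" for n by blast
    have "(\<lambda>n. f * (1 / real (Suc n))) \<longlonglongrightarrow> f * 0"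
      using LIMSEQ_inverse_real_of_nat by (intro tendsto_mult tendsto_const) (simp add: inverse_eq_divide)
    then have "(\<lambda>n. f / real (Suc n)) \<longlonglongrightarrow> 0" by simp
    from spg_vanishing[OF A this z] x show False by simp
  qed
  then obtain n where n: "spg A (f / real (Suc n)) x \<noteq> 0" by blast
  define t where "t = f / real (Suc n)"
  have t: "0 < t" "t \<le> f" using f by (auto simp: t_def field_simps)
  obtain T where T: "oseq T" "\<And>n. sle (T n) Q0" "osum T = spg A t"
    using decompose_small[OF Q0 spg(1)[OF A]] by blast
  have "\<exists>i. T i x \<noteq> 0"
  proof (rule ccontr)
    assume "\<not> ?thesis"
    then have "(\<lambda>i. 0) sums spg A t x" using osum_projection(1)[OF T(1), of x] T(3) by simp
    then show False using n sums_unique2[OF _ sums_zero] by (auto simp: t_def)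
  qed
  then obtain i where i: "T i x \<noteq> 0" by blast
  have "t * (norm (T i y))\<^sup>2 \<le> A y \<bullet> y" for y
  proof -
    have "norm (T i y) \<le> norm (spg A t y)"
      using pleq_norm[OF osum_projection(3)[OF T(1)] oseqD(1)[OF T(1)] osum_projection(2)[OF T(1)]] T(3) by simp
    then have "t * (norm (T i y))\<^sup>2 \<le> t * (norm (spg A t y))\<^sup>2" using t by (intro mult_left_mono power_mono) auto
    then show ?thesis using energy_ge[OF A, of t y] energy_le[OF A, of t y] by linarith
  qed
  then show ?thesis using that T(2) t i by blast
qed

text \<open>A greedy choice: at each step the pair (s, P) removed is nearly optimal for the current
  vector. If the limit Z of the remainders were nonzero, a single pair below Z would remain
  admissible at every step, and each return of a vector that sees it would remove a fixed positive
  amount, contradicting convergence.\<close>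

theorem sum_of_copies:
  assumes A: "pos A" and B: "pos B" and g: "good \<beta> A" and inc: "incseq \<beta>" and fill: "fillable \<beta> B T"
    and F: "oseq F" "osum F = id_blinfun - T" and Fc: "\<And>n x. F n (B x) = B (F n x)"
    and Fb: "\<And>n x. F (Suc n) x = x \<Longrightarrow> B x \<bullet> x \<le> \<beta> n * (norm x)\<^sup>2"
    and F0: "\<And>x. F 0 x = x \<Longrightarrow> \<delta> * (norm x)\<^sup>2 \<le> B x \<bullet> x" "\<And>x. F 0 x = x \<Longrightarrow> B x \<bullet> x \<le> f * (norm x)\<^sup>2"
      "0 < \<delta>" "0 < f" "f < \<beta> 0" "F 0 \<noteq> 0"
    and N: "sle (null_proj A) (null_proj B)" and sm: "strict_mono \<beta> \<or> inft (null_proj B)"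
  shows "\<exists>C. (\<forall>j::nat. unitarily_equiv M (C j) B) \<and> (\<forall>x. (\<lambda>j. C j x) sums A x)"
proof -
  obtain Q0 where Q0: "Q0 \<in> projections M" "Q0 \<noteq> 0" "\<not> inft Q0" "pleq Q0 (F 0)"
    using finite_subprojection[OF oseqD(1)[OF F(1)] F0(6)] by blast
  define \<theta> where "\<theta> = \<delta> * (1 / f - 2 / (f + \<beta> 0)) / 4"
  have "2 / (f + \<beta> 0) < 2 / (f + f)" by (rule divide_strict_left_mono) (use F0(4,5) in auto)
  also have "2 / (f + f) = 1 / f" by simp
  finally have \<theta>: "\<theta> > 0" using F0(3) by (simp add: \<theta>_def)
  define ok where "ok A' \<longleftrightarrow> pos A' \<and> good \<beta> A' \<and> sle (null_proj A') (null_proj B)" for A'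
  define adm where "adm = (\<lambda>(A' :: 'a \<Rightarrow>\<^sub>L 'a) s (P :: 'a \<Rightarrow>\<^sub>L 'a). sle P Q0 \<and> 0 < s \<and> s \<le> f \<and> (\<forall>y. s * (norm (blinfun_apply P y))\<^sup>2 \<le> blinfun_apply A' y \<bullet> y))"
  have step: "\<exists>C. unitarily_equiv M C B \<and> ok (A' - C) \<and> (\<forall>s P. adm A' s P \<longrightarrow> \<theta> / 2 * (s * (norm (blinfun_apply P x))\<^sup>2) \<le> blinfun_apply C x \<bullet> x)"
    if A': "ok A'" for A' x
  proof -
    have p: "pos A'" using A' by (simp add: ok_def)
    define V where "V = {s * (norm (blinfun_apply P x))\<^sup>2 | s P. adm A' s P}"
    have ad0: "adm A' f 0"
      using sle_pleq[OF projection_0 Q0(1) zero_pleq] F0(4) posD(3)[OF p] by (simp add: adm_def)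
    have V0: "0 \<in> V" unfolding V_def mem_Collect_eq
      by (rule exI[of _ f], rule exI[of _ 0]) (use ad0 in simp)
    have Vb: "bdd_above V" by (rule bdd_aboveI[of _ "A' x \<bullet> x"]) (auto simp: V_def adm_def)
    \<comment> \<open>The supremum need not be attained; some candidate is worth at least half of
      it, the candidate 0 when the supremum is 0. This is the source of \<theta> / 2.\<close>
    have "\<exists>v\<in>V. \<forall>w\<in>V. w \<le> 2 * v"
    proof (cases "Sup V \<le> 0")
      case True
      then have "\<forall>w\<in>V. w \<le> 0" using cSup_upper[OF _ Vb] order_trans by blast
      then show ?thesis using bexI[OF _ V0, of "\<lambda>v. \<forall>w\<in>V. w \<le> 2 * v"] by simp
    next
      case False
      then have "Sup V / 2 < Sup V" by simp
      then obtain v where v: "v \<in> V" "Sup V / 2 < v" using less_cSup_iff[OF _ Vb] V0 by blast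
      then have "w \<le> 2 * v" if "w \<in> V" for w using cSup_upper[OF that Vb] by linarith
      then show ?thesis using v by blast
    qed
    then obtain s P where sP: "adm A' s P" and max: "\<And>s' P'. adm A' s' P' \<Longrightarrow> s' * (norm (P' x))\<^sup>2 \<le> 2 * (s * (norm (P x))\<^sup>2)"
      unfolding V_def by blast
    obtain C where C: "unitarily_equiv M C B" "pos (A' - C)" "good \<beta> (A' - C)"
      "strict_mono \<beta> \<longrightarrow> null_proj (A' - C) = null_proj A'" "\<theta> * (s * (norm (P x))\<^sup>2) \<le> C x \<bullet> x"
    proof -
      have "good \<beta> A'" "sle (null_proj A') (null_proj B)" using A' by (auto simp: ok_def)
      moreover have "sle P Q0" "0 < s" "s \<le> f" "\<And>y. s * (norm (P y))\<^sup>2 \<le> A' y \<bullet> y" using sP by (auto simp: adm_def)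
      ultimately show ?thesis
        using that remove_copy[OF p B _ inc fill F Fc Fb F0(1-5) Q0(1,3,4), of P s x] unfolding \<theta>_def by blast
    qed
    have "ok (A' - C)"
      unfolding ok_def
    proof (intro conjI C(2,3))
      show "sle (null_proj (A' - C)) (null_proj B)"
      proof (cases "strict_mono \<beta>")
        case True then show ?thesis using C(4) A' by (simp add: ok_def)
      next
        case False
        then show ?thesis using sm inft_absorbs null_proj_M(1)[OF posD(1)[OF C(2)]] by blast
      qed
    qed
    moreover have "\<theta> / 2 * (s' * (norm (P' x))\<^sup>2) \<le> C x \<bullet> x" if "adm A' s' P'" for s' P'
    proof -
      have "\<theta> / 2 * (s' * (norm (P' x))\<^sup>2) \<le> \<theta> / 2 * (2 * (s * (norm (P x))\<^sup>2))"
        by (rule mult_left_mono[OF max[OF that]]) (use \<theta> in simp)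
      also have "\<dots> = \<theta> * (s * (norm (P x))\<^sup>2)" by simp
      finally show ?thesis using C(5) by linarith
    qed
    ultimately show ?thesis using C(1) by blast
  qed
  obtain v :: "nat \<Rightarrow> 'a" where v: "\<And>T. T \<in> M \<Longrightarrow> (\<And>n. T (v n) = 0) \<Longrightarrow> T = 0" using separating_sequence by blast
  define x where "x n = v (fst (prod_decode n))" for n
  have "\<exists>a. \<forall>n. (ok (a n) \<and> (n = 0 \<longrightarrow> a n = A)) \<and> (unitarily_equiv M (a n - a (Suc n)) B \<and>
      (\<forall>s P. adm (a n) s P \<longrightarrow> \<theta> / 2 * (s * (norm (P (x n)))\<^sup>2) \<le> (a n - a (Suc n)) (x n) \<bullet> x n))"
  proof (rule dependent_nat_choice)
    show "\<exists>a. ok a \<and> (0 = 0 \<longrightarrow> a = A)" using A g N by (auto simp: ok_def)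
    fix a and n :: nat assume "ok a \<and> (n = 0 \<longrightarrow> a = A)"
    then obtain C where C: "unitarily_equiv M C B" "ok (a - C)"
      "\<forall>s P. adm a s P \<longrightarrow> \<theta> / 2 * (s * (norm (P (x n)))\<^sup>2) \<le> C (x n) \<bullet> x n" using step by blast
    show "\<exists>y. (ok y \<and> (Suc n = 0 \<longrightarrow> y = A)) \<and> (unitarily_equiv M (a - y) B \<and>
      (\<forall>s P. adm a s P \<longrightarrow> \<theta> / 2 * (s * (norm (P (x n)))\<^sup>2) \<le> (a - y) (x n) \<bullet> x n))"
      by (rule exI[of _ "a - C"]) (use C in simp)
  qed
  then obtain a where a: "\<And>n. ok (a n)" "a 0 = A" "\<And>n. unitarily_equiv M (a n - a (Suc n)) B"
    and big: "\<And>n s P. adm (a n) s P \<Longrightarrow> \<theta> / 2 * (s * (norm (P (x n)))\<^sup>2) \<le> (a n - a (Suc n)) (x n) \<bullet> x n" by blast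
  have ap: "pos (a n)" for n using a(1) by (simp add: ok_def)
  define C where "C n = a n - a (Suc n)" for n
  have Cp: "pos (C n)" for n unfolding C_def by (rule pos_unitarily_equiv[OF a(3) B])
  have dec: "a (Suc n) y \<bullet> y \<le> a n y \<bullet> y" for n y
    using posD(3)[OF Cp, of n y] by (simp add: C_def blinfun.diff_left inner_diff_left)
  have "\<exists>L. \<forall>y. (\<lambda>n. (- a n) y) \<longlonglongrightarrow> blinfun_apply L y"
    by (rule monotone_strong_limit[where C = 0]) (simp_all add: blinfun.minus_left dec posD(3)[OF ap], simp add: posD(2)[OF ap])
  then obtain L where L: "\<And>y. (\<lambda>n. (- a n) y) \<longlonglongrightarrow> blinfun_apply L y" by blast
  define Z where "Z = - L"
  have lim: "(\<lambda>n. a n y) \<longlonglongrightarrow> Z y" for y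
    using tendsto_minus[OF L[of y]] by (simp add: Z_def blinfun.minus_left)
  have ZM: "Z \<in> M" by (rule M_strong_limit[OF posD(1)[OF ap] lim])
  have limi: "(\<lambda>n. a n y \<bullet> z) \<longlonglongrightarrow> Z y \<bullet> z" "(\<lambda>n. y \<bullet> a n z) \<longlonglongrightarrow> y \<bullet> Z z" for y z
    by (intro tendsto_intros lim)+
  have Zle: "Z y \<bullet> y \<le> a n y \<bullet> y" for n y
  proof (rule LIMSEQ_le_const2[OF limi(1)[of y y]])
    have "decseq (\<lambda>n. a n y \<bullet> y)" unfolding decseq_Suc_iff using dec by blast
    then show "\<exists>N. \<forall>m\<ge>N. a m y \<bullet> y \<le> a n y \<bullet> y" unfolding decseq_def by blast
  qed
  have Zp: "pos Z"
  proof (rule posI[OF ZM])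
    show "Z y \<bullet> z = y \<bullet> Z z" for y z
      using LIMSEQ_unique[OF limi(1)[of y z]] limi(2)[of y z] by (simp add: posD(2)[OF ap])
    show "0 \<le> Z y \<bullet> y" for y by (rule LIMSEQ_le_const[OF limi(1)]) (use posD(3)[OF ap] in blast)
  qed
  have "Z = 0"
  proof (rule v[OF ZM], rule ccontr)
    fix k assume "Z (v k) \<noteq> 0"
    then obtain s P where sP: "sle P Q0" "0 < s" "s \<le> f" "\<And>y. s * (norm (P y))\<^sup>2 \<le> Z y \<bullet> y" "P (v k) \<noteq> 0"
      using small_projection_below[OF Zp _ Q0(1,2) F0(4), of "v k"] by blast
    define \<eta> where "\<eta> = \<theta> / 2 * (s * (norm (P (v k)))\<^sup>2)"
    have \<eta>: "\<eta> > 0" using \<theta> sP(2,5) by (simp add: \<eta>_def)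
    \<comment> \<open>Z lies below every remainder, so the pair found below Z competes at all
      steps.\<close>
    have adm: "adm (a n) s P" for n using sP(1-4) Zle order_trans unfolding adm_def by blast
    have "(\<lambda>n. a n (v k) \<bullet> v k - a (Suc n) (v k) \<bullet> v k) \<longlonglongrightarrow> Z (v k) \<bullet> v k - Z (v k) \<bullet> v k"
      by (rule tendsto_diff[OF limi(1) LIMSEQ_Suc[OF limi(1)]])
    then have "\<forall>\<^sub>F n in sequentially. a n (v k) \<bullet> v k - a (Suc n) (v k) \<bullet> v k < \<eta>"
      using order_tendstoD(2) \<eta> by fastforce
    then obtain M0 where M0: "\<And>n. n \<ge> M0 \<Longrightarrow> a n (v k) \<bullet> v k - a (Suc n) (v k) \<bullet> v k < \<eta>"
      unfolding eventually_sequentially by blast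
    define n where "n = prod_encode (k, M0)"
    have "x n = v k" by (simp add: x_def n_def)
    then have "\<eta> \<le> a n (v k) \<bullet> v k - a (Suc n) (v k) \<bullet> v k"
      using big[OF adm, of n] by (simp add: \<eta>_def blinfun.diff_left inner_diff_left)
    moreover have "n \<ge> M0" unfolding n_def by (rule le_prod_encode_2)
    ultimately show False using M0 by fastforce
  qed
  have "(\<lambda>j. C j y) sums A y" for y
  proof -
    have "(\<Sum>j<n. C j y) = A y - a n y" for n
      by (induction n) (simp_all add: a(2) C_def blinfun.diff_left)
    moreover have "(\<lambda>n. A y - a n y) \<longlonglongrightarrow> A y - Z y" by (intro tendsto_intros lim)
    ultimately show ?thesis by (simp add: sums_def \<open>Z = 0\<close>)
  qed
  moreover have "unitarily_equiv M (C j) B" for j using a(3) by (simp add: C_def)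
  ultimately show ?thesis by blast
qed

text \<open>Orthogonal copies of P sum to an infinite projection, which a partial isometry carries
  onto Q. The complement of each transported copy contains all the later ones, so it is infinite and
  equivalent to the complement of P; the two equivalences add up to a unitary.\<close>

lemma copies_of_projection:
  assumes Q: "inft Q" and P: "P \<in> projections M" "P \<noteq> 0" and nP: "inft (id_blinfun - P)"
  shows "\<exists>R. (\<forall>j::nat. unitarily_equiv M (R j) P) \<and> (\<forall>x. (\<lambda>j. R j x) sums Q x)"
proof -
  obtain E where E: "oseq E" "\<And>n. inft (E n)" "osum E = id_blinfun" using inft_split_sequence[OF inft_id] by blast
  have "\<forall>n. \<exists>R. eqv P R \<and> pleq R (E n)" using inft_absorbs[OF E(2) P(1)] by (auto simp: sle_def)
  then obtain R where R: "\<And>n. eqv P (R n)" "\<And>n. pleq (R n) (E n)" by metis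
  have Rp: "R n \<in> projections M" for n using R(1) eqv_projections by blast
  have Ro: "oseq R" by (rule oseq_pleq[OF E(1) Rp R(2)])
  note r = osum_projection[OF Ro]
  have R1: "eqv (R 0) (R n)" for n using R(1) eqv_sym eqv_trans by blast
  have "inft (osum R)"
    by (rule sequence_inft[OF Ro r(3) R1 _ r(2)]) (use P(2) eqv_0[OF R(1)] in blast)
  then obtain V where V: "partiso V (osum R) Q" using inft_eqv_inft[OF _ Q] unfolding eqv_def by blast
  define S where "S n = V o\<^sub>L R n o\<^sub>L adj V" for n
  note rs = partiso_restrict[OF V Rp r(3), folded S_def]
  have Sp: "S n \<in> projections M" "eqv P (S n)" for n
    using rs(1) R(1) eqv_trans partisoD(3) unfolding eqv_def by blast+
  have "inft (id_blinfun - S n)" for n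
  proof -
    define D where "D = osum (\<lambda>m. S (n + Suc m))"
    have So': "porth (S i) (S j)" if "i \<noteq> j" for i j
    proof -
      have "S i (S j y) = V (R i (R j (adj V y)))" for y
        using rs(3)[of i "R j (adj V y)"] by (simp add: S_def)
      then show ?thesis using porthD[OF oseqD(2)[OF Ro that]] by (simp add: porth_def)
    qed
    have o: "oseq (\<lambda>m. S (n + Suc m))" unfolding oseq_def using Sp(1) So' by simp
    have "inft D"
      unfolding D_def
    proof (rule sequence_inft[OF o osum_projection(3)[OF o] _ _ osum_projection(2)[OF o]])
      show "eqv (S (n + Suc 0)) (S (n + Suc m))" for m using Sp(2) eqv_sym eqv_trans by blast
      show "S (n + Suc 0) \<noteq> 0" using P(2) eqv_0[OF Sp(2)] by blast
    qed
    moreover have "porth (S n) D" unfolding D_def by (rule osum_projection(5)[OF o]) (rule So', simp)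
    then have "pleq D (id_blinfun - S n)" unfolding porth_compl[OF Sp(1)] .
    ultimately show ?thesis using inft_pleq projection_compl[OF Sp(1)] by blast
  qed
  then have e: "eqv (id_blinfun - P) (id_blinfun - S n)" for n using inft_eqv_inft[OF nP] by blast
  have "unitarily_equiv M (S n) P" for n
  proof -
    obtain U1 where U1: "partiso U1 P (S n)" using Sp(2) by (auto simp: eqv_def)
    obtain U2 where U2: "partiso U2 (id_blinfun - P) (id_blinfun - S n)" using e by (auto simp: eqv_def)
    have c: "porth Q (id_blinfun - Q)" if "Q \<in> projections M" for Q
      by (simp add: porth_def blinfun.diff_left blinfun.diff_right projectionsD(2)[OF that])
    have U: "partiso (U1 + U2) id_blinfun id_blinfun"
      using partiso_add[OF U1 U2 c[OF P(1)] c[OF Sp(1)]] by simp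
    have adjU: "adj (U1 + U2) y = adj U1 y + adj U2 y" for y
      by (simp add: adj_add partisoD(1)[OF U1] partisoD(1)[OF U2] blinfun.add_left)
    have "S n = (U1 + U2) o\<^sub>L P o\<^sub>L adj (U1 + U2)"
    proof (rule blinfun_eqI)
      fix y
      have "P (adj U2 y) = 0"
        using partisoD(8)[OF U2, of y] porthD[OF c[OF P(1)], of "adj U2 y"] by simp
      then have "P (adj (U1 + U2) y) = adj U1 y" by (simp add: adjU blinfun.add_right partisoD(8)[OF U1])
      moreover have "U2 (adj U1 y) = 0"
      proof -
        have "U2 (adj U1 y) = U2 ((id_blinfun - P) (P (adj U1 y)))"
          using partisoD(6)[OF U2, of "adj U1 y"] partisoD(8)[OF U1, of y] by simp
        then show ?thesis by (simp add: blinfun.diff_left projectionsD(2)[OF P(1)])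
      qed
      ultimately show "S n y = ((U1 + U2) o\<^sub>L P o\<^sub>L adj (U1 + U2)) y"
        by (simp add: blinfun.add_left partisoD(5)[OF U1])
    qed
    then show ?thesis
      unfolding unitarily_equiv_def using partisoD(1)[OF U]
      by (intro bexI[of _ "U1 + U2"] conjI) (auto intro!: blinfun_eqI simp: partisoD(4,5)[OF U])
  qed
  moreover have "(\<lambda>j. S j x) sums Q x" for x
  proof -
    have "(\<lambda>j. V (R j (adj V x))) sums V (osum R (adj V x))"
      by (rule bounded_linear.sums[OF blinfun.bounded_linear_right r(1)])
    then show ?thesis by (simp add: S_def partisoD(5,8)[OF V])
  qed
  ultimately show ?thesis by blast
qed

end

section \<open>Spectral measures of positive operators\<close>

context sf_factor
begin

lemma spg_zero: "pos B \<Longrightarrow> t \<le> 0 \<Longrightarrow> spg B t = id_blinfun"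
  by (rule pleq_antisym[OF _ spg_greatest[OF _ projection_id]])
    (auto simp: spg(1) projection_id pleq_def posD(3) intro: order_trans[OF mult_nonpos_nonneg])

lemma spg_norm: assumes B: "pos B" and t: "norm B < t" shows "spg B t = 0"
proof (rule blinfun_eqI, rule ccontr)
  fix x assume "blinfun_apply (spg B t) x \<noteq> blinfun_apply 0 x"
  then have "norm B * (norm (spg B t x))\<^sup>2 < t * (norm (spg B t x))\<^sup>2" using t by simp
  also have "\<dots> \<le> B (spg B t x) \<bullet> spg B t x" by (rule spg_ge[OF B])
  also have "\<dots> \<le> norm B * (norm (spg B t x))\<^sup>2" using blinfun_le_norm[of B "spg B t x"] by (simp add: power2_norm_eq_inner)
  finally show False by simp
qed

text \<open>Along u n increasing to t the spectral projections decrease to \<open>spg B t\<close>: a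
  vector fixed by all of them has form at least t times its squared norm. The complements therefore
  increase strongly, and so do their squared norms at x.\<close>

lemma spg_left_continuous:
  assumes B: "pos B" and e: "e > 0"
  shows "\<exists>d>0. (norm (spg B (t - d) x))\<^sup>2 < (norm (spg B t x))\<^sup>2 + e"
proof -
  note G = spg(1)[OF B]
  define u where "u n = t - 1 / real (Suc n)" for n
  have u: "u n \<le> t" "u n \<le> u (Suc n)" for n by (auto simp: u_def frac_le)
  have ulim: "u \<longlonglongrightarrow> t" unfolding u_def by real_asymp
  define S where "S n = id_blinfun - spg B (u n)" for n
  define R where "R n = (case n of 0 \<Rightarrow> S 0 | Suc m \<Rightarrow> spg B (u m) - spg B (u (Suc m)))" for n
  \<comment> \<open>The complements shifted by one index, so that the chain starts at 0 and its
    first increment is S 0.\<close>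
  define S' where "S' n = (case n of 0 \<Rightarrow> 0 | Suc m \<Rightarrow> S m)" for n
  have le: "pleq (spg B (u (Suc n))) (spg B (u n))" for n by (rule spg_antimono[OF B u(2)])
  have Sp: "S' n \<in> projections M" for n
    by (simp add: S'_def S_def projection_0 projection_compl G split: nat.split)
  have Rp: "R n \<in> projections M" for n
    by (simp add: R_def S_def projection_compl projection_diff G le split: nat.split)
  have step: "S' (Suc n) = S' n + R n" for n by (simp add: S'_def S_def R_def split: nat.split)
  have o: "porth (S' n) (R n)" for n
  proof (cases n)
    case (Suc m)
    have "spg B (u m) (spg B (u (Suc m)) x) = spg B (u (Suc m)) x" for x using le by (simp add: pleq_def)
    then show ?thesis by (simp add: Suc porth_def S'_def S_def R_def blinfun.diff_left blinfun.diff_right projectionsD(2)[OF G])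
  qed (simp add: S'_def porth_def)
  note inc = oseq_increments[of S' R, OF Sp Rp step o]
  have sum: "(\<Sum>k<Suc n. R k) = S n" for n
  proof -
    have "(\<Sum>k<n. R k) = S' n" for n by (induction n) (simp_all add: step, simp add: S'_def)
    from this[of "Suc n"] show ?thesis by (simp only: S'_def nat.case)
  qed
  have comp: "pleq (id_blinfun - P) (id_blinfun - Q)" if "pleq Q P" "P \<in> projections M" "Q \<in> projections M" for P Q
    using pleqD'[OF that(1,3,2)] by (simp add: pleq_def blinfun.diff_left blinfun.diff_right)
  have "osum R = id_blinfun - spg B t"
  proof (rule osum_eq_projectionI[OF inc(1) projection_compl[OF G]])
    fix n
    have "pleq (R n) (S' (Suc n))" by (rule inc(3))
    moreover have "pleq (S' (Suc n)) (id_blinfun - spg B t)"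
      unfolding S'_def S_def nat.case by (rule comp[OF spg_antimono[OF B u(1)] G G])
    ultimately show "pleq (R n) (id_blinfun - spg B t)" using pleq_trans by blast
  next
    fix w assume w: "(id_blinfun - spg B t) w = w" "\<And>n. R n w = 0"
    have "S n w = 0" for n
    proof -
      have "S n w = (\<Sum>k<Suc n. R k w)" by (simp only: sum[symmetric] blinfun.sum_left)
      then show ?thesis by (simp add: w(2))
    qed
    then have "spg B (u n) w = w" for n by (simp add: S_def blinfun.diff_left)
    then have "u n * (norm w)\<^sup>2 \<le> B w \<bullet> w" for n by (rule spg(3)[OF B])
    moreover have "(\<lambda>n. u n * (norm w)\<^sup>2) \<longlonglongrightarrow> t * (norm w)\<^sup>2" by (intro tendsto_intros ulim)
    ultimately have "t * (norm w)\<^sup>2 \<le> B w \<bullet> w" using LIMSEQ_le_const2[of "\<lambda>n. u n * (norm w)\<^sup>2"] by blast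
    moreover have "spg B t w = 0" using w(1) by (simp add: blinfun.diff_left)
    ultimately show "w = 0" using spg(4)[OF B, of t w] by force
  qed
  then have "(\<lambda>n. (norm (R n x))\<^sup>2) sums (norm ((id_blinfun - spg B t) x))\<^sup>2" using osum_projection(6)[OF inc(1)] by simp
  then have "(\<lambda>n. \<Sum>k<Suc n. (norm (R k x))\<^sup>2) \<longlonglongrightarrow> (norm ((id_blinfun - spg B t) x))\<^sup>2"
    unfolding sums_def by (rule LIMSEQ_Suc)
  moreover have nc: "(norm ((id_blinfun - P) x))\<^sup>2 = (norm x)\<^sup>2 - (norm (P x))\<^sup>2" if "P \<in> projections M" for P
    using norm_compl[OF that projection_id, of x] by (simp add: pleq_def)
  moreover have "(\<Sum>k<Suc n. (norm (R k x))\<^sup>2) = (norm x)\<^sup>2 - (norm (spg B (u n) x))\<^sup>2" for n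
  proof -
    have "(\<Sum>k<n. (norm (R k x))\<^sup>2) = (norm (S' n x))\<^sup>2" for n
      by (induction n) (simp_all add: step porth_add_norm[OF Sp Rp o], simp add: S'_def)
    from this[of "Suc n"] show ?thesis by (simp only: S'_def nat.case S_def nc[OF G])
  qed
  ultimately have "(\<lambda>n. (norm x)\<^sup>2 - (norm (spg B (u n) x))\<^sup>2) \<longlonglongrightarrow> (norm x)\<^sup>2 - (norm (spg B t x))\<^sup>2" by (simp add: G)
  then have "\<forall>\<^sub>F n in sequentially. (norm x)\<^sup>2 - (norm (spg B t x))\<^sup>2 - e < (norm x)\<^sup>2 - (norm (spg B (u n) x))\<^sup>2"
    by (rule order_tendstoD) (use e in simp)
  then obtain n where "(norm x)\<^sup>2 - (norm (spg B t x))\<^sup>2 - e < (norm x)\<^sup>2 - (norm (spg B (u n) x))\<^sup>2"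
    unfolding eventually_sequentially by blast
  then show ?thesis by (intro exI[of _ "1 / real (Suc n)"]) (simp add: u_def)
qed

text \<open>Reflecting the line makes the left-continuous \<open>t \<mapsto> \<chi>\<^bsub>[t,\<infinity>)\<^esub>(B)\<close> right-continuous and increasing.\<close>

definition vmeasure :: "('a \<Rightarrow>\<^sub>L 'a) \<Rightarrow> 'a \<Rightarrow> real measure" where
  "vmeasure B x = distr (interval_measure (\<lambda>s. (norm (spg B (- s) x))\<^sup>2)) borel uminus"

lemma vmeasure_sets [simp, measurable_cong]: "sets (vmeasure B x) = sets borel" "space (vmeasure B x) = UNIV"
  by (simp_all add: vmeasure_def)

lemma spg_mono_norm: "pos B \<Longrightarrow> s \<le> t \<Longrightarrow> (norm (spg B t x))\<^sup>2 \<le> (norm (spg B s x))\<^sup>2"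
  by (intro power_mono pleq_norm spg_antimono spg) auto

text \<open>The reflection turns [a, b) into (-b, -a], the kind of interval on which an interval
  measure is prescribed.\<close>

lemma vmeasure_Ico:
  assumes B: "pos B" and ab: "a \<le> b"
  shows "emeasure (vmeasure B x) {a..<b} = ennreal ((norm (spg B a x))\<^sup>2 - (norm (spg B b x))\<^sup>2)"
proof -
  let ?G = "\<lambda>s. (norm (spg B (- s) x))\<^sup>2"
  have mono: "?G s \<le> ?G t" if "s \<le> t" for s t by (rule spg_mono_norm[OF B]) (use that in simp)
  have cont: "continuous (at_right s) ?G" for s
  proof (subst continuous_at_right_real_increasing[OF mono])
    show "\<forall>\<epsilon>>0. \<exists>\<delta>>0. ?G (s + \<delta>) - ?G s < \<epsilon>"
    proof (intro allI impI)
      fix \<epsilon> :: real assume "\<epsilon> > 0"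
      then obtain d where "d > 0" "(norm (spg B (- s - d) x))\<^sup>2 < (norm (spg B (- s) x))\<^sup>2 + \<epsilon>" using spg_left_continuous[OF B] by blast
      then show "\<exists>\<delta>>0. ?G (s + \<delta>) - ?G s < \<epsilon>" by (intro exI[of _ d]) simp
    qed
  qed
  have "emeasure (vmeasure B x) {a..<b} = emeasure (interval_measure ?G) (uminus -` {a..<b} \<inter> space (interval_measure ?G))"
    unfolding vmeasure_def by (rule emeasure_distr) auto
  also have "uminus -` {a..<b} \<inter> space (interval_measure ?G) = {-b<..-a}" by auto
  also have "emeasure (interval_measure ?G) {-b<..-a} = ennreal (?G (-a) - ?G (-b))"
    by (rule emeasure_interval_measure_Ioc[OF _ mono cont]) (use ab in simp)
  finally show ?thesis by simp
qed

lemma vmeasure_Ico_total: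
  assumes B: "pos B" and "a \<le> 0" "norm B < b"
  shows "emeasure (vmeasure B x) {a..<b} = ennreal ((norm x)\<^sup>2)"
proof -
  have "a \<le> b" using assms norm_ge_zero[of B] by linarith
  then show ?thesis using vmeasure_Ico[OF B, of a b] spg_zero[OF B assms(2)] spg_norm[OF B assms(3)] by simp
qed

lemma vmeasure_UNIV:
  assumes B: "pos B" shows "emeasure (vmeasure B x) UNIV = ennreal ((norm x)\<^sup>2)"
proof -
  have "(\<lambda>n. emeasure (vmeasure B x) {- real n..<real n}) \<longlonglongrightarrow> emeasure (vmeasure B x) (\<Union>n. {- real n..<real n})"
    by (rule Lim_emeasure_incseq) (auto simp: incseq_def)
  moreover have "(\<Union>n. {- real n..<real n}) = UNIV"
  proof (rule antisym[OF subset_UNIV], rule subsetI)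
    fix y :: real
    obtain n where "\<bar>y\<bar> < real n" using reals_Archimedean2 by blast
    then show "y \<in> (\<Union>n. {- real n..<real n})" by (intro UN_I[of n]) auto
  qed
  moreover have "\<forall>\<^sub>F n in sequentially. emeasure (vmeasure B x) {- real n..<real n} = ennreal ((norm x)\<^sup>2)"
    using eventually_gt_at_top[of "nat \<lceil>norm B\<rceil>"]
    by eventually_elim (rule vmeasure_Ico_total[OF B], simp, linarith)
  then have "(\<lambda>n. emeasure (vmeasure B x) {- real n..<real n}) \<longlonglongrightarrow> ennreal ((norm x)\<^sup>2)" by (rule tendsto_eventually)
  ultimately show ?thesis using LIMSEQ_unique by fastforce
qed

section \<open>The projection-valued measure on Borel sets\<close>

lemma projection_norm_eqI:
  assumes "P \<in> projections M" "Q \<in> projections M" "\<And>x. norm (P x) = norm (Q x)"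
  shows "P = Q"
proof (rule projection_eqI[OF assms(1,2)])
  have "P x = x \<longleftrightarrow> norm (P x) = norm x" if "P \<in> projections M" for P x
  proof
    assume "norm (P x) = norm x"
    then have "(norm ((id_blinfun - P) x))\<^sup>2 = 0" using norm_compl[OF that projection_id, of x] by (simp add: pleq_def)
    then show "P x = x" by (simp add: blinfun.diff_left)
  qed simp
  then show "P x = x \<longleftrightarrow> Q x = x" for x using assms by simp
qed

lemma norm_le_pleq:
  assumes "P \<in> projections M" "Q \<in> projections M" "\<And>x. norm (P x) \<le> norm (Q x)"
  shows "pleq P Q"
proof (rule pleqI[OF assms(1)])
  fix x assume "P x = x"
  then have "norm (Q x) = norm x" using assms(3)[of x] projectionsD(5)[OF assms(2), of x] by simp
  then have "(norm ((id_blinfun - Q) x))\<^sup>2 = 0" using norm_compl[OF assms(2) projection_id, of x] by (simp add: pleq_def)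
  then show "Q x = x" by (simp add: blinfun.diff_left)
qed

text \<open>Testing the inequality at Q x leaves nothing for P (Q x).\<close>

lemma norm_sum_porth:
  assumes "P \<in> projections M" "Q \<in> projections M" "\<And>x. (norm (P x))\<^sup>2 + (norm (Q x))\<^sup>2 \<le> (norm x)\<^sup>2"
  shows "porth P Q"
  unfolding porth_def
proof
  fix x
  have "(norm (P (Q x)))\<^sup>2 \<le> 0" using assms(3)[of "Q x"] by (simp add: projectionsD(2)[OF assms(2)])
  then show "P (Q x) = 0" by simp
qed

text \<open>Induction over the Borel sets starting from half-open intervals. For disjoint unions the
  projections have to be orthogonal, which follows from the masses alone: on disjoint sets they add
  up to at most the squared norm of x.\<close>

lemma vmeasure_projection:
  assumes B: "pos B" and S: "S \<in> sets borel"
  shows "\<exists>P. P \<in> projections M \<and> (\<forall>x. emeasure (vmeasure B x) S = ennreal ((norm (P x))\<^sup>2))"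
proof -
  let ?G = "range (\<lambda>(a, b). {a..<b :: real})"
  have st: "Int_stable ?G"
  proof (rule Int_stableI)
    fix a b assume "a \<in> ?G" "b \<in> ?G"
    then obtain p q r s where "a = {p..<q}" "b = {r..<s}" by auto
    then have "a \<inter> b = {max p r..<min q s}" by auto
    then show "a \<inter> b \<in> ?G" by (auto simp: image_iff)
  qed
  have bo: "sets borel = sigma_sets UNIV ?G" unfolding borel_eq_atLeastLessThan by simp
  have "?G \<subseteq> Pow UNIV" by simp
  from st this S[unfolded bo] show ?thesis
  proof (induction rule: sigma_sets_induct_disjoint)
    case (basic A)
    then obtain a b where A: "A = {a..<b}" by auto
    show ?case
    proof (cases "a \<le> b")
      case True
      note le = spg_antimono[OF B True]
      show ?thesis
        by (rule exI[of _ "spg B a - spg B b"])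
          (simp add: A vmeasure_Ico[OF B True] projection_diff[OF spg(1) spg(1) le] B norm_compl[OF spg(1) spg(1) le])
    qed (auto simp: A intro!: exI[of _ 0] projection_0)
  next
    case empty
    show ?case by (auto intro!: exI[of _ 0] projection_0)
  next
    case (compl A)
    then obtain P where P: "P \<in> projections M" "\<And>x. emeasure (vmeasure B x) A = ennreal ((norm (P x))\<^sup>2)" by blast
    have "emeasure (vmeasure B x) (UNIV - A) = ennreal ((norm ((id_blinfun - P) x))\<^sup>2)" for x
    proof -
      have "emeasure (vmeasure B x) (UNIV - A) = emeasure (vmeasure B x) UNIV - emeasure (vmeasure B x) A"
        using emeasure_compl[of A "vmeasure B x"] compl(1) P(2)[of x] by (simp add: bo)
      also have "\<dots> = ennreal ((norm x)\<^sup>2 - (norm (P x))\<^sup>2)"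
        by (simp add: vmeasure_UNIV[OF B] P(2) ennreal_minus)
      also have "(norm x)\<^sup>2 - (norm (P x))\<^sup>2 = (norm ((id_blinfun - P) x))\<^sup>2"
        using norm_compl[OF P(1) projection_id, of x] by (simp add: pleq_def)
      finally show ?thesis .
    qed
    then show ?case using projection_compl[OF P(1)] by blast
  next
    case (union A)
    then obtain P where P: "\<And>i. P i \<in> projections M" "\<And>i x. emeasure (vmeasure B x) (A i) = ennreal ((norm (P i x))\<^sup>2)" by metis
    have Ab: "A i \<in> sets borel" for i using union(2) by (auto simp: bo)
    have "porth (P m) (P n)" if mn: "m \<noteq> n" for m n
    proof (rule norm_sum_porth[OF P(1) P(1)])
      fix x
      have "ennreal ((norm (P m x))\<^sup>2 + (norm (P n x))\<^sup>2) = emeasure (vmeasure B x) (A m) + emeasure (vmeasure B x) (A n)"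
        by (simp add: P(2))
      also have "\<dots> = emeasure (vmeasure B x) (A m \<union> A n)"
        by (rule plus_emeasure) (use Ab union(1) mn in \<open>auto simp: disjoint_family_on_def\<close>)
      also have "\<dots> \<le> emeasure (vmeasure B x) UNIV" by (rule emeasure_mono) auto
      also have "\<dots> = ennreal ((norm x)\<^sup>2)" by (rule vmeasure_UNIV[OF B])
      finally show "(norm (P m x))\<^sup>2 + (norm (P n x))\<^sup>2 \<le> (norm x)\<^sup>2" by (subst (asm) ennreal_le_iff) auto
    qed
    then have o: "oseq P" using P(1) by (simp add: oseq_def)
    note r = osum_projection[OF o]
    have "emeasure (vmeasure B x) (\<Union>i. A i) = ennreal ((norm (osum P x))\<^sup>2)" for x
    proof -
      have "emeasure (vmeasure B x) (\<Union>i. A i) = (\<Sum>i. emeasure (vmeasure B x) (A i))"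
        by (rule suminf_emeasure[symmetric]) (use Ab union(1) in auto)
      also have "\<dots> = (\<Sum>i. ennreal ((norm (P i x))\<^sup>2))" by (simp add: P(2))
      also have "\<dots> = ennreal ((norm (osum P x))\<^sup>2)"
        by (rule suminf_ennreal_eq[OF _ r(6)]) simp
      finally show ?thesis .
    qed
    then show ?case using r(2) by blast
  qed
qed

definition vproj :: "('a \<Rightarrow>\<^sub>L 'a) \<Rightarrow> real set \<Rightarrow> 'a \<Rightarrow>\<^sub>L 'a" where
  "vproj B S = (SOME P. P \<in> projections M \<and> (\<forall>x. emeasure (vmeasure B x) S = ennreal ((norm (P x))\<^sup>2)))"

lemma vproj:
  assumes "pos B" "S \<in> sets borel"
  shows "vproj B S \<in> projections M" "emeasure (vmeasure B x) S = ennreal ((norm (vproj B S x))\<^sup>2)"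
  using someI_ex[OF vmeasure_projection[OF assms], folded vproj_def] by blast+

lemma vproj_eqI:
  assumes B: "pos B" and S: "S \<in> sets borel" and P: "P \<in> projections M"
    "\<And>x. emeasure (vmeasure B x) S = ennreal ((norm (P x))\<^sup>2)"
  shows "vproj B S = P"
proof (rule projection_norm_eqI[OF vproj(1)[OF B S] P(1)])
  fix x
  have "ennreal ((norm (vproj B S x))\<^sup>2) = ennreal ((norm (P x))\<^sup>2)" using vproj(2)[OF B S, of x] P(2)[of x] by (rule trans[OF sym])
  then have "(norm (vproj B S x))\<^sup>2 = (norm (P x))\<^sup>2" by (subst (asm) ennreal_inj) auto
  then show "norm (vproj B S x) = norm (P x)" by (rule power2_eq_imp_eq) auto
qed

lemma vproj_mono:
  assumes B: "pos B" and S: "S \<in> sets borel" "T \<in> sets borel" "S \<subseteq> T"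
  shows "pleq (vproj B S) (vproj B T)"
proof (rule norm_le_pleq[OF vproj(1)[OF B S(1)] vproj(1)[OF B S(2)]])
  fix x
  have "emeasure (vmeasure B x) S \<le> emeasure (vmeasure B x) T" by (rule emeasure_mono) (use S in auto)
  then show "norm (vproj B S x) \<le> norm (vproj B T x)" by (simp add: vproj(2)[OF B] S)
qed

lemma vproj_disjoint:
  assumes B: "pos B" and S: "S \<in> sets borel" "T \<in> sets borel" "S \<inter> T = {}"
  shows "porth (vproj B S) (vproj B T)" "vproj B (S \<union> T) = vproj B S + vproj B T"
proof -
  note p = vproj[OF B S(1)] and q = vproj[OF B S(2)]
  have e: "emeasure (vmeasure B x) (S \<union> T) = ennreal ((norm (vproj B S x))\<^sup>2 + (norm (vproj B T x))\<^sup>2)" for x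
    using plus_emeasure[of S "vmeasure B x" T] S by (simp add: p q)
  show o: "porth (vproj B S) (vproj B T)"
  proof (rule norm_sum_porth[OF p(1) q(1)])
    fix x
    have "emeasure (vmeasure B x) (S \<union> T) \<le> emeasure (vmeasure B x) UNIV" by (rule emeasure_mono) auto
    then show "(norm (vproj B S x))\<^sup>2 + (norm (vproj B T x))\<^sup>2 \<le> (norm x)\<^sup>2"
      unfolding e vmeasure_UNIV[OF B] by (subst (asm) ennreal_le_iff) auto
  qed
  show "vproj B (S \<union> T) = vproj B S + vproj B T"
    by (rule vproj_eqI[OF B]) (use S in \<open>auto simp: projection_add[OF p(1) q(1) o] e porth_add_norm[OF p(1) q(1) o]\<close>)
qed

text \<open>Split S by T: on the range of the projection of T the part inside T acts as itself and
  the part outside T vanishes.\<close>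

lemma vproj_Int:
  assumes B: "pos B" and S: "S \<in> sets borel" "T \<in> sets borel"
  shows "vproj B (S \<inter> T) = vproj B S o\<^sub>L vproj B T"
proof (rule blinfun_eqI)
  fix x
  have I: "S \<inter> T \<in> sets borel" and D: "S - T \<in> sets borel" using S by auto
  have "(S \<inter> T) \<inter> (S - T) = {}" by blast
  moreover have "S \<inter> T \<union> (S - T) = S" by blast
  ultimately have "vproj B S = vproj B (S \<inter> T) + vproj B (S - T)" using vproj_disjoint(2)[OF B I D] by argo
  moreover have "vproj B (S \<inter> T) (vproj B T x) = vproj B (S \<inter> T) x"
    by (rule pleqD'[OF vproj_mono[OF B I S(2)] vproj(1)[OF B I] vproj(1)[OF B S(2)]]) auto
  moreover have "vproj B (S - T) (vproj B T x) = 0"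
    by (rule porthD[OF vproj_disjoint(1)[OF B D S(2)]]) auto
  ultimately show "vproj B (S \<inter> T) x = (vproj B S o\<^sub>L vproj B T) x" by (simp add: blinfun.add_left)
qed

lemma vproj_sums:
  fixes F :: "nat \<Rightarrow> real set"
  assumes B: "pos B" and F: "range F \<subseteq> sets borel" "disjoint_family F"
  shows "(\<lambda>n. vproj B (F n) x) sums vproj B (\<Union>n. F n) x"
proof -
  have Fb: "F n \<in> sets borel" for n using F(1) by auto
  have o: "oseq (\<lambda>n. vproj B (F n))"
    unfolding oseq_def using vproj(1)[OF B Fb] vproj_disjoint(1)[OF B Fb Fb] F(2)
    by (auto simp: disjoint_family_on_def)
  note r = osum_projection[OF o]
  have "vproj B (\<Union>n. F n) = osum (\<lambda>n. vproj B (F n))"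
  proof (rule vproj_eqI[OF B _ r(2)])
    show "(\<Union>n. F n) \<in> sets borel" using Fb by auto
    fix x
    have "emeasure (vmeasure B x) (\<Union>i. F i) = (\<Sum>i. emeasure (vmeasure B x) (F i))"
      by (rule suminf_emeasure[symmetric]) (use F in auto)
    also have "\<dots> = (\<Sum>i. ennreal ((norm (vproj B (F i) x))\<^sup>2))" by (simp add: vproj(2)[OF B Fb])
    also have "\<dots> = ennreal ((norm (osum (\<lambda>n. vproj B (F n)) x))\<^sup>2)"
      by (rule suminf_ennreal_eq[OF _ r(6)]) simp
    finally show "emeasure (vmeasure B x) (\<Union>i. F i) = ennreal ((norm (osum (\<lambda>n. vproj B (F n)) x))\<^sup>2)" .
  qed
  then show ?thesis using r(1)[of x] by simp
qed

text \<open>On a uniform partition the bounds add up to the mesh times m a - m b, which tends to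
  0.\<close>

lemma telescoping_eq:
  fixes d m :: "real \<Rightarrow> real"
  assumes ab: "a \<le> b" and d: "\<And>s t. a \<le> s \<Longrightarrow> s \<le> t \<Longrightarrow> t \<le> b \<Longrightarrow> \<bar>d s - d t\<bar> \<le> (t - s) * (m s - m t)"
  shows "d a = d b"
proof -
  have "\<bar>d a - d b\<bar> \<le> (b - a) * (m a - m b) / real (Suc n)" for n
  proof -
    define h where "h = (b - a) / real (Suc n)"
    have h: "h \<ge> 0" "real (Suc n) * h = b - a" using ab by (auto simp: h_def)
    define p where "p k = a + real k * h" for k
    have "k \<le> Suc n \<Longrightarrow> \<bar>d a - d (p k)\<bar> \<le> h * (m a - m (p k))" for k
    proof (induction k)
      case (Suc k)
      have "real (Suc k) * h \<le> real (Suc n) * h" using Suc.prems h by (intro mult_right_mono) auto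
      then have "p (Suc k) \<le> b" using h by (simp add: p_def)
      moreover have "p (Suc k) = p k + h" by (simp add: p_def algebra_simps)
      moreover have "a \<le> p k" using h by (simp add: p_def)
      ultimately have "\<bar>d (p k) - d (p (Suc k))\<bar> \<le> h * (m (p k) - m (p (Suc k)))" using d[of "p k" "p (Suc k)"] h by simp
      moreover have "\<bar>d a - d (p k)\<bar> \<le> h * (m a - m (p k))" using Suc by simp
      ultimately show ?case unfolding right_diff_distrib by linarith
    qed (simp add: p_def)
    from this[of "Suc n"] have "\<bar>d a - d b\<bar> \<le> h * (m a - m b)" using h by (simp add: p_def del: of_nat_Suc)
    then show ?thesis by (simp add: h_def)
  qed
  moreover have "(\<lambda>n. (b - a) * (m a - m b) / real (Suc n)) \<longlonglongrightarrow> 0"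
    by (intro LIMSEQ_Suc tendsto_divide_0[OF tendsto_const] filterlim_at_top_imp_at_infinity filterlim_real_sequentially)
  ultimately have "\<bar>d a - d b\<bar> \<le> 0" by (intro LIMSEQ_le_const[of _ 0]) auto
  then show ?thesis by simp
qed

text \<open>On the band [s, t) both the form of B and the integral of the identity lie between s and
  t times the mass. Their difference therefore satisfies the hypothesis of
  \<open>telescoping_eq\<close> and has equal values at 0 and beyond the norm of B, where both
  vanish.\<close>

lemma vmeasure_integral:
  assumes B: "pos B"
  shows "has_bochner_integral (vmeasure B x) (\<lambda>t. t) (B x \<bullet> x)"
proof -
  let ?\<mu> = "vmeasure B x"
  define c where "c = norm B + 1"
  have c: "c > 0" "norm B < c" by (auto simp: c_def add_nonneg_pos)
  interpret finite_measure ?\<mu> by (rule finite_measureI) (simp add: vmeasure_UNIV[OF B])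
  define m where "m s = (norm (spg B s x))\<^sup>2" for s
  define g where "g s = B (spg B s x) \<bullet> spg B s x" for s
  define h where "h s = (\<integral>u. u * indicator {s..<c} u \<partial>?\<mu>)" for s
  have int: "integrable ?\<mu> (\<lambda>u. u * indicator {s..<t} u)" for s t :: real
    by (rule integrable_const_bound[where B = "\<bar>s\<bar> + \<bar>t\<bar>"]) (auto simp: indicator_def)
  have mono: "m t \<le> m s" if "s \<le> t" for s t unfolding m_def by (rule spg_mono_norm[OF B that])
  have meas: "measure ?\<mu> {s..<t} = m s - m t" if "s \<le> t" for s t
    using vmeasure_Ico[OF B that, of x] mono[OF that] by (simp add: measure_def m_def)
  have ind: "integrable ?\<mu> (indicator {s..<t} :: real \<Rightarrow> real)" for s t :: real
    by (rule integrable_real_indicator) (auto simp: less_top[symmetric])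
  have "g 0 - h 0 = g c - h c"
  proof (rule telescoping_eq[where m = m and d = "\<lambda>s. g s - h s" and a = 0 and b = c])
    show "0 \<le> c" using c by simp
    fix s t :: real assume st: "0 \<le> s" "s \<le> t" "t \<le> c"
    let ?J = "\<integral>u. u * indicator {s..<t} u \<partial>?\<mu>"
    have "h s = (\<integral>u. u * indicator {s..<t} u + u * indicator {t..<c} u \<partial>?\<mu>)"
      unfolding h_def by (rule Bochner_Integration.integral_cong) (use st in \<open>auto simp: indicator_def\<close>)
    also have "\<dots> = ?J + h t" unfolding h_def by (rule Bochner_Integration.integral_add[OF int int])
    finally have hJ: "h s - h t = ?J" by simp
    have "(\<integral>u. s * indicator {s..<t} u \<partial>?\<mu>) \<le> ?J"
      by (rule integral_mono[OF integrable_mult_right[OF ind] int]) (auto simp: indicator_def)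
    then have J1: "s * (m s - m t) \<le> ?J" using meas[OF st(2)] by simp
    have "?J \<le> (\<integral>u. t * indicator {s..<t} u \<partial>?\<mu>)"
      by (rule integral_mono[OF int integrable_mult_right[OF ind]]) (auto simp: indicator_def)
    then have J2: "?J \<le> t * (m s - m t)" using meas[OF st(2)] by simp
    note le = spg_antimono[OF B st(2)] and G = spg(1)[OF B]
    let ?w = "spg B s x - spg B t x"
    have Gst: "spg B t (spg B s x) = spg B t x" by (rule pleqD'[OF le G G])
    have "B (spg B s x) \<bullet> spg B s x = B (spg B t x) \<bullet> spg B t x + B ?w \<bullet> ?w"
      using energy_split[OF B G[of t] spg_comm[OF B, of t], of "spg B s x"] by (simp add: Gst)
    then have gw: "g s - g t = B ?w \<bullet> ?w" by (simp add: g_def)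
    have nw: "(norm ?w)\<^sup>2 = m s - m t" using norm_compl[OF G G le, of x] by (simp add: m_def blinfun.diff_left)
    have "spg B s ?w = ?w" using le by (simp add: blinfun.diff_right projectionsD(2)[OF G] pleq_def)
    then have g1: "s * (m s - m t) \<le> g s - g t" using spg(3)[OF B, of s ?w] by (simp add: gw nw)
    have "spg B t ?w = 0" by (simp add: blinfun.diff_right projectionsD(2)[OF G] Gst)
    then have g2: "g s - g t \<le> t * (m s - m t)" using spg_le[OF B, of t ?w] by (simp add: gw nw)
    show "\<bar>(g s - h s) - (g t - h t)\<bar> \<le> (t - s) * (m s - m t)"
      using J1 J2 g1 g2 hJ unfolding left_diff_distrib by linarith
  qed
  moreover have "g c = 0" "h c = 0" "g 0 = B x \<bullet> x" by (simp_all add: g_def h_def spg_norm[OF B c(2)] spg_zero[OF B])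
  ultimately have h0: "h 0 = B x \<bullet> x" by simp
  \<comment> \<open>[0, c) already carries the total mass, so the truncated integrand agrees with
    the identity almost everywhere.\<close>
  have "emeasure ?\<mu> (UNIV - {0..<c}) = emeasure ?\<mu> UNIV - emeasure ?\<mu> {0..<c}"
    using emeasure_compl[of "{0..<c}" ?\<mu>] by simp
  then have "emeasure ?\<mu> (UNIV - {0..<c}) = 0"
    unfolding vmeasure_UNIV[OF B] vmeasure_Ico_total[OF B order_refl c(2)] by simp
  then have "AE u in ?\<mu>. u \<in> {0..<c}" by (intro AE_I[where N = "UNIV - {0..<c}"]) auto
  then have ae: "AE u in ?\<mu>. u * indicator {0..<c} u = u" by eventually_elim simp
  have "has_bochner_integral ?\<mu> (\<lambda>u. u * indicator {0..<c} u) (B x \<bullet> x)"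
    using has_bochner_integral_integrable[OF int[of 0 c]] h0 by (simp add: h_def)
  then show ?thesis by (rule has_bochner_integral_cong_AE[THEN iffD1, OF _ _ ae, rotated 2]) auto
qed

section \<open>Existence of spectral measures and their values at points\<close>

lemma cinner_pos: assumes B: "pos B" shows "cinner (B x) x = complex_of_real (B x \<bullet> x)"
proof (rule complex_eqI)
  have "Im (cinner (B x) x) = - ((\<i> *\<^sub>C B x) \<bullet> x)" by (rule Im_cinner)
  moreover have "(\<i> *\<^sub>C B x) \<bullet> x = - ((\<i> *\<^sub>C B x) \<bullet> x)"
  proof -
    have "(\<i> *\<^sub>C B x) \<bullet> x = B (\<i> *\<^sub>C x) \<bullet> x" using bounded_opsD[OF M_bounded_ops[OF posD(1)[OF B]]] by simp
    also have "\<dots> = (\<i> *\<^sub>C x) \<bullet> B x" by (rule posD(2)[OF B])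
    also have "\<dots> = x \<bullet> (cnj \<i> *\<^sub>C B x)" by (rule inner_scaleC_left)
    also have "\<dots> = (cnj \<i> *\<^sub>C B x) \<bullet> x" by (rule inner_commute)
    also have "cnj \<i> *\<^sub>C B x = - (\<i> *\<^sub>C B x)"
      using scaleC_scaleC[of "-1" \<i> "B x"] scaleC_of_real[of "-1" "\<i> *\<^sub>C B x"] by simp
    finally show ?thesis by simp
  qed
  ultimately show "Im (cinner (B x) x) = Im (complex_of_real (B x \<bullet> x))" by simp
qed (simp add: inner_eq_Re_cinner)

lemma spectral_measure_exists:
  assumes B: "pos B" shows "spectral_measure B (vproj B)"
  unfolding spectral_measure_def
proof (intro conjI ballI allI impI)
  show "is_projection (vproj B S)" if "S \<in> sets borel" for S
    using vproj(1)[OF B that] by (simp add: projections_def)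
  show "vproj B UNIV = id_blinfun"
    by (rule vproj_eqI[OF B]) (auto simp: projection_id vmeasure_UNIV[OF B])
  show "vproj B (S \<inter> T) = vproj B S o\<^sub>L vproj B T" if "S \<in> sets borel" "T \<in> sets borel" for S T
    by (rule vproj_Int[OF B that])
  show "(\<lambda>n. vproj B (F n) x) sums vproj B (\<Union>n. F n) x" if "range F \<subseteq> sets borel \<and> disjoint_family F" for F x
    using vproj_sums[OF B] that by blast
  fix x
  have "measure_of UNIV (sets borel) (\<lambda>S. ennreal (Re (cinner (vproj B S x) x))) = measure_of UNIV (sets borel) (emeasure (vmeasure B x))"
  proof (rule measure_of_eq)
    fix S :: "real set" assume "S \<in> sigma_sets UNIV (sets borel)"
    then have "S \<in> sets borel" by (metis sets.sigma_sets_eq space_borel)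
    then show "ennreal (Re (cinner (vproj B S x) x)) = emeasure (vmeasure B x) S"
      by (simp add: vproj[OF B] inner_eq_Re_cinner[symmetric] projectionsD(4))
  qed simp
  also have "\<dots> = vmeasure B x"
    using measure_of_of_measure[of "vmeasure B x"] by simp
  finally have e: "measure_of UNIV (sets borel) (\<lambda>S. ennreal (Re (cinner (vproj B S x) x))) = vmeasure B x" .
  show "has_bochner_integral (measure_of UNIV (sets borel) (\<lambda>S. ennreal (Re (cinner (vproj B S x) x))))
      complex_of_real (cinner (B x) x)"
    unfolding e cinner_pos[OF B] by (rule has_bochner_integral_of_real[OF vmeasure_integral[OF B]])
qed

text \<open>This gives the uniqueness behind \<open>spectral_proj\<close> at singletons: every
  spectral measure has the eigenprojection there. On the range of E {b} the form of B is b times the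
  squared norm, which polarizes to B y = b y; conversely an eigenvector for b has zero mass on both
  open half-lines.\<close>

lemma spectral_measure_point:
  assumes B: "pos B" and E: "spectral_measure B E"
  shows "E {b} = null_proj (B - b *\<^sub>R id_blinfun)"
proof -
  have ip: "is_projection (E S)" and mult: "T \<in> sets borel \<Longrightarrow> E (S \<inter> T) = E S o\<^sub>L E T" if "S \<in> sets borel" for S T
    using E that by (auto simp: spectral_measure_def)
  have EU: "E UNIV = id_blinfun" using E by (simp add: spectral_measure_def)
  have cadd: "(\<lambda>n. E (F n) x) sums E (\<Union>n. F n) x" if "range F \<subseteq> sets borel" "disjoint_family F" for F :: "nat \<Rightarrow> real set" and x
    using E that by (auto simp: spectral_measure_def)
  have idem: "E S (E S x) = E S x" and sa: "E S x \<bullet> y = x \<bullet> E S y" if "S \<in> sets borel" for S x y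
  proof -
    have h: "E S \<in> bounded_ops" "E S o\<^sub>L E S = E S" "adj (E S) = E S" using ip[OF that] by (auto simp: is_projection_def)
    show "E S (E S x) = E S x" using h(2) by (metis blinfun_apply_blinfun_compose)
    show "E S x \<bullet> y = x \<bullet> E S y" using adj_inner[OF h(1), of x y] h(3) by simp
  qed
  have nrm: "E S x \<bullet> x = (norm (E S x))\<^sup>2" if "S \<in> sets borel" for S x
    using sa[OF that, of "E S x" x] idem[OF that, of x] by (simp add: power2_norm_eq_inner)
  have E0: "E {} x = 0" for x
  proof -
    have "(\<lambda>n::nat. E {} x) sums E {} x" using cadd[of "\<lambda>_. {}" x] by (simp add: disjoint_family_on_def)
    then have "(\<lambda>n::nat. E {} x) \<longlonglongrightarrow> 0" by (intro summable_LIMSEQ_zero sums_summable)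
    then show ?thesis using LIMSEQ_unique[OF tendsto_const] by blast
  qed
  have add: "E (S \<union> T) x = E S x + E T x" if "S \<in> sets borel" "T \<in> sets borel" "S \<inter> T = {}" for S T x
  proof -
    have "(\<lambda>n. E (binaryset S T n) x) sums E (\<Union>n. binaryset S T n) x"
    proof (rule cadd)
      show "range (binaryset S T) \<subseteq> sets borel" using that by (auto simp: range_binaryset_eq)
      show "disjoint_family (binaryset S T)" using that by (auto simp: disjoint_family_on_def binaryset_def)
    qed
    moreover have "(\<lambda>n. E (binaryset S T n) x) sums (E S x + E T x)" by (rule binaryset_sums) (rule E0)
    ultimately show ?thesis using sums_unique2 by (fastforce simp: UN_binaryset_eq)
  qed
  have compl: "E (- S) x = x - E S x" if "S \<in> sets borel" for S x
    using add[OF that borel_comp[OF that], of x] EU by (simp add: algebra_simps)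
  define \<mu> where "\<mu> x = measure_of UNIV (sets borel) (\<lambda>S. ennreal (Re (cinner (E S x) x)))" for x
  have sets [simp, measurable_cong]: "sets (\<mu> x) = sets borel" and space [simp]: "space (\<mu> x) = UNIV" for x
    by (simp_all add: \<mu>_def) (metis sets.sigma_sets_eq space_borel)
  have em: "emeasure (\<mu> x) S = ennreal ((norm (E S x))\<^sup>2)" if S: "S \<in> sets borel" for x S
  proof -
    have "emeasure (\<mu> x) S = ennreal (Re (cinner (E S x) x))"
      unfolding \<mu>_def
    proof (rule emeasure_measure_of_sigma[OF _ _ _ S])
      show "sigma_algebra UNIV (sets (borel :: real measure))" using sets.sigma_algebra_axioms[of "borel :: real measure"] by simp
      show "positive (sets borel) (\<lambda>S. ennreal (Re (cinner (E S x) x)))" by (simp add: positive_def E0 flip: inner_eq_Re_cinner)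
      show "countably_additive (sets borel) (\<lambda>S. ennreal (Re (cinner (E S x) x)))"
      proof (rule countably_additiveI)
        fix F :: "nat \<Rightarrow> real set" assume F: "range F \<subseteq> sets borel" "disjoint_family F" "(\<Union>i. F i) \<in> sets borel"
        have "(\<lambda>n. E (F n) x \<bullet> x) sums (E (\<Union>i. F i) x \<bullet> x)"
          by (rule bounded_linear.sums[OF bounded_linear_inner_left cadd[OF F(1,2)]])
        then show "(\<Sum>i. ennreal (Re (cinner (E (F i) x) x))) = ennreal (Re (cinner (E (\<Union>i. F i) x) x))"
          unfolding inner_eq_Re_cinner[symmetric] by (rule suminf_ennreal_eq[rotated]) (use F(1) nrm in auto)
      qed
    qed
    then show ?thesis using nrm[OF S, of x] by (simp add: inner_eq_Re_cinner)
  qed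
  have int: "has_bochner_integral (\<mu> y) (\<lambda>t. t) (B y \<bullet> y)" for y
  proof -
    have "has_bochner_integral (\<mu> y) complex_of_real (cinner (B y) y)" using E by (simp add: spectral_measure_def \<mu>_def)
    from has_bochner_integral_bounded_linear[OF bounded_linear_Re this] show ?thesis by (simp add: inner_eq_Re_cinner)
  qed
  have fin: "finite_measure (\<mu> x)" for x by (rule finite_measureI) (simp add: em)
  \<comment> \<open>By multiplicativity the scalar measure of E S x is that of x restricted to S, so
    integrals over S become forms of B at E S x.\<close>
  have dens: "\<mu> (E S x) = density (\<mu> x) (\<lambda>t. ennreal (indicator S t))" if S: "S \<in> sets borel" for S x
  proof (rule measure_eqI)
    fix T assume "T \<in> sets (\<mu> (E S x))"
    then have T: "T \<in> sets borel" by simp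
    have "emeasure (density (\<mu> x) (\<lambda>t. ennreal (indicator S t))) T = (\<integral>\<^sup>+t. indicator (S \<inter> T) t \<partial>\<mu> x)"
    proof (subst emeasure_density)
      show "(\<integral>\<^sup>+t. ennreal (indicator S t) * indicator T t \<partial>\<mu> x) = (\<integral>\<^sup>+t. indicator (S \<inter> T) t \<partial>\<mu> x)"
        by (rule nn_integral_cong) (simp split: split_indicator)
    qed (use S T in auto)
    also have "\<dots> = ennreal ((norm (E (T \<inter> S) x))\<^sup>2)" using S T by (simp add: em Int_commute)
    also have "\<dots> = emeasure (\<mu> (E S x)) T" by (simp add: em[OF T] mult[OF T S])
    finally show "emeasure (\<mu> (E S x)) T = emeasure (density (\<mu> x) (\<lambda>t. ennreal (indicator S t))) T" by simp
  qed simp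
  have q: "has_bochner_integral (\<mu> x) (\<lambda>t. indicator S t * t) (B (E S x) \<bullet> E S x)" if S: "S \<in> sets borel" for S x
  proof -
    have m: "(\<lambda>t::real. t) \<in> borel_measurable (\<mu> x)" "(\<lambda>t. indicator S t :: real) \<in> borel_measurable (\<mu> x)"
      "AE t in \<mu> x. 0 \<le> (indicator S t :: real)" using S by auto
    show ?thesis
      using int[of "E S x"] integrable_density[OF m] integral_density[OF m] unfolding dens[OF S] has_bochner_integral_iff by simp
  qed
  \<comment> \<open>Adding the integrals over S and its complement recovers the full form of B at x,
    which forces the cross term to vanish.\<close>
  have orth: "B (E S x) \<bullet> (x - E S x) = 0" if S: "S \<in> sets borel" for S x
  proof -
    have "has_bochner_integral (\<mu> x) (\<lambda>t. indicator S t * t + indicator (- S) t * t) (B (E S x) \<bullet> E S x + B (E (- S) x) \<bullet> E (- S) x)"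
      by (intro has_bochner_integral_add q S borel_comp)
    moreover have "(\<lambda>t::real. indicator S t * t + indicator (- S) t * t) = (\<lambda>t. t)" by (auto simp: indicator_def)
    ultimately have "has_bochner_integral (\<mu> x) (\<lambda>t. t) (B (E S x) \<bullet> E S x + B (x - E S x) \<bullet> (x - E S x))"
      by (simp add: compl[OF S])
    then have "B (E S x) \<bullet> E S x + B (x - E S x) \<bullet> (x - E S x) = B x \<bullet> x"
      using int[of x] has_bochner_integral_eq by blast
    moreover have "B x = B (E S x) + B (x - E S x)" by (simp add: blinfun.diff_right)
    moreover have "B (x - E S x) \<bullet> E S x = B (E S x) \<bullet> (x - E S x)" using posD(2)[OF B] by (metis inner_commute)
    moreover have "x = E S x + (x - E S x)" by simp
    ultimately have "B (E S x) \<bullet> E S x + B (x - E S x) \<bullet> (x - E S x) = (B (E S x) + B (x - E S x)) \<bullet> (E S x + (x - E S x))" by simp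
    then show ?thesis
      using \<open>B (x - E S x) \<bullet> E S x = B (E S x) \<bullet> (x - E S x)\<close> unfolding inner_add_left inner_add_right by linarith
  qed
  have b: "{b} \<in> sets borel" by simp
  let ?P = "E {b}"
  have Pb: "B (?P x) \<bullet> ?P x = b * (norm (?P x))\<^sup>2" for x
  proof -
    interpret finite_measure "\<mu> x" by (rule fin)
    have "has_bochner_integral (\<mu> x) (\<lambda>t. b * indicator {b} t) (b * measure (\<mu> x) {b})"
      by (intro has_bochner_integral_mult_right has_bochner_integral_real_indicator) (auto simp: less_top[symmetric])
    moreover have "(\<lambda>t. b * indicator {b} t) = (\<lambda>t. indicator {b} t * t)" by (auto simp: indicator_def)
    ultimately show ?thesis using q[OF b, of x] has_bochner_integral_eq by (fastforce simp: measure_def em)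
  qed
  have ker1: "B y = b *\<^sub>R y" if y: "?P y = y" for y
  proof -
    have "(B y - b *\<^sub>R y) \<bullet> z = 0" for z
    proof -
      let ?v = "z - ?P z"
      have Pv: "?P ?v = 0" by (simp add: blinfun.diff_right idem)
      have "B y \<bullet> ?v = 0" using orth[OF b, of "y + ?v"] Pv y by (simp add: blinfun.add_right)
      moreover have "y \<bullet> ?v = 0" using sa[OF b, of y ?v] y Pv by simp
      moreover have "B y \<bullet> ?P z = b * (y \<bullet> ?P z)"
      proof -
        have e: "B (y + ?P z) \<bullet> (y + ?P z) = b * (norm (y + ?P z))\<^sup>2" using Pb[of "y + z"] y by (simp add: blinfun.add_right)
        have "B (?P z) \<bullet> y = B y \<bullet> ?P z" using posD(2)[OF B] by (metis inner_commute)
        then have "B (y + ?P z) \<bullet> (y + ?P z) = B y \<bullet> y + 2 * (B y \<bullet> ?P z) + B (?P z) \<bullet> ?P z"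
          by (simp add: blinfun.add_right inner_add_left inner_add_right)
        moreover have "b * (norm (y + ?P z))\<^sup>2 = b * (norm y)\<^sup>2 + 2 * (b * (y \<bullet> ?P z)) + b * (norm (?P z))\<^sup>2"
          by (simp add: power2_norm_eq_inner inner_add_left inner_add_right inner_commute distrib_left)
        ultimately show ?thesis using e Pb[of z] Pb[of y] y by simp
      qed
      ultimately show ?thesis by (simp add: inner_diff_left inner_diff_right)
    qed
    from this[of "B y - b *\<^sub>R y"] show ?thesis by simp
  qed
  \<comment> \<open>\<sigma> is used with the values 1 and -1 and selects the side of b. A
    nonnegative integrand with integral 0 that is positive on R leaves R without mass.\<close>
  have ker2: "E R x = 0" if x: "B x = b *\<^sub>R x" and R: "R \<in> sets borel" and \<sigma>: "\<And>t. t \<in> R \<Longrightarrow> 0 < \<sigma> * (t - b)" for R x and \<sigma> :: real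
  proof -
    interpret finite_measure "\<mu> x" by (rule fin)
    let ?y = "E R x"
    have yx: "?y \<bullet> x = (norm ?y)\<^sup>2" by (rule nrm[OF R])
    have "B ?y \<bullet> ?y = B ?y \<bullet> x" using orth[OF R, of x] by (simp add: inner_diff_right)
    also have "\<dots> = b * (norm ?y)\<^sup>2" using posD(2)[OF B, of ?y x] by (simp add: x yx)
    finally have By: "B ?y \<bullet> ?y = b * (norm ?y)\<^sup>2" .
    have "has_bochner_integral (\<mu> x) (\<lambda>t. b * indicator R t) (b * measure (\<mu> x) R)"
      by (intro has_bochner_integral_mult_right has_bochner_integral_real_indicator) (use R in \<open>auto simp: less_top[symmetric]\<close>)
    from has_bochner_integral_mult_right[of \<sigma>, OF has_bochner_integral_diff[OF q[OF R, of x] this]]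
    have i: "has_bochner_integral (\<mu> x) (\<lambda>t. \<sigma> * (indicator R t * t - b * indicator R t)) 0"
      by (simp add: By measure_def em[OF R])
    have nn: "0 \<le> \<sigma> * (indicator R t * t - b * indicator R t)" for t using \<sigma>[of t] by (auto simp: indicator_def)
    have "AE t in \<mu> x. \<sigma> * (indicator R t * t - b * indicator R t) = 0"
      using i integral_nonneg_eq_0_iff_AE[of "\<mu> x" "\<lambda>t. \<sigma> * (indicator R t * t - b * indicator R t)"] nn
      unfolding has_bochner_integral_iff by simp
    then have "AE t in \<mu> x. t \<notin> R"
    proof eventually_elim
      case (elim t)
      then show ?case using \<sigma>[of t] by (auto simp: indicator_def)
    qed
    then have "emeasure (\<mu> x) R = 0" using AE_iff_measurable[of R "\<mu> x" "\<lambda>t. t \<notin> R"] R by auto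
    then show ?thesis by (simp add: em[OF R])
  qed
  have ker: "?P x = x \<longleftrightarrow> (B - b *\<^sub>R id_blinfun) x = 0" for x
  proof
    assume "(B - b *\<^sub>R id_blinfun) x = 0"
    then have x: "B x = b *\<^sub>R x" by (simp add: blinfun.diff_left blinfun.scaleR_left)
    have "E {b<..} x = 0" by (rule ker2[OF x, of _ 1]) auto
    moreover have "E {..<b} x = 0" by (rule ker2[OF x, of _ "-1"]) auto
    moreover have "E (- {b}) x = E {b<..} x + E {..<b} x"
    proof -
      have "- {b} = {b<..} \<union> {..<b}" by auto
      moreover have "{b<..} \<inter> {..<b} = {}" by auto
      ultimately show ?thesis using add[of "{b<..}" "{..<b}" x] by simp
    qed
    ultimately show "?P x = x" using compl[OF b, of x] by simp
  qed (use ker1 in \<open>simp add: blinfun.diff_left blinfun.scaleR_left\<close>)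
  have BM: "B - b *\<^sub>R id_blinfun \<in> M" using posD(1)[OF B] by (simp add: M_diff M_scaleR M_id)
  have eq: "is_projection P \<Longrightarrow> (\<And>x. P x = x \<longleftrightarrow> (B - b *\<^sub>R id_blinfun) x = 0) \<Longrightarrow> P = proj_on {x. (B - b *\<^sub>R id_blinfun) x = 0}" for P :: "'a \<Rightarrow>\<^sub>L 'a"
  proof (rule is_projection_M_eqI[OF _ subspace_ker closed_ker])
    assume P: "is_projection P" and k: "\<And>x. P x = x \<longleftrightarrow> (B - b *\<^sub>R id_blinfun) x = 0"
    have "P o\<^sub>L P = P" using P by (simp add: is_projection_def)
    then have PP: "P (P x) = P x" for x by (metis blinfun_apply_blinfun_compose)
    have "{x. P x = x} \<subseteq> range P" by (metis (mono_tags) mem_Collect_eq rangeI subsetI)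
    moreover have "range P \<subseteq> {x. P x = x}" by (auto simp: PP)
    ultimately have "range P = {x. P x = x}" by blast
    then show "range P = {x. (B - b *\<^sub>R id_blinfun) x = 0}" by (simp only: k)
  qed
  show ?thesis
  proof (rule trans[OF eq[OF ip[OF b] ker] sym[OF eq[OF _ null_proj_M(2)[OF BM]]]])
    show "is_projection (null_proj (B - b *\<^sub>R id_blinfun))" using null_proj_M(1)[OF BM] by (simp add: projections_def)
  qed
qed

theorem spectral_proj_singleton:
  assumes B: "pos B" shows "spectral_proj {b} B = null_proj (B - b *\<^sub>R id_blinfun)"
proof -
  have "\<exists>E. spectral_measure B E \<and> null_proj (B - b *\<^sub>R id_blinfun) = E {b}"
    by (intro exI[of _ "vproj B"] conjI spectral_measure_exists[OF B] sym[OF spectral_measure_point[OF B spectral_measure_exists[OF B]]])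
  moreover have "P = null_proj (B - b *\<^sub>R id_blinfun)" if "\<exists>E. spectral_measure B E \<and> P = E {b}" for P
    using that spectral_measure_point[OF B] by blast
  ultimately show ?thesis unfolding spectral_proj_def by (rule the_equality)
qed

end

section \<open>The ideal of the finite projections\<close>

context vn_algebra
begin

lemma M_uminus: "T \<in> M \<Longrightarrow> - T \<in> M"
  using M_scaleR[of T "-1"] by simp

lemma op_ring_simps: "carrier (op_ring M) = M" "x \<otimes>\<^bsub>op_ring M\<^esub> y = x o\<^sub>L y" "\<one>\<^bsub>op_ring M\<^esub> = id_blinfun"
  "\<zero>\<^bsub>op_ring M\<^esub> = 0" "x \<oplus>\<^bsub>op_ring M\<^esub> y = x + y"
  by (simp_all add: op_ring_def)

lemma ring_op_ring: "ring (op_ring M)"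
proof (rule ringI)
  show "abelian_group (op_ring M)"
  proof (rule abelian_groupI; simp only: op_ring_simps)
    show "\<exists>y\<in>M. y + x = 0" if "x \<in> M" for x using M_uminus[OF that] by (intro bexI[of _ "- x"]) simp_all
  qed (auto intro: M_add M_0)
  show "Group.monoid (op_ring M)"
    by (rule monoidI; simp only: op_ring_simps) (auto intro!: blinfun_eqI simp: M_comp M_id)
qed (auto simp: op_ring_simps blinfun.add_left blinfun.add_right intro!: blinfun_eqI)

lemma op_ring_minus:
  assumes "x \<in> M" shows "\<ominus>\<^bsub>op_ring M\<^esub> x = - x"
proof -
  interpret ring "op_ring M" by (rule ring_op_ring)
  show ?thesis by (rule minus_equality) (simp_all add: op_ring_simps assms M_uminus)
qed

lemma ideal_op_ringI:
  assumes K: "K \<subseteq> M" "0 \<in> K" "\<And>x y. x \<in> K \<Longrightarrow> y \<in> K \<Longrightarrow> x + y \<in> K"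
    and l: "\<And>a x. a \<in> K \<Longrightarrow> x \<in> M \<Longrightarrow> x o\<^sub>L a \<in> K" and r: "\<And>a x. a \<in> K \<Longrightarrow> x \<in> M \<Longrightarrow> a o\<^sub>L x \<in> K"
  shows "ideal K (op_ring M)"
proof -
  interpret ring "op_ring M" by (rule ring_op_ring)
  have neg: "- a \<in> K" if "a \<in> K" for a
  proof -
    have "(- id_blinfun) o\<^sub>L a = - a" by (rule blinfun_eqI) (simp add: blinfun.minus_left)
    then show ?thesis using l[OF that M_uminus[OF M_id]] by simp
  qed
  show ?thesis
  proof (rule idealI[OF ring_op_ring])
    show "subgroup K (add_monoid (op_ring M))"
    proof (rule add.subgroupI)
      show "\<ominus>\<^bsub>op_ring M\<^esub> a \<in> K" if "a \<in> K" for a using neg[OF that] op_ring_minus that K(1) by auto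
    qed (use K in \<open>auto simp: op_ring_simps\<close>)
  qed (use l r in \<open>simp_all add: op_ring_simps\<close>)
qed

lemma closed_M: "closed M"
  unfolding closed_sequential_limits
proof (intro allI impI, elim conjE)
  fix X and L :: "'a \<Rightarrow>\<^sub>L 'a" assume X: "\<forall>n. X n \<in> M" "X \<longlonglongrightarrow> L"
  have "(\<lambda>n. X n x) \<longlonglongrightarrow> L x" for x using X(2) by (rule bounded_linear.tendsto[OF blinfun.bounded_linear_left])
  then show "L \<in> M" using M_strong_limit[of X] X(1) by blast
qed

text \<open>An intersection of ideals is an ideal once the family is nonempty; M itself belongs to
  it, being norm closed.\<close>

lemma ideal_finite_ideal: "ideal (finite_ideal M) (op_ring M)"
proof -
  interpret ring "op_ring M" by (rule ring_op_ring)
  show ?thesis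
    unfolding finite_ideal_def
  proof (rule i_Intersect)
    have "M \<in> {I. ideal I (op_ring M) \<and> closed I \<and> Collect (finite_proj M) \<subseteq> I}"
      using oneideal closed_M by (auto simp: op_ring_simps finite_proj_def projections_def)
    then show "{I. ideal I (op_ring M) \<and> closed I \<and> Collect (finite_proj M) \<subseteq> I} \<noteq> {}" by blast
  qed simp
qed

lemma finite_ideal:
  shows "finite_ideal M \<subseteq> M" "0 \<in> finite_ideal M"
    "S \<in> finite_ideal M \<Longrightarrow> T \<in> finite_ideal M \<Longrightarrow> S + T \<in> finite_ideal M"
    "S \<in> finite_ideal M \<Longrightarrow> T \<in> M \<Longrightarrow> T o\<^sub>L S \<in> finite_ideal M"
    "S \<in> finite_ideal M \<Longrightarrow> T \<in> M \<Longrightarrow> S o\<^sub>L T \<in> finite_ideal M"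
    "F \<in> projections M \<Longrightarrow> \<not> inft F \<Longrightarrow> F \<in> finite_ideal M"
proof -
  interpret ideal "finite_ideal M" "op_ring M" by (rule ideal_finite_ideal)
  show "finite_ideal M \<subseteq> M" using a_subset by (simp add: op_ring_simps)
  show "0 \<in> finite_ideal M" using additive_subgroup.zero_closed[OF additive_subgroup_axioms] by (simp add: op_ring_simps)
  show "S \<in> finite_ideal M \<Longrightarrow> T \<in> finite_ideal M \<Longrightarrow> S + T \<in> finite_ideal M" using additive_subgroup.a_closed[OF additive_subgroup_axioms, of S T] by (simp add: op_ring_simps)
  show "S \<in> finite_ideal M \<Longrightarrow> T \<in> M \<Longrightarrow> T o\<^sub>L S \<in> finite_ideal M" using I_l_closed[of S T] by (simp add: op_ring_simps)
  show "S \<in> finite_ideal M \<Longrightarrow> T \<in> M \<Longrightarrow> S o\<^sub>L T \<in> finite_ideal M" using I_r_closed[of S T] by (simp add: op_ring_simps)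
  show "F \<in> finite_ideal M" if "F \<in> projections M" "\<not> inft F"
    unfolding finite_ideal_def using that by (auto simp: infinite_proj_def)
qed

lemma quot_map_eq: "quot_map M A = {J + A | J. J \<in> finite_ideal M}"
  unfolding quot_map_def a_r_coset_def' by (auto simp: op_ring_simps)

section \<open>Essential norm and essential spectrum\<close>

lemma ess_norm_le:
  assumes "J \<in> finite_ideal M" shows "ess_norm M A \<le> norm (J + A)"
  unfolding ess_norm_def quot_norm_def
  by (rule cINF_lower) (use assms in \<open>auto simp: quot_map_eq intro: bdd_belowI[of _ 0]\<close>)

lemma ess_norm_ge:
  assumes "\<And>J. J \<in> finite_ideal M \<Longrightarrow> a \<le> norm (J + A)" shows "a \<le> ess_norm M A"
  unfolding ess_norm_def quot_norm_def
  by (rule cINF_greatest) (use assms finite_ideal(2) in \<open>auto simp: quot_map_eq\<close>)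

lemma ess_norm_le_norm: "ess_norm M A \<le> norm A"
  using ess_norm_le[OF finite_ideal(2), of A] by simp

text \<open>A self-adjoint operator bounded below has trivial kernel and closed range, whose
  orthogonal complement is the kernel; so it is bijective. The inverse commutes with whatever
  commutes with T.\<close>

lemma invertible_in_M:
  assumes T: "T \<in> M" and sa: "\<And>x y. T x \<bullet> y = x \<bullet> T y" and c: "c > 0" and lb: "\<And>x. c * norm x \<le> norm (T x)"
  shows "\<exists>D\<in>M. (\<forall>x. D (T x) = x) \<and> (\<forall>x. T (D x) = x)"
proof -
  have inj: "x = y" if "T x = T y" for x y
  proof -
    have "c * norm (x - y) \<le> 0" using lb[of "x - y"] that by (simp add: blinfun.diff_right)
    then show ?thesis using c by (simp add: mult_le_0_iff)
  qed
  have sub: "subspace (range T)" by (rule linear_subspace_image) (rule bounded_linear.linear[OF blinfun.bounded_linear_right], rule subspace_UNIV)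
  have clo: "closed (range T)"
    unfolding closed_sequential_limits
  proof (intro allI impI, elim conjE)
    fix Y l assume Y: "\<forall>n. Y n \<in> range (blinfun_apply T)" "Y \<longlonglongrightarrow> l"
    then have "\<forall>n. \<exists>x. Y n = T x" by blast
    then obtain X where X: "\<And>n. Y n = T (X n)" by metis
    have "Cauchy X"
    proof (rule metric_CauchyI)
      fix e :: real assume "e > 0"
      then have "e * c > 0" using c by simp
      then obtain N where N: "\<And>m n. m \<ge> N \<Longrightarrow> n \<ge> N \<Longrightarrow> dist (Y m) (Y n) < e * c"
        using LIMSEQ_imp_Cauchy[OF Y(2)] by (meson metric_CauchyD)
      have "dist (X m) (X n) < e" if "m \<ge> N" "n \<ge> N" for m n
      proof -
        have "c * dist (X m) (X n) \<le> dist (Y m) (Y n)" using lb[of "X m - X n"] by (simp add: dist_norm X blinfun.diff_right)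
        also have "\<dots> < c * e" using N[OF that] by (simp add: mult.commute)
        finally show ?thesis using c by simp
      qed
      then show "\<exists>N. \<forall>m\<ge>N. \<forall>n\<ge>N. dist (X m) (X n) < e" by blast
    qed
    then obtain x where "X \<longlonglongrightarrow> x" using Cauchy_convergent convergent_def by blast
    then have "(\<lambda>n. T (X n)) \<longlonglongrightarrow> T x" by (rule blinfun.tendsto[OF tendsto_const])
    then have "l = T x" using LIMSEQ_unique[OF Y(2)] by (simp add: X[symmetric])
    then show "l \<in> range T" by simp
  qed
  have surj: "\<exists>x. T x = y" for y
  proof -
    let ?p = "proj_on (range T) y"
    have "(y - ?p) \<bullet> T z = 0" for z by (rule proj_on_works(2)[OF sub clo]) simp
    then have "T (y - ?p) \<bullet> T (y - ?p) = 0" using sa[of "y - ?p" "T (y - ?p)"] by simp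
    then have "T (y - ?p) = T 0" by simp
    then have "y = ?p" using inj by fastforce
    then show ?thesis using proj_on_works(1)[OF sub clo, of y] by (metis rangeE)
  qed
  then obtain g where g: "\<And>y. T (g y) = y" by metis
  have "bounded_linear g"
  proof (rule bounded_linear_intro)
    show "g (x + y) = g x + g y" for x y by (rule inj) (simp add: g blinfun.add_right)
    show "g (r *\<^sub>R x) = r *\<^sub>R g x" for r x by (rule inj) (simp add: g blinfun.scaleR_right)
    show "norm (g x) \<le> norm x * (1 / c)" for x using lb[of "g x"] c by (simp add: g field_simps)
  qed
  then obtain D where D: "blinfun_apply D = g" using bounded_linear_Blinfun_apply by blast
  have "D \<in> M"
  proof (rule in_M)
    fix X x assume X: "X \<in> commutant M"
    show "D (X x) = X (D x)" by (rule inj) (simp add: D g commutantD[OF X T])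
  qed
  moreover have "D (T x) = x" for x by (rule inj) (simp add: D g)
  ultimately show ?thesis using g D by metis
qed

text \<open>Otherwise F = 1 - spg B e is finite. Then T = B (1 - F) + F is bounded below by min e 1,
  hence invertible in M, and it differs from B by B F - F, which lies in the ideal; so the class of
  B would be invertible.\<close>

lemma ess_spectrum_0:
  assumes B: "pos B" and z: "0 \<in> ess_spectrum M B" and e: "e > 0"
  shows "inft (id_blinfun - spg B e)"
proof (rule ccontr)
  assume fin: "\<not> ?thesis"
  note G = spg(1)[OF B, of e]
  define F where "F = id_blinfun - spg B e"
  have Fp: "F \<in> projections M" unfolding F_def by (rule projection_compl[OF G])
  have FI: "F \<in> finite_ideal M" using finite_ideal(6)[OF Fp] fin by (simp add: F_def)
  define T where "T = (B o\<^sub>L spg B e) + F"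
  have BM: "B \<in> M" using B posD by blast
  have TM: "T \<in> M" unfolding T_def by (intro M_add M_comp BM projectionsD(1)[OF G] projectionsD(1)[OF Fp])
  have Tx: "T x = B (spg B e x) + F x" for x by (simp add: T_def blinfun.add_left)
  have sa: "T x \<bullet> y = x \<bullet> T y" for x y
  proof -
    have "B (spg B e x) \<bullet> y = x \<bullet> B (spg B e y)"
      by (simp add: posD(2)[OF B] projectionsD(3)[OF G] spg_comm[OF B])
    then show ?thesis by (simp add: Tx inner_add_left inner_add_right projectionsD(3)[OF Fp])
  qed
  define c where "c = min e 1"
  have c: "c > 0" "c \<le> e" "c \<le> 1" using e by (auto simp: c_def)
  have "c * norm x \<le> norm (T x)" for x
  proof (cases "x = 0")
    case False
    have "B (spg B e x) \<bullet> x = B (spg B e x) \<bullet> spg B e x"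
      using projectionsD(2,3)[OF G] by (metis spg_comm[OF B])
    then have "T x \<bullet> x = B (spg B e x) \<bullet> spg B e x + (norm (F x))\<^sup>2"
      by (simp add: Tx inner_add_left projectionsD(4)[OF Fp])
    moreover have "c * (norm (spg B e x))\<^sup>2 \<le> e * (norm (spg B e x))\<^sup>2" "c * (norm (F x))\<^sup>2 \<le> 1 * (norm (F x))\<^sup>2"
      using c by (intro mult_right_mono; simp)+
    moreover have "(norm (F x))\<^sup>2 = (norm x)\<^sup>2 - (norm (spg B e x))\<^sup>2"
      unfolding F_def using norm_compl[OF G projection_id, of x] by (simp add: pleq_def)
    ultimately have "c * (norm x)\<^sup>2 \<le> T x \<bullet> x" using spg_ge[OF B, of e x] by (simp add: right_diff_distrib)
    also have "\<dots> \<le> norm (T x) * norm x" by (rule norm_cauchy_schwarz)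
    finally show ?thesis using False by (simp add: power2_eq_square)
  qed simp
  then obtain D where D: "D \<in> M" "\<And>x. D (T x) = x" "\<And>x. T (D x) = x"
    using invertible_in_M[OF TM sa c(1)] by blast
  interpret R: ring "op_ring M" by (rule ring_op_ring)
  interpret I: ideal "finite_ideal M" "op_ring M" by (rule ideal_finite_ideal)
  interpret Q: ring "quot_alg M" unfolding quot_alg_def by (rule I.quotient_is_ring)
  have hom: "quot_map M \<in> ring_hom (op_ring M) (quot_alg M)"
    unfolding quot_alg_def quot_map_def[abs_def] by (rule I.rcos_ring_hom)
  have car: "quot_map M x \<in> carrier (quot_alg M)" if "x \<in> M" for x
    using ring_hom_closed[OF hom, of x] that by (simp add: op_ring_simps)
  have mul: "quot_map M (x o\<^sub>L y) = quot_map M x \<otimes>\<^bsub>quot_alg M\<^esub> quot_map M y" if "x \<in> M" "y \<in> M" for x y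
    using ring_hom_mult[OF hom, of x y] that by (simp add: op_ring_simps)
  have one: "quot_map M id_blinfun = \<one>\<^bsub>quot_alg M\<^esub>"
    using ring_hom_one[OF hom] by (simp add: op_ring_simps)
  have same: "quot_map M x = quot_map M y" if "x \<in> M" "y \<in> M" "x - y \<in> finite_ideal M" for x y
    using R.quotient_eq_iff_same_a_r_cos[OF ideal_finite_ideal, of x y] that
    by (simp add: quot_map_def op_ring_simps a_minus_def op_ring_minus)
  have BF: "(B o\<^sub>L F) - F \<in> finite_ideal M"
  proof -
    have "(B - id_blinfun) o\<^sub>L F \<in> finite_ideal M" by (intro finite_ideal(4)[OF FI] M_diff BM M_id)
    moreover have "(B - id_blinfun) o\<^sub>L F = (B o\<^sub>L F) - F" by (rule blinfun_eqI) (simp add: blinfun.diff_left)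
    ultimately show ?thesis by simp
  qed
  have Tx': "T x = B x - ((B o\<^sub>L F) - F) x" for x
    by (simp add: Tx F_def blinfun.diff_left blinfun.diff_right)
  have "(D o\<^sub>L B) - id_blinfun \<in> finite_ideal M"
  proof -
    have "D o\<^sub>L ((B o\<^sub>L F) - F) = (D o\<^sub>L B) - id_blinfun"
    proof (rule blinfun_eqI)
      fix x
      have "((B o\<^sub>L F) - F) x = B x - T x" using Tx'[of x] by simp
      then show "(D o\<^sub>L ((B o\<^sub>L F) - F)) x = ((D o\<^sub>L B) - id_blinfun) x"
        by (simp only: blinfun_apply_blinfun_compose blinfun.diff_left[of "D o\<^sub>L B"] blinfun.diff_right D(2) id_blinfun.rep_eq id_apply)
    qed
    then show ?thesis using finite_ideal(4)[OF BF D(1)] by simp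
  qed
  then have "quot_map M D \<otimes>\<^bsub>quot_alg M\<^esub> quot_map M B = \<one>\<^bsub>quot_alg M\<^esub>"
    using same[of "D o\<^sub>L B" id_blinfun] mul[OF D(1) BM] one M_comp[OF D(1) BM] M_id by simp
  moreover have "(B o\<^sub>L D) - id_blinfun \<in> finite_ideal M"
  proof -
    have "((B o\<^sub>L F) - F) o\<^sub>L D = (B o\<^sub>L D) - id_blinfun"
    proof (rule blinfun_eqI)
      fix x
      have "((B o\<^sub>L F) - F) (D x) = B (D x) - x" using Tx'[of "D x"] unfolding D(3) by (metis add_diff_cancel_left' diff_add_cancel)
      then show "(((B o\<^sub>L F) - F) o\<^sub>L D) x = ((B o\<^sub>L D) - id_blinfun) x"
        by (simp only: blinfun_apply_blinfun_compose blinfun.diff_left[of "B o\<^sub>L D"] id_blinfun.rep_eq id_apply)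
    qed
    then show ?thesis using finite_ideal(5)[OF BF D(1)] by simp
  qed
  then have "quot_map M B \<otimes>\<^bsub>quot_alg M\<^esub> quot_map M D = \<one>\<^bsub>quot_alg M\<^esub>"
    using same[of "B o\<^sub>L D" id_blinfun] mul[OF BM D(1)] one M_comp[OF BM D(1)] M_id by simp
  ultimately have U: "quot_map M B \<in> Units (quot_alg M)"
    unfolding Units_def using car[OF BM] car[OF D(1)] by blast
  have "scalar_op 0 = (0 :: 'a \<Rightarrow>\<^sub>L 'a)"
    by (rule blinfun_eqI) (use scaleC_of_real[of 0] in \<open>simp add: scalar_op.rep_eq\<close>)
  then have "quot_map M (scalar_op 0) = \<zero>\<^bsub>quot_alg M\<^esub>"
    by (simp add: quot_map_eq quot_alg_def FactRing_def)
  then have "quot_map M B \<ominus>\<^bsub>quot_alg M\<^esub> quot_map M (scalar_op 0) = quot_map M B"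
    using car[OF BM] by (simp add: a_minus_def)
  then show False using z U by (simp add: ess_spectrum_def)
qed

end

context sf_factor
begin

text \<open>If \<open>spg A t\<close> were finite, A composed with it would lie in the ideal, and
  what remains of A has norm at most t.\<close>

lemma ess_norm_inft:
  assumes A: "pos A" and t: "t < ess_norm M A"
  shows "inft (spg A t)"
proof (cases "t \<le> 0")
  case True
  then show ?thesis using spg_zero[OF A] inft_id by simp
next
  case False
  show ?thesis
  proof (rule ccontr)
    assume fin: "\<not> inft (spg A t)"
    note F = spg(1)[OF A, of t]
    define D where "D = A o\<^sub>L (id_blinfun - spg A t)"
    have Dx: "D x = A (x - spg A t x)" for x by (simp add: D_def blinfun.diff_left)
    have Dx': "D x = (id_blinfun - spg A t) (A x)" for x
      by (simp add: Dx blinfun.diff_left blinfun.diff_right spg_comm[OF A])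
    note C = projection_compl[OF F]
    have "A o\<^sub>L spg A t \<in> finite_ideal M" by (rule finite_ideal(4)[OF finite_ideal(6)[OF F fin] posD(1)[OF A]])
    from finite_ideal(4)[OF this M_uminus[OF M_id]]
    have "ess_norm M A \<le> norm (((- id_blinfun) o\<^sub>L (A o\<^sub>L spg A t)) + A)" using ess_norm_le[of "(- id_blinfun) o\<^sub>L (A o\<^sub>L spg A t)" A] by blast
    also have "((- id_blinfun) o\<^sub>L (A o\<^sub>L spg A t)) + A = D"
      by (rule blinfun_eqI) (simp add: Dx blinfun.minus_left blinfun.diff_right blinfun.add_left)
    also have "norm D \<le> t"
    proof (rule norm_blinfun_bound)
      show "0 \<le> t" using False by simp
      fix x
      have q: "D x \<bullet> x = A (x - spg A t x) \<bullet> (x - spg A t x)" for x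
      proof -
        have "D x \<bullet> x = (id_blinfun - spg A t) (D x) \<bullet> x" by (simp add: Dx' projectionsD(2)[OF C])
        also have "\<dots> = D x \<bullet> (id_blinfun - spg A t) x" by (rule projectionsD(3)[OF C])
        finally show ?thesis by (simp add: Dx blinfun.diff_left)
      qed
      have le: "D x \<bullet> x \<le> t * (x \<bullet> x)" for x
      proof -
        have "D x \<bullet> x \<le> t * (norm (x - spg A t x))\<^sup>2"
          unfolding q by (rule spg_le[OF A]) (simp add: blinfun.diff_right projectionsD(2)[OF F])
        also have "\<dots> \<le> t * (norm x)\<^sup>2"
          using projectionsD(5)[OF C, of x] False by (intro mult_left_mono power_mono) (auto simp: blinfun.diff_left)
        finally show ?thesis by (simp add: power2_norm_eq_inner)
      qed
      have sa: "D x \<bullet> y = x \<bullet> D y" for x y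
        using posD(2)[OF A] projectionsD(3)[OF C, of "A x" y] by (simp add: Dx' [of x] Dx[of y] blinfun.diff_left)
      have "(norm (D x))\<^sup>2 \<le> t * (D x \<bullet> x)"
        by (rule psd_norm_bound[OF sa _ le]) (simp add: q posD(3)[OF A])
      also have "\<dots> \<le> t * (t * (x \<bullet> x))" by (rule mult_left_mono[OF le]) (use False in simp)
      also have "\<dots> = (t * norm x)\<^sup>2" by (simp add: power_mult_distrib power2_norm_eq_inner) (simp add: power2_eq_square)
      finally show "norm (D x) \<le> t * norm x" using False by (intro power2_le_imp_le[of "norm (D x)"]) auto
    qed
    finally show False using t by simp
  qed
qed

text \<open>The operators that are arbitrarily small off suitable finite projections form a
  norm-closed ideal containing all finite projections, hence containing the smallest such
  ideal.\<close>

lemma finite_ideal_small: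
  assumes J: "J \<in> finite_ideal M" and e: "e > 0"
  shows "\<exists>F\<in>projections M. \<not> inft F \<and> (\<forall>x. F x = 0 \<longrightarrow> norm (J x) \<le> e * norm x)"
proof -
  define K where "K = {T \<in> M. \<forall>e>0. \<exists>F\<in>projections M. \<not> inft F \<and> (\<forall>x. F x = 0 \<longrightarrow> norm (T x) \<le> e * norm x)}"
  have KM: "K \<subseteq> M" by (auto simp: K_def)
  have Kd: "\<exists>F\<in>projections M. \<not> inft F \<and> (\<forall>x. F x = 0 \<longrightarrow> norm (T x) \<le> e * norm x)" if "T \<in> K" "e > 0" for T e
    using that by (simp add: K_def)
  have "ideal K (op_ring M)"
  proof (rule ideal_op_ringI[OF KM])
    show "0 \<in> K" unfolding K_def using M_0 projection_0 inft_0 by auto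
    fix S T assume ST: "S \<in> K" "T \<in> K"
    show "S + T \<in> K"
      unfolding K_def mem_Collect_eq
    proof (intro conjI allI impI)
      show "S + T \<in> M" using ST KM by (auto intro: M_add)
      fix e :: real assume "e > 0"
      then have e: "e / 2 > 0" by simp
      obtain F where F: "F \<in> projections M" "\<not> inft F" "\<And>x. F x = 0 \<Longrightarrow> norm (S x) \<le> e / 2 * norm x" using Kd[OF ST(1) e] by blast
      obtain F' where F': "F' \<in> projections M" "\<not> inft F'" "\<And>x. F' x = 0 \<Longrightarrow> norm (T x) \<le> e / 2 * norm x" using Kd[OF ST(2) e] by blast
      have FM: "F + F' \<in> M" by (intro M_add projectionsD(1) F(1) F'(1))
      \<comment> \<open>The join of F and F'. If it were infinite, cutting off first F and then F'
        would leave an infinite projection, but nothing is left.\<close>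
      let ?G = "supp (F + F')"
      have G: "?G \<in> projections M" by (rule supp(1)[OF FM])
      have ker: "(F + F') x = 0 \<longleftrightarrow> F x = 0 \<and> F' x = 0" for x
      proof
        assume "(F + F') x = 0"
        then have "F x \<bullet> x + F' x \<bullet> x = 0" by (simp add: blinfun.add_left flip: inner_add_left)
        then show "F x = 0 \<and> F' x = 0"
          by (simp add: projectionsD(4)[OF F(1)] projectionsD(4)[OF F'(1)] add_nonneg_eq_0_iff)
      qed (simp add: blinfun.add_left)
      have "\<not> inft ?G"
      proof
        assume "inft ?G"
        then have i1: "inft (pinf ?G (id_blinfun - F))" by (rule inft_inf_compl[OF _ F(1,2)])
        then have i2: "inft (pinf (pinf ?G (id_blinfun - F)) (id_blinfun - F'))" by (rule inft_inf_compl[OF _ F'(1,2)])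
        have "pinf (pinf ?G (id_blinfun - F)) (id_blinfun - F') = 0"
        proof (rule projection_eqI[OF inft_projection[OF i2] projection_0])
          fix x
          have "x = 0" if "?G x = x" "F x = 0" "F' x = 0" using supp(4)[OF FM, of x] ker that by simp
          moreover have "pinf (pinf ?G (id_blinfun - F)) (id_blinfun - F') x = x \<longleftrightarrow> ?G x = x \<and> F x = 0 \<and> F' x = 0"
            unfolding pinf(2)[OF inft_projection[OF i1] projection_compl[OF F'(1)]] pinf(2)[OF G projection_compl[OF F(1)]]
            by (simp add: blinfun.diff_left)
          ultimately show "pinf (pinf ?G (id_blinfun - F)) (id_blinfun - F') x = x \<longleftrightarrow> blinfun_apply 0 x = x"
            by (cases "x = 0") auto
        qed
        then show False using i2 inft_0 by simp
      qed
      moreover have "norm ((S + T) x) \<le> e * norm x" if "?G x = 0" for x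
      proof -
        have "F x = 0" "F' x = 0" using that supp(4)[OF FM, of x] ker by auto
        then show ?thesis using norm_triangle_ineq[of "S x" "T x"] F(3)[of x] F'(3)[of x] by (simp add: blinfun.add_left)
      qed
      ultimately show "\<exists>F\<in>projections M. \<not> inft F \<and> (\<forall>x. F x = 0 \<longrightarrow> norm ((S + T) x) \<le> e * norm x)" using G by blast
    qed
  next
    fix T X assume T: "T \<in> K" and X: "X \<in> M"
    have e': "e / (norm X + 1) > 0" "e / (norm X + 1) * (norm X * y) \<le> e * y" if "e > 0" "y \<ge> 0" for e y :: real
    proof -
      have "norm X + 1 > 0" by (simp add: add_nonneg_pos)
      then show "e / (norm X + 1) > 0" using that by simp
      have "e * y * (norm X / (norm X + 1)) \<le> e * y * 1"
        by (rule mult_left_mono) (use that \<open>norm X + 1 > 0\<close> in simp_all)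
      then show "e / (norm X + 1) * (norm X * y) \<le> e * y" by (simp add: mult_ac)
    qed
    show "X o\<^sub>L T \<in> K"
      unfolding K_def mem_Collect_eq
    proof (intro conjI allI impI)
      show "X o\<^sub>L T \<in> M" using T X KM by (auto intro: M_comp)
      fix e :: real assume e: "e > 0"
      obtain F where F: "F \<in> projections M" "\<not> inft F" "\<And>x. F x = 0 \<Longrightarrow> norm (T x) \<le> e / (norm X + 1) * norm x" using Kd[OF T e'(1)[OF e order_refl]] by blast
      have "norm ((X o\<^sub>L T) x) \<le> e * norm x" if "F x = 0" for x
      proof -
        have "norm ((X o\<^sub>L T) x) \<le> norm X * (e / (norm X + 1) * norm x)"
          using norm_blinfun[of X "T x"] mult_left_mono[OF F(3)[OF that], of "norm X"] by simp
        also have "\<dots> \<le> e * norm x" using e'(2)[OF e, of "norm x"] by (simp add: mult_ac)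
        finally show ?thesis .
      qed
      then show "\<exists>F\<in>projections M. \<not> inft F \<and> (\<forall>x. F x = 0 \<longrightarrow> norm ((X o\<^sub>L T) x) \<le> e * norm x)" using F(1,2) by blast
    qed
    show "T o\<^sub>L X \<in> K"
      unfolding K_def mem_Collect_eq
    proof (intro conjI allI impI)
      show "T o\<^sub>L X \<in> M" using T X KM by (auto intro: M_comp)
      fix e :: real assume e: "e > 0"
      obtain F where F: "F \<in> projections M" "\<not> inft F" "\<And>x. F x = 0 \<Longrightarrow> norm (T x) \<le> e / (norm X + 1) * norm x" using Kd[OF T e'(1)[OF e order_refl]] by blast
      \<comment> \<open>Multiplication on the right moves the exceptional projection to the support
        of F X, which is equivalent to a subprojection of F and so finite.\<close>
      have FX: "F o\<^sub>L X \<in> M" using projectionsD(1)[OF F(1)] X by (rule M_comp)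
      have "pleq (rproj (F o\<^sub>L X)) F" by (rule rproj(3)[OF FX F(1)]) (simp add: projectionsD(2)[OF F(1)])
      then have "\<not> inft (rproj (F o\<^sub>L X))" using inft_pleq F(1,2) by blast
      then have "\<not> inft (supp (F o\<^sub>L X))" using polar[OF FX] inft_eqv eqv_sym by blast
      moreover have "norm ((T o\<^sub>L X) x) \<le> e * norm x" if "supp (F o\<^sub>L X) x = 0" for x
      proof -
        have "F (X x) = 0" using that supp(4)[OF FX, of x] by simp
        then have "norm (T (X x)) \<le> e / (norm X + 1) * norm (X x)" by (rule F(3))
        also have "\<dots> \<le> e / (norm X + 1) * (norm X * norm x)"
          by (rule mult_left_mono[OF norm_blinfun]) (use e'(1)[OF e order_refl] in simp)
        also have "\<dots> \<le> e * norm x" using e'(2)[OF e, of "norm x"] by simp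
        finally show ?thesis by simp
      qed
      ultimately show "\<exists>F\<in>projections M. \<not> inft F \<and> (\<forall>x. F x = 0 \<longrightarrow> norm ((T o\<^sub>L X) x) \<le> e * norm x)" using supp(1)[OF FX] by blast
    qed
  qed
  moreover have "closed K"
    unfolding closed_sequential_limits
  proof (intro allI impI, elim conjE)
    fix X and L :: "'a \<Rightarrow>\<^sub>L 'a" assume X: "\<forall>n. X n \<in> K" "X \<longlonglongrightarrow> L"
    show "L \<in> K"
      unfolding K_def mem_Collect_eq
    proof (intro conjI allI impI)
      show "L \<in> M" using X KM closed_M unfolding closed_sequential_limits by blast
      fix e :: real assume "e > 0"
      then have e: "e / 2 > 0" by simp
      obtain n where n: "dist (X n) L < e / 2" using metric_LIMSEQ_D[OF X(2) e] by blast
      obtain F where F: "F \<in> projections M" "\<not> inft F" "\<And>x. F x = 0 \<Longrightarrow> norm (X n x) \<le> e / 2 * norm x" using Kd[OF _ e] X(1) by blast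
      have "norm (L x) \<le> e * norm x" if "F x = 0" for x
      proof -
        have "norm ((X n - L) x) \<le> norm (X n - L) * norm x" by (rule norm_blinfun)
        also have "\<dots> \<le> e / 2 * norm x" using n by (intro mult_right_mono) (auto simp: dist_norm)
        finally have "norm (X n x - L x) \<le> e / 2 * norm x" by (simp add: blinfun.diff_left)
        then show ?thesis using F(3)[OF that] norm_triangle_ineq4[of "X n x" "X n x - L x"] by simp
      qed
      then show "\<exists>F\<in>projections M. \<not> inft F \<and> (\<forall>x. F x = 0 \<longrightarrow> norm (L x) \<le> e * norm x)" using F(1,2) by blast
    qed
  qed
  moreover have "Collect (finite_proj M) \<subseteq> K"
  proof
    fix F assume "F \<in> Collect (finite_proj M)"
    then have F: "F \<in> projections M" "\<not> inft F" by (auto simp: infinite_proj_def finite_proj_def)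
    then show "F \<in> K" unfolding K_def mem_Collect_eq
      by (intro conjI projectionsD(1) allI impI bexI[of _ F]) auto
  qed
  ultimately have "finite_ideal M \<subseteq> K" unfolding finite_ideal_def by blast
  then show ?thesis using Kd J e by blast
qed

text \<open>An element of the ideal is small off some finite F, and the infinite Q still contains
  nonzero vectors annihilated by F.\<close>

lemma ess_norm_projection:
  assumes Q: "inft Q" and a: "a \<ge> 0"
  shows "a \<le> ess_norm M (a *\<^sub>R Q)"
proof (rule ess_norm_ge)
  fix J assume J: "J \<in> finite_ideal M"
  show "a \<le> norm (J + a *\<^sub>R Q)"
  proof (rule field_le_epsilon)
    fix e :: real assume e: "e > 0"
    obtain F where F: "F \<in> projections M" "\<not> inft F" "\<And>x. F x = 0 \<Longrightarrow> norm (J x) \<le> e * norm x"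
      using finite_ideal_small[OF J e] by blast
    have i: "inft (pinf Q (id_blinfun - F))" by (rule inft_inf_compl[OF Q F(1,2)])
    then have "pinf Q (id_blinfun - F) \<noteq> 0" using inft_0 by metis
    then obtain y where y: "pinf Q (id_blinfun - F) y \<noteq> 0" by (metis blinfun_eqI zero_blinfun.rep_eq)
    define x where "x = pinf Q (id_blinfun - F) y"
    have "Q x = x \<and> (id_blinfun - F) x = x"
      using pinf(2)[OF inft_projection[OF Q] projection_compl[OF F(1)], of x] projectionsD(2)[OF inft_projection[OF i], of y]
      by (simp add: x_def)
    then have x: "Q x = x" "F x = 0" "norm x > 0" using y by (auto simp: x_def blinfun.diff_left)
    have "a * norm x = norm ((J + a *\<^sub>R Q) x - J x)" using a x by (simp add: blinfun.add_left blinfun.scaleR_left)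
    also have "\<dots> \<le> norm ((J + a *\<^sub>R Q) x) + norm (J x)" by (rule norm_triangle_ineq4)
    also have "\<dots> \<le> norm (J + a *\<^sub>R Q) * norm x + e * norm x" by (intro add_mono norm_blinfun F(3) x)
    finally have "a * norm x \<le> (norm (J + a *\<^sub>R Q) + e) * norm x" by (simp add: distrib_right)
    then show "a \<le> norm (J + a *\<^sub>R Q) + e" using x(3) by simp
  qed
qed

lemma good_below_ess_norm:
  assumes A: "pos A" and b: "\<And>n. \<beta> n < ess_norm M A" shows "good \<beta> A"
  unfolding good_def using ess_norm_inft[OF A b] spg(3)[OF A] by blast

end

section \<open>Choosing the spectral bands\<close>

context sf_factor
begin

text \<open>B acts on the part of x below \<mu>, so some level \<delta> < \<mu> sees more of x than
  \<mu> does. Left continuity at \<mu> gives f < \<mu> that still sees less of x than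
  \<delta>.\<close>

lemma band_exists:
  assumes B: "pos B" and \<mu>: "\<mu> > 0" and x: "B x \<noteq> B (spg B \<mu> x)"
  obtains \<delta> f where "0 < \<delta>" "\<delta> < f" "f < \<mu>" "spg B \<delta> - spg B f \<noteq> 0"
proof -
  note G = spg(1)[OF B]
  have "\<exists>\<delta>. 0 < \<delta> \<and> \<delta> < \<mu> \<and> spg B \<delta> x \<noteq> spg B \<mu> x"
  proof (rule ccontr)
    assume "\<not> ?thesis"
    then have eq: "spg B \<delta> x = spg B \<mu> x" if "0 < \<delta>" "\<delta> < \<mu>" for \<delta> using that by blast
    have "B (x - spg B \<mu> x) = 0"
    proof (rule spg_vanishing[OF B])
      \<comment> \<open>The offset 2 keeps every level strictly below \<mu>.\<close>
      show "(\<lambda>n. \<mu> / real (n + 2)) \<longlonglongrightarrow> 0" by real_asymp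
      fix n
      have d: "0 < \<mu> / real (n + 2)" "\<mu> / real (n + 2) < \<mu>" using \<mu> by (auto simp: divide_less_eq)
      have "spg B (\<mu> / real (n + 2)) (spg B \<mu> x) = spg B \<mu> x"
        using spg_antimono[OF B less_imp_le[OF d(2)]] by (simp add: pleq_def)
      then show "spg B (\<mu> / real (n + 2)) (x - spg B \<mu> x) = 0" using eq[OF d] by (simp add: blinfun.diff_right)
    qed
    then show False using x by (simp add: blinfun.diff_right)
  qed
  then obtain \<delta> where \<delta>: "0 < \<delta>" "\<delta> < \<mu>" "spg B \<delta> x \<noteq> spg B \<mu> x" by blast
  have "(norm ((spg B \<delta> - spg B \<mu>) x))\<^sup>2 > 0" using \<delta>(3) by (simp add: blinfun.diff_left)
  then have "(norm (spg B \<delta> x))\<^sup>2 - (norm (spg B \<mu> x))\<^sup>2 > 0"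
    using norm_compl[OF G G spg_antimono[OF B less_imp_le[OF \<delta>(2)]], of x] by simp
  from spg_left_continuous[OF B this, of \<mu> x]
  obtain d where d: "d > 0" "(norm (spg B (\<mu> - d) x))\<^sup>2 < (norm (spg B \<delta> x))\<^sup>2" by auto
  have "\<delta> < \<mu> - d"
  proof (rule ccontr)
    assume "\<not> ?thesis"
    then have "\<mu> - d \<le> \<delta>" by simp
    from spg_mono_norm[OF B this, of x] show False using d(2) by linarith
  qed
  moreover have "spg B \<delta> - spg B (\<mu> - d) \<noteq> 0" using d(2) by auto
  ultimately show ?thesis using that[of \<delta> "\<mu> - d"] \<delta>(1) d(1) by simp
qed

lemma band_bounds:
  assumes B: "pos B" and st: "s \<le> t" and x: "(spg B s - spg B t) x = x"
  shows "s * (norm x)\<^sup>2 \<le> B x \<bullet> x" "B x \<bullet> x \<le> t * (norm x)\<^sup>2"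
proof -
  note G = spg(1)[OF B] and le = spg_antimono[OF B st]
  have "spg B s ((spg B s - spg B t) x) = (spg B s - spg B t) x"
    using le by (simp add: blinfun.diff_left blinfun.diff_right projectionsD(2)[OF G] pleq_def)
  then show "s * (norm x)\<^sup>2 \<le> B x \<bullet> x" by (intro spg(3)[OF B]) (simp add: x)
  have "spg B t ((spg B s - spg B t) x) = 0"
    by (simp add: blinfun.diff_left blinfun.diff_right projectionsD(2)[OF G] pleqD'[OF le G G])
  then show "B x \<bullet> x \<le> t * (norm x)\<^sup>2" by (intro spg_le[OF B]) (simp add: x)
qed

text \<open>A vector above e 0 that lies in no band stays above every e n, hence above \<mu>, where
  the last premise leaves nothing.\<close>

lemma ascending_bands:
  assumes B: "pos B" and inc: "incseq e" and lim: "e \<longlonglongrightarrow> \<mu>" and z: "spg B \<mu> = 0"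
  defines "F \<equiv> \<lambda>n. spg B (e n) - spg B (e (Suc n))"
  shows "oseq F" "osum F = spg B (e 0)"
proof -
  note G = spg(1)[OF B]
  have le: "pleq (spg B (e n)) (spg B (e m))" if "m \<le> n" for m n
    by (rule spg_antimono[OF B incseqD[OF inc that]])
  have Fp: "F n \<in> projections M" for n unfolding F_def by (rule projection_diff[OF G G le]) simp
  have Sp: "spg B (e 0) - spg B (e n) \<in> projections M" for n by (rule projection_diff[OF G G le]) simp
  have step: "spg B (e 0) - spg B (e (Suc n)) = spg B (e 0) - spg B (e n) + F n" for n by (simp add: F_def)
  have o: "porth (spg B (e 0) - spg B (e n)) (F n)" for n
  proof -
    have "spg B (e m) (spg B (e k) x) = spg B (e k) x" if "m \<le> k" for m k x using le[OF that] by (simp add: pleq_def)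
    then show ?thesis by (simp add: porth_def F_def blinfun.diff_left blinfun.diff_right)
  qed
  note i = oseq_increments[of "\<lambda>n. spg B (e 0) - spg B (e n)" F, OF Sp Fp step o]
  show F: "oseq F" by (rule i)
  show "osum F = spg B (e 0)"
  proof (rule osum_eq_projectionI[OF F G])
    show "pleq (F n) (spg B (e 0))" for n
      by (rule pleq_trans[OF i(3) pleq_diff[OF G G le]]) simp
    fix w assume w: "spg B (e 0) w = w" "\<And>n. F n w = 0"
    have "spg B (e n) w = w" for n
      by (induction n) (use w in \<open>simp_all add: F_def blinfun.diff_left\<close>)
    then have "e n * (norm w)\<^sup>2 \<le> B w \<bullet> w" for n by (rule spg(3)[OF B])
    moreover have "(\<lambda>n. e n * (norm w)\<^sup>2) \<longlonglongrightarrow> \<mu> * (norm w)\<^sup>2" by (intro tendsto_intros lim)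
    ultimately have "\<mu> * (norm w)\<^sup>2 \<le> B w \<bullet> w" using LIMSEQ_le_const2[of "\<lambda>n. e n * (norm w)\<^sup>2"] by blast
    then show "w = 0" using spg(4)[OF B, of \<mu> w] z by force
  qed
qed

lemma oseq_single:
  assumes P: "P \<in> projections M"
  shows "oseq (\<lambda>n. if n = k then P else 0)" "osum (\<lambda>n. if n = k then P else 0) = P"
proof -
  show "oseq (\<lambda>n. if n = k then P else 0)" by (simp add: oseq_def porth_def P projection_0)
  show "osum (\<lambda>n. if n = k then P else 0) = P"
  proof (rule osum_eqI)
    fix x
    have "(\<lambda>n. if n = k then P x else 0) sums P x" by (rule sums_single)
    then show "(\<lambda>n. (if n = k then P else 0) x) sums P x" by (simp add: if_distrib[of "\<lambda>T. blinfun_apply T x"] cong: if_cong)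
  qed
qed

text \<open>norm B - B is positive, so a vector at which the form reaches the norm lies in its
  kernel.\<close>

lemma spg_norm_eq:
  assumes B: "pos B" shows "spg B (norm B) = null_proj (B - norm B *\<^sub>R id_blinfun)"
proof (rule projection_eqI[OF spg(1)[OF B] null_proj_M(1)])
  let ?b = "norm B"
  note G = spg(1)[OF B, of ?b]
  show BM: "B - ?b *\<^sub>R id_blinfun \<in> M" using posD(1)[OF B] by (intro M_diff M_scaleR M_id)
  fix x
  have "spg B ?b x = x \<longleftrightarrow> B x = ?b *\<^sub>R x"
  proof
    assume "spg B ?b x = x"
    then have ge: "?b * (norm x)\<^sup>2 \<le> B x \<bullet> x" by (rule spg(3)[OF B])
    have "pos (?b *\<^sub>R id_blinfun - B)"
      by (rule posI) (use blinfun_le_norm[of B] posD(1)[OF B] in \<open>auto intro!: M_diff M_scaleR M_id simp: blinfun.diff_left blinfun.scaleR_left inner_diff_left inner_diff_right posD(2)[OF B]\<close>)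
    then have "(?b *\<^sub>R id_blinfun - B) x = 0"
      by (rule pos_zero) (use ge blinfun_le_norm[of B x] in \<open>simp add: blinfun.diff_left blinfun.scaleR_left inner_diff_left power2_norm_eq_inner\<close>)
    then show "B x = ?b *\<^sub>R x" by (simp add: blinfun.diff_left blinfun.scaleR_left)
  next
    assume x: "B x = ?b *\<^sub>R x"
    let ?y = "x - spg B ?b x"
    have "B ?y = ?b *\<^sub>R ?y" using x spg_comm[OF B, of ?b x] by (simp add: blinfun.diff_right blinfun.scaleR_right scaleR_diff_right)
    then have "B ?y \<bullet> ?y = ?b * (norm ?y)\<^sup>2" by (simp add: power2_norm_eq_inner)
    moreover have "spg B ?b ?y = 0" by (simp add: blinfun.diff_right projectionsD(2)[OF G])
    ultimately have "?y = 0" using spg(4)[OF B] by force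
    then show "spg B ?b x = x" by simp
  qed
  then show "spg B ?b x = x \<longleftrightarrow> null_proj (B - ?b *\<^sub>R id_blinfun) x = x"
    using null_proj_M(2)[OF BM, of x] by (simp add: blinfun.diff_left blinfun.scaleR_left)
qed

text \<open>Covers conditions (i) and (ii), which both give \<open>spg B (ess_norm M A) = 0\<close>.
  Levels rising strictly to the essential norm of A then dominate all bands of B. An infinite null
  space of B serves as the filler T; if it is finite, 0 in the essential spectrum makes the low
  bands of B infinite and they serve instead.\<close>

theorem sum_of_copies_below:
  assumes A: "pos A" and B: "pos B" and B0: "B \<noteq> 0" and ess: "0 \<in> ess_spectrum M B"
    and N: "sle (null_proj A) (null_proj B)" and \<mu>: "ess_norm M A > 0" and z: "spg B (ess_norm M A) = 0"
  shows "\<exists>C. (\<forall>j::nat. unitarily_equiv M (C j) B) \<and> (\<forall>x. (\<lambda>j. C j x) sums A x)"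
proof -
  define \<mu> where "\<mu> = ess_norm M A"
  have \<mu>0: "\<mu> > 0" and z: "spg B \<mu> = 0" using \<mu> z by (simp_all add: \<mu>_def)
  note G = spg(1)[OF B]
  have "\<exists>x. B x \<noteq> 0" using B0 by (metis blinfun_eqI zero_blinfun.rep_eq)
  then obtain x where "B x \<noteq> B (spg B \<mu> x)" by (auto simp: z)
  then obtain \<delta> f where \<delta>: "0 < \<delta>" "\<delta> < f" "f < \<mu>" "spg B \<delta> - spg B f \<noteq> 0" by (rule band_exists[OF B \<mu>0])
  \<comment> \<open>Strictly increasing from f to \<mu> without reaching it.\<close>
  define g where "g n = \<mu> - (\<mu> - f) / real (Suc n)" for n
  have g: "strict_mono g" "g 0 = f" "g n < \<mu>" "g \<longlonglongrightarrow> \<mu>" for n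
  proof -
    show "strict_mono g" unfolding strict_mono_Suc_iff g_def using \<delta>(3) by (auto intro!: divide_strict_left_mono)
    show "g 0 = f" "g n < \<mu>" using \<delta>(3) by (simp_all add: g_def)
    show "g \<longlonglongrightarrow> \<mu>" unfolding g_def by real_asymp
  qed
  \<comment> \<open>Band edges \<delta>, f, g 1, g 2, ... With \<beta> n = g (n+1) the band F (n+1)
    runs from g n to g (n+1) and so lies below \<beta> n.\<close>
  define e where "e n = (case n of 0 \<Rightarrow> \<delta> | Suc m \<Rightarrow> g m)" for n
  have e: "e 0 = \<delta>" "e (Suc n) = g n" for n by (simp_all add: e_def)
  have einc: "incseq e" unfolding incseq_Suc_iff
  proof
    fix n show "e n \<le> e (Suc n)"
      using \<delta>(2) strict_monoD[OF g(1), of "n - 1" n] g(2) by (cases n) (auto simp: e)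
  qed
  have elim: "e \<longlonglongrightarrow> \<mu>" by (rule LIMSEQ_imp_Suc) (simp add: e g(4))
  define \<beta> where "\<beta> n = g (Suc n)" for n
  have \<beta>: "strict_mono \<beta>" "f < \<beta> 0" "\<beta> n < \<mu>" for n
    using g strict_monoD[OF g(1)] strict_monoD[OF g(1), of 0 1] by (auto simp: \<beta>_def strict_mono_def)
  have \<beta>inc: "incseq \<beta>" by (rule strict_mono_mono[OF \<beta>(1), unfolded mono_def[symmetric]])
  have good: "good \<beta> A" by (rule good_below_ess_norm[OF A]) (use \<beta>(3) in \<open>simp add: \<mu>_def\<close>)
  define F where "F n = spg B (e n) - spg B (e (Suc n))" for n
  note F = ascending_bands[OF B einc elim z, folded F_def, unfolded e(1)]
  have Fc: "F n (B x) = B (F n x)" for n x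
    by (simp add: F_def blinfun.diff_left blinfun.diff_right spg_comm[OF B])
  have Fb: "B x \<bullet> x \<le> \<beta> n * (norm x)\<^sup>2" if "F (Suc n) x = x" for n x
    using band_bounds(2)[OF B incseq_SucD[OF einc], of "Suc n" x] that by (simp add: F_def e \<beta>_def)
  have F0: "\<delta> * (norm x)\<^sup>2 \<le> B x \<bullet> x" "B x \<bullet> x \<le> f * (norm x)\<^sup>2" if "F 0 x = x" for x
    using band_bounds[OF B incseq_SucD[OF einc], of 0 x] that by (simp_all add: F_def e g(2))
  have F00: "F 0 \<noteq> 0" using \<delta>(4) by (simp add: F_def e g(2))
  note NB = null_proj_M(1)[OF posD(1)[OF B]]
  note sB = supp(1)[OF posD(1)[OF B]]
  have f0: "0 < f" using \<delta> by simp
  show ?thesis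
  proof (cases "inft (null_proj B)")
    case True
    define L where "L = supp B - spg B \<delta>"
    note dle = spg_pleq_supp[OF B \<delta>(1)]
    have Lp: "L \<in> projections M" unfolding L_def by (rule projection_diff[OF G sB dle])
    \<comment> \<open>The part of the support of B below \<delta> is added at index 1, because index
      0 has to stay bounded below by \<delta>.\<close>
    define H where "H n = (if n = (1::nat) then L else 0)" for n
    note H = oseq_single[OF Lp, of 1, folded H_def]
    have dL: "porth (spg B \<delta>) L" unfolding L_def by (rule porth_diff[OF G sB dle])
    have FH: "porth (F m) (H n)" for m n
    proof -
      have "porth (F m) L" by (rule porth_pleq[OF dL _ oseqD(1)[OF F(1)] G]) (use osum_projection(3)[OF F(1), of m] F(2) in simp)
      then show ?thesis by (simp add: H_def porth_def)
    qed
    note s = osum_add[OF F(1) H(1) FH]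
    have "fillable \<beta> B (null_proj B)" by (rule fillable_infinite_null[OF B True]) (use \<beta>(2) f0 in simp)
    note fill = this
    show ?thesis
    proof (rule sum_of_copies[OF A B good \<beta>inc fill s(1), where \<delta> = \<delta> and f = f])
      show "osum (\<lambda>n. F n + H n) = id_blinfun - null_proj B" unfolding s(2) F(2) H(2) L_def supp_def by simp
      have Lc: "L (B x) = B (L x)" for x
        by (simp add: L_def supp_def blinfun.diff_left blinfun.diff_right spg_comm[OF B] null_proj_pos[OF B])
      show "(F n + H n) (B x) = B ((F n + H n) x)" for n x
        by (simp add: H_def blinfun.add_left blinfun.add_right Fc Lc)
      show "B x \<bullet> x \<le> \<beta> n * (norm x)\<^sup>2" if x: "(F (Suc n) + H (Suc n)) x = x" for n x
      proof (cases n)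
        case 0
        have le1: "pleq (spg B (\<beta> 0)) (spg B \<delta>)" by (rule spg_antimono[OF B]) (use \<beta>(2) \<delta>(2) in simp)
        have "spg B (\<beta> 0) (L x) = 0"
          unfolding L_def blinfun.diff_left blinfun.diff_right
          using pleqD'[OF pleq_trans[OF le1 dle] G sB] pleqD'[OF le1 G G] by simp
        moreover have "spg B (\<beta> 0) (F 1 x) = 0"
        proof -
          have e2: "e (Suc 1) = \<beta> 0" by (simp add: e \<beta>_def)
          have "pleq (spg B (\<beta> 0)) (spg B (e 1))" by (rule spg_antimono[OF B]) (use incseq_SucD[OF einc, of 1] e2 in simp)
          then show ?thesis unfolding F_def e2 blinfun.diff_left blinfun.diff_right
            using pleqD'[OF _ G G] by (simp add: projectionsD(2)[OF G])
        qed
        ultimately have "spg B (\<beta> 0) ((F (Suc 0) + H (Suc 0)) x) = 0" by (simp add: H_def blinfun.add_left blinfun.add_right)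
        then show ?thesis using spg_le[OF B, of "\<beta> 0" x] x 0 by simp
      next
        case (Suc m)
        then show ?thesis using x Fb by (simp add: H_def)
      qed
    qed (use F0 F00 \<delta> f0 \<beta>(1,2) N in \<open>auto simp: H_def\<close>)
  next
    case False
    \<comment> \<open>The complement of \<open>spg B \<epsilon>\<close> is infinite, and removing
      the finite null projection from it cannot make it finite.\<close>
    have "inft (supp B - spg B \<epsilon>)" if \<epsilon>: "\<epsilon> > 0" for \<epsilon>
    proof (rule ccontr)
      assume fin: "\<not> ?thesis"
      note le = spg_pleq_supp[OF B \<epsilon>]
      have Lp: "supp B - spg B \<epsilon> \<in> projections M" by (rule projection_diff[OF G sB le])
      have "pleq (supp B - spg B \<epsilon>) (id_blinfun - null_proj B)"
        using pleq_diff[OF G sB le] by (simp add: supp_def)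
      then have "porth (null_proj B) (supp B - spg B \<epsilon>)" unfolding porth_compl[OF NB] .
      then have "\<not> inft (null_proj B + (supp B - spg B \<epsilon>))" by (rule finite_add[OF NB False Lp fin])
      moreover have "null_proj B + (supp B - spg B \<epsilon>) = id_blinfun - spg B \<epsilon>" by (simp add: supp_def)
      ultimately show False using ess_spectrum_0[OF B ess \<epsilon>] by simp
    qed
    then have "fillable \<beta> B (id_blinfun - spg B \<delta>)"
      by (rule fillable_small_tail[OF B _ \<beta>(1) \<delta>(1)]) (use \<beta>(2) \<delta>(2) in simp_all)
    then show ?thesis
      by (rule sum_of_copies[OF A B good \<beta>inc _ F(1) _ Fc Fb F0 \<delta>(1) f0 \<beta>(2) F00 N disjI1[OF \<beta>(1)]]) (simp_all add: F(2))
  qed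
qed

text \<open>Covers condition (iii). The constant sequence \<beta> = norm B works: B never exceeds
  it, and A attains it on an infinite eigenspace. As B is not a multiple of its top eigenprojection,
  it has a nonzero band strictly below the norm, from which the tilt can start.\<close>

theorem sum_of_copies_attained:
  assumes A: "pos A" and B: "pos B" and b: "norm B > 0" and K: "inft (null_proj (A - norm B *\<^sub>R id_blinfun))"
    and nB: "inft (null_proj B)" and ne: "B \<noteq> norm B *\<^sub>R null_proj (B - norm B *\<^sub>R id_blinfun)"
  shows "\<exists>C. (\<forall>j::nat. unitarily_equiv M (C j) B) \<and> (\<forall>x. (\<lambda>j. C j x) sums A x)"
proof -
  define b where "b = norm B"
  have b0: "b > 0" using b by (simp add: b_def)
  note G = spg(1)[OF B]
  have AM: "A - b *\<^sub>R id_blinfun \<in> M" and BM: "B - b *\<^sub>R id_blinfun \<in> M" using posD(1)[OF A] posD(1)[OF B] by (auto intro!: M_diff M_scaleR M_id)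
  have Ble: "B x \<bullet> x \<le> b * (norm x)\<^sup>2" for x using blinfun_le_norm[of B x] by (simp add: b_def power2_norm_eq_inner)
  note Kb = spg_norm_eq[OF B, folded b_def, symmetric]
  have "\<exists>x. B x \<noteq> B (spg B b x)"
  proof (rule ccontr)
    assume "\<not> ?thesis"
    then have "B x = B (spg B b x)" for x by blast
    moreover have "B (spg B b x) = b *\<^sub>R spg B b x" for x
      using null_proj_M(2)[OF BM, of "spg B b x"] by (simp add: Kb projectionsD(2)[OF G] blinfun.diff_left blinfun.scaleR_left)
    ultimately have "B x = b *\<^sub>R spg B b x" for x by metis
    then have "B = b *\<^sub>R null_proj (B - b *\<^sub>R id_blinfun)" by (intro blinfun_eqI) (simp add: Kb blinfun.scaleR_left)
    then show False using ne by (simp add: b_def)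
  qed
  then obtain x where "B x \<noteq> B (spg B b x)" by blast
  then obtain \<delta> f where \<delta>: "0 < \<delta>" "\<delta> < f" "f < b" "spg B \<delta> - spg B f \<noteq> 0" by (rule band_exists[OF B b0])
  define P where "P = spg B \<delta> - spg B f"
  note fle = spg_antimono[OF B less_imp_le[OF \<delta>(2)]] and sB = supp(1)[OF posD(1)[OF B]]
  have Pp: "P \<in> projections M" unfolding P_def by (rule projection_diff[OF G G fle])
  have Ps: "pleq P (supp B)" unfolding P_def by (rule pleq_trans[OF pleq_diff[OF G G fle] spg_pleq_supp[OF B \<delta>(1)]])
  have Lp: "supp B - P \<in> projections M" by (rule projection_diff[OF Pp sB Ps])
  \<comment> \<open>The band P for the tilt at index 0, the rest of the support of B at index 1, and
    0 afterwards.\<close>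
  define F where "F n = (if n = (0::nat) then P else 0) + (if n = 1 then supp B - P else 0)" for n
  have PL: "porth (if m = (0::nat) then P else 0) (if n = (1::nat) then supp B - P else 0)" for m n
    using porth_diff[OF Pp sB Ps] by (simp add: porth_def)
  note F = osum_add[OF oseq_single(1)[OF Pp, of 0] oseq_single(1)[OF Lp, of 1] PL, folded F_def, unfolded oseq_single(2)[OF Pp] oseq_single(2)[OF Lp]]
  have "fillable (\<lambda>_. b) B (null_proj B)" by (rule fillable_infinite_null[OF B nB]) (use b0 in simp)
  note fill = this
  show ?thesis
  proof (rule sum_of_copies[OF A B _ _ fill F(1), where \<delta> = \<delta> and f = f])
    show "good (\<lambda>_. b) A" unfolding good_def
    proof (intro allI exI conjI impI)
      show "inft (null_proj (A - b *\<^sub>R id_blinfun))" using K by (simp add: b_def)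
      show "b * (norm x)\<^sup>2 \<le> A x \<bullet> x" if "null_proj (A - b *\<^sub>R id_blinfun) x = x" for x
        using that null_proj_M(2)[OF AM, of x] by (simp add: blinfun.diff_left blinfun.scaleR_left power2_norm_eq_inner)
    qed
    show "osum F = id_blinfun - null_proj B" using F(2) by (simp add: supp_def)
    have Pc: "P (B x) = B (P x)" for x by (simp add: P_def blinfun.diff_left blinfun.diff_right spg_comm[OF B])
    show "F n (B x) = B (F n x)" for n x
      by (simp add: F_def supp_def blinfun.add_left blinfun.diff_left blinfun.diff_right Pc null_proj_pos[OF B])
    show "sle (null_proj A) (null_proj B)" by (rule inft_absorbs[OF nB null_proj_M(1)[OF posD(1)[OF A]]])
    show "\<delta> * (norm x)\<^sup>2 \<le> B x \<bullet> x" "B x \<bullet> x \<le> f * (norm x)\<^sup>2" if "F 0 x = x" for x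
      using band_bounds[OF B less_imp_le[OF \<delta>(2)], of x] that by (simp_all add: F_def P_def)
  qed (use \<delta> Ble nB in \<open>auto simp: F_def P_def\<close>)
qed

text \<open>Covers condition (iv): scaling by b turns the unitary copies of P that sum to Q into
  copies of B that sum to A.\<close>

theorem sum_of_copies_projections:
  assumes A: "A = a *\<^sub>R Q" "inft Q" and B: "B = b *\<^sub>R P" "b > 0" "P \<in> projections M" "P \<noteq> 0"
    and nB: "inft (null_proj B)" and ab: "a = b"
  shows "\<exists>C. (\<forall>j::nat. unitarily_equiv M (C j) B) \<and> (\<forall>x. (\<lambda>j. C j x) sums A x)"
proof -
  have BM: "B \<in> M" unfolding B(1) by (rule M_scaleR[OF projectionsD(1)[OF B(3)]])
  have "null_proj B = id_blinfun - P"
  proof (rule projection_eqI[OF null_proj_M(1)[OF BM] projection_compl[OF B(3)]])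
    show "null_proj B x = x \<longleftrightarrow> (id_blinfun - P) x = x" for x
      unfolding null_proj_M(2)[OF BM] using B(1,2) by (simp add: blinfun.scaleR_left blinfun.diff_left)
  qed
  then obtain R where R: "\<And>j::nat. unitarily_equiv M (R j) P" "\<And>x. (\<lambda>j. R j x) sums Q x"
    using copies_of_projection[OF A(2) B(3,4)] nB by auto
  have "unitarily_equiv M (b *\<^sub>R R j) B" for j
  proof -
    obtain U where U: "U \<in> M" "adj U o\<^sub>L U = id_blinfun" "U o\<^sub>L adj U = id_blinfun" "R j = U o\<^sub>L P o\<^sub>L adj U"
      using R(1)[of j] unfolding unitarily_equiv_def by blast
    have "b *\<^sub>R R j = U o\<^sub>L B o\<^sub>L adj U"
      by (rule blinfun_eqI) (simp add: U(4) B(1) blinfun.scaleR_left blinfun.scaleR_right)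
    then show ?thesis unfolding unitarily_equiv_def using U(1-3) by blast
  qed
  moreover have "(\<lambda>j. (b *\<^sub>R R j) x) sums A x" for x
    using sums_scaleR_right[OF R(2)[of x], of b] by (simp add: A(1) ab blinfun.scaleR_left)
  ultimately show ?thesis by (intro exI[of _ "\<lambda>j. b *\<^sub>R R j"]) simp
qed

end

section \<open>The four conditions and their mutual exclusion\<close>

theorem corollary5p5:
  fixes M :: "('a::complex_hilbert \<Rightarrow>\<^sub>L 'a) set"
    and A B :: "'a \<Rightarrow>\<^sub>L 'a"
  assumes "factor M" and "sigma_finite M" and "semifinite M" and "infinite_algebra M"
    and "A \<in> positives M" and "B \<in> positives M" and "B \<noteq> 0"
    and "0 \<in> ess_spectrum M B"
    and "mvn_le M (null_proj A) (null_proj B)"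
  shows "let
      i = (ess_norm M A > norm B);
      ii = (ess_norm M A = norm B \<and> spectral_proj {norm B} B = 0);
      iii = (ess_norm M A = norm B \<and> spectral_proj {norm B} B \<noteq> 0 \<and>
             B \<noteq> norm B *\<^sub>R spectral_proj {norm B} B \<and>
             infinite_proj M (spectral_proj {ess_norm M A} A) \<and>
             infinite_proj M (null_proj B));
      iv = (ess_norm M A = norm B \<and>
            B = norm B *\<^sub>R spectral_proj {norm B} B \<and>
            A = norm A *\<^sub>R spectral_proj {norm A} A \<and>
            infinite_proj M (spectral_proj {norm A} A) \<and>
            infinite_proj M (null_proj B))
    in \<not> (i \<and> ii) \<and> \<not> (i \<and> iii) \<and> \<not> (i \<and> iv) \<and> \<not> (ii \<and> iii) \<and> \<not> (ii \<and> iv) \<and> \<not> (iii \<and> iv) \<and>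
      (i \<or> ii \<or> iii \<or> iv \<longrightarrow>
        (\<exists>C :: nat \<Rightarrow> 'a \<Rightarrow>\<^sub>L 'a. (\<forall>j. unitarily_equiv M (C j) B) \<and>
          (\<forall>x. (\<lambda>j. C j x) sums A x)))"
proof -
  interpret sf_factor M
    using assms(1-4) by unfold_locales (auto simp: factor_def)
  have pos: "pos T" if "T \<in> positives M" for T
  proof -
    have T: "T \<in> M" "\<And>x. cinner (T x) x \<in> \<real>\<^sub>\<ge>\<^sub>0" using that by (auto simp: positives_def)
    show ?thesis by (rule posI[OF T(1)]) (rule positive_imp_selfadjoint[OF M_bounded_ops[OF T(1)] T(2)])+
  qed
  note A = pos[OF assms(5)] and B = pos[OF assms(6)]
  note spA = spectral_proj_singleton[OF A] and spB = spectral_proj_singleton[OF B]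
  have b: "norm B > 0" using assms(7) by simp
  have N: "sle (null_proj A) (null_proj B)"
    using assms(9) null_proj_M(1)[OF posD(1)[OF A]] null_proj_M(1)[OF posD(1)[OF B]]
    unfolding mvn_le_def sle_def by (auto simp: eqv_mvn_equiv proj_le_pleq)
  have BM: "B - c *\<^sub>R id_blinfun \<in> M" for c using posD(1)[OF B] by (intro M_diff M_scaleR M_id)
  let ?C = "\<exists>C :: nat \<Rightarrow> 'a \<Rightarrow>\<^sub>L 'a. (\<forall>j. unitarily_equiv M (C j) B) \<and> (\<forall>x. (\<lambda>j. C j x) sums A x)"
  have i: ?C if "ess_norm M A > norm B"
    by (rule sum_of_copies_below[OF A B assms(7,8) N _ spg_norm[OF B that]]) (use that b in linarith)
  have ii: ?C if "ess_norm M A = norm B" "spectral_proj {norm B} B = 0"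
    by (rule sum_of_copies_below[OF A B assms(7,8) N]) (use b that in \<open>simp_all add: spg_norm_eq[OF B] spB\<close>)
  have iii: ?C if "ess_norm M A = norm B" "B \<noteq> norm B *\<^sub>R spectral_proj {norm B} B"
      "infinite_proj M (spectral_proj {ess_norm M A} A)" "infinite_proj M (null_proj B)"
    by (rule sum_of_copies_attained[OF A B b]) (use that in \<open>simp_all add: spA spB\<close>)
  have iv: ?C if h: "ess_norm M A = norm B" "B = norm B *\<^sub>R spectral_proj {norm B} B"
      "A = norm A *\<^sub>R spectral_proj {norm A} A" "infinite_proj M (spectral_proj {norm A} A)" "infinite_proj M (null_proj B)"
  proof (rule sum_of_copies_projections[OF h(3,4,2) b _ _ h(5)])
    show "spectral_proj {norm B} B \<in> projections M" unfolding spB by (rule null_proj_M(1)[OF BM])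
    show "spectral_proj {norm B} B \<noteq> 0" using h(2) assms(7) by auto
    \<comment> \<open>A is a multiple of an infinite projection, so its norm equals its essential
      norm, which is norm B in this case.\<close>
    have "norm A \<le> ess_norm M (norm A *\<^sub>R spectral_proj {norm A} A)" by (rule ess_norm_projection[OF h(4)]) simp
    then show "norm A = norm B" using h(1) ess_norm_le_norm[of A] by (simp flip: h(3))
  qed
  \<comment> \<open>Separates (ii) from (iv), since B is nonzero; the other pairs contradict each
    other clause by clause.\<close>
  have ex: "\<not> (spectral_proj {norm B} B = 0 \<and> B = norm B *\<^sub>R spectral_proj {norm B} B)" using assms(7) by auto
  show ?thesis unfolding Let_def using i ii iii iv ex by (intro conjI impI) (blast | force)+
qed

end
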